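(* Let $n=2g+2$ with $g\ge1$. There exists a constant $\kappa_n$ depending only on $n$ such that the following holds for all real $X>0$ and $\delta>0$. Suppose that $f\in\mathcal{F}_\delta(X)$ and that $D$ is an effective divisor on $X_f$ of degree $2g-1$. Then there exist $(A,B)\in V_f(\mathbb{Z})$ and a primitive vector $w\in\mathbb{Z}^n$ such that $$n\cdot\log\,(w,w)_{H_{A,B}}-\log\det H_{A,B}\ \le\ n\cdot h(D)-(n+1)\log X+n\delta\log X+\kappa_n.$$
   Context: $\mathcal{F}_\delta(X)$ is the set of binary forms $f=f_0x^n+\cdots+f_ny^n\in\mathbb{Z}[x,y]$ of nonzero discriminant with $\max_i|f_i|<X$ such that $f$ is irreducible in $\mathbb{Q}[x,y]$ and $|\mathrm{disc}(f)|\ge X^{2n-2-\delta}$. Here $\mathrm{disc}(f)$ is the discriminant of the binary form, homogeneous of degree $2n-2$ in the coefficients, equal to $\prod_{i<j}(\alpha_i\beta_j-\alpha_j\beta_i)^2$ if $f=\prod_{i=1}^n(\alpha_ix-\beta_iy)$ over an algebraically closed field. $X_f$ is the smooth hyperelliptic curve $z^2=f(x,y)$ over $\mathbb{Q}$ in $\mathbb{P}(1,1,g+1)$ with double cover $\pi:X_f\to\mathbb{P}^1_{\mathbb{Q}}$; divisors are $\mathbb{Q}$-rational. For an effective divisor $D$ of degree $m$, let $U=u_0x^m+\cdots+u_my^m\in\mathbb{Z}[x,y]$ be a primitive form (unique up to sign) vanishing precisely at the points of $\pi(D)$ with multiplicity; $h(D)=\log\max_i|u_i|$. $V_f(\mathbb{Z})$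 is the set of pairs $(A,B)$ of symmetric $n\times n$ integer matrices with $(-1)^{n(n-1)/2}\det(Ax-By)=f(x,y)$. For a pair of real symmetric matrices $(A,B)$ whose form $\det(Ax-By)$ has nonzero discriminant, there is a $\mathbb{C}$-basis $b_1,\dots,b_n$ of $\mathbb{C}^n$, unique up to reordering and rescaling, in which the $\mathbb{C}$-bilinear extensions $(-,-)_A,(-,-)_B$ of the forms with Gram matrices $A,B$ are both diagonal. $H_{A,B}$ is the restriction to $\mathbb{R}^n$ of the Hermitian form on $\mathbb{C}^n$ with $(b_i,b_j)=0$ for $i\neq j$ and $(b_i,b_i)=\max(|(b_i,b_i)_A|,|(b_i,b_i)_B|)$; it is an inner product on $\mathbb{R}^n$ independent of choices. $(w,w)_{H_{A,B}}$ is the corresponding squared length and $\det H_{A,B}$ is the determinant of its Gram matrix in the standard basis. *)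

theory Defs
  imports
    Complex_Main
    "HOL-Library.Multiset"
    "HOL-Computational_Algebra.Computational_Algebra"
    "HOL-Algebra.Algebraic_Closure_Type"
    "Jordan_Normal_Form.Matrix"
    "Jordan_Normal_Form.Determinant"
begin

section \<open>Binary forms\<close>

text \<open>
  A binary form of degree \<open>n\<close> is given by its coefficients \<open>c 0, \<dots>, c n\<close>, where \<open>c i\<close> is the
  coefficient of \<open>x^(n-i) y^i\<close>.  The ring \<open>R[x,y]\<close> is rendered as \<open>(R[x])[y]\<close>, i.e. as
  \<open>R poly poly\<close> with outer variable \<open>y\<close>.
\<close>

definition var_x :: "'a::comm_ring_1 poly poly" where
  "var_x = [:[:0, 1:]:]"

definition var_y :: "'a::comm_ring_1 poly poly" where
  "var_y = [:0, 1:]"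

definition const2 :: "'a::comm_ring_1 \<Rightarrow> 'a poly poly" where
  "const2 a = [:[:a:]:]"

definition bform :: "nat \<Rightarrow> (nat \<Rightarrow> 'a::comm_ring_1) \<Rightarrow> 'a poly poly" where
  "bform n c = (\<Sum>i\<le>n. const2 (c i) * var_x ^ (n - i) * var_y ^ i)"

definition bform_eval :: "nat \<Rightarrow> (nat \<Rightarrow> 'a::comm_ring_1) \<Rightarrow> 'a \<Rightarrow> 'a \<Rightarrow> 'a" where
  "bform_eval n c x y = (\<Sum>i\<le>n. c i * x ^ (n - i) * y ^ i)"

definition max_coeff :: "nat \<Rightarrow> (nat \<Rightarrow> int) \<Rightarrow> int" where
  "max_coeff n f = Max ((\<lambda>i. \<bar>f i\<bar>) ` {..n})"

definition disc :: "nat \<Rightarrow> (nat \<Rightarrow> int) \<Rightarrow> complex" where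
  "disc n f = (THE d. \<exists>\<alpha> \<beta> :: nat \<Rightarrow> complex.
     bform n (\<lambda>i. of_int (f i)) =
       (\<Prod>i<n. const2 (\<alpha> i) * var_x - const2 (\<beta> i) * var_y) \<and>
     d = (\<Prod>j<n. \<Prod>i<j. (\<alpha> i * \<beta> j - \<alpha> j * \<beta> i)\<^sup>2))"

definition form_family :: "nat \<Rightarrow> real \<Rightarrow> real \<Rightarrow> (nat \<Rightarrow> int) set" where
  "form_family n \<delta> Xb =
     {f. (\<forall>i>n. f i = 0) \<and>
         disc n f \<noteq> 0 \<and>
         real_of_int (max_coeff n f) < Xb \<and>
         comm_semiring_1_class.irreducible (bform n (\<lambda>i. of_int (f i)) :: rat poly poly) \<and>
         cmod (disc n f) \<ge> Xb powr (2 * real n - 2 - \<delta>)}"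


section \<open>Hyperelliptic curves and effective divisors\<close>

text \<open>
  A point of the weighted projective space \<open>P(1,1,g+1)\<close> over the algebraic closure of the
  rationals is the set of all its coordinate triples; likewise for points of \<open>P^1\<close>.
\<close>

type_synonym qbar = "rat alg_closure"

type_synonym wpoint = "(qbar \<times> qbar \<times> qbar) set"

definition wproj_point :: "nat \<Rightarrow> qbar \<Rightarrow> qbar \<Rightarrow> qbar \<Rightarrow> wpoint" where
  "wproj_point g x y z = {(t * x, t * y, t ^ (g + 1) * z) | t. t \<noteq> 0}"

definition proj_point :: "qbar \<Rightarrow> qbar \<Rightarrow> (qbar \<times> qbar) set" where
  "proj_point x y = {(t * x, t * y) | t. t \<noteq> 0}"

definition curve_points :: "nat \<Rightarrow> (nat \<Rightarrow> int) \<Rightarrow> wpoint set" where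
  "curve_points g f = {wproj_point g x y z | x y z.
     (x, y, z) \<noteq> (0, 0, 0) \<and> z\<^sup>2 = bform_eval (2 * g + 2) (\<lambda>i. of_int (f i)) x y}"

definition double_cover :: "wpoint \<Rightarrow> (qbar \<times> qbar) set" where
  "double_cover P = (\<lambda>(x, y, z). (x, y)) ` P"

text \<open>
  The prime field is fixed by every field automorphism, so these automorphisms form the absolute
  Galois group of the rationals.
\<close>

definition galois_group :: "(qbar \<Rightarrow> qbar) set" where
  "galois_group = {\<sigma>. bij \<sigma> \<and> (\<forall>a b. \<sigma> (a + b) = \<sigma> a + \<sigma> b) \<and> (\<forall>a b. \<sigma> (a * b) = \<sigma> a * \<sigma> b)}"

definition galois_act :: "(qbar \<Rightarrow> qbar) \<Rightarrow> wpoint \<Rightarrow> wpoint" where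
  "galois_act \<sigma> P = (\<lambda>(x, y, z). (\<sigma> x, \<sigma> y, \<sigma> z)) ` P"

text \<open>
  Rational effective divisors are the Galois-invariant finite multisets of geometric points
  (the base field is perfect); the degree is the size of the multiset.
\<close>

definition effective_divisor :: "nat \<Rightarrow> (nat \<Rightarrow> int) \<Rightarrow> wpoint multiset \<Rightarrow> bool" where
  "effective_divisor g f D \<longleftrightarrow>
     set_mset D \<subseteq> curve_points g f \<and>
     (\<forall>\<sigma>\<in>galois_group. image_mset (galois_act \<sigma>) D = D)"

text \<open>
  The multiplicity of a form \<open>U\<close> at the point \<open>[a:b]\<close> is the exponent of the irreducible form
  \<open>b x - a y\<close> in \<open>U\<close>.
\<close>

definition pushforward_form :: "wpoint multiset \<Rightarrow> (nat \<Rightarrow> int) \<Rightarrow> bool" where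
  "pushforward_form D u \<longleftrightarrow>
     Gcd (u ` {..size D}) = 1 \<and>
     (\<forall>a b. (a, b) \<noteq> (0, 0) \<longrightarrow>
        multiplicity (const2 b * var_x - const2 a * var_y)
          (bform (size D) (\<lambda>i. of_int (u i)) :: qbar poly poly) =
        count (image_mset double_cover D) (proj_point a b))"

definition divisor_height :: "wpoint multiset \<Rightarrow> real" where
  "divisor_height D = ln (real_of_int (max_coeff (size D) (SOME u. pushforward_form D u)))"


section \<open>Pairs of symmetric matrices\<close>

definition pencil_det :: "nat \<Rightarrow> 'a::comm_ring_1 mat \<Rightarrow> 'a mat \<Rightarrow> 'a poly poly" where
  "pencil_det n A B = (-1) ^ (n * (n - 1) div 2) *
     Determinant.det (var_x \<cdot>\<^sub>m map_mat const2 A - var_y \<cdot>\<^sub>m map_mat const2 B)"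

definition V_int :: "nat \<Rightarrow> (nat \<Rightarrow> int) \<Rightarrow> (int mat \<times> int mat) set" where
  "V_int n f = {(A, B). A \<in> carrier_mat n n \<and> B \<in> carrier_mat n n \<and>
     transpose_mat A = A \<and> transpose_mat B = B \<and> pencil_det n A B = bform n f}"

definition bil :: "'a::comm_ring_1 mat \<Rightarrow> 'a vec \<Rightarrow> 'a vec \<Rightarrow> 'a" where
  "bil A v w = v \<bullet> (A *\<^sub>v w)"

definition herm :: "complex mat \<Rightarrow> complex vec \<Rightarrow> complex vec \<Rightarrow> complex" where
  "herm G v w = v \<bullet> (G *\<^sub>v conjugate w)"

text \<open>The columns of \<open>P\<close> are a basis diagonalising both bilinear forms.\<close>

definition diag_basis :: "nat \<Rightarrow> complex mat \<Rightarrow> complex mat \<Rightarrow> complex mat \<Rightarrow> bool" where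
  "diag_basis n A B P \<longleftrightarrow> P \<in> carrier_mat n n \<and> invertible_mat P \<and>
     (\<forall>i<n. \<forall>j<n. i \<noteq> j \<longrightarrow> bil A (col P i) (col P j) = 0 \<and> bil B (col P i) (col P j) = 0)"

definition herm_gram :: "nat \<Rightarrow> complex mat \<Rightarrow> complex mat \<Rightarrow> complex mat" where
  "herm_gram n A B = (THE G. G \<in> carrier_mat n n \<and>
     (\<exists>P. diag_basis n A B P \<and>
        (\<forall>i<n. \<forall>j<n. herm G (col P i) (col P j) =
           (if i = j
            then complex_of_real (max (cmod (bil A (col P i) (col P i)))
                                      (cmod (bil B (col P i) (col P i))))
            else 0))))"

text \<open>
  The Gram matrix in the standard basis of the restriction to real vectors.  The Hermitian form
  takes real values on real vectors, since complex conjugation permutes the lines spanned by the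
  diagonalising basis; hence taking real parts loses nothing.
\<close>

definition H_gram :: "nat \<Rightarrow> real mat \<Rightarrow> real mat \<Rightarrow> real mat" where
  "H_gram n A B = map_mat Re (herm_gram n (map_mat complex_of_real A) (map_mat complex_of_real B))"

definition primitive_vec :: "int vec \<Rightarrow> bool" where
  "primitive_vec w \<longleftrightarrow> Gcd (set\<^sub>v w) = 1"

end

theory Submission
  imports
    Defs
    "Berlekamp_Zassenhaus.Mahler_Measure"
    "Jordan_Normal_Form.Char_Poly"
begin

text \<open>
  After a substitution \<open>y \<mapsto> y + t x\<close> the form \<open>U\<close> pushing \<open>D\<close> forward becomes a polynomial of full degree,
  \<open>r s\<^sup>2\<close> with \<open>r\<close> squarefree.  Above a root of \<open>r\<close> the divisor \<open>D\<close> contains the two points of the curve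
  unequally often, so no Galois conjugation fixing the root swaps them; hence \<open>f\<close> is a square \<open>V\<^sup>2\<close> modulo
  \<open>r\<close> over the rationals.  On polynomials modulo \<open>r\<close> consider the functional \<open>\<tau>(p) = \<Sum> p(x) / r'(x)\<close>, summed
  over the roots of \<open>r\<close>.  From \<open>V\<close> one builds a lattice \<open>L\<close> whose \<open>\<tau>\<close>-dual contains \<open>L\<close> and \<open>x L\<close>, and the Gram
  matrices of \<open>\<tau>(b b')\<close> and \<open>\<tau>(x b b')\<close> on \<open>L\<close> form an integral pencil of determinant \<open>\<plusminus>r\<close>.  Bordering it
  by a hyperbolic block gives a pencil \<open>(A, B)\<close> of determinant \<open>\<plusminus>f\<close> such that, for the vector \<open>w\<close> of
  coefficients of \<open>s\<close>, adding the rank one matrix of \<open>A w\<close> changes the determinant by \<open>\<plusminus>U\<close>.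

  At the roots \<open>\<theta>\<close> of \<open>f\<close> this yields \<open>H(w, w) = \<Sum> max(1, |\<theta>|) |U(\<theta>)| / |f'(\<theta>)|\<close>, while \<open>det H\<close> is the Mahler
  measure \<open>M\<close> of \<open>f\<close>.  The inequality follows from Landau's bound on \<open>M\<close> and from
  \<open>|f'(\<theta>)| \<ge> c max(1, |\<theta>|)^(n-2) |disc f|^(1/2) / M^(n-2)\<close>.
\<close>

section \<open>Integral lattices modulo a primitive polynomial\<close>

text \<open>Let I be the fractional ideal (1, x) of the ring attached to the binary form of
  \<open>U\<close>. As \<open>U\<close> need not be monic, powers of I replace the lattices spanned
  by powers of x. Modulo \<open>U\<close> the group \<open>Jd i\<close> is I^(m-1-i) for i up to m,
  \<open>J\<close> is the inverse of I, and \<open>Jp s\<close> is J^(s+1); primitivity of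
  \<open>U\<close> is what makes I invertible. The degree of D is odd, so r has odd degree 2h+1, and
  \<open>Jd h\<close>, \<open>Jd (h + 1)\<close> form a dual pair in the middle of this chain,
  neighbours under multiplication by x. The obstacle is that V is only rational: V b need not pair
  integrally with these groups. So L is built like a Kneser neighbour: restrict to elements pairing
  integrally with V J^(k+1), then adjoin V J^(k+2). The determinant is found without computing an
  index. It vanishes at the roots of r, so it is \<kappa> r; an integral inverse of the pencil up to
  the factor r makes \<kappa> a unit of Z; a Hankel matrix gives the sign. In the exponent, log M
  enters n(n-2)-1 times and log |disc f| with weight -n/2, and n(n-2)-1-n(n-1) = -(n+1).\<close>

inductive_set zspan :: "'a::ab_group_add set \<Rightarrow> 'a set" for B :: "'a set" where
  zero: "0 \<in> zspan B"
| add: "p \<in> zspan B \<Longrightarrow> b \<in> B \<Longrightarrow> p + b \<in> zspan B"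
| sub: "p \<in> zspan B \<Longrightarrow> b \<in> B \<Longrightarrow> p - b \<in> zspan B"

lemma zspan_base: "b \<in> B \<Longrightarrow> b \<in> zspan B"
  using zspan.add[OF zspan.zero] by fastforce

lemma zspan_add: "q \<in> zspan B \<Longrightarrow> p \<in> zspan B \<Longrightarrow> p + q \<in> zspan B"
proof (induction q rule: zspan.induct)
  case zero then show ?case by simp
next
  case (add q b)
  then show ?case using zspan.add[of "p + q" B b] by (simp add: add.assoc)
next
  case (sub q b)
  then show ?case using zspan.sub[of "p + q" B b] by (simp add: algebra_simps)
qed

lemma zspan_uminus: "q \<in> zspan B \<Longrightarrow> - q \<in> zspan B"
proof (induction q rule: zspan.induct)
  case zero then show ?case by (simp add: zspan.zero)
next
  case (add q b)
  then show ?case using zspan.sub[of "- q" B b] by simp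
next
  case (sub q b)
  then show ?case using zspan.add[of "- q" B b] by (simp add: algebra_simps)
qed

lemma zspan_diff: "p \<in> zspan B \<Longrightarrow> q \<in> zspan B \<Longrightarrow> p - q \<in> zspan B"
  using zspan_add[of "- q" B p] zspan_uminus[of q B] by simp

definition subgrp :: "'a::ab_group_add set \<Rightarrow> bool" where
  "subgrp A \<longleftrightarrow> 0 \<in> A \<and> (\<forall>a\<in>A. \<forall>b\<in>A. a - b \<in> A)"

lemma subgrp_zero: "subgrp A \<Longrightarrow> 0 \<in> A"
  and subgrp_diff: "subgrp A \<Longrightarrow> a \<in> A \<Longrightarrow> b \<in> A \<Longrightarrow> a - b \<in> A"
  by (auto simp: subgrp_def)

lemma subgrp_uminus: "subgrp A \<Longrightarrow> a \<in> A \<Longrightarrow> - a \<in> A"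
  using subgrp_diff[of A 0 a] subgrp_zero[of A] by simp

lemma subgrp_add: "subgrp A \<Longrightarrow> a \<in> A \<Longrightarrow> b \<in> A \<Longrightarrow> a + b \<in> A"
  using subgrp_diff[of A a "- b"] subgrp_uminus[of A b] by simp

lemma subgrp_sum: "subgrp A \<Longrightarrow> (\<And>i. i \<in> I \<Longrightarrow> f i \<in> A) \<Longrightarrow> sum f I \<in> A"
  by (induction I rule: infinite_finite_induct) (auto intro: subgrp_add subgrp_zero)

lemma subgrp_zspan: "subgrp (zspan B)"
  by (simp add: subgrp_def zspan.zero zspan_diff)

lemma zspan_subset: "subgrp A \<Longrightarrow> B \<subseteq> A \<Longrightarrow> p \<in> zspan B \<Longrightarrow> p \<in> A"
  by (erule zspan.induct) (auto intro: subgrp_add subgrp_diff subgrp_zero)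

lemma subgrp_smult_nat:
  fixes A :: "complex poly set"
  assumes "subgrp A" "a \<in> A" shows "smult (of_nat c) a \<in> A"
  by (induction c) (use assms in \<open>auto simp: smult_add_left intro: subgrp_add subgrp_zero\<close>)

lemma subgrp_smult_Ints:
  fixes A :: "complex poly set"
  assumes "subgrp A" "a \<in> A" "c \<in> \<int>" shows "smult c a \<in> A"
proof -
  obtain z where z: "c = of_int z" using assms(3) by (auto elim: Ints_cases)
  show ?thesis
  proof (cases "z \<ge> 0")
    case True
    then show ?thesis using subgrp_smult_nat[OF assms(1,2), of "nat z"] z by simp
  next
    case False
    then have "smult c a = - smult (of_nat (nat (- z))) a" using z by simp
    then show ?thesis using subgrp_uminus[OF assms(1) subgrp_smult_nat[OF assms(1,2)]] by metis
  qed
qed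

text \<open>Forward substitution; it supplies the coordinates of the dual basis in
  \<open>dual_basis_exists\<close>.\<close>

lemma triangular_solve:
  fixes M :: "nat \<Rightarrow> nat \<Rightarrow> 'a::field"
  assumes "\<And>i. i < m \<Longrightarrow> M i i \<noteq> 0"
  shows "\<exists>y. \<forall>i<m. (\<Sum>l\<le>i. M i l * y l) = r i"
  using assms
proof (induction m)
  case 0 then show ?case by simp
next
  case (Suc m)
  then obtain y where y: "\<forall>i<m. (\<Sum>l\<le>i. M i l * y l) = r i" by force
  define y' where "y' = y(m := (r m - (\<Sum>l<m. M m l * y l)) / M m m)"
  have "(\<Sum>l\<le>i. M i l * y' l) = r i" if "i < Suc m" for i
  proof (cases "i = m")
    case True
    have "(\<Sum>l\<le>m. M m l * y' l) = (\<Sum>l<m. M m l * y l) + M m m * y' m"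
      by (simp add: lessThan_Suc_atMost[symmetric] y'_def)
    then show ?thesis using Suc.prems[of m] True by (simp add: y'_def)
  next
    case False
    then have "(\<Sum>l\<le>i. M i l * y' l) = (\<Sum>l\<le>i. M i l * y l)"
      using that by (intro sum.cong) (auto simp: y'_def)
    then show ?thesis using y False that by simp
  qed
  then show ?case by blast
qed

section \<open>The residue functional of a primitive integral form and its dual basis\<close>

locale residue_form =
  fixes U :: "complex poly" and m :: nat
  assumes deg: "degree U = m" and mpos: "m > 0"
    and Uint: "\<And>i. coeff U i \<in> \<int>"
    and prim: "\<exists>e. (\<forall>i. e i \<in> \<int>) \<and> (\<Sum>i\<le>m. e i * coeff U i) = 1"
begin

lemma U0: "U \<noteq> 0" using deg mpos by auto

text \<open>
  For squarefree \<open>U\<close> this is \<open>\<Sum> p(x) / U'(x)\<close> over the roots of \<open>U\<close>; the polynomials \<open>Z l\<close> below are dual to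
  the powers of \<open>x\<close>.
\<close>

definition tau :: "complex poly \<Rightarrow> complex" where
  "tau p = coeff (p mod U) (m - 1) / lead_coeff U"

lemma tau_add: "tau (p + q) = tau p + tau q"
  by (simp add: tau_def poly_mod_add_left add_divide_distrib)

lemma tau_smult: "tau (smult c p) = c * tau p"
  by (simp add: tau_def mod_smult_left)

lemma tau_0 [simp]: "tau 0 = 0" by (simp add: tau_def)

lemma tau_diff: "tau (p - q) = tau p - tau q"
  using tau_add[of "p - q" q] by simp

lemma tau_sum: "tau (sum f I) = (\<Sum>i\<in>I. tau (f i))"
  by (induction I rule: infinite_finite_induct) (auto simp: tau_add)

lemma tau_lin: "tau ((\<Sum>l\<in>I. smult (n l) (f l)) * q) = (\<Sum>l\<in>I. n l * tau (f l * q))"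
  by (simp add: sum_distrib_right tau_sum tau_smult)

lemma tau_dvd: "U dvd p \<Longrightarrow> tau p = 0" by (simp add: tau_def mod_eq_0_iff_dvd[symmetric])

lemma tau_cong: "U dvd p - q \<Longrightarrow> tau p = tau q"
  using tau_dvd[of "p - q"] by (simp add: tau_diff)

lemma tau_cong_mult: "U dvd p - q \<Longrightarrow> tau (r * p) = tau (r * q)"
  by (rule tau_cong) (metis dvd_mult right_diff_distrib)

lemma tau_cong_mult': "U dvd p - q \<Longrightarrow> tau (p * r) = tau (q * r)"
  using tau_cong_mult[of p q r] by (simp add: mult.commute)

lemma tau_small: "degree p < m \<Longrightarrow> tau p = coeff p (m - 1) / lead_coeff U"
  by (simp add: tau_def mod_poly_less deg)

lemma tau_monom: "a < m - 1 \<Longrightarrow> tau (monom 1 a) = 0"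
  using mpos by (subst tau_small) (auto simp: degree_monom_eq)

lemma tau_monom_top: "tau (monom 1 (m - 1)) = 1 / lead_coeff U"
  using mpos by (subst tau_small) (auto simp: degree_monom_eq)

definition Z :: "nat \<Rightarrow> complex poly" where "Z l = poly_shift (Suc l) U"

lemma coeff_Z: "coeff (Z l) i = coeff U (i + Suc l)"
  by (simp add: Z_def coeff_poly_shift)

lemma deg_Z: "l < m \<Longrightarrow> degree (Z l) \<le> m - 1 - l"
  by (rule degree_le) (auto simp: coeff_Z deg intro!: coeff_eq_0)

lemma lead_Z: "l < m \<Longrightarrow> coeff (Z l) (m - 1 - l) = lead_coeff U"
  by (simp add: coeff_Z deg)

lemma deg_Z_eq: "l < m \<Longrightarrow> degree (Z l) = m - 1 - l"
  using deg_Z[of l] lead_Z[of l] U0 le_degree[of "Z l" "m - 1 - l"] by simp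

lemma X_Z_Suc: "monom 1 1 * Z (Suc l) = Z l - [:coeff U (Suc l):]"
  by (rule poly_eqI) (auto simp: coeff_monom_mult coeff_Z coeff_pCons split: nat.splits)

lemma X_Z_0: "monom 1 1 * Z 0 = U - [:coeff U 0:]"
  by (rule poly_eqI) (auto simp: coeff_monom_mult coeff_Z coeff_pCons split: nat.splits)

lemma shift_split: "monom 1 (Suc l) * Z l = U - poly_cutoff (Suc l) U"
  by (rule poly_eqI) (auto simp: coeff_monom_mult coeff_Z coeff_poly_cutoff)

text \<open>For a \<le> l the product is already reduced. For a > l, \<open>shift_split\<close>
  makes x^(l+1) Z_l congruent to minus the part of \<open>U\<close> of degree at most l, so x^a Z_l
  has an integral representative of degree below a, with no x^(m-1) term.\<close>

lemma monom_Z: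
  assumes "a < m" "l < m"
  shows "\<exists>q. U dvd monom 1 a * Z l - q \<and> degree q < m \<and> (\<forall>i. coeff q i \<in> \<int>) \<and>
     coeff q (m - 1) = (if a = l then lead_coeff U else 0)"
proof (cases "a \<le> l")
  case True
  have "degree (monom 1 a * Z l) \<le> a + (m - 1 - l)"
    using degree_mult_le[of "monom 1 a" "Z l"] deg_Z[OF assms(2)] by (simp add: degree_monom_eq)
  then have d: "degree (monom 1 a * Z l) < m" using True assms by linarith
  have c: "coeff (monom 1 a * Z l) (m - 1) = (if a = l then lead_coeff U else 0)"
    using assms True deg by (auto simp: coeff_monom_mult coeff_Z intro!: coeff_eq_0)
  show ?thesis
    by (rule exI[of _ "monom 1 a * Z l"]) (use d c Uint in \<open>auto simp: coeff_monom_mult coeff_Z\<close>)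
next
  case False
  define q where "q = - (monom 1 (a - Suc l) * poly_cutoff (Suc l) U)"
  have eq: "monom 1 a * Z l = monom 1 (a - Suc l) * (U - poly_cutoff (Suc l) U)"
    using False by (simp add: shift_split[symmetric] mult.assoc[symmetric] mult_monom)
  have "monom 1 a * Z l - q = monom 1 (a - Suc l) * U"
    unfolding eq q_def by (simp add: algebra_simps)
  then have 1: "U dvd monom 1 a * Z l - q" by simp
  have c0: "coeff q i = 0" if "i \<ge> a" for i
    using that False by (auto simp: q_def coeff_monom_mult coeff_poly_cutoff)
  have 2: "degree q < m"
    using c0 assms by (intro degree_lessI) (auto simp: mpos)
  have 3: "coeff q i \<in> \<int>" for i
    using Uint by (auto simp: q_def coeff_monom_mult coeff_poly_cutoff)
  show ?thesis using 1 2 3 c0[of "m - 1"] assms False by (intro exI[of _ q]) auto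
qed

lemma tau_monom_Z:
  assumes "a < m" "l < m" shows "tau (monom 1 a * Z l) = (if a = l then 1 else 0)"
proof -
  obtain q where q: "U dvd monom 1 a * Z l - q" "degree q < m"
    "coeff q (m - 1) = (if a = l then lead_coeff U else 0)"
    using monom_Z[OF assms] by blast
  show ?thesis using tau_cong[OF q(1)] tau_small[OF q(2)] q(3) U0 by auto
qed

lemma poly_as_sum: fixes p :: "complex poly" assumes "degree p < m" shows "p = (\<Sum>a<m. smult (coeff p a) (monom 1 a))"
proof (rule poly_eqI)
  fix i
  show "coeff p i = coeff (\<Sum>a<m. smult (coeff p a) (monom 1 a)) i"
    using assms by (cases "i < m") (auto simp: coeff_sum mult_delta_right intro!: coeff_eq_0)
qed

lemma tau_Z: assumes "degree p < m" "l < m" shows "tau (p * Z l) = coeff p l"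
proof -
  have "tau (p * Z l) = tau (\<Sum>a<m. smult (coeff p a) (monom 1 a * Z l))"
    by (subst poly_as_sum[OF assms(1)]) (simp add: sum_distrib_right)
  also have "\<dots> = (\<Sum>a<m. coeff p a * (if a = l then 1 else 0))"
    using assms by (simp add: tau_sum tau_smult tau_monom_Z)
  also have "\<dots> = coeff p l" using assms by (simp add: mult_delta_right)
  finally show ?thesis .
qed

text \<open>If the remainder of \<open>p\<close> were nonzero, a suitable power of x would lift its
  leading term to degree m - 1, where \<open>tau\<close> sees it.\<close>

lemma nondeg: assumes "\<And>a. a < m \<Longrightarrow> tau (p * monom 1 a) = 0" shows "U dvd p"
proof (rule ccontr)
  assume nd: "\<not> U dvd p"
  define r where "r = p mod U"
  have r0: "r \<noteq> 0" using nd by (auto simp: r_def mod_eq_0_iff_dvd)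
  have dr: "degree r < m" using degree_mod_less'[OF U0 r0[unfolded r_def]] deg by (simp add: r_def)
  define a where "a = m - 1 - degree r"
  have am: "a < m" using mpos by (simp add: a_def)
  have U1: "U dvd p - r" by (simp add: r_def minus_mod_eq_mult_div)
  have "degree (r * monom 1 a) = m - 1"
    using r0 dr by (subst degree_mult_eq) (auto simp: degree_monom_eq a_def)
  then have "tau (r * monom 1 a) = coeff (r * monom 1 a) (m - 1) / lead_coeff U"
    using mpos by (intro tau_small) auto
  moreover have "coeff (r * monom 1 a) (m - 1) = lead_coeff r"
    using dr by (simp add: coeff_monom_mult a_def mult.commute[of r])
  ultimately have "tau (r * monom 1 a) \<noteq> 0" using r0 U0 by simp
  then show False using assms[OF am] tau_cong_mult'[OF U1] by simp
qed

lemma expand_Z: "U dvd p - (\<Sum>l<m. smult (tau (p * monom 1 l)) (Z l))"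
proof (rule nondeg)
  fix a assume a: "a < m"
  have "tau ((\<Sum>l<m. smult (tau (p * monom 1 l)) (Z l)) * monom 1 a)
     = (\<Sum>l<m. tau (p * monom 1 l) * tau (monom 1 a * Z l))"
    unfolding tau_lin by (simp add: mult.commute[of _ "monom 1 a"])
  also have "\<dots> = (\<Sum>l<m. tau (p * monom 1 l) * (if a = l then 1 else 0))"
    using a by (intro sum.cong) (simp_all add: tau_monom_Z)
  also have "\<dots> = tau (p * monom 1 a)" using a by (simp add: mult_delta_right)
  finally show "tau ((p - (\<Sum>l<m. smult (tau (p * monom 1 l)) (Z l))) * monom 1 a) = 0"
    by (simp add: left_diff_distrib tau_diff)
qed

lemma int_sum: "(\<And>i. i \<in> I \<Longrightarrow> f i \<in> (\<int>::complex set)) \<Longrightarrow> sum f I \<in> \<int>"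
  by (rule Ints_sum)

lemma tau_int_poly_Z:
  assumes "degree q < m" "\<And>i. coeff q i \<in> \<int>" "l < m" shows "tau (q * Z l) \<in> \<int>"
  using tau_Z[OF assms(1,3)] assms(2) by simp

text \<open>x^c Z_a reduces to a polynomial with integral coefficients, and pairing with Z_b reads
  off one of them.\<close>

lemma tau_ZZx: assumes "a < m" "b < m" "c < m" shows "tau (monom 1 c * Z a * Z b) \<in> \<int>"
proof -
  obtain q where q: "U dvd monom 1 c * Z a - q" "degree q < m" "\<And>i. coeff q i \<in> \<int>"
    using monom_Z[OF assms(3,1)] by blast
  show ?thesis using tau_cong_mult'[OF q(1), of "Z b"] tau_int_poly_Z[OF q(2,3) assms(2)] by simp
qed

lemma tau_ZZ: assumes "a < m" "b < m" shows "tau (Z a * Z b) \<in> \<int>"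
  using tau_ZZx[OF assms mpos] by (simp add: monom_0)

text \<open>By \<open>expand_Z\<close> the product Z_a Z_b is an integral combination of the Z_l
  modulo \<open>U\<close>. This is the source of the closure of \<open>J\<close> under
  multiplication.\<close>

lemma tau_ZZZ: assumes "a < m" "b < m" "c < m" shows "tau (Z a * Z b * Z c) \<in> \<int>"
proof -
  have "tau (Z a * Z b * Z c) = tau ((\<Sum>l<m. smult (tau (Z a * Z b * monom 1 l)) (Z l)) * Z c)"
    by (rule tau_cong_mult'[OF expand_Z])
  also have "\<dots> = (\<Sum>l<m. tau (monom 1 l * Z a * Z b) * tau (Z l * Z c))"
    unfolding tau_lin by (simp add: mult_ac)
  also have "\<dots> \<in> \<int>" using assms by (intro int_sum Ints_mult tau_ZZx tau_ZZ) auto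
  finally show ?thesis .
qed

text \<open>
  \<open>Jd i\<close> and \<open>Jd (m - i)\<close> are dual to each other, and the \<open>Z l\<close> span \<open>Jd m\<close> modulo \<open>U\<close>.
\<close>

definition Jd :: "nat \<Rightarrow> complex poly set" where
  "Jd i = {b. (\<forall>a<i. tau (b * monom 1 a) \<in> \<int>) \<and> (\<forall>l<m. tau (b * Z l) \<in> \<int>)}"

lemma JdI: "(\<And>a. a < i \<Longrightarrow> tau (b * monom 1 a) \<in> \<int>) \<Longrightarrow> (\<And>l. l < m \<Longrightarrow> tau (b * Z l) \<in> \<int>) \<Longrightarrow> b \<in> Jd i"
  by (simp add: Jd_def)

lemma Jd_x: "b \<in> Jd i \<Longrightarrow> a < i \<Longrightarrow> tau (b * monom 1 a) \<in> \<int>"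
  and Jd_Z: "b \<in> Jd i \<Longrightarrow> l < m \<Longrightarrow> tau (b * Z l) \<in> \<int>"
  by (auto simp: Jd_def)

lemma subgrp_Jd: "subgrp (Jd i)"
  by (auto simp: subgrp_def Jd_def left_diff_distrib tau_diff)

lemma U_Jd: "U dvd p \<Longrightarrow> p \<in> Jd i"
  by (rule JdI) (auto simp: tau_dvd)

lemma Jd_mono: "i \<le> j \<Longrightarrow> Jd j \<subseteq> Jd i" by (auto simp: Jd_def)

lemma Z_Jd: "i \<le> m \<Longrightarrow> l < m \<Longrightarrow> Z l \<in> Jd i"
  by (rule JdI) (use tau_monom_Z[of _ l] in \<open>auto simp: tau_ZZ mult.commute\<close>)

lemma monom_Jd: "a + i < m \<Longrightarrow> monom 1 a \<in> Jd i"
  by (rule JdI) (auto simp: mult_monom tau_monom tau_monom_Z)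

text \<open>Subtracting the Z_a with coefficients tau(p x^a) kills the pairings with x^a for a < i.
  This bounds the degree of the remainder, and pairing it with the \<open>Z l\<close> shows that its
  coefficients are integers. Hence Z_a (a < i) and x^a (a < m - i) generate \<open>Jd i\<close>
  modulo \<open>U\<close>.\<close>

lemma Jd_struct:
  assumes p: "p \<in> Jd i" and i: "i \<le> m"
  shows "\<exists>n n'. (\<forall>a. n a \<in> \<int>) \<and> (\<forall>a. n' a \<in> \<int>) \<and>
    U dvd p - ((\<Sum>a<i. smult (n a) (Z a)) + (\<Sum>a<m-i. smult (n' a) (monom 1 a)))"
proof -
  define n where "n a = (if a < i then tau (p * monom 1 a) else 0)" for a
  define p1 where "p1 = p - (\<Sum>a<i. smult (n a) (Z a))"
  define r where "r = p1 mod U"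
  have U1: "U dvd p1 - r" by (simp add: r_def minus_mod_eq_mult_div)
  have dr: "degree r < m" using degree_mod_less[OF U0, of p1] deg mpos by (auto simp: r_def)
  have nI: "n a \<in> \<int>" for a using Jd_x[OF p] by (simp add: n_def)
  have "p1 \<in> Jd i"
    unfolding p1_def
    by (intro subgrp_diff[OF subgrp_Jd] p subgrp_sum[OF subgrp_Jd] subgrp_smult_Ints[OF subgrp_Jd] Z_Jd nI)
       (use i in auto)
  then have rI: "coeff r l \<in> \<int>" for l
    using Jd_Z[of p1 i l] tau_Z[OF dr, of l] tau_cong_mult'[OF U1, of "Z l"] dr
    by (cases "l < m") (auto simp: coeff_eq_0)
  have p1x: "tau (r * monom 1 a) = 0" if "a < i" for a
  proof -
    have "tau ((\<Sum>l<i. smult (n l) (Z l)) * monom 1 a) = (\<Sum>l<i. n l * tau (monom 1 a * Z l))"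
      unfolding tau_lin by (simp add: mult.commute[of _ "monom 1 a"])
    also have "\<dots> = (\<Sum>l<i. n l * (if a = l then 1 else 0))"
      using that i by (intro sum.cong) (simp_all add: tau_monom_Z)
    also have "\<dots> = tau (p * monom 1 a)" using that by (simp add: n_def mult_delta_right)
    finally show ?thesis using tau_cong_mult'[OF U1, of "monom 1 a"]
      by (simp add: p1_def left_diff_distrib tau_diff)
  qed
  \<comment> \<open>As in \<open>nondeg\<close>: otherwise some x^a with a < i lifts the leading
    term of \<open>r\<close> to degree m - 1, against \<open>p1x\<close>.\<close>
  have degr: "coeff r l = 0" if "l \<ge> m - i" for l
  proof (rule ccontr)
    assume "coeff r l \<noteq> 0"
    then have r0: "r \<noteq> 0" and "degree r \<ge> m - i" using that le_degree[of r l] by auto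
    define a where "a = m - 1 - degree r"
    have a: "a < i" using \<open>degree r \<ge> m - i\<close> dr i by (auto simp: a_def)
    have "degree (r * monom 1 a) = m - 1"
      using r0 dr by (subst degree_mult_eq) (auto simp: degree_monom_eq a_def)
    then have "tau (r * monom 1 a) = coeff (r * monom 1 a) (m - 1) / lead_coeff U"
      using mpos by (intro tau_small) auto
    moreover have "coeff (r * monom 1 a) (m - 1) = lead_coeff r"
      using dr by (simp add: coeff_monom_mult a_def mult.commute[of r])
    ultimately show False using p1x[OF a] r0 U0 by simp
  qed
  have "r = (\<Sum>a<m. smult (coeff r a) (monom 1 a))" by (rule poly_as_sum[OF dr])
  also have "\<dots> = (\<Sum>a<m-i. smult (coeff r a) (monom 1 a))"
    by (rule sum.mono_neutral_right) (auto simp: degr)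
  finally have "p - ((\<Sum>a<i. smult (n a) (Z a)) + (\<Sum>a<m-i. smult (coeff r a) (monom 1 a))) = p1 - r"
    by (simp add: p1_def)
  then show ?thesis using U1 nI rI by metis
qed

lemma Jd_dual: assumes "p \<in> Jd i" "q \<in> Jd (m - i)" "i \<le> m" shows "tau (p * q) \<in> \<int>"
proof -
  obtain n n' where n: "\<And>a. n a \<in> \<int>" "\<And>a. n' a \<in> \<int>"
    "U dvd p - ((\<Sum>a<i. smult (n a) (Z a)) + (\<Sum>a<m-i. smult (n' a) (monom 1 a)))"
    using Jd_struct[OF assms(1,3)] by metis
  have "tau (p * q) = (\<Sum>a<i. n a * tau (q * Z a)) + (\<Sum>a<m-i. n' a * tau (q * monom 1 a))"
    unfolding tau_cong_mult'[OF n(3)]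
    by (simp add: distrib_right tau_add tau_lin mult.commute[of q])
  also have "\<dots> \<in> \<int>"
    using assms n by (intro Ints_add int_sum Ints_mult Jd_Z[OF assms(2)] Jd_x[OF assms(2)]) auto
  finally show ?thesis .
qed

text \<open>The x^a with a < m - i and all \<open>Z l\<close> lie in \<open>Jd i\<close>, and
  integral pairing with exactly these defines \<open>Jd (m - i)\<close>.\<close>

lemma Jd_dual_conv:
  assumes "\<And>p. p \<in> Jd i \<Longrightarrow> tau (b * p) \<in> \<int>" "i \<le> m" shows "b \<in> Jd (m - i)"
  by (rule JdI) (use assms in \<open>auto intro!: assms(1) monom_Jd Z_Jd\<close>)

abbreviation "J \<equiv> Jd m"

lemma J_struct: assumes "p \<in> J"
  shows "\<exists>n. (\<forall>a. n a \<in> \<int>) \<and> U dvd p - (\<Sum>a<m. smult (n a) (Z a))"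
  using Jd_struct[OF assms] by auto

lemma Z_J: "l < m \<Longrightarrow> Z l \<in> J" by (simp add: Z_Jd)

text \<open>In powers of I = (1, x): multiplying I^(m-1-i) by the inverse of I gives I^(m-2-i). The
  \<open>min\<close> covers i = m, where it says that J J lies in \<open>J\<close>. The pairings are
  moved onto products x^a Z_l and Z_a Z_l, which lie in the dual \<open>Jd (m - i)\<close>.\<close>

lemma J_mult_Jd:
  assumes "p \<in> J" "q \<in> Jd i" "i \<le> m" shows "p * q \<in> Jd (min m (Suc i))"
proof -
  obtain n where n: "\<And>a. n a \<in> \<int>" "U dvd p - (\<Sum>a<m. smult (n a) (Z a))"
    using J_struct[OF assms(1)] by metis
  have xZ: "monom 1 a * Z l \<in> Jd (m - i)" if "a \<le> i" "a < m" "l < m" for a l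
  proof (rule JdI)
    fix c assume "c < m - i"
    then have "a + c < m" using that by simp
    then show "tau (monom 1 a * Z l * monom 1 c) \<in> \<int>"
      using tau_monom_Z[of "a + c" l] that
      by (simp add: mult.assoc mult.commute[of "Z l"] mult.left_commute[of _ "Z l"] mult_monom)
         (simp add: mult.assoc[symmetric] mult_monom)
  next
    fix b assume "b < m"
    then show "tau (monom 1 a * Z l * Z b) \<in> \<int>" using that by (intro tau_ZZx)
  qed
  have ZZ: "Z a * Z l \<in> Jd (m - i)" if "a < m" "l < m" for a l
    by (rule JdI) (use that in \<open>auto intro!: tau_ZZZ simp: tau_ZZx mult.commute[of _ "monom 1 _"] mult.assoc[symmetric]\<close>)
  show ?thesis
  proof (rule JdI)
    fix a assume a: "a < min m (Suc i)"
    have "tau (p * q * monom 1 a) = (\<Sum>l<m. n l * tau (q * (monom 1 a * Z l)))"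
      unfolding mult.assoc tau_cong_mult'[OF n(2)]
      unfolding tau_lin by (simp add: mult_ac)
    also have "\<dots> \<in> \<int>"
      using a n(1) by (intro int_sum Ints_mult Jd_dual[OF assms(2) _ assms(3)] xZ) auto
    finally show "tau (p * q * monom 1 a) \<in> \<int>" .
  next
    fix a assume a: "a < m"
    have "tau (p * q * Z a) = (\<Sum>l<m. n l * tau (q * (Z a * Z l)))"
      unfolding mult.assoc tau_cong_mult'[OF n(2)]
      unfolding tau_lin by (simp add: mult_ac)
    also have "\<dots> \<in> \<int>"
      using a n(1) by (intro int_sum Ints_mult Jd_dual[OF assms(2) _ assms(3)] ZZ) auto
    finally show "tau (p * q * Z a) \<in> \<int>" .
  qed
qed

lemma J_mult: "p \<in> J \<Longrightarrow> q \<in> J \<Longrightarrow> p * q \<in> J"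
  using J_mult_Jd[of p q m] by simp

lemma x_Jd: assumes "p \<in> Jd (Suc i)" shows "monom 1 1 * p \<in> Jd i"
proof (rule JdI)
  fix a assume "a < i"
  then have "tau (p * monom 1 (Suc a)) \<in> \<int>" using Jd_x[OF assms] by simp
  then show "tau (monom 1 1 * p * monom 1 a) \<in> \<int>"
    by (simp add: mult.commute[of _ p] mult.assoc mult_monom)
next
  fix l assume l: "l < m"
  have t: "tau p \<in> \<int>" using Jd_x[OF assms, of 0] by (simp add: monom_0)
  show "tau (monom 1 1 * p * Z l) \<in> \<int>"
  proof (cases l)
    case 0
    have "tau (monom 1 1 * p * Z l) = tau (p * (U - [:coeff U 0:]))"
      by (simp add: X_Z_0[symmetric] 0 mult_ac)
    also have "\<dots> = - (coeff U 0 * tau p)"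
      by (simp add: right_diff_distrib tau_diff tau_dvd tau_smult)
    finally show ?thesis using t Uint by simp
  next
    case (Suc l')
    have "tau (monom 1 1 * p * Z l) = tau (p * (Z l' - [:coeff U l:]))"
      by (simp add: X_Z_Suc[symmetric] Suc mult_ac)
    also have "\<dots> = tau (p * Z l') - coeff U l * tau p"
      by (simp add: right_diff_distrib tau_diff tau_dvd tau_smult)
    finally show ?thesis using t Uint Jd_Z[OF assms, of l'] l Suc by simp
  qed
qed

text \<open>Multiplication by x leaves \<open>J\<close> only by an integer constant: with u_a the
  coefficients of \<open>U\<close>, x Z_a = Z_(a-1) - u_a, where Z_(-1) stands for
  \<open>U\<close>.\<close>

lemma x_J: assumes "p \<in> J" shows "\<exists>c\<in>\<int>. monom 1 1 * p - [:c:] \<in> J"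
proof -
  obtain n where n: "\<And>a. n a \<in> \<int>" "U dvd p - (\<Sum>a<m. smult (n a) (Z a))"
    using J_struct[OF assms] by metis
  define c where "c = - (\<Sum>a<m. n a * coeff U a)"
  have xZ: "monom 1 1 * Z a + [:coeff U a:] \<in> J" if "a < m" for a
    using that by (cases a) (auto simp: X_Z_0[unfolded One_nat_def] X_Z_Suc[unfolded One_nat_def] U_Jd Z_J)
  have const: "[:sum f I:] = (\<Sum>i\<in>I. [:f i:])" for f :: "nat \<Rightarrow> complex" and I
    by (rule poly_eqI) (auto simp: coeff_sum coeff_pCons split: nat.splits)
  have "(\<Sum>a<m. smult (n a) (monom 1 1 * Z a + [:coeff U a:])) \<in> J"
    using n(1) xZ by (intro subgrp_sum[OF subgrp_Jd] subgrp_smult_Ints[OF subgrp_Jd]) auto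
  also have "(\<Sum>a<m. smult (n a) (monom 1 1 * Z a + [:coeff U a:]))
     = monom 1 1 * (\<Sum>a<m. smult (n a) (Z a)) - [:c:]"
    unfolding c_def
    by (simp add: smult_add_right sum.distrib sum_distrib_left const)
  finally have 1: "monom 1 1 * (\<Sum>a<m. smult (n a) (Z a)) - [:c:] \<in> J" .
  have "monom 1 1 * (p - (\<Sum>a<m. smult (n a) (Z a))) \<in> J"
    by (rule U_Jd) (use n(2) in simp)
  from subgrp_add[OF subgrp_Jd 1 this] have "monom 1 1 * p - [:c:] \<in> J"
    unfolding right_diff_distrib by (simp only: diff_add_eq add_diff_cancel_left' add.commute
      diff_add_cancel add_diff_eq) (simp add: algebra_simps)
  moreover have "c \<in> \<int>" unfolding c_def using n(1) Uint by (intro Ints_minus int_sum Ints_mult) auto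
  ultimately show ?thesis by blast
qed

text \<open>Here primitivity enters. Every coefficient u_l of \<open>U\<close> equals Z_(l-1) - x
  Z_l and so lies in J + x J (for l = 0 and l = m with \<open>U\<close> and 0 at the ends), and some
  integral combination of the coefficients is 1.\<close>

lemma one_J: "\<exists>j0\<in>J. \<exists>j1\<in>J. 1 = j0 + monom 1 1 * j1"
proof -
  obtain e where e: "\<And>i. e i \<in> \<int>" "(\<Sum>i\<le>m. e i * coeff U i) = 1" using prim by blast
  have "\<exists>\<alpha>\<in>J. \<exists>\<beta>\<in>J. [:coeff U l:] = \<alpha> + monom 1 1 * \<beta>" if "l \<le> m" for l
  proof (cases "l = m")
    case True
    have "[:coeff U l:] = Z (m - 1)"
      using True mpos deg by (intro poly_eqI) (auto simp: coeff_Z coeff_pCons coeff_eq_0 split: nat.splits)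
    then have "[:coeff U l:] = Z (m - 1) + monom 1 1 * 0" by simp
    moreover have "Z (m - 1) \<in> J" using mpos by (simp add: Z_J)
    ultimately show ?thesis using subgrp_zero[OF subgrp_Jd, of m] by blast
  next
    case False
    then have l: "l < m" using that by simp
    then have mz: "- Z l \<in> J" using subgrp_uminus[OF subgrp_Jd] Z_J by blast
    show ?thesis
    proof (cases l)
      case 0
      have "[:coeff U l:] = U + monom 1 1 * (- Z l)" using X_Z_0 0 by simp
      moreover have "U \<in> J" by (simp add: U_Jd)
      ultimately show ?thesis using mz by blast
    next
      case (Suc l')
      have "[:coeff U l:] = Z l' + monom 1 1 * (- Z l)" using X_Z_Suc[of l'] Suc by simp
      moreover have "Z l' \<in> J" using l Suc by (simp add: Z_J)
      ultimately show ?thesis using mz by blast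
    qed
  qed
  then obtain \<alpha> \<beta> where ab: "\<And>l. l \<le> m \<Longrightarrow> \<alpha> l \<in> J" "\<And>l. l \<le> m \<Longrightarrow> \<beta> l \<in> J"
    "\<And>l. l \<le> m \<Longrightarrow> [:coeff U l:] = \<alpha> l + monom 1 1 * \<beta> l" by metis
  have "1 = (\<Sum>l\<le>m. smult (e l) [:coeff U l:])"
  proof (rule poly_eqI)
    fix i show "coeff 1 i = coeff (\<Sum>l\<le>m. smult (e l) [:coeff U l:]) i"
      using e(2) by (cases i) (simp_all add: coeff_sum)
  qed
  also have "\<dots> = (\<Sum>l\<le>m. smult (e l) (\<alpha> l)) + monom 1 1 * (\<Sum>l\<le>m. smult (e l) (\<beta> l))"
    unfolding sum_distrib_left sum.distrib[symmetric]
    by (rule sum.cong) (auto simp: ab(3) smult_add_right simp del: smult_pCons)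
  finally have "1 = (\<Sum>l\<le>m. smult (e l) (\<alpha> l)) + monom 1 1 * (\<Sum>l\<le>m. smult (e l) (\<beta> l))" .
  moreover have "(\<Sum>l\<le>m. smult (e l) (\<alpha> l)) \<in> J" "(\<Sum>l\<le>m. smult (e l) (\<beta> l)) \<in> J"
    using ab(1,2) e(1) by (auto intro!: subgrp_sum[OF subgrp_Jd] subgrp_smult_Ints[OF subgrp_Jd])
  ultimately show ?thesis by blast
qed

end

lemma Ints_real_of_int_floor: "z \<in> \<int> \<Longrightarrow> of_int \<lfloor>Re z\<rfloor> = (z::complex)"
  by (auto elim!: Ints_cases)

section \<open>Dual lattices and triangular bases\<close>

context residue_form begin

definition dual :: "complex poly set \<Rightarrow> complex poly set" where
  "dual D = {b. \<forall>p\<in>D. tau (b * p) \<in> \<int>}"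

text \<open>Lattices modulo \<open>U\<close> are kept as unreduced sets of polynomials containing
  all multiples of \<open>U\<close>. Discreteness is a common denominator of the reduced elements,
  and full rank is an element of every degree below m, from which a triangular basis can be
  built.\<close>

definition lattice :: "complex poly set \<Rightarrow> bool" where
  "lattice D \<longleftrightarrow> subgrp D \<and> (\<forall>p. U dvd p \<longrightarrow> p \<in> D) \<and>
     (\<exists>N>0. \<forall>p\<in>D. degree p < m \<longrightarrow> (\<forall>i. of_nat N * coeff p i \<in> \<int>)) \<and>
     (\<forall>i<m. \<exists>p\<in>D. p \<noteq> 0 \<and> degree p = i)"

text \<open>A Hermite normal form. In each degree i take an element whose leading coefficient,
  cleared by \<open>N\<close>, is the least positive integer that occurs; division with remainder by
  it then lowers the degree of any element of \<open>D\<close>.\<close>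

lemma lattice_basis:
  assumes "lattice D"
  shows "\<exists>b N. N > (0::nat) \<and> (\<forall>i<m. b i \<in> D \<and> degree (b i) = i \<and> b i \<noteq> 0) \<and>
    (\<forall>i<m. \<forall>j. of_nat N * coeff (b i) j \<in> \<int>) \<and>
    (\<forall>p\<in>D. degree p < m \<longrightarrow> (\<exists>c. (\<forall>i. c i \<in> \<int>) \<and> p = (\<Sum>i<m. smult (c i) (b i))))"
proof -
  have sg: "subgrp D" using assms by (simp add: lattice_def)
  obtain N where N: "N > (0::nat)" "\<And>p i. p \<in> D \<Longrightarrow> degree p < m \<Longrightarrow> of_nat N * coeff p i \<in> \<int>"
    using assms by (auto simp: lattice_def)
  define K where "K i d \<longleftrightarrow> d > (0::nat) \<and> (\<exists>p\<in>D. degree p = i \<and> of_nat N * coeff p i = of_nat d)" for i d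
  have neg: "- p \<in> D" if "p \<in> D" for p using subgrp_uminus[OF sg that] .
  have exK: "\<exists>d. K i d" if i: "i < m" for i
  proof -
    obtain p where p: "p \<in> D" "p \<noteq> 0" "degree p = i" using assms i by (auto simp: lattice_def)
    obtain z where z: "of_nat N * coeff p i = of_int z" using N(2)[OF p(1)] p i by (metis Ints_cases)
    have "coeff p i \<noteq> 0" using p by auto
    then have z0: "z \<noteq> 0" using z N(1) by auto
    show ?thesis
    proof (cases "z > 0")
      case True
      then show ?thesis using p z by (intro exI[of _ "nat z"]) (auto simp: K_def intro!: bexI[of _ p])
    next
      case False
      then have "of_nat N * coeff (- p) i = of_nat (nat (- z))" using z by simp
      then have "K i (nat (- z))" using False z0 p neg[OF p(1)]
        unfolding K_def by (intro conjI bexI[of _ "- p"]) auto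
      then show ?thesis ..
    qed
  qed
  define d where "d i = (LEAST d. K i d)" for i
  have dK: "K i (d i)" if "i < m" for i unfolding d_def using exK[OF that] by (rule LeastI_ex)
  have dmin: "d i \<le> e" if "K i e" for i e unfolding d_def using that by (rule Least_le)
  have "\<forall>i. \<exists>p. i < m \<longrightarrow> p \<in> D \<and> degree p = i \<and> of_nat N * coeff p i = of_nat (d i)"
    using dK unfolding K_def by blast
  then obtain b where b: "\<And>i. i < m \<Longrightarrow> b i \<in> D" "\<And>i. i < m \<Longrightarrow> degree (b i) = i"
    "\<And>i. i < m \<Longrightarrow> of_nat N * coeff (b i) i = of_nat (d i)" by metis
  have dpos: "d i > 0" if "i < m" for i using dK[OF that] by (simp add: K_def)
  have b0: "b i \<noteq> 0" if "i < m" for i using b(3)[OF that] dpos[OF that] by auto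
  have main: "i \<le> m \<Longrightarrow> p \<in> D \<Longrightarrow> \<forall>j\<ge>i. coeff p j = 0 \<Longrightarrow>
      \<exists>c. (\<forall>i. c i \<in> \<int>) \<and> p = (\<Sum>l<i. smult (c l) (b l))" for i p
  proof (induction i arbitrary: p)
    case 0
    then have "p = 0" by (simp add: poly_eq_iff)
    then show ?case by (intro exI[of _ "\<lambda>_. 0"]) simp
  next
    case (Suc i)
    have i: "i < m" using Suc.prems by simp
    have dp: "degree p < m"
      using Suc.prems mpos by (intro degree_lessI) auto
    obtain z where z: "of_nat N * coeff p i = of_int z" using N(2)[OF Suc.prems(2) dp] by (metis Ints_cases)
    define q where "q = p - smult (of_int (z div int (d i))) (b i)"
    have qD: "q \<in> D" unfolding q_def
      by (intro subgrp_diff[OF sg] subgrp_smult_Ints[OF sg] Suc.prems b i) auto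
    have hi: "coeff q j = 0" if "j \<ge> Suc i" for j
      using Suc.prems(3) that b(2)[OF i] by (auto simp: q_def coeff_eq_0)
    have "of_nat N * coeff q i = of_int z - of_int (z div int (d i)) * (of_nat N * coeff (b i) i)"
      by (simp add: q_def z[symmetric] algebra_simps)
    also have "\<dots> = of_int (z - z div int (d i) * int (d i))" by (simp add: b(3)[OF i])
    also have "\<dots> = of_int (z mod int (d i))" by (simp add: minus_div_mult_eq_mod)
    finally have qi: "of_nat N * coeff q i = of_int (z mod int (d i))" .
    have mb: "0 \<le> z mod int (d i)" "z mod int (d i) < int (d i)" using dpos[OF i] by auto
    \<comment> \<open>A nonzero remainder would be a positive leading coefficient below the minimum
      \<open>d i\<close>.\<close>
    have "coeff q i = 0"
    proof (rule ccontr)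
      assume ne: "coeff q i \<noteq> 0"
      then have "degree q = i" using hi le_degree[OF ne] degree_le[of i q] by (intro antisym) auto
      moreover have "z mod int (d i) \<noteq> 0" using qi ne N(1) by auto
      ultimately have "K i (nat (z mod int (d i)))" using qD qi mb unfolding K_def by auto
      then show False using dmin[of i "nat (z mod int (d i))"] mb by linarith
    qed
    then have "\<forall>j\<ge>i. coeff q j = 0" using hi by (metis Suc_leI le_neq_implies_less)
    then obtain c where c: "\<forall>i. c i \<in> \<int>" "q = (\<Sum>l<i. smult (c l) (b l))"
      using Suc.IH[OF _ qD] i by auto
    have "p = (\<Sum>l<Suc i. smult ((c(i := of_int (z div int (d i)))) l) (b l))"
      using c(2) by (simp add: q_def algebra_simps)
    then show ?case using c(1) by (intro exI[of _ "c(i := of_int (z div int (d i)))"]) auto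
  qed
  show ?thesis
  proof (intro exI[of _ b] exI[of _ N] conjI allI impI ballI)
    fix i j assume "i < m" then show "of_nat N * coeff (b i) j \<in> \<int>" using N(2)[OF b(1)] b(2) by simp
  next
    fix p assume "p \<in> D" "degree p < m"
    then show "\<exists>c. (\<forall>i. c i \<in> \<int>) \<and> p = (\<Sum>i<m. smult (c i) (b i))"
      by (intro main) (auto intro!: coeff_eq_0)
  qed (use b b0 N in auto)
qed

lemma triangular_span:
  assumes b: "\<And>i. i < m \<Longrightarrow> degree (b i) = i" "\<And>i. i < m \<Longrightarrow> b i \<noteq> 0"
  shows "i \<le> m \<Longrightarrow> \<forall>j\<ge>i. coeff p j = 0 \<Longrightarrow> \<exists>c. p = (\<Sum>l<i. smult (c l) (b l :: complex poly))"
proof (induction i arbitrary: p)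
  case 0
  then have "p = 0" by (simp add: poly_eq_iff)
  then show ?case by simp
next
  case (Suc i)
  have i: "i < m" using Suc.prems by simp
  have bi: "coeff (b i) i \<noteq> 0" using b(1)[OF i] b(2)[OF i] leading_coeff_neq_0[of "b i"] by simp
  define q where "q = p - smult (coeff p i / coeff (b i) i) (b i)"
  have "coeff q j = 0" if "j \<ge> i" for j
    using that bi Suc.prems(2) b(1)[OF i] by (cases "j = i") (auto simp: q_def coeff_eq_0)
  then obtain c where "q = (\<Sum>l<i. smult (c l) (b l))" using Suc.IH[of q] i by auto
  then have "p = (\<Sum>l<Suc i. smult ((c(i := coeff p i / coeff (b i) i)) l) (b l))"
    by (simp add: q_def algebra_simps)
  then show ?case by blast
qed

text \<open>The b_i are triangular in the powers of x, to which the \<open>Z l\<close> are dual, so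
  the coordinates of the dual basis in the \<open>Z l\<close> solve a triangular system.\<close>

lemma dual_basis_exists:
  assumes b: "\<And>i. i < m \<Longrightarrow> degree (b i) = i" "\<And>i. i < m \<Longrightarrow> b i \<noteq> 0"
  obtains bs where "\<And>i j. i < m \<Longrightarrow> j < m \<Longrightarrow> tau (b i * bs j) = (if i = j then 1 else 0)"
    "\<And>p. U dvd p - (\<Sum>j<m. smult (tau (p * bs j)) (b j))"
proof -
  have bi: "coeff (b i) i \<noteq> 0" if "i < m" for i
    using b(1)[OF that] b(2)[OF that] leading_coeff_neq_0[of "b i"] by simp
  have "\<exists>y. \<forall>i<m. (\<Sum>l\<le>i. coeff (b i) l * y l) = (if i = j then 1 else 0)" for j
    by (rule triangular_solve) (use bi in auto)
  then obtain y where y: "\<And>i j. i < m \<Longrightarrow> (\<Sum>l\<le>i. coeff (b i) l * y j l) = (if i = j then 1 else 0)"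
    by metis
  define bs where "bs j = (\<Sum>l<m. smult (y j l) (Z l))" for j
  have 1: "tau (b i * bs j) = (if i = j then 1 else 0)" if "i < m" "j < m" for i j
  proof -
    have "tau (b i * bs j) = (\<Sum>l<m. y j l * tau (b i * Z l))"
      by (simp add: bs_def mult.commute[of "b i"] tau_lin)
    also have "\<dots> = (\<Sum>l<m. coeff (b i) l * y j l)"
      using that b(1) by (intro sum.cong) (simp_all add: tau_Z)
    also have "\<dots> = (\<Sum>l\<le>i. coeff (b i) l * y j l)"
      using that b(1) by (intro sum.mono_neutral_right) (auto intro!: coeff_eq_0)
    finally show ?thesis using y[OF that(1)] by simp
  qed
  have 2: "U dvd p - (\<Sum>j<m. smult (tau (p * bs j)) (b j))" for p
  proof -
    define r where "r = p mod U"
    have U1: "U dvd p - r" by (simp add: r_def minus_mod_eq_mult_div)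
    have dr: "degree r < m" using degree_mod_less[OF U0, of p] deg mpos by (auto simp: r_def)
    obtain c where c: "r = (\<Sum>l<m. smult (c l) (b l))"
    proof -
      have "\<forall>j\<ge>m. coeff r j = 0" using dr by (auto intro: coeff_eq_0)
      from triangular_span[where b = b, OF b order.refl this] show ?thesis using that by blast
    qed
    have "tau (p * bs j) = c j" if "j < m" for j
    proof -
      have "tau (p * bs j) = (\<Sum>l<m. c l * tau (b l * bs j))"
        unfolding tau_cong_mult'[OF U1] c tau_lin ..
      also have "\<dots> = (\<Sum>l<m. c l * (if l = j then 1 else 0))"
        using that by (intro sum.cong) (simp_all add: 1)
      finally show ?thesis using that by (simp add: mult_delta_right)
    qed
    then have "(\<Sum>j<m. smult (tau (p * bs j)) (b j)) = r" unfolding c by (intro sum.cong) auto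
    then show ?thesis using U1 by simp
  qed
  show ?thesis using that 1 2 by blast
qed

text \<open>The basis dual to a triangular basis of \<open>D\<close> lies in \<open>dual D\<close>;
  pairing with it yields the coordinates of \<open>p\<close>, which are therefore integers.\<close>

lemma double_dual: assumes D: "lattice D" shows "dual (dual D) \<subseteq> D"
proof
  fix p assume p: "p \<in> dual (dual D)"
  obtain b N where bb: "\<forall>i<m. b i \<in> D \<and> degree (b i) = i \<and> b i \<noteq> 0"
    and b4: "\<forall>p\<in>D. degree p < m \<longrightarrow> (\<exists>c. (\<forall>i. c i \<in> \<int>) \<and> p = (\<Sum>i<m. smult (c i) (b i)))"
    using lattice_basis[OF D] by blast
  have b: "b i \<in> D" "degree (b i) = i" "b i \<noteq> 0" if "i < m" for i using bb that by auto
  obtain bs where bs: "\<And>i j. i < m \<Longrightarrow> j < m \<Longrightarrow> tau (b i * bs j) = (if i = j then 1 else 0)"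
    "\<And>p. U dvd p - (\<Sum>j<m. smult (tau (p * bs j)) (b j))"
    using dual_basis_exists[where b = b, OF b(2,3)] by blast
  have sg: "subgrp D" and UD: "\<And>p. U dvd p \<Longrightarrow> p \<in> D" using D by (auto simp: lattice_def)
  have bsD: "bs j \<in> dual D" if j: "j < m" for j
    unfolding dual_def
  proof (intro CollectI ballI)
    fix q assume q: "q \<in> D"
    have U1: "U dvd q - q mod U" by (simp add: minus_mod_eq_mult_div)
    have "q mod U \<in> D" using subgrp_diff[OF sg q UD[OF U1]] by simp
    moreover have "degree (q mod U) < m" using degree_mod_less[OF U0, of q] deg mpos by auto
    ultimately obtain c where c: "\<forall>i. c i \<in> \<int>" "q mod U = (\<Sum>i<m. smult (c i) (b i))" using b4 by blast
    have "tau (bs j * q) = (\<Sum>l<m. c l * tau (b l * bs j))"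
      unfolding mult.commute[of "bs j"] tau_cong_mult'[OF U1] c(2) tau_lin ..
    also have "\<dots> = (\<Sum>l<m. c l * (if l = j then 1 else 0))"
      using j by (intro sum.cong) (simp_all add: bs(1))
    finally show "tau (bs j * q) \<in> \<int>" using c(1) j by (simp add: mult_delta_right)
  qed
  have "(\<Sum>j<m. smult (tau (p * bs j)) (b j)) \<in> D"
    using p bsD b(1) by (intro subgrp_sum[OF sg] subgrp_smult_Ints[OF sg]) (auto simp: dual_def)
  from subgrp_add[OF sg UD[OF bs(2)[of p]] this] show "p \<in> D" by simp
qed

text \<open>The index is shifted by one: \<open>Jp s\<close> is the power J^(s+1). This explains the
  extra \<open>Suc\<close> in \<open>Jp_mult\<close>.\<close>

primrec Jp :: "nat \<Rightarrow> complex poly set" where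
  "Jp 0 = J"
| "Jp (Suc s) = zspan {a * b | a b. a \<in> J \<and> b \<in> Jp s}"

lemma subgrp_Jp: "subgrp (Jp s)"
  by (cases s) (simp_all add: subgrp_Jd subgrp_zspan)

lemma zspan_mult:
  fixes c :: "complex poly"
  assumes "subgrp A" "\<And>b. b \<in> B \<Longrightarrow> c * b \<in> A" "p \<in> zspan B" shows "c * p \<in> A"
proof -
  have "subgrp {p. c * p \<in> A}" using assms(1) by (auto simp: subgrp_def right_diff_distrib)
  from zspan_subset[OF this _ assms(3)] assms(2) show ?thesis by auto
qed

lemma J_Jp: "a \<in> J \<Longrightarrow> b \<in> Jp s \<Longrightarrow> a * b \<in> Jp (Suc s)"
  by (auto intro!: zspan_base)

lemma J_Jp': "a \<in> J \<Longrightarrow> b \<in> Jp s \<Longrightarrow> a * b \<in> Jp s"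
proof (induction s arbitrary: b)
  case 0 then show ?case by (simp add: J_mult)
next
  case (Suc s)
  have "a * (c * d) \<in> Jp (Suc s)" if "c \<in> J" "d \<in> Jp s" for c d
    using J_Jp[OF that(1) Suc.IH[OF Suc.prems(1) that(2)]] by (simp add: mult.left_commute)
  moreover have b: "b \<in> zspan {a * b | a b. a \<in> J \<and> b \<in> Jp s}" using Suc.prems by simp
  ultimately show ?case by (intro zspan_mult[OF subgrp_Jp _ b]) blast
qed

lemma Jp_Suc_subset: "Jp (Suc s) \<subseteq> Jp s"
proof
  fix p assume "p \<in> Jp (Suc s)"
  then have p: "p \<in> zspan {a * b | a b. a \<in> J \<and> b \<in> Jp s}" by simp
  show "p \<in> Jp s" by (rule zspan_subset[OF subgrp_Jp _ p]) (auto intro: J_Jp')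
qed

lemma Jp_subset_J: "Jp s \<subseteq> J"
proof (induction s)
  case (Suc s)
  then show ?case using Jp_Suc_subset[of s] by (rule subset_trans[rotated])
qed simp

lemma Jp_mult: "a \<in> Jp s \<Longrightarrow> b \<in> Jp t \<Longrightarrow> b * a \<in> Jp (Suc (s + t))"
proof (induction s arbitrary: a)
  case 0 then show ?case using J_Jp[of a b t] by (simp add: mult.commute)
next
  case (Suc s)
  have "b * (c * d) \<in> Jp (Suc (Suc s + t))" if "c \<in> J" "d \<in> Jp s" for c d
    using J_Jp[OF that(1) Suc.IH[OF that(2) Suc.prems(2)]] by (simp add: mult.left_commute)
  moreover have a: "a \<in> zspan {a * b | a b. a \<in> J \<and> b \<in> Jp s}" using Suc.prems by simp
  ultimately show ?case by (intro zspan_mult[OF subgrp_Jp _ a]) blast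
qed

text \<open>By \<open>x_J\<close> one factor from \<open>J\<close> absorbs x up to an integer, at
  the cost of one power.\<close>

lemma x_Jp: assumes "p \<in> Jp (Suc s)" shows "monom 1 1 * p \<in> Jp s"
proof -
  have "monom 1 1 * (a * b) \<in> Jp s" if ab: "a \<in> J" "b \<in> Jp s" for a b
  proof -
    obtain c where c: "c \<in> \<int>" "monom 1 1 * a - [:c:] \<in> J" using x_J[OF ab(1)] by blast
    have "monom 1 1 * (a * b) = (monom 1 1 * a - [:c:]) * b + smult c b"
      by (simp add: algebra_simps)
    then show ?thesis
      using subgrp_add[OF subgrp_Jp J_Jp'[OF c(2) ab(2)] subgrp_smult_Ints[OF subgrp_Jp ab(2) c(1)]] by simp
  qed
  moreover have p: "p \<in> zspan {a * b | a b. a \<in> J \<and> b \<in> Jp s}" using assms by simp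
  ultimately show ?thesis by (intro zspan_mult[OF subgrp_Jp _ p]) blast
qed

text \<open>Each further power of \<open>J\<close> admits one more power of x. The exact bound m - 1
  + s is what the degree of \<open>F\<close> is measured against in \<open>tau_VV\<close>.\<close>

lemma tau_x_Jp: "q \<in> Jp s \<Longrightarrow> a \<le> m - 1 + s \<Longrightarrow> tau (monom 1 a * q) \<in> \<int>"
proof (induction s arbitrary: q a)
  case 0
  then have "a < m" using mpos by simp
  then show ?case using 0 Jd_x[of q m a] by (simp add: mult.commute)
next
  case (Suc s)
  show ?case
  proof (cases a)
    case 0
    have "q \<in> Jp s" using Suc.prems Jp_Suc_subset by blast
    then show ?thesis using Suc.IH[of q 0] 0 by simp
  next
    case (Suc a')
    have "monom 1 a * q = monom 1 a' * (monom 1 1 * q)"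
      by (simp add: Suc mult.assoc[symmetric] mult_monom)
    moreover have "tau (monom 1 a' * (monom 1 1 * q)) \<in> \<int>"
      by (rule Suc.IH[OF x_Jp[OF Suc.prems(1)]]) (use Suc.prems Suc in simp)
    ultimately show ?thesis by (simp only:)
  qed
qed

lemma tau_poly_Jp:
  assumes "q \<in> Jp s" "degree F \<le> m - 1 + s" "\<And>i. coeff F i \<in> \<int>" shows "tau (F * q) \<in> \<int>"
proof -
  have "tau (F * q) = tau ((\<Sum>i\<le>degree F. smult (coeff F i) (monom 1 i)) * q)"
    using poly_as_sum_of_monoms[of F] by (simp add: smult_monom)
  also have "\<dots> = (\<Sum>i\<le>degree F. coeff F i * tau (monom 1 i * q))" by (rule tau_lin)
  also have "\<dots> \<in> \<int>" using assms by (intro int_sum Ints_mult tau_x_Jp) auto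
  finally show ?thesis .
qed

text \<open>The (s+1)-st power of the relation 1 = j0 + x j1 of \<open>one_J\<close>, collected by
  powers of x.\<close>

lemma one_Jp: "\<exists>e. (\<forall>i. e i \<in> Jp s) \<and> 1 = (\<Sum>i\<le>Suc s. monom 1 i * e i)"
proof (induction s)
  case 0
  obtain j0 j1 where j: "j0 \<in> J" "j1 \<in> J" "1 = j0 + monom 1 1 * j1" using one_J by blast
  then show ?case by (intro exI[of _ "\<lambda>i. if i = 0 then j0 else j1"]) (auto simp: monom_0)
next
  case (Suc s)
  obtain j0 j1 where j: "j0 \<in> J" "j1 \<in> J" "1 = j0 + monom 1 1 * j1" using one_J by blast
  obtain e where e: "\<And>i. e i \<in> Jp s" "1 = (\<Sum>i\<le>Suc s. monom 1 i * e i)" using Suc by blast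
  define xx where "xx = monom (1::complex) 1"
  have mS: "monom 1 (Suc i) = xx * monom 1 i" for i by (simp add: xx_def mult_monom)
  define e' where "e' i = (if i \<le> Suc s then j0 * e i else 0) + (case i of 0 \<Rightarrow> 0 | Suc l \<Rightarrow> j1 * e l)" for i
  have 1: "e' i \<in> Jp (Suc s)" for i
    unfolding e'_def using j e(1) subgrp_zero[OF subgrp_Jp, of "Suc s"]
    by (intro subgrp_add[OF subgrp_Jp]) (auto split: nat.splits intro!: J_Jp simp del: Jp.simps)
  have "(\<Sum>i\<le>Suc (Suc s). monom 1 i * e' i)
     = (\<Sum>i\<le>Suc (Suc s). monom 1 i * (if i \<le> Suc s then j0 * e i else 0))
       + (\<Sum>i\<le>Suc (Suc s). monom 1 i * (case i of 0 \<Rightarrow> 0 | Suc l \<Rightarrow> j1 * e l))"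
    unfolding e'_def distrib_left sum.distrib ..
  also have "(\<Sum>i\<le>Suc (Suc s). monom 1 i * (if i \<le> Suc s then j0 * e i else 0)) = j0 * (\<Sum>i\<le>Suc s. monom 1 i * e i)"
    unfolding sum_distrib_left by (subst sum.atMost_Suc) (auto intro!: sum.cong simp: mult_ac)
  also have "(\<Sum>i\<le>Suc (Suc s). monom 1 i * (case i of 0 \<Rightarrow> 0 | Suc l \<Rightarrow> j1 * e l))
      = (xx * j1) * (\<Sum>i\<le>Suc s. monom 1 i * e i)"
    unfolding sum_distrib_left sum.atMost_Suc_shift[of _ "Suc s"] mS
    by (simp del: sum.atMost_Suc add: mult_ac)
  finally have "(\<Sum>i\<le>Suc (Suc s). monom 1 i * e' i) = 1"
    using e(2) j(3)[folded xx_def] by (simp flip: distrib_right)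
  then show ?case using 1 by metis
qed

end

section \<open>The pencil attached to a square root modulo a polynomial\<close>

text \<open>The bound in \<open>degF\<close> is n = 2k + 1 + m, the size of the final pencil.
  \<open>V\<close> is allowed denominators, since it comes from rational interpolation.\<close>

locale square_root_mod = residue_form +
  fixes V F :: "complex poly" and k h :: nat
  assumes m_odd: "m = 2 * h + 1" and degV: "degree V < m"
    and V_rat: "\<exists>N>0. \<forall>i. of_nat N * coeff V i \<in> \<int>"
    and V_sq: "U dvd V\<^sup>2 - F"
    and F_int: "\<And>i. coeff F i \<in> \<int>" and degF: "degree F \<le> 2 * k + 1 + m"
begin

lemma h_bounds: "h \<le> m" "Suc h \<le> m" "m - h = Suc h" "m - Suc h = h" using m_odd by auto

text \<open>
  The dual of \<open>L0\<close> is \<open>L1\<close>, which contains \<open>L0\<close> and \<open>x L0\<close>; this makes both \<open>\<tau>(b b')\<close> and \<open>\<tau>(x b b')\<close>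
  integral on \<open>L0\<close>.
\<close>

definition L0 :: "complex poly set" where
  "L0 = {a + V * b | a b. a \<in> Jd (Suc h) \<and> (\<forall>j\<in>Jp k. tau (a * (V * j)) \<in> \<int>) \<and> b \<in> Jp (Suc k)}"

definition L1 :: "complex poly set" where
  "L1 = {a + V * b | a b. a \<in> Jd h \<and> (\<forall>j\<in>Jp (Suc k). tau (a * (V * j)) \<in> \<int>) \<and> b \<in> Jp k}"

text \<open>\<open>L1\<close> without the condition on pairings with \<open>V\<close>. Its dual lies
  in \<open>L0\<close>, which is how the dual of \<open>L0\<close> gets controlled.\<close>

definition D0 :: "complex poly set" where
  "D0 = {a + V * b | a b. a \<in> Jd h \<and> b \<in> Jp k}"

text \<open>V^2 may be replaced by \<open>F\<close>, and b b' lies in \<open>Jp (2 * k + 2)\<close>,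
  which pairs integrally with integral polynomials of degree up to (m - 1) + (2k + 2): exactly the
  bound on \<open>F\<close>.\<close>

lemma tau_VV: assumes "b \<in> Jp (Suc k)" "b' \<in> Jp k" shows "tau ((V * b) * (V * b')) \<in> \<int>"
proof -
  have "b' * b \<in> Jp (Suc (Suc k + k))" using Jp_mult[OF assms] .
  then have "tau (F * (b' * b)) \<in> \<int>"
    by (rule tau_poly_Jp) (use degF F_int mpos in auto)
  moreover have "tau ((V * b) * (V * b')) = tau (V\<^sup>2 * (b' * b))"
    by (simp add: power2_eq_square mult_ac)
  ultimately show ?thesis using tau_cong_mult'[OF V_sq] by simp
qed

text \<open>The mixed terms are integral by the side conditions in the two definitions, a a' by the
  duality of \<open>Jd h\<close> and \<open>Jd (Suc h)\<close> (as m = 2h + 1), and the last term by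
  \<open>tau_VV\<close>.\<close>

lemma L0_L1: assumes "p \<in> L0" "q \<in> L1" shows "tau (p * q) \<in> \<int>"
proof -
  obtain a b where p: "p = a + V * b" "a \<in> Jd (Suc h)" "\<And>j. j \<in> Jp k \<Longrightarrow> tau (a * (V * j)) \<in> \<int>" "b \<in> Jp (Suc k)"
    using assms(1) unfolding L0_def by blast
  obtain a' b' where q: "q = a' + V * b'" "a' \<in> Jd h" "\<And>j. j \<in> Jp (Suc k) \<Longrightarrow> tau (a' * (V * j)) \<in> \<int>" "b' \<in> Jp k"
    using assms(2) unfolding L1_def by blast
  have "p * q = a' * a + a * (V * b') + a' * (V * b) + (V * b) * (V * b')"
    by (simp add: p(1) q(1) algebra_simps)
  moreover have "tau (a' * a) \<in> \<int>" using Jd_dual[OF q(2), of a] p(2) m_odd by (simp add: mult_2)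
  ultimately show ?thesis
    using p(3)[OF q(4)] q(3)[OF p(4)] tau_VV[OF p(4) q(4)] by (simp add: tau_add)
qed

lemma tau_V_J: assumes N: "\<And>i. of_nat N * coeff V i \<in> \<int>" and "b \<in> J"
  shows "of_nat N * tau (V * b) \<in> \<int>"
proof -
  have "of_nat N * tau (V * b) = tau (smult (of_nat N) V * b)" by (simp add: tau_smult)
  also have "\<dots> \<in> \<int>"
    by (rule tau_poly_Jp[of _ 0]) (use assms degV in auto)
  finally show ?thesis .
qed

lemma subgrp_VJ: assumes "subgrp A" "subgrp B" shows "subgrp {a + V * b | a b. a \<in> A \<and> b \<in> B}"
  unfolding subgrp_def
proof (intro conjI ballI)
  show "0 \<in> {a + V * b | a b. a \<in> A \<and> b \<in> B}"
    using subgrp_zero[OF assms(1)] subgrp_zero[OF assms(2)] by force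
next
  fix x y assume "x \<in> {a + V * b | a b. a \<in> A \<and> b \<in> B}" "y \<in> {a + V * b | a b. a \<in> A \<and> b \<in> B}"
  then obtain a b a' b' where "x = a + V * b" "y = a' + V * b'" "a \<in> A" "b \<in> B" "a' \<in> A" "b' \<in> B" by blast
  then have "x - y = (a - a') + V * (b - b')" "a - a' \<in> A" "b - b' \<in> B"
    using subgrp_diff assms by (auto simp: algebra_simps)
  then show "x - y \<in> {a + V * b | a b. a \<in> A \<and> b \<in> B}" by blast
qed

text \<open>Pairing with \<open>Z j\<close> reads off the j-th coefficient of a reduced element, so
  a denominator of \<open>V\<close> works for all of them. The multiples N Z_l, one in every degree
  below m, give full rank.\<close>

lemma lattice_VJ:
  assumes A: "subgrp A" "A \<subseteq> Jd i" "\<And>p. U dvd p \<Longrightarrow> p \<in> A"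
    and N: "N > (0::nat)" "\<And>l. l < m \<Longrightarrow> smult (of_nat N) (Z l) \<in> A"
  shows "lattice {a + V * b | a b. a \<in> A \<and> b \<in> Jp s}"
proof -
  let ?D = "{a + V * b | a b. a \<in> A \<and> b \<in> Jp s}"
  have AD: "A \<subseteq> ?D" using subgrp_zero[OF subgrp_Jp, of s] by force
  obtain M where M: "M > (0::nat)" "\<And>i. of_nat M * coeff V i \<in> \<int>" using V_rat by blast
  have bd: "of_nat M * coeff p j \<in> \<int>" if p: "p \<in> ?D" "degree p < m" for p j
  proof (cases "j < m")
    case True
    obtain a b where ab: "p = a + V * b" "a \<in> A" "b \<in> Jp s" using p(1) by blast
    have "coeff p j = tau (a * Z j) + tau (V * (b * Z j))"
      using tau_Z[OF p(2) True] by (simp add: ab(1) distrib_right tau_add mult.assoc)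
    then have "of_nat M * coeff p j = of_nat M * tau (a * Z j) + of_nat M * tau (V * (b * Z j))"
      by (simp add: distrib_left)
    moreover have "b \<in> J" using ab(3) Jp_subset_J by blast
    then have "of_nat M * tau (V * (b * Z j)) \<in> \<int>" using M True by (intro tau_V_J J_mult Z_J) auto
    moreover have "tau (a * Z j) \<in> \<int>" using A(2) ab(2) True by (intro Jd_Z) auto
    ultimately show ?thesis by simp
  next
    case False
    then show ?thesis using p(2) by (simp add: coeff_eq_0)
  qed
  have "\<exists>p\<in>?D. p \<noteq> 0 \<and> degree p = i" if "i < m" for i
  proof (rule bexI)
    show "smult (of_nat N) (Z (m - 1 - i)) \<in> ?D" by (rule subsetD[OF AD N(2)]) (use mpos in simp)
    show "smult (of_nat N) (Z (m - 1 - i)) \<noteq> 0 \<and> degree (smult (of_nat N) (Z (m - 1 - i))) = i"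
      using N(1) that mpos deg_Z_eq[of "m - 1 - i"] lead_Z[of "m - 1 - i"] U0 by auto
  qed
  then show ?thesis
    unfolding lattice_def
  proof (intro conjI allI impI)
    show "subgrp ?D" by (rule subgrp_VJ[OF A(1) subgrp_Jp])
    show "p \<in> ?D" if "U dvd p" for p by (rule subsetD[OF AD A(3)[OF that]])
    show "\<exists>N>0. \<forall>p\<in>?D. degree p < m \<longrightarrow> (\<forall>i. of_nat N * coeff p i \<in> \<int>)"
      by (intro exI[of _ M] conjI ballI impI allI M(1) bd)
  qed simp
qed

lemma lattice_D0: "lattice D0"
  unfolding D0_def
  by (rule lattice_VJ[of "Jd h" h 1]) (use h_bounds in \<open>auto simp: subgrp_Jd U_Jd Z_Jd\<close>)

lemma L0_alt: "L0 = {a + V * b | a b. a \<in> {a \<in> Jd (Suc h). \<forall>j\<in>Jp k. tau (a * (V * j)) \<in> \<int>} \<and> b \<in> Jp (Suc k)}"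
  by (auto simp: L0_def)

lemma lattice_L0: "lattice L0"
proof -
  obtain N where N: "N > (0::nat)" "\<And>i. of_nat N * coeff V i \<in> \<int>" using V_rat by blast
  have 1: "tau (smult (of_nat N) (Z l) * (V * j)) \<in> \<int>" if "l < m" "j \<in> Jp k" for l j
  proof -
    have "Z l * j \<in> J" using that Jp_subset_J by (intro J_mult Z_J) auto
    from tau_V_J[OF N(2) this] show ?thesis by (simp add: tau_smult mult_ac)
  qed
  show ?thesis
    unfolding L0_alt
    by (rule lattice_VJ[of _ "Suc h" N])
       (use h_bounds N 1 in \<open>auto simp: subgrp_def left_diff_distrib tau_diff U_Jd tau_dvd
          intro: subgrp_zero[OF subgrp_Jd] subgrp_diff[OF subgrp_Jd] Z_Jd subgrp_smult_Ints[OF subgrp_Jd]\<close>)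
qed

text \<open>Dualising the inclusion of \<open>dual D0\<close> in \<open>L0\<close> puts p into
  \<open>D0\<close>, say p = a + V b. Pairing p with the elements V j of \<open>L0\<close> and
  subtracting the integral term of \<open>tau_VV\<close> gives the condition on a required by
  \<open>L1\<close>.\<close>

lemma dual_L0: assumes p: "p \<in> dual L0" shows "p \<in> L1"
proof -
  have Jsub: "0 \<in> Jp s" for s by (rule subgrp_zero[OF subgrp_Jp])
  have "dual D0 \<subseteq> L0"
  proof
    fix a assume a: "a \<in> dual D0"
    have "tau (a * q) \<in> \<int>" if "q \<in> Jd h" for q
    proof -
      have "q \<in> D0" using that Jsub unfolding D0_def by force
      then show ?thesis using a by (simp add: dual_def)
    qed
    then have "a \<in> Jd (m - h)" using m_odd by (intro Jd_dual_conv) auto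
    then have "a \<in> Jd (Suc h)" using m_odd by (simp add: mult_2)
    moreover have "tau (a * (V * j)) \<in> \<int>" if "j \<in> Jp k" for j
    proof -
      have "V * j \<in> D0" using that subgrp_zero[OF subgrp_Jd, of h] unfolding D0_def by force
      then show ?thesis using a by (simp add: dual_def)
    qed
    ultimately show "a \<in> L0" using Jsub[of "Suc k"] unfolding L0_def by force
  qed
  then have "p \<in> dual (dual D0)" using p by (auto simp: dual_def)
  then have "p \<in> D0" using double_dual[OF lattice_D0] by blast
  then obtain a b where ab: "p = a + V * b" "a \<in> Jd h" "b \<in> Jp k" by (auto simp: D0_def)
  have "tau (a * (V * j)) \<in> \<int>" if j: "j \<in> Jp (Suc k)" for j
  proof -
    have "V * j \<in> L0" using j subgrp_zero[OF subgrp_Jd, of "Suc h"] unfolding L0_def by force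
    then have "tau (p * (V * j)) \<in> \<int>" using p by (simp add: dual_def)
    moreover have "p * (V * j) = a * (V * j) + (V * j) * (V * b)"
      by (simp add: ab(1) algebra_simps)
    then have "tau (p * (V * j)) = tau (a * (V * j)) + tau ((V * j) * (V * b))" by (simp add: tau_add)
    ultimately have "tau (a * (V * j)) = tau (p * (V * j)) - tau ((V * j) * (V * b))" by simp
    also have "\<dots> \<in> \<int>" using \<open>tau (p * (V * j)) \<in> \<int>\<close> tau_VV[OF j ab(3)] by (rule Ints_diff)
    finally show ?thesis .
  qed
  then show ?thesis using ab unfolding L1_def by blast
qed

lemma L0_subset_L1: "L0 \<subseteq> L1"
proof
  fix p assume "p \<in> L0"
  then obtain a b where p: "p = a + V * b" "a \<in> Jd (Suc h)" "\<And>j. j \<in> Jp k \<Longrightarrow> tau (a * (V * j)) \<in> \<int>" "b \<in> Jp (Suc k)"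
    unfolding L0_def by blast
  have "a \<in> Jd h" using p(2) Jd_mono[of h "Suc h"] by auto
  then show "p \<in> L1" using p Jp_Suc_subset unfolding L1_def by blast
qed

lemma x_L0: assumes "p \<in> L0" shows "monom 1 1 * p \<in> L1"
proof -
  obtain a b where p: "p = a + V * b" "a \<in> Jd (Suc h)" "\<And>j. j \<in> Jp k \<Longrightarrow> tau (a * (V * j)) \<in> \<int>" "b \<in> Jp (Suc k)"
    using assms unfolding L0_def by blast
  have "tau (monom 1 1 * a * (V * j)) \<in> \<int>" if "j \<in> Jp (Suc k)" for j
    using p(3)[OF x_Jp[OF that]] by (simp add: mult_ac)
  moreover have "monom 1 1 * p = monom 1 1 * a + V * (monom 1 1 * b)" by (simp add: p(1) algebra_simps)
  ultimately show ?thesis using x_Jd[OF p(2)] x_Jp[OF p(4)] unfolding L1_def by blast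
qed

text \<open>Hence tau(Z_l p q) is integral for p, q in \<open>L1\<close>, which gives
  \<open>integral_pencil\<close> an inverse up to a factor with integral coefficients.\<close>

lemma J_L1: assumes j: "j \<in> J" and "p \<in> L1" shows "j * p \<in> L0"
proof -
  obtain a b where p: "p = a + V * b" "a \<in> Jd h" "\<And>j. j \<in> Jp (Suc k) \<Longrightarrow> tau (a * (V * j)) \<in> \<int>" "b \<in> Jp k"
    using assms(2) unfolding L1_def by blast
  have "j * a \<in> Jd (Suc h)" using J_mult_Jd[OF j p(2)] m_odd by (simp add: min_def split: if_splits)
  moreover have "tau (j * a * (V * j')) \<in> \<int>" if "j' \<in> Jp k" for j'
    using p(3)[OF J_Jp[OF j that]] by (simp add: mult_ac)
  moreover have "j * p = j * a + V * (j * b)" by (simp add: p(1) algebra_simps)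
  ultimately show ?thesis using J_Jp[OF j p(4)] unfolding L0_def by blast
qed

text \<open>\<open>V\<close> times the relation of \<open>one_Jp\<close>. The c_i pair integrally
  with \<open>L0\<close>, so these pairings can be used as integral border entries of the
  pencil.\<close>

lemma V_expansion: "\<exists>c. (\<forall>i. c i \<in> L1) \<and> V = (\<Sum>i\<le>Suc k. monom 1 i * c i)"
proof -
  obtain e where e: "\<And>i. e i \<in> Jp k" "1 = (\<Sum>i\<le>Suc k. monom 1 i * e i)" using one_Jp by blast
  have "V * e i \<in> L1" for i using e(1) subgrp_zero[OF subgrp_Jd, of h] unfolding L1_def by force
  moreover have "V = (\<Sum>i\<le>Suc k. monom 1 i * (V * e i))"
  proof -
    have "V = V * (\<Sum>i\<le>Suc k. monom 1 i * e i)" using e(2) by simp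
    also have "\<dots> = (\<Sum>i\<le>Suc k. monom 1 i * (V * e i))" unfolding sum_distrib_left by (simp add: mult_ac)
    finally show ?thesis .
  qed
  ultimately show ?thesis by (intro exI[of _ "\<lambda>i. V * e i"]) simp
qed

end

section \<open>Evaluation at a root expressed through the residue functional\<close>

context residue_form begin

text \<open>This is (U(X) - U(x)) / (X - x) as a polynomial in X, by
  \<open>quot_root_mult\<close>.\<close>

definition quot_root :: "complex \<Rightarrow> complex poly" where "quot_root x = (\<Sum>l<m. smult (x ^ l) (Z l))"

lemma quot_root_mult: "[:- x, 1:] * quot_root x = U - [:poly U x:]"
proof -
  have aux: "[:- x, 1:] * (\<Sum>l<i. smult (x ^ l) (Z l))
      = U - smult (x ^ i) (poly_shift i U) - [:\<Sum>l<i. coeff U l * x ^ l:]" for i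
  proof (induction i)
    case 0
    show ?case by simp
  next
    case (Suc i)
    have S: "poly_shift i U = [:coeff U i:] + monom 1 1 * Z i"
      by (rule poly_eqI) (auto simp: coeff_monom_mult coeff_Z coeff_poly_shift coeff_pCons split: nat.splits)
    have e: "[:- x, 1:] = monom 1 1 - [:x:]" by (simp add: monom_altdef)
    have "[:- x, 1:] * (\<Sum>l<Suc i. smult (x ^ l) (Z l))
        = U - smult (x ^ i) (poly_shift i U) - [:\<Sum>l<i. coeff U l * x ^ l:] + [:- x, 1:] * smult (x ^ i) (Z i)"
      by (simp only: sum.lessThan_Suc distrib_left Suc.IH)
    moreover have "[:- x, 1:] * smult (x ^ i) (Z i) = smult (x ^ i) (monom 1 1 * Z i) - smult (x ^ Suc i) (Z i)"
      unfolding e by (simp add: left_diff_distrib right_diff_distrib smult_diff_right mult.commute)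
    moreover have "U - smult (x ^ i) (poly_shift i U) - [:\<Sum>l<i. coeff U l * x ^ l:] +
        (smult (x ^ i) (monom 1 1 * Z i) - smult (x ^ Suc i) (Z i))
      = U - smult (x ^ Suc i) (Z i) - [:\<Sum>l<Suc i. coeff U l * x ^ l:]"
      unfolding S by (simp add: smult_add_right mult.commute)
    ultimately show ?case by (simp only: Z_def)
  qed
  have s: "smult (x ^ m) (poly_shift m U) = [:coeff U m * x ^ m:]"
    by (rule poly_eqI) (auto simp: coeff_poly_shift coeff_pCons deg coeff_eq_0 split: nat.splits)
  have "poly U x = (\<Sum>l<m. coeff U l * x ^ l) + coeff U m * x ^ m"
    by (simp add: poly_altdef deg lessThan_Suc_atMost[symmetric])
  then show ?thesis using aux[of m] s by (simp add: quot_root_def)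
qed

lemma tau_quot_root: "tau (quot_root x) = 1"
proof -
  have "tau (quot_root x) = (\<Sum>l<m. x ^ l * tau (monom 1 0 * Z l))"
    by (simp add: quot_root_def tau_sum tau_smult monom_0)
  also have "\<dots> = (\<Sum>l<m. x ^ l * (if 0 = l then 1 else 0))"
    using mpos by (intro sum.cong refl) (simp only: lessThan_iff tau_monom_Z)
  also have "\<dots> = 1" using mpos by (simp add: mult_delta_right)
  finally show ?thesis .
qed

text \<open>At a root x the product (X - x) \<open>quot_root x\<close> is \<open>U\<close>, so
  modulo \<open>U\<close> only the constant p(x) of p survives.\<close>

lemma tau_quot_root_mult: assumes "poly U x = 0" shows "tau (quot_root x * p) = poly p x"
proof -
  obtain q where q: "p - [:poly p x:] = [:- x, 1:] * q"
    using poly_eq_0_iff_dvd[of "p - [:poly p x:]" x] by (auto simp: dvd_def)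
  have "quot_root x * p = quot_root x * [:poly p x:] + quot_root x * ([:- x, 1:] * q)"
    by (simp only: q[symmetric] distrib_left[symmetric]) simp
  moreover have "quot_root x * [:poly p x:] = smult (poly p x) (quot_root x)" by simp
  moreover have "quot_root x * ([:- x, 1:] * q) = U * q"
  proof -
    have "quot_root x * ([:- x, 1:] * q) = ([:- x, 1:] * quot_root x) * q" by (simp only: mult_ac)
    also have "\<dots> = U * q" unfolding quot_root_mult using assms by simp
    finally show ?thesis .
  qed
  ultimately have e: "quot_root x * p = smult (poly p x) (quot_root x) + U * q" by (metis (no_types))
  have z: "tau (U * q) = 0" by (rule tau_dvd) (rule dvd_triv_left)
  show ?thesis by (simp only: e tau_add tau_smult tau_quot_root z mult_1_right add_0_right)
qed

text \<open>The coordinates of q in the basis b are its pairings with the dual vectors bs.\<close>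

lemma parseval:
  assumes "\<And>p. U dvd p - (\<Sum>j<m. smult (tau (p * bs j)) (b j))"
  shows "(\<Sum>j<m. tau (p * b j) * tau (q * bs j)) = tau (p * q)"
proof -
  have "tau (p * q) = tau (q * p)" by (simp only: mult.commute)
  also have "\<dots> = tau ((\<Sum>j<m. smult (tau (q * bs j)) (b j)) * p)" by (rule tau_cong_mult'[OF assms])
  also have "\<dots> = (\<Sum>j<m. tau (q * bs j) * tau (b j * p))" by (rule tau_lin)
  finally have "tau (p * q) = (\<Sum>j<m. tau (q * bs j) * tau (b j * p))" .
  then show ?thesis by (simp add: mult.commute)
qed

end

section \<open>The integral pencil and its inverse up to the factor \<open>U\<close>\<close>

context square_root_mod begin

text \<open>In a basis b of \<open>L0\<close> with dual basis bs in \<open>L1\<close>,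
  \<open>A0\<close> and \<open>B0\<close> are the Gram matrices of tau(p q) and tau(x p q),
  \<open>Xm l\<close> is that of tau(Z_l p q) on bs, and \<open>c\<close> pairs the expansion of
  \<open>V\<close> with b. Multiplication by \<open>quot_root x\<close> inverts that by x - X up to
  U(x), so the same holds for the matrix sum x^l \<open>Xm l\<close> and x A0 - B0. The condition
  with d keeps this matrix nonzero at the roots of \<open>U\<close>. The last three conditions write
  \<open>A0\<close> as a triangular transform of a Hankel matrix, from which the sign of the
  determinant will be read.\<close>

lemma integral_pencil:
  shows "\<exists>(A0::nat\<Rightarrow>nat\<Rightarrow>int) (B0::nat\<Rightarrow>nat\<Rightarrow>int) (Xm::nat\<Rightarrow>nat\<Rightarrow>nat\<Rightarrow>int) (c::nat\<Rightarrow>nat\<Rightarrow>int) (M::nat\<Rightarrow>nat\<Rightarrow>real).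
  (\<forall>i j. A0 i j = A0 j i) \<and> (\<forall>i j. B0 i j = B0 j i) \<and>
  (\<forall>x. \<forall>i<m. \<forall>j<m. (\<Sum>p<m. (x * of_int (A0 i p) - of_int (B0 i p)) * (\<Sum>l<m. of_int (Xm l p j) * x ^ l))
      = (if i = j then poly U x else 0)) \<and>
  (\<forall>x. poly U x = 0 \<longrightarrow> (\<Sum>i<m. \<Sum>j<m. (\<Sum>p\<le>Suc k. of_int (c p i) * x ^ p) *
      (\<Sum>l<m. of_int (Xm l i j) * x ^ l) * (\<Sum>p\<le>Suc k. of_int (c p j) * x ^ p)) = poly F x) \<and>
  (\<forall>x. poly U x = 0 \<longrightarrow> (\<exists>d. (\<Sum>i<m. \<Sum>j<m. d i * (\<Sum>l<m. of_int (Xm l i j) * x ^ l) * d j) = 1)) \<and>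
  (\<forall>i<m. M i i \<noteq> 0) \<and> (\<forall>i<m. \<forall>a>i. M i a = 0) \<and>
  (\<forall>i<m. \<forall>j<m. of_int (A0 i j) =
      (\<Sum>a<m. \<Sum>b<m. of_real (M i a) * of_real (M j b) * tau (monom 1 (a + b))))"
proof -
  obtain b N where N: "N > (0::nat)" and bb: "\<forall>i<m. b i \<in> L0 \<and> degree (b i) = i \<and> b i \<noteq> 0"
    and bN: "\<forall>i<m. \<forall>j. of_nat N * coeff (b i) j \<in> \<int>"
    and b4: "\<forall>p\<in>L0. degree p < m \<longrightarrow> (\<exists>c. (\<forall>i. c i \<in> \<int>) \<and> p = (\<Sum>i<m. smult (c i) (b i)))"
    using lattice_basis[OF lattice_L0] by blast
  have b: "b i \<in> L0" "degree (b i) = i" "b i \<noteq> 0" if "i < m" for i using bb that by auto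
  obtain bs where bs: "\<And>i j. i < m \<Longrightarrow> j < m \<Longrightarrow> tau (b i * bs j) = (if i = j then 1 else 0)"
    and pb: "\<And>p. U dvd p - (\<Sum>j<m. smult (tau (p * bs j)) (b j))"
    using dual_basis_exists[where b = b, OF b(2,3)] by blast
  have bsL1: "bs j \<in> L1" if j: "j < m" for j
  proof (rule dual_L0)
    show "bs j \<in> dual L0" unfolding dual_def
    proof (intro CollectI ballI)
      fix q assume q: "q \<in> L0"
      have sg: "subgrp L0" and UD: "\<And>p. U dvd p \<Longrightarrow> p \<in> L0" using lattice_L0 by (auto simp: lattice_def)
      have U1: "U dvd q - q mod U" by (simp add: minus_mod_eq_mult_div)
      have "q mod U \<in> L0" using subgrp_diff[OF sg q UD[OF U1]] by simp
      moreover have "degree (q mod U) < m" using degree_mod_less[OF U0, of q] deg mpos by auto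
      ultimately obtain c where c: "\<forall>i. c i \<in> \<int>" "q mod U = (\<Sum>i<m. smult (c i) (b i))" using b4 by blast
      have "tau (bs j * q) = (\<Sum>l<m. c l * tau (b l * bs j))"
        unfolding mult.commute[of "bs j"] tau_cong_mult'[OF U1] c(2) tau_lin ..
      also have "\<dots> = (\<Sum>l<m. c l * (if l = j then 1 else 0))"
        using j by (intro sum.cong) (simp_all add: bs)
      finally show "tau (bs j * q) \<in> \<int>" using c(1) j by (simp add: mult_delta_right)
    qed
  qed
  obtain cp where cp: "\<And>i. cp i \<in> L1" "V = (\<Sum>i\<le>Suc k. monom 1 i * cp i)" using V_expansion by blast
  \<comment> \<open>The floor only converts a value already known to be an integer to type
    \<open>int\<close>.\<close>
  define ti where "ti p = \<lfloor>Re (tau p)\<rfloor>" for p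
  have ti: "of_int (ti p) = tau p" if "tau p \<in> \<int>" for p
    unfolding ti_def using Ints_real_of_int_floor[OF that] .
  have A0: "of_int (ti (b i * b j)) = tau (b i * b j)" if "i < m" "j < m" for i j
    using that L0_subset_L1 b by (intro ti L0_L1) auto
  have B0: "of_int (ti (monom 1 1 * b i * b j)) = tau (monom 1 1 * b i * b j)" if "i < m" "j < m" for i j
    using L0_L1[OF b(1)[OF that(2)] x_L0[OF b(1)[OF that(1)]]] by (intro ti) (simp add: mult.commute)
  have X0: "of_int (ti (Z l * bs i * bs j)) = tau (Z l * bs i * bs j)" if "l < m" "i < m" "j < m" for l i j
    using that by (intro ti L0_L1 J_L1 Z_J bsL1)
  have C0: "of_int (ti (cp p * b i)) = tau (cp p * b i)" if "i < m" for i p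
    using L0_L1[OF b(1)[OF that] cp(1)] by (intro ti) (simp add: mult.commute)
  have XX: "(\<Sum>l<m. of_int (ti (Z l * bs i * bs j)) * x ^ l) = tau (quot_root x * bs i * bs j)"
    if "i < m" "j < m" for i j x
  proof -
    have "tau (quot_root x * bs i * bs j) = (\<Sum>l<m. x ^ l * tau (Z l * (bs i * bs j)))"
      unfolding quot_root_def mult.assoc tau_lin ..
    also have "\<dots> = (\<Sum>l<m. of_int (ti (Z l * bs i * bs j)) * x ^ l)"
      using that by (intro sum.cong) (simp_all add: X0 mult.assoc[symmetric])
    finally show ?thesis ..
  qed
  define Cx where "Cx x = (\<Sum>p\<le>Suc k. smult (x ^ p) (cp p))" for x
  have CC: "(\<Sum>p\<le>Suc k. of_int (ti (cp p * b i)) * x ^ p) = tau (Cx x * b i)" if "i < m" for i x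
    unfolding Cx_def tau_lin using C0[OF that] by (intro sum.cong) (simp_all add: mult.commute)
  have AB: "x * of_int (ti (b i * b j)) - of_int (ti (monom 1 1 * b i * b j)) = tau ((- ([:- x, 1:] * b i)) * b j)"
    if "i < m" "j < m" for i j x
  proof -
    have e: "- ([:- x, 1:] * b i) = smult x (b i) - monom 1 1 * b i" by (simp add: monom_altdef)
    show ?thesis unfolding e by (simp only: left_diff_distrib tau_diff A0[OF that] B0[OF that]) (simp add: tau_smult)
  qed
  have P3: "(\<Sum>p<m. (x * of_int (ti (b i * b p)) - of_int (ti (monom 1 1 * b i * b p))) *
       (\<Sum>l<m. of_int (ti (Z l * bs p * bs j)) * x ^ l)) = (if i = j then poly U x else 0)"
    if "i < m" "j < m" for i j x
  proof -
    have "(\<Sum>p<m. (x * of_int (ti (b i * b p)) - of_int (ti (monom 1 1 * b i * b p))) *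
       (\<Sum>l<m. of_int (ti (Z l * bs p * bs j)) * x ^ l))
      = (\<Sum>p<m. tau ((- ([:- x, 1:] * b i)) * b p) * tau ((quot_root x * bs j) * bs p))"
    proof (intro sum.cong refl)
      fix p assume "p \<in> {..<m}"
      then have p: "p < m" by simp
      show "(x * of_int (ti (b i * b p)) - of_int (ti (monom 1 1 * b i * b p))) *
       (\<Sum>l<m. of_int (ti (Z l * bs p * bs j)) * x ^ l)
       = tau ((- ([:- x, 1:] * b i)) * b p) * tau ((quot_root x * bs j) * bs p)"
        unfolding AB[OF that(1) p] XX[OF p that(2)] by (simp only: mult_ac)
    qed
    also have "\<dots> = tau ((- ([:- x, 1:] * b i)) * (quot_root x * bs j))" by (rule parseval[OF pb])
    finally have 1: "(\<Sum>p<m. (x * of_int (ti (b i * b p)) - of_int (ti (monom 1 1 * b i * b p))) *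
       (\<Sum>l<m. of_int (ti (Z l * bs p * bs j)) * x ^ l)) = tau ((- ([:- x, 1:] * b i)) * (quot_root x * bs j))" .
    have "(- ([:- x, 1:] * b i)) * (quot_root x * bs j) = - (([:- x, 1:] * quot_root x) * (b i * bs j))"
      by (simp only: mult_minus_left mult_minus_right mult_ac)
    then have "(- ([:- x, 1:] * b i)) * (quot_root x * bs j) = smult (poly U x) (b i * bs j) - U * (b i * bs j)"
      unfolding quot_root_mult by (simp add: left_diff_distrib)
    then show ?thesis unfolding 1 using bs[OF that] tau_dvd[of "U * (b i * bs j)"]
      by (simp only: tau_diff tau_smult dvd_triv_left) simp
  qed
  \<comment> \<open>Two uses of \<open>parseval\<close> collapse the double sum to tau(quot_root x *
    Cx^2). At a root this is the square of the value of \<open>Cx x\<close> at x, which is V(x)^2 =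
    F(x).\<close>
  have P4: "(\<Sum>i<m. \<Sum>j<m. (\<Sum>p\<le>Suc k. of_int (ti (cp p * b i)) * x ^ p) *
      (\<Sum>l<m. of_int (ti (Z l * bs i * bs j)) * x ^ l) * (\<Sum>p\<le>Suc k. of_int (ti (cp p * b j)) * x ^ p)) = poly F x"
    if x: "poly U x = 0" for x
  proof -
    have "(\<Sum>i<m. \<Sum>j<m. (\<Sum>p\<le>Suc k. of_int (ti (cp p * b i)) * x ^ p) *
      (\<Sum>l<m. of_int (ti (Z l * bs i * bs j)) * x ^ l) * (\<Sum>p\<le>Suc k. of_int (ti (cp p * b j)) * x ^ p))
     = (\<Sum>i<m. tau (Cx x * b i) * (\<Sum>j<m. tau (Cx x * b j) * tau ((quot_root x * bs i) * bs j)))"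
    proof (intro sum.cong refl, subst sum_distrib_left, intro sum.cong refl)
      fix i j assume "i \<in> {..<m}" "j \<in> {..<m}"
      then have ij: "i < m" "j < m" by auto
      show "(\<Sum>p\<le>Suc k. of_int (ti (cp p * b i)) * x ^ p) *
      (\<Sum>l<m. of_int (ti (Z l * bs i * bs j)) * x ^ l) * (\<Sum>p\<le>Suc k. of_int (ti (cp p * b j)) * x ^ p)
       = tau (Cx x * b i) * (tau (Cx x * b j) * tau ((quot_root x * bs i) * bs j))"
        unfolding CC[OF ij(1)] CC[OF ij(2)] XX[OF ij] by (simp only: mult_ac)
    qed
    also have "\<dots> = (\<Sum>i<m. tau (Cx x * b i) * tau (Cx x * (quot_root x * bs i)))"
      by (simp only: parseval[OF pb])
    also have "\<dots> = (\<Sum>i<m. tau (Cx x * b i) * tau ((Cx x * quot_root x) * bs i))"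
      by (simp only: mult.assoc)
    also have "\<dots> = tau (Cx x * (Cx x * quot_root x))" by (rule parseval[OF pb])
    also have "\<dots> = tau (quot_root x * (Cx x * Cx x))" by (simp only: mult_ac)
    also have "\<dots> = (poly (Cx x) x)\<^sup>2" using tau_quot_root_mult[OF x] by (simp add: power2_eq_square)
    also have "poly (Cx x) x = poly V x"
      by (simp add: Cx_def cp(2) poly_sum poly_monom)
    also have "(poly V x)\<^sup>2 = poly F x"
    proof -
      obtain q where "V\<^sup>2 - F = U * q" using V_sq by (auto simp: dvd_def)
      then have "poly (V\<^sup>2 - F) x = 0" using x by (simp only: poly_mult mult_zero_left)
      then show ?thesis by simp
    qed
    finally show ?thesis .
  qed
  \<comment> \<open>The witness consists of the coordinates of 1 in the basis bs, so the double sum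
    is tau(quot_root x) = 1.\<close>
  have P5: "\<exists>d. (\<Sum>i<m. \<Sum>j<m. d i * (\<Sum>l<m. of_int (ti (Z l * bs i * bs j)) * x ^ l) * d j) = 1"
    if x: "poly U x = 0" for x
  proof (rule exI[of _ "\<lambda>i. tau (1 * b i)"])
    have "(\<Sum>i<m. \<Sum>j<m. tau (1 * b i) * (\<Sum>l<m. of_int (ti (Z l * bs i * bs j)) * x ^ l) * tau (1 * b j))
     = (\<Sum>i<m. tau (1 * b i) * (\<Sum>j<m. tau (1 * b j) * tau ((quot_root x * bs i) * bs j)))"
    proof (intro sum.cong refl, subst sum_distrib_left, intro sum.cong refl)
      fix i j assume "i \<in> {..<m}" "j \<in> {..<m}"
      then have ij: "i < m" "j < m" by auto
      show "tau (1 * b i) * (\<Sum>l<m. of_int (ti (Z l * bs i * bs j)) * x ^ l) * tau (1 * b j)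
       = tau (1 * b i) * (tau (1 * b j) * tau ((quot_root x * bs i) * bs j))"
        unfolding XX[OF ij] by (simp only: mult_ac)
    qed
    also have "\<dots> = (\<Sum>i<m. tau (1 * b i) * tau (1 * (quot_root x * bs i)))"
      by (simp only: parseval[OF pb])
    also have "\<dots> = (\<Sum>i<m. tau (1 * b i) * tau ((1 * quot_root x) * bs i))"
      by (simp only: mult.assoc)
    also have "\<dots> = tau (1 * (1 * quot_root x))" by (rule parseval[OF pb])
    also have "\<dots> = 1" by (simp add: tau_quot_root)
    finally show "(\<Sum>i<m. \<Sum>j<m. tau (1 * b i) * (\<Sum>l<m. of_int (ti (Z l * bs i * bs j)) * x ^ l) * tau (1 * b j)) = 1" .
  qed
  define M where "M i a = Re (coeff (b i) a)" for i a
  have M: "complex_of_real (M i a) = coeff (b i) a" if "i < m" for i a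
  proof -
    have "of_nat N * coeff (b i) a \<in> \<int>" using bN that by blast
    then obtain z where z: "of_nat N * coeff (b i) a = of_int z" by (auto elim: Ints_cases)
    have "coeff (b i) a = (of_nat N * coeff (b i) a) / of_nat N" using N by simp
    then have "coeff (b i) a = of_real (of_int z / of_nat N)" unfolding z by simp
    then show ?thesis by (simp add: M_def)
  qed
  have M1: "M i i \<noteq> 0" if "i < m" for i
  proof
    assume "M i i = 0"
    then have "coeff (b i) (degree (b i)) = 0" using M[OF that, of i] b(2)[OF that] by simp
    then show False using b(3)[OF that] by (simp only: leading_coeff_0_iff)
  qed
  have M2: "M i a = 0" if "i < m" "i < a" for i a
    using b(2)[OF that(1)] that(2) by (simp add: M_def coeff_eq_0)
  have M3: "of_int (ti (b i * b j)) = (\<Sum>a<m. \<Sum>b<m. of_real (M i a) * of_real (M j b) * tau (monom 1 (a + b)))"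
    if "i < m" "j < m" for i j
  proof -
    have s: "b i = (\<Sum>a<m. smult (coeff (b i) a) (monom 1 a))" if "i < m" for i
      using poly_as_sum[of "b i"] b(2)[OF that] that by simp
    have "tau (b i * b j) = (\<Sum>a<m. coeff (b i) a * (\<Sum>c<m. coeff (b j) c * tau (monom 1 c * monom 1 a)))"
      by (subst s[OF that(1)], unfold tau_lin, subst mult.commute[of "monom 1 _"], subst s[OF that(2)], unfold tau_lin) simp
    then show ?thesis unfolding A0[OF that]
      using that by (simp add: M sum_distrib_left mult_monom mult.assoc add.commute)
  qed
  have S1: "\<forall>i j. ti (b i * b j) = ti (b j * b i)" by (simp add: mult.commute)
  have S2: "\<forall>i j. ti (monom 1 1 * b i * b j) = ti (monom 1 1 * b j * b i)" by (simp add: mult_ac)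
  have S3: "\<forall>x. \<forall>i<m. \<forall>j<m. (\<Sum>p<m. (x * of_int (ti (b i * b p)) - of_int (ti (monom 1 1 * b i * b p))) *
       (\<Sum>l<m. of_int (ti (Z l * bs p * bs j)) * x ^ l)) = (if i = j then poly U x else 0)"
    by (intro allI impI P3)
  have S4: "\<forall>x. poly U x = 0 \<longrightarrow> (\<Sum>i<m. \<Sum>j<m. (\<Sum>p\<le>Suc k. of_int (ti (cp p * b i)) * x ^ p) *
      (\<Sum>l<m. of_int (ti (Z l * bs i * bs j)) * x ^ l) * (\<Sum>p\<le>Suc k. of_int (ti (cp p * b j)) * x ^ p)) = poly F x"
    by (intro allI impI P4)
  have S7: "\<forall>x. poly U x = 0 \<longrightarrow> (\<exists>d. (\<Sum>i<m. \<Sum>j<m. d i * (\<Sum>l<m. of_int (ti (Z l * bs i * bs j)) * x ^ l) * d j) = 1)"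
    by (intro allI impI P5)
  have S5: "\<forall>i<m. M i i \<noteq> 0" "\<forall>i<m. \<forall>a>i. M i a = 0"
    by (intro allI impI M1, assumption) (intro allI impI M2)
  have S6: "\<forall>i<m. \<forall>j<m. of_int (ti (b i * b j)) = (\<Sum>a<m. \<Sum>b<m. of_real (M i a) * of_real (M j b) * tau (monom 1 (a + b)))"
    by (intro allI impI M3)
  show ?thesis
    by (rule exI[of _ "\<lambda>i j. ti (b i * b j)"], rule exI[of _ "\<lambda>i j. ti (monom 1 1 * b i * b j)"],
        rule exI[of _ "\<lambda>l i j. ti (Z l * bs i * bs j)"], rule exI[of _ "\<lambda>p i. ti (cp p * b i)"], rule exI[of _ M],
        intro conjI S1 S2 S3 S4 S5 S6 S7)
qed

end

section \<open>Determinants of bordered pencils\<close>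

lemma det_antitriangular:
  fixes A :: "'a::comm_ring_1 mat"
  assumes "A \<in> carrier_mat n n" "\<And>i j. i < n \<Longrightarrow> j < n \<Longrightarrow> i + j < n - 1 \<Longrightarrow> A $$ (i, j) = 0"
  shows "det A = (- 1) ^ (n * (n - 1) div 2) * (\<Prod>i<n. A $$ (i, n - 1 - i))"
  using assms
proof (induction n arbitrary: A)
  case 0
  then show ?case by simp
next
  case (Suc n)
  let ?D = "mat_delete A 0 n"
  have D: "?D \<in> carrier_mat n n" using Suc.prems(1) by (simp add: mat_delete_def)
  have ind: "?D $$ (i, j) = A $$ (Suc i, j)" if "i < n" "j < n" for i j
    using that Suc.prems(1) by (simp add: mat_delete_def)
  have IH: "det ?D = (- 1) ^ (n * (n - 1) div 2) * (\<Prod>i<n. ?D $$ (i, n - 1 - i))"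
    by (rule Suc.IH[OF D]) (use Suc.prems in \<open>auto simp: ind\<close>)
  have "det A = (\<Sum>j<Suc n. A $$ (0, j) * cofactor A 0 j)"
    using laplace_expansion_row[OF Suc.prems(1), of 0] by simp
  also have "\<dots> = A $$ (0, n) * cofactor A 0 n"
    using Suc.prems(2)[of 0] by simp
  also have "\<dots> = A $$ (0, n) * ((- 1) ^ n * ((- 1) ^ (n * (n - 1) div 2) * (\<Prod>i<n. A $$ (Suc i, n - 1 - i))))"
    unfolding cofactor_def IH by (simp add: ind)
  also have "\<dots> = (- 1) ^ (n + n * (n - 1) div 2) * (A $$ (0, n) * (\<Prod>i<n. A $$ (Suc i, n - Suc i)))"
    by (simp add: power_add)
  also have "A $$ (0, n) * (\<Prod>i<n. A $$ (Suc i, n - Suc i)) = (\<Prod>i<Suc n. A $$ (i, n - i))"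
    by (simp only: prod.lessThan_Suc_shift) simp
  also have "n + n * (n - 1) div 2 = Suc n * (Suc n - 1) div 2"
    by (cases n) (simp_all add: algebra_simps)
  finally show ?case by simp
qed

text \<open>The Schur complement, with \<open>Y\<close> in the role of D^(-1) C.\<close>

lemma det_schur:
  fixes A :: "'a::idom mat"
  assumes A: "A \<in> carrier_mat n n" and B: "B \<in> carrier_mat n m" and C: "C \<in> carrier_mat m n"
    and D: "D \<in> carrier_mat m m" and Y: "Y \<in> carrier_mat m n" and DY: "D * Y = C"
  shows "det (four_block_mat A B C D) = det (A - B * Y) * det D"
proof -
  let ?E = "four_block_mat (1\<^sub>m n) (0\<^sub>m n m) (- Y) (1\<^sub>m m)"
  have E: "?E \<in> carrier_mat (n + m) (n + m)" using Y by auto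
  have eq0: "four_block_mat A B C D * ?E
    = four_block_mat (A * 1\<^sub>m n + B * (- Y)) (A * 0\<^sub>m n m + B * 1\<^sub>m m) (C * 1\<^sub>m n + D * (- Y)) (C * 0\<^sub>m n m + D * 1\<^sub>m m)"
    by (rule mult_four_block_mat[OF A B C D]) (use Y in auto)
  have e1: "A * 1\<^sub>m n + B * (- Y) = A - B * Y" using A B Y by (intro eq_matI) auto
  have e2: "A * 0\<^sub>m n m + B * 1\<^sub>m m = B" using A B by (intro eq_matI) auto
  have "D * (- Y) = - C" using D Y DY by auto
  then have e3: "C * 1\<^sub>m n + D * (- Y) = 0\<^sub>m m n" using C by (intro eq_matI) auto
  have e4: "C * 0\<^sub>m n m + D * 1\<^sub>m m = D" using C D by (intro eq_matI) auto
  have eq: "four_block_mat A B C D * ?E = four_block_mat (A - B * Y) B (0\<^sub>m m n) D"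
    using eq0 unfolding e1 e2 e3 e4 .
  have "det (four_block_mat A B C D * ?E) = det (A - B * Y) * det D"
    unfolding eq by (rule det_four_block_mat_lower_left_zero[OF _ B refl D]) (use B Y in auto)
  moreover have "det ?E = 1"
    using Y by (subst det_four_block_mat_upper_right_zero[of _ n _ m]) auto
  moreover have "det (four_block_mat A B C D * ?E) = det (four_block_mat A B C D) * det ?E"
    by (rule det_mult[OF _ E]) (use A D in auto)
  ultimately show ?thesis by simp
qed

text \<open>
  The rows \<open>k, k + 1, \<dots>, 2 k\<close> belong to the exponents \<open>0, k, k - 1, \<dots>, 1\<close>; in this order the border becomes
  antitriangular after one column operation.
\<close>

definition rev_index :: "nat \<Rightarrow> nat \<Rightarrow> nat" where
  "rev_index k q = (if q = k then 0 else 2 * k + 1 - q)"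

text \<open>With rows i < k and columns a \<le> k this is the k by (k + 1) matrix whose kernel
  contains (1, x, ..., x^k).\<close>

definition shift_entry :: "'a::comm_ring_1 \<Rightarrow> nat \<Rightarrow> nat \<Rightarrow> 'a" where
  "shift_entry x i a = (if a = i then x else if a = Suc i then - 1 else 0)"

definition border_mat :: "nat \<Rightarrow> 'a::comm_ring_1 \<Rightarrow> (nat \<Rightarrow> nat \<Rightarrow> 'a) \<Rightarrow> 'a mat" where
  "border_mat k x \<Gamma> = mat (2 * k + 1) (2 * k + 1) (\<lambda>(r, q).
     if r < k \<and> q < k then 0 else if r < k then shift_entry x r (rev_index k q)
     else if q < k then shift_entry x q (rev_index k r) else \<Gamma> (rev_index k r) (rev_index k q))"

lemma sum_rev_index: "(\<Sum>q\<in>{k..<2*k+1}. f (rev_index k q)) = (\<Sum>a\<le>k. f a)"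
  by (rule sum.reindex_bij_witness[of _ "\<lambda>a. if a = 0 then k else 2 * k + 1 - a" "rev_index k"]) (auto simp: rev_index_def)

lemma sum_shift_entry: assumes "r < k" shows "(\<Sum>a\<le>k. shift_entry x r a * x ^ a) = 0"
proof -
  have "(\<Sum>a\<le>k. shift_entry x r a * x ^ a) = (\<Sum>a\<in>{r, Suc r}. shift_entry x r a * x ^ a)"
    using assms by (intro sum.mono_neutral_right) (auto simp: shift_entry_def)
  then show ?thesis by (simp add: shift_entry_def)
qed

text \<open>With a zero block of size k and a k by (k + 1) block killing (1, x, ..., x^k), the
  determinant is up to sign the value of \<Gamma> on that vector. The matrix \<open>E\<close>
  replaces column k by the combination of the last k + 1 columns with weights x^a; doing the same to
  the rows leaves an antitriangular matrix with -1 outside the middle.\<close>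

lemma det_border_mat:
  fixes x :: "'a::comm_ring_1"
  shows "det (border_mat k x \<Gamma>) = (- 1) ^ k * (\<Sum>a\<le>k. \<Sum>b\<le>k. x ^ a * x ^ b * \<Gamma> a b)"
proof -
  let ?n = "2 * k + 1"
  let ?F = "border_mat k x \<Gamma>"
  define E where "E = mat ?n ?n (\<lambda>(r, q). if q = k \<and> r \<ge> k then x ^ rev_index k r else if r = q then 1 else 0)"
  have F: "?F \<in> carrier_mat ?n ?n" by (simp add: border_mat_def)
  have E: "E \<in> carrier_mat ?n ?n" by (simp add: E_def)
  have dE: "det E = 1"
  proof -
    have "det E = prod_list (diag_mat E)"
      by (rule det_lower_triangular[OF _ E]) (auto simp: E_def)
    also have "diag_mat E = map (\<lambda>_. 1) [0..<?n]"
      unfolding diag_mat_def by (rule map_cong) (auto simp: E_def rev_index_def)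
    finally show ?thesis by (simp add: prod_list_replicate map_replicate_const)
  qed
  define G where "G = ?F * E"
  have G: "G \<in> carrier_mat ?n ?n" using F E by (simp add: G_def)
  have Gq: "G $$ (r, q) = ?F $$ (r, q)" if "r < ?n" "q < ?n" "q \<noteq> k" for r q
  proof -
    have "G $$ (r, q) = (\<Sum>p<?n. ?F $$ (r, p) * E $$ (p, q))"
      using that F E by (simp add: G_def scalar_prod_def atLeast0LessThan)
    also have "\<dots> = (\<Sum>p<?n. ?F $$ (r, p) * (if p = q then 1 else 0))"
      using that by (intro sum.cong) (auto simp: E_def)
    finally show ?thesis using that by (simp add: mult_delta_right)
  qed
  have Gk: "G $$ (r, k) = (\<Sum>a\<le>k. (if r < k then shift_entry x r a else \<Gamma> (rev_index k r) a) * x ^ a)" if "r < ?n" for r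
  proof -
    have "G $$ (r, k) = (\<Sum>p<?n. ?F $$ (r, p) * E $$ (p, k))"
      using that F E by (simp add: G_def scalar_prod_def atLeast0LessThan)
    also have "\<dots> = (\<Sum>p\<in>{k..<?n}. ?F $$ (r, p) * E $$ (p, k))"
      by (rule sum.mono_neutral_right) (auto simp: E_def)
    also have "\<dots> = (\<Sum>p\<in>{k..<?n}. (if r < k then shift_entry x r (rev_index k p) else \<Gamma> (rev_index k r) (rev_index k p)) * x ^ rev_index k p)"
      using that by (intro sum.cong) (auto simp: E_def border_mat_def)
    finally show ?thesis using sum_rev_index[of "\<lambda>a. (if r < k then shift_entry x r a else \<Gamma> (rev_index k r) a) * x ^ a" k] by simp
  qed
  define W where "W = transpose_mat E * G"
  have W: "W \<in> carrier_mat ?n ?n" using E G by (simp add: W_def)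
  have Wr: "W $$ (r, q) = G $$ (r, q)" if "r < ?n" "q < ?n" "r \<noteq> k" for r q
  proof -
    have "W $$ (r, q) = (\<Sum>p<?n. E $$ (p, r) * G $$ (p, q))"
      using that G E by (simp add: W_def scalar_prod_def atLeast0LessThan)
    also have "\<dots> = (\<Sum>p<?n. (if p = r then 1 else 0) * G $$ (p, q))"
      using that by (intro sum.cong) (auto simp: E_def)
    finally show ?thesis using that by (simp add: mult_delta_left)
  qed
  have Wk: "W $$ (k, q) = (\<Sum>p\<in>{k..<?n}. x ^ rev_index k p * G $$ (p, q))" if "q < ?n" for q
  proof -
    have "W $$ (k, q) = (\<Sum>p<?n. E $$ (p, k) * G $$ (p, q))"
      using that G E by (simp add: W_def scalar_prod_def atLeast0LessThan)
    also have "\<dots> = (\<Sum>p\<in>{k..<?n}. E $$ (p, k) * G $$ (p, q))"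
      by (rule sum.mono_neutral_right) (auto simp: E_def)
    also have "\<dots> = (\<Sum>p\<in>{k..<?n}. x ^ rev_index k p * G $$ (p, q))"
      by (intro sum.cong) (auto simp: E_def)
    finally show ?thesis .
  qed
  have W0: "W $$ (r, q) = 0" if "r < ?n" "q < ?n" "r + q < ?n - 1" for r q
  proof (cases "r = k")
    case True
    then have q: "q < k" using that by simp
    have "W $$ (k, q) = (\<Sum>p\<in>{k..<?n}. x ^ rev_index k p * shift_entry x q (rev_index k p))"
      using q by (subst Wk) (auto intro!: sum.cong simp: Gq border_mat_def)
    also have "\<dots> = (\<Sum>a\<le>k. x ^ a * shift_entry x q a)" by (rule sum_rev_index)
    finally show ?thesis using sum_shift_entry[OF q, of x] True by (simp add: mult.commute)
  next
    case False
    show ?thesis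
    proof (cases "q = k")
      case True
      then have "r < k" using that by simp
      then show ?thesis using that False True Wr[of r q] Gk[of r] sum_shift_entry[of r k x] by simp
    next
      case qk: False
      then show ?thesis using that False by (auto simp: Wr Gq border_mat_def shift_entry_def rev_index_def)
    qed
  qed
  have Wd: "W $$ (i, ?n - 1 - i) = (if i = k then (\<Sum>a\<le>k. \<Sum>b\<le>k. x ^ a * x ^ b * \<Gamma> a b) else - 1)" if "i < ?n" for i
  proof (cases "i = k")
    case True
    have "W $$ (k, k) = (\<Sum>p\<in>{k..<?n}. x ^ rev_index k p * (\<Sum>b\<le>k. \<Gamma> (rev_index k p) b * x ^ b))"
      by (subst Wk) (auto intro!: sum.cong simp: Gk)
    also have "\<dots> = (\<Sum>a\<le>k. x ^ a * (\<Sum>b\<le>k. \<Gamma> a b * x ^ b))" by (rule sum_rev_index)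
    also have "\<dots> = (\<Sum>a\<le>k. \<Sum>b\<le>k. x ^ a * x ^ b * \<Gamma> a b)" by (simp add: sum_distrib_left mult_ac)
    finally show ?thesis using True by simp
  next
    case False
    then show ?thesis using that by (auto simp: Wr Gq border_mat_def shift_entry_def rev_index_def)
  qed
  have "det W = (- 1) ^ (?n * (?n - 1) div 2) * (\<Prod>i<?n. W $$ (i, ?n - 1 - i))"
    by (rule det_antitriangular[OF W W0])
  also have "(\<Prod>i<?n. W $$ (i, ?n - 1 - i)) = (\<Prod>i<?n. (if i = k then (\<Sum>a\<le>k. \<Sum>b\<le>k. x ^ a * x ^ b * \<Gamma> a b) else - 1))"
    using Wd by (intro prod.cong) auto
  also have "\<dots> = (\<Sum>a\<le>k. \<Sum>b\<le>k. x ^ a * x ^ b * \<Gamma> a b) * (\<Prod>i\<in>{..<?n} - {k}. - 1)"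
    by (subst prod.remove[of _ k]) auto
  also have "(\<Prod>i\<in>{..<?n} - {k}. - 1 :: 'a) = 1" by (simp add: power_mult)
  also have "?n * (?n - 1) div 2 = k + 2 * (k * k)" by (simp add: algebra_simps)
  also have "(- 1 :: 'a) ^ (k + 2 * (k * k)) = (- 1) ^ k" by (simp add: power_add power_mult)
  finally have dW: "det W = (- 1) ^ k * (\<Sum>a\<le>k. \<Sum>b\<le>k. x ^ a * x ^ b * \<Gamma> a b)" by simp
  have "det W = det (transpose_mat E) * (det ?F * det E)"
    unfolding W_def G_def using E F by (simp add: det_mult[of _ ?n])
  then show ?thesis using dW dE det_transpose[OF E] by simp
qed

definition coupling_mat :: "nat \<Rightarrow> nat \<Rightarrow> (nat \<Rightarrow> nat \<Rightarrow> 'a::comm_ring_1) \<Rightarrow> 'a mat" where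
  "coupling_mat k m C = mat (2 * k + 1) m (\<lambda>(r, j). if r < k then 0 else C (rev_index k r) j)"

text \<open>Eliminating \<open>T0\<close>, whose inverse is \<open>Xs\<close> / u, leaves a matrix
  of the same border shape, with \<Gamma> corrected by C Xs C^T / u.\<close>

lemma det_block_pencil:
  fixes x :: "'a::field"
  assumes T0: "T0 \<in> carrier_mat m m" and Xs: "Xs \<in> carrier_mat m m" and u: "u \<noteq> 0"
    and T0X: "T0 * Xs = u \<cdot>\<^sub>m 1\<^sub>m m"
  shows "det (four_block_mat (border_mat k x \<Gamma>) (coupling_mat k m C) (transpose_mat (coupling_mat k m C)) T0)
    = (- 1) ^ k * det T0 * ((\<Sum>a\<le>k. \<Sum>b\<le>k. x ^ a * x ^ b * \<Gamma> a b)
        - (\<Sum>i<m. \<Sum>j<m. (\<Sum>a\<le>k. x ^ a * C a i) * Xs $$ (i, j) * (\<Sum>b\<le>k. x ^ b * C b j)) / u)"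
proof -
  let ?n = "2 * k + 1"
  let ?C = "coupling_mat k m C"
  have C: "?C \<in> carrier_mat ?n m" by (simp add: coupling_mat_def)
  have F: "border_mat k x \<Gamma> \<in> carrier_mat ?n ?n" by (simp add: border_mat_def)
  define Y where "Y = (1 / u) \<cdot>\<^sub>m (Xs * transpose_mat ?C)"
  have Y: "Y \<in> carrier_mat m ?n" using Xs C by (simp add: Y_def)
  have "T0 * Y = (1 / u) \<cdot>\<^sub>m (T0 * (Xs * transpose_mat ?C))"
    unfolding Y_def using T0 Xs C by (subst mult_smult_distrib) auto
  also have "T0 * (Xs * transpose_mat ?C) = (T0 * Xs) * transpose_mat ?C"
    using T0 Xs C by (subst assoc_mult_mat[of _ m m _ m _ ?n]) auto
  also have "\<dots> = u \<cdot>\<^sub>m transpose_mat ?C"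
    unfolding T0X using C by (subst mult_smult_assoc_mat[of _ m m _ ?n]) auto
  finally have TY: "T0 * Y = transpose_mat ?C" using u C by (intro eq_matI) auto
  define \<Gamma>' where "\<Gamma>' a b = \<Gamma> a b - (\<Sum>i<m. \<Sum>j<m. C a i * Xs $$ (i, j) * C b j) / u" for a b
  have "border_mat k x \<Gamma> - ?C * Y = border_mat k x \<Gamma>'"
  proof (rule eq_matI)
    fix r q assume "r < dim_row (border_mat k x \<Gamma>')" "q < dim_col (border_mat k x \<Gamma>')"
    then have rq: "r < ?n" "q < ?n" by (auto simp: border_mat_def)
    have Yi: "Y $$ (i, q) = (\<Sum>j<m. Xs $$ (i, j) * ?C $$ (q, j)) / u" if "i < m" for i
      using that rq Xs C by (simp add: Y_def scalar_prod_def atLeast0LessThan)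
    have "(?C * Y) $$ (r, q) = (\<Sum>i<m. ?C $$ (r, i) * Y $$ (i, q))"
      using rq C Y by (simp add: scalar_prod_def atLeast0LessThan)
    also have "\<dots> = (\<Sum>i<m. \<Sum>j<m. ?C $$ (r, i) * Xs $$ (i, j) * ?C $$ (q, j)) / u"
      by (simp add: Yi sum_divide_distrib sum_distrib_left mult.assoc)
    also have "\<dots> = (if r < k \<or> q < k then 0 else (\<Sum>i<m. \<Sum>j<m. C (rev_index k r) i * Xs $$ (i, j) * C (rev_index k q) j) / u)"
      using rq by (auto simp: coupling_mat_def)
    finally have CY: "(?C * Y) $$ (r, q) = \<dots>" .
    have "(border_mat k x \<Gamma> - ?C * Y) $$ (r, q) = border_mat k x \<Gamma> $$ (r, q) - (?C * Y) $$ (r, q)"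
      using rq C Y by (intro index_minus_mat) auto
    then show "(border_mat k x \<Gamma> - ?C * Y) $$ (r, q) = border_mat k x \<Gamma>' $$ (r, q)"
      unfolding CY using rq by (auto simp: border_mat_def \<Gamma>'_def)
  qed (use C Y in \<open>auto simp: border_mat_def\<close>)
  then have "det (four_block_mat (border_mat k x \<Gamma>) ?C (transpose_mat ?C) T0) = det (border_mat k x \<Gamma>') * det T0"
    using det_schur[OF F C _ T0 Y TY] C by simp
  also have "det (border_mat k x \<Gamma>') = (- 1) ^ k * (\<Sum>a\<le>k. \<Sum>b\<le>k. x ^ a * x ^ b * \<Gamma>' a b)" by (rule det_border_mat)
  also have "(\<Sum>a\<le>k. \<Sum>b\<le>k. x ^ a * x ^ b * \<Gamma>' a b) = (\<Sum>a\<le>k. \<Sum>b\<le>k. x ^ a * x ^ b * \<Gamma> a b)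
      - (\<Sum>a\<le>k. \<Sum>b\<le>k. x ^ a * x ^ b * (\<Sum>i<m. \<Sum>j<m. C a i * Xs $$ (i, j) * C b j)) / u"
    by (simp only: \<Gamma>'_def right_diff_distrib sum_subtractf times_divide_eq_right sum_divide_distrib[symmetric])
  also have "(\<Sum>a\<le>k. \<Sum>b\<le>k. x ^ a * x ^ b * (\<Sum>i<m. \<Sum>j<m. C a i * Xs $$ (i, j) * C b j))
      = (\<Sum>i<m. \<Sum>j<m. (\<Sum>a\<le>k. x ^ a * C a i) * Xs $$ (i, j) * (\<Sum>b\<le>k. x ^ b * C b j))"
  proof -
    have "(\<Sum>i<m. \<Sum>j<m. (\<Sum>a\<le>k. x ^ a * C a i) * Xs $$ (i, j) * (\<Sum>b\<le>k. x ^ b * C b j))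
      = (\<Sum>i<m. \<Sum>j<m. \<Sum>a\<le>k. \<Sum>b\<le>k. x ^ a * x ^ b * (C a i * Xs $$ (i, j) * C b j))"
      by (simp add: sum_distrib_left sum_distrib_right mult_ac)
    also have "\<dots> = (\<Sum>i<m. \<Sum>a\<le>k. \<Sum>j<m. \<Sum>b\<le>k. x ^ a * x ^ b * (C a i * Xs $$ (i, j) * C b j))"
      by (intro sum.cong refl sum.swap)
    also have "\<dots> = (\<Sum>a\<le>k. \<Sum>i<m. \<Sum>b\<le>k. \<Sum>j<m. x ^ a * x ^ b * (C a i * Xs $$ (i, j) * C b j))"
      by (subst sum.swap) (intro sum.cong refl sum.swap)
    also have "\<dots> = (\<Sum>a\<le>k. \<Sum>b\<le>k. \<Sum>i<m. \<Sum>j<m. x ^ a * x ^ b * (C a i * Xs $$ (i, j) * C b j))"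
      by (intro sum.cong refl sum.swap)
    finally show ?thesis by (simp add: sum_distrib_left)
  qed
  finally show ?thesis by (simp add: mult_ac)
qed

section \<open>The Hermitian form of a real pencil\<close>

lemma invertible_mat_iff_det:
  assumes "A \<in> carrier_mat n n"
  shows "invertible_mat (A :: 'a::field mat) \<longleftrightarrow> det A \<noteq> 0"
proof
  assume "invertible_mat A"
  then obtain B where B: "A * B = 1\<^sub>m (dim_row A)" "B * A = 1\<^sub>m (dim_row B)"
    by (auto simp: invertible_mat_def inverts_mat_def)
  have "dim_row B = n" "dim_col B = n"
    using B assms by (metis carrier_matD(2) index_mult_mat(3) index_one_mat(3))
       (metis B(1) assms carrier_matD(1) index_mult_mat(3) index_one_mat(3))
  then have "B \<in> carrier_mat n n" by auto
  then have "det A * det B = 1" using det_mult[OF assms, of B] B(1) assms by simp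
  then show "det A \<noteq> 0" by auto
next
  assume "det A \<noteq> 0"
  from det_non_zero_imp_unit[OF assms this, of "()"]
  obtain B where "B \<in> carrier_mat n n" "A * B = 1\<^sub>m n" "B * A = 1\<^sub>m n"
    by (auto simp: Units_def ring_mat_def)
  then show "invertible_mat A" using assms by (auto simp: invertible_mat_def inverts_mat_def)
qed

lemma mat_inverse_obtain:
  assumes "A \<in> carrier_mat n n" "det (A :: 'a::field mat) \<noteq> 0"
  obtains B where "B \<in> carrier_mat n n" "A * B = 1\<^sub>m n" "B * A = 1\<^sub>m n"
  using det_non_zero_imp_unit[OF assms, of "()"] by (auto simp: Units_def ring_mat_def)

lemma det_mat_diag: "det (mat_diag n f :: 'a::idom mat) = (\<Prod>i<n. f i)"
proof -
  have "det (mat_diag n f) = prod_list (diag_mat (mat_diag n f))"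
    by (rule det_upper_triangular[of _ n]) (auto simp: mat_diag_def upper_triangular_def)
  also have "diag_mat (mat_diag n f) = map f [0..<n]"
    unfolding diag_mat_def by (rule map_cong) (auto simp: mat_diag_def)
  finally show ?thesis by (simp add: prod.list_conv_set_nth atLeast0LessThan)
qed

text \<open>A permutation other than the identity sends some r to a value different from both r and
  i, where the entry vanishes.\<close>

lemma det_off_column:
  fixes K :: "'a::comm_ring_1 mat"
  assumes K: "K \<in> carrier_mat n n" and i: "i < n"
    and z: "\<And>r q. r < n \<Longrightarrow> q < n \<Longrightarrow> r \<noteq> q \<Longrightarrow> q \<noteq> i \<Longrightarrow> K $$ (r, q) = 0"
  shows "det K = (\<Prod>r<n. K $$ (r, r))"
proof -
  have "det K = (\<Sum>p\<in>{p. p permutes {0..<n}}. signof p * (\<Prod>r = 0..<n. K $$ (r, p r)))"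
    by (rule det_def'[OF K])
  also have "\<dots> = (\<Sum>p\<in>{id}. signof p * (\<Prod>r = 0..<n. K $$ (r, p r)))"
  proof (rule sum.mono_neutral_right)
    show "finite {p. p permutes {0..<n}}" by (rule finite_permutations) simp
    show "{id} \<subseteq> {p. p permutes {0..<n}}" by (simp add: permutes_id)
    show "\<forall>p\<in>{p. p permutes {0..<n}} - {id}. signof p * (\<Prod>r = 0..<n. K $$ (r, p r)) = 0"
    proof
      fix p assume p: "p \<in> {p. p permutes {0..<n}} - {id}"
      then have perm: "p permutes {0..<n}" and "p \<noteq> id" by auto
      have "\<exists>r\<in>{0..<n}. p r \<noteq> r \<and> p r \<noteq> i"
      proof (rule ccontr)
        assume h: "\<not> ?thesis"
        obtain r where r: "p r \<noteq> r" using \<open>p \<noteq> id\<close> by (auto simp: fun_eq_iff)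
        then have rn: "r \<in> {0..<n}" using perm by (auto simp: permutes_def)
        then have pr: "p r = i" using h r by blast
        have "p i = i" using h i by auto
        then have "r = i" using pr permutes_inj[OF perm] by (metis injD)
        then show False using r pr by simp
      qed
      then obtain r where r: "r \<in> {0..<n}" "p r \<noteq> r" "p r \<noteq> i" by blast
      then have "K $$ (r, p r) = 0" using perm permutes_in_image[OF perm, of r] by (intro z) auto
      then have "(\<Prod>r = 0..<n. K $$ (r, p r)) = 0" using r(1) by (intro prod_zero) auto
      then show "signof p * (\<Prod>r = 0..<n. K $$ (r, p r)) = 0" by simp
    qed
  qed
  finally show ?thesis by (simp add: atLeast0LessThan)
qed

text \<open>As d_i = 0, column i consists of the rank one part alone. Subtracting t_q / t_i times it
  clears that part from every other column q.\<close>

lemma det_diag_plus_rank_one: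
  fixes t :: "nat \<Rightarrow> 'a::field"
  assumes i: "i < n" and di: "d i = 0"
  shows "det (mat n n (\<lambda>(r, q). (if r = q then d r else 0) + t r * t q)) = (t i)\<^sup>2 * (\<Prod>l\<in>{..<n}-{i}. d l)"
proof (cases "t i = 0")
  case True
  let ?M = "mat n n (\<lambda>(r, q). (if r = q then d r else 0) + t r * t q)"
  have "det ?M = (\<Sum>j<n. ?M $$ (i, j) * cofactor ?M i j)"
    by (rule laplace_expansion_row) (use i in auto)
  also have "\<dots> = 0" using i di True by (intro sum.neutral) auto
  finally show ?thesis using True by simp
next
  case False
  let ?M = "mat n n (\<lambda>(r, q). (if r = q then d r else 0) + t r * t q)"
  define E where "E = mat n n (\<lambda>(r, q). if r = q then 1 else if r = i then - (t q / t i) else 0)"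
  have E: "E \<in> carrier_mat n n" by (simp add: E_def)
  have dE: "det E = 1"
  proof -
    have "det (transpose_mat E) = (\<Prod>r<n. transpose_mat E $$ (r, r))"
      by (rule det_off_column[of _ n i]) (use i in \<open>auto simp: E_def\<close>)
    also have "\<dots> = 1" by (intro prod.neutral) (auto simp: E_def)
    finally show ?thesis using det_transpose[OF E] by simp
  qed
  have M: "?M \<in> carrier_mat n n" by simp
  have ent: "(?M * E) $$ (r, q) = (if q = i then t r * t i else if r = q then d r else 0)" if "r < n" "q < n" for r q
  proof -
    have "(?M * E) $$ (r, q) = (\<Sum>l<n. ?M $$ (r, l) * E $$ (l, q))"
      using that E by (simp add: scalar_prod_def atLeast0LessThan)
    also have "\<dots> = (\<Sum>l\<in>{q, i}. ?M $$ (r, l) * E $$ (l, q))"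
      using that i by (intro sum.mono_neutral_right) (auto simp: E_def)
    also have "\<dots> = (if q = i then t r * t i else if r = q then d r else 0)"
      using that i di False by (cases "q = i") (auto simp: E_def field_simps)
    finally show ?thesis .
  qed
  have "det (?M * E) = (\<Prod>r<n. (?M * E) $$ (r, r))"
    by (rule det_off_column[of _ n i]) (use i E ent in auto)
  also have "\<dots> = (\<Prod>r<n. if r = i then t i * t i else d r)"
    by (intro prod.cong refl) (auto simp: ent)
  also have "\<dots> = (t i)\<^sup>2 * (\<Prod>l\<in>{..<n}-{i}. d l)"
    using i by (subst prod.remove[of _ i]) (auto simp: power2_eq_square intro!: prod.cong)
  finally show ?thesis using det_mult[OF M E] dE by simp
qed

interpretation cnj: comm_ring_hom cnj by unfold_locales auto

lemma bil_col:
  assumes "M \<in> carrier_mat n n" "P \<in> carrier_mat n n" "i < n" "j < n"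
  shows "bil M (col P i) (col P j) = (transpose_mat P * (M * P)) $$ (i, j)"
  using assms by (simp add: bil_def col_mult2[of _ n n _ n])

lemma herm_col:
  assumes "M \<in> carrier_mat n n" "P \<in> carrier_mat n n" "i < n" "j < n"
  shows "herm M (col P i) (col P j) = (transpose_mat P * (M * map_mat cnj P)) $$ (i, j)"
proof -
  have "conjugate (col P j) = col (map_mat cnj P) j"
    using assms by (intro eq_vecI) auto
  then show ?thesis using assms by (simp add: herm_def col_mult2[of _ n n _ n])
qed

lemma smult_minus_diag:
  fixes M :: "'a::comm_ring_1 mat"
  assumes "M \<in> carrier_mat n n"
  shows "x \<cdot>\<^sub>m M - M * mat_diag n f = M * mat_diag n (\<lambda>i. x - f i)"
  using assms by (intro eq_matI) (auto simp: mat_diag_mult_right[of _ n] algebra_simps)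

text \<open>e is the coefficient of x^n and all n roots are finite and distinct; in particular det A
  = e is nonzero, as \<open>det_A\<close> shows.\<close>

locale real_pencil =
  fixes n :: nat and A B :: "complex mat" and e :: complex and \<theta> :: "nat \<Rightarrow> complex"
  assumes A: "A \<in> carrier_mat n n" and B: "B \<in> carrier_mat n n"
    and At: "transpose_mat A = A" and Bt: "transpose_mat B = B"
    and Ac: "map_mat cnj A = A" and Bc: "map_mat cnj B = B"
    and inj: "inj_on \<theta> {..<n}" and e0: "e \<noteq> 0"
    and det_pencil: "\<And>x. det (x \<cdot>\<^sub>m A - B) = e * (\<Prod>i<n. x - \<theta> i)"
begin

lemma assoc_square_mats: "X1 \<in> carrier_mat n n \<Longrightarrow> X2 \<in> carrier_mat n n \<Longrightarrow> X3 \<in> carrier_mat n n \<Longrightarrow> X1 * X2 * X3 = X1 * (X2 * X3)"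
  by (rule assoc_mult_mat)

lemma exists_nonroot: "\<exists>x. \<forall>i<n. x \<noteq> \<theta> i"
proof -
  have "\<exists>x. x \<notin> \<theta> ` {..<n}" using infinite_UNIV_char_0 by (intro ex_new_if_finite) auto
  then show ?thesis by blast
qed

text \<open>The columns of P are kernel vectors of \<theta>_i A - B. Both P^T A P and P^T B P = (P^T
  A P) diag(\<theta>) are symmetric, which kills the off-diagonal entries because the \<theta>_i
  differ.\<close>

lemma eigenbasis: "\<exists>P a. P \<in> carrier_mat n n \<and> det P \<noteq> 0 \<and>
   transpose_mat P * (A * P) = mat_diag n a \<and> transpose_mat P * (B * P) = mat_diag n (\<lambda>i. a i * \<theta> i)"
proof -
  have "\<exists>p. p \<in> carrier_vec n \<and> p \<noteq> 0\<^sub>v n \<and> (\<theta> i \<cdot>\<^sub>m A - B) *\<^sub>v p = 0\<^sub>v n" if "i < n" for i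
  proof -
    have "det (\<theta> i \<cdot>\<^sub>m A - B) = 0" unfolding det_pencil using that by (auto intro!: prod_zero)
    then show ?thesis using det_0_iff_vec_prod_zero_field[OF minus_carrier_mat[OF B], of "\<theta> i \<cdot>\<^sub>m A"] by blast
  qed
  then obtain p where p: "\<And>i. i < n \<Longrightarrow> p i \<in> carrier_vec n" "\<And>i. i < n \<Longrightarrow> p i \<noteq> 0\<^sub>v n"
    "\<And>i. i < n \<Longrightarrow> (\<theta> i \<cdot>\<^sub>m A - B) *\<^sub>v p i = 0\<^sub>v n" by metis
  define P where "P = mat n n (\<lambda>(r, j). p j $ r)"
  have P: "P \<in> carrier_mat n n" by (simp add: P_def)
  have PT: "transpose_mat P \<in> carrier_mat n n" using P by simp
  have Pc: "col P j = p j" if "j < n" for j using that p(1)[OF that] by (intro eq_vecI) (auto simp: P_def)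
  have BP: "B * P = (A * P) * mat_diag n \<theta>"
  proof (rule eq_matI)
    fix r j assume "r < dim_row ((A * P) * mat_diag n \<theta>)" "j < dim_col ((A * P) * mat_diag n \<theta>)"
    then have rj: "r < n" "j < n" using A P by (auto simp: mat_diag_def)
    have "((\<theta> j \<cdot>\<^sub>m A - B) *\<^sub>v p j) $ r = 0" using p(3)[OF rj(2)] rj by simp
    then have "(\<Sum>l<n. (\<theta> j * A $$ (r, l) - B $$ (r, l)) * p j $ l) = 0"
      using rj A B p(1)[OF rj(2)] by (simp add: scalar_prod_def atLeast0LessThan)
    then have "\<theta> j * (\<Sum>l<n. A $$ (r, l) * p j $ l) = (\<Sum>l<n. B $$ (r, l) * p j $ l)"
      by (simp add: left_diff_distrib sum_subtractf sum_distrib_left mult.assoc)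
    moreover have "(B * P) $$ (r, j) = (\<Sum>l<n. B $$ (r, l) * p j $ l)"
      using rj B P by (simp add: scalar_prod_def atLeast0LessThan P_def)
    moreover have "(A * P) $$ (r, j) = (\<Sum>l<n. A $$ (r, l) * p j $ l)"
      using rj A P by (simp add: scalar_prod_def atLeast0LessThan P_def)
    ultimately show "(B * P) $$ (r, j) = ((A * P) * mat_diag n \<theta>) $$ (r, j)"
      using rj A P by (simp add: mat_diag_mult_right[of _ n] mult.commute)
  qed (use A B P in \<open>auto simp: mat_diag_def\<close>)
  define M where "M = transpose_mat P * (A * P)"
  have M: "M \<in> carrier_mat n n" using A P by (simp add: M_def)
  have MB: "transpose_mat P * (B * P) = M * mat_diag n \<theta>"
    unfolding BP M_def using A P by (simp add: assoc_square_mats)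
  have sym: "transpose_mat (transpose_mat P * (C * P)) = transpose_mat P * (C * P)"
    if "C \<in> carrier_mat n n" "transpose_mat C = C" for C
    using that P by (simp add: transpose_mult[of _ n n _ n] assoc_square_mats)
  have "transpose_mat (M * mat_diag n \<theta>) = M * mat_diag n \<theta>" using sym[OF B Bt] MB by simp
  moreover have "transpose_mat M = M" using sym[OF A At] by (simp add: M_def)
  ultimately have M0: "M $$ (i, j) * \<theta> j = M $$ (i, j) * \<theta> i" if "i < n" "j < n" for i j
  proof -
    have "(M * mat_diag n \<theta>) $$ (j, i) = (M * mat_diag n \<theta>) $$ (i, j)"
      using \<open>transpose_mat (M * mat_diag n \<theta>) = _\<close> that M
      by (metis carrier_matD index_transpose_mat(1) index_mult_mat(2,3) mat_diag_dim)
    moreover have "M $$ (j, i) = M $$ (i, j)"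
      using \<open>transpose_mat M = M\<close> that M by (metis carrier_matD index_transpose_mat(1))
    ultimately show ?thesis using that M by (auto simp: mat_diag_mult_right[of _ n])
  qed
  define a where "a i = M $$ (i, i)" for i
  have Md: "M = mat_diag n a"
  proof (rule eq_matI)
    fix i j assume "i < dim_row (mat_diag n a)" "j < dim_col (mat_diag n a)"
    then have ij: "i < n" "j < n" by (auto simp: mat_diag_def)
    show "M $$ (i, j) = mat_diag n a $$ (i, j)"
    proof (cases "i = j")
      case False
      then have "\<theta> i \<noteq> \<theta> j" using inj ij by (auto simp: inj_on_def)
      then show ?thesis using M0[OF ij] ij False by (simp add: mat_diag_def)
    qed (use ij in \<open>simp add: mat_diag_def a_def\<close>)
  qed (use M in \<open>auto simp: mat_diag_def\<close>)
  \<comment> \<open>Invertibility of A is not yet available, so independence is proved with (xA -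
    B)^(-1) A for a nonroot x. The columns are eigenvectors of it with the distinct eigenvalues 1 /
    (x - \<theta>_j).\<close>
  have "det P \<noteq> 0"
  proof
    assume "det P = 0"
    then obtain v where v: "v \<in> carrier_vec n" "v \<noteq> 0\<^sub>v n" "P *\<^sub>v v = 0\<^sub>v n"
      using det_0_iff_vec_prod_zero_field[OF P] by blast
    obtain x where x: "\<forall>i<n. x \<noteq> \<theta> i" using exists_nonroot by blast
    let ?K0 = "x \<cdot>\<^sub>m A - B"
    have K0: "?K0 \<in> carrier_mat n n" by (rule minus_carrier_mat[OF B])
    have "det ?K0 \<noteq> 0" unfolding det_pencil using x e0 by simp
    then obtain R where R: "R \<in> carrier_mat n n" "R * ?K0 = 1\<^sub>m n" using mat_inverse_obtain[OF K0] by metis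
    have "?K0 * P = (A * P) * mat_diag n (\<lambda>i. x - \<theta> i)"
    proof -
      have "?K0 * P = x \<cdot>\<^sub>m (A * P) - B * P" using A B P
        by (simp add: minus_mult_distrib_mat[of _ n n _ _ n] mult_smult_assoc_mat[of _ n n _ n])
      also have "\<dots> = (A * P) * mat_diag n (\<lambda>i. x - \<theta> i)"
        unfolding BP using A P by (intro smult_minus_diag) simp
      finally show ?thesis .
    qed
    then have "R * (?K0 * P) = R * ((A * P) * mat_diag n (\<lambda>i. x - \<theta> i))" by simp
    moreover have "R * (?K0 * P) = P" using assoc_square_mats[OF R(1) K0 P] R(2) P by simp
    moreover have "R * ((A * P) * mat_diag n (\<lambda>i. x - \<theta> i)) = (R * (A * P)) * mat_diag n (\<lambda>i. x - \<theta> i)"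
      using A P R(1) by (intro assoc_square_mats[symmetric]) auto
    ultimately have RK: "P = (R * (A * P)) * mat_diag n (\<lambda>i. x - \<theta> i)" by (simp only:)
    define K where "K = R * A"
    have K: "K \<in> carrier_mat n n" using R A by (simp add: K_def)
    have KP: "(\<Sum>l<n. K $$ (r, l) * P $$ (l, j)) * (x - \<theta> j) = P $$ (r, j)" if "r < n" "j < n" for r j
    proof -
      have "P $$ (r, j) = ((K * P) * mat_diag n (\<lambda>i. x - \<theta> i)) $$ (r, j)"
        unfolding K_def assoc_square_mats[OF R(1) A P] by (rule arg_cong[OF RK])
      also have "\<dots> = (K * P) $$ (r, j) * (x - \<theta> j)"
        using that K P by (simp add: mat_diag_mult_right[of _ n])
      also have "(K * P) $$ (r, j) = (\<Sum>l<n. K $$ (r, l) * P $$ (l, j))"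
        using that K P by (simp add: scalar_prod_def atLeast0LessThan)
      finally show ?thesis by simp
    qed
    have ind: "S \<subseteq> {..<n} \<Longrightarrow> \<forall>r<n. (\<Sum>j\<in>S. c j * P $$ (r, j)) = 0 \<Longrightarrow> \<forall>j\<in>S. c j = 0" if "finite S" for S c
      using that
    proof (induction S arbitrary: c)
      case empty then show ?case by simp
    next
      case (insert i S)
      define mu where "mu j = 1 / (x - \<theta> j)" for j
      have KP': "(\<Sum>l<n. K $$ (r, l) * P $$ (l, j)) = mu j * P $$ (r, j)" if "r < n" "j < n" for r j
        using KP[OF that] x that by (auto simp: mu_def field_simps)
      have mu: "(\<Sum>j\<in>insert i S. c j * mu j * P $$ (r, j)) = 0" if r: "r < n" for r
      proof -
        have "(\<Sum>j\<in>insert i S. c j * mu j * P $$ (r, j)) = (\<Sum>j\<in>insert i S. \<Sum>l<n. K $$ (r, l) * (c j * P $$ (l, j)))"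
        proof (rule sum.cong[OF refl])
          fix j assume "j \<in> insert i S"
          then have "j < n" using insert.prems(1) by auto
          have "c j * mu j * P $$ (r, j) = c j * (\<Sum>l<n. K $$ (r, l) * P $$ (l, j))"
            using KP'[OF r \<open>j < n\<close>] by simp
          then show "c j * mu j * P $$ (r, j) = (\<Sum>l<n. K $$ (r, l) * (c j * P $$ (l, j)))"
            by (simp add: sum_distrib_left mult_ac)
        qed
        also have "\<dots> = (\<Sum>l<n. K $$ (r, l) * (\<Sum>j\<in>insert i S. c j * P $$ (l, j)))"
          by (subst sum.swap) (simp only: sum_distrib_left)
        also have "\<dots> = 0" using insert.prems(2) by (intro sum.neutral) auto
        finally show ?thesis .
      qed
      have "\<forall>r<n. (\<Sum>j\<in>S. (c j * (mu j - mu i)) * P $$ (r, j)) = 0"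
      proof (intro allI impI)
        fix r assume r: "r < n"
        have "(\<Sum>j\<in>S. (c j * (mu j - mu i)) * P $$ (r, j))
          = (\<Sum>j\<in>insert i S. (c j * (mu j - mu i)) * P $$ (r, j))"
          using insert.hyps by simp
        also have "\<dots> = (\<Sum>j\<in>insert i S. c j * mu j * P $$ (r, j)) - mu i * (\<Sum>j\<in>insert i S. c j * P $$ (r, j))"
          unfolding sum_distrib_left sum_subtractf[symmetric] by (intro sum.cong) (auto simp: algebra_simps)
        finally show "(\<Sum>j\<in>S. (c j * (mu j - mu i)) * P $$ (r, j)) = 0"
          using mu[OF r] insert.prems(2) r by simp
      qed
      then have "\<forall>j\<in>S. c j * (mu j - mu i) = 0" using insert.IH[of "\<lambda>j. c j * (mu j - mu i)"] insert.prems(1) by auto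
      moreover have "mu j \<noteq> mu i" if "j \<in> S" for j
      proof -
        have "j < n" "i < n" "j \<noteq> i" using that insert by auto
        then have "\<theta> j \<noteq> \<theta> i" using inj by (auto simp: inj_on_def)
        then show ?thesis using x \<open>j < n\<close> \<open>i < n\<close> by (simp add: mu_def)
      qed
      ultimately have cS: "\<forall>j\<in>S. c j = 0" by auto
      have i: "i < n" using insert.prems by auto
      have "c i * P $$ (r, i) = 0" if "r < n" for r
        using insert.prems(2) that insert.hyps cS by simp
      moreover have "\<exists>r<n. P $$ (r, i) \<noteq> 0"
      proof (rule ccontr)
        assume "\<not> ?thesis"
        then have "p i = 0\<^sub>v n" using p(1)[OF i] i by (intro eq_vecI) (auto simp: P_def)
        then show False using p(2)[OF i] by simp
      qed
      ultimately show ?case using cS by auto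
    qed
    have "\<forall>r<n. (\<Sum>j\<in>{..<n}. v $ j * P $$ (r, j)) = 0"
    proof (intro allI impI)
      fix r assume r: "r < n"
      have "(P *\<^sub>v v) $ r = 0" using v(3) r by simp
      then show "(\<Sum>j\<in>{..<n}. v $ j * P $$ (r, j)) = 0"
        using r P v(1) by (simp add: scalar_prod_def atLeast0LessThan mult.commute)
    qed
    then have "\<forall>j\<in>{..<n}. v $ j = 0" using ind[of "{..<n}" "\<lambda>j. v $ j"] by simp
    then show False using v(1,2) by (metis carrier_vecD eq_vecI index_zero_vec lessThan_iff)
  qed
  moreover have "transpose_mat P * (B * P) = mat_diag n (\<lambda>i. a i * \<theta> i)"
    unfolding MB Md by simp
  ultimately show ?thesis using P Md M_def by metis
qed

end

lemma map_mat_mult_cnj: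
  assumes "X1 \<in> carrier_mat n n" "X2 \<in> carrier_mat n n"
  shows "map_mat cnj (X1 * X2) = map_mat cnj X1 * map_mat cnj X2"
  by (rule cnj.mat_hom_mult[OF assms])

lemma map_mat_cnj_diag: "map_mat cnj (mat_diag n a) = mat_diag n (\<lambda>i. cnj (a i))"
  by (intro eq_matI) (auto simp: mat_diag_def)

lemma map_mat_cnj_transpose: "map_mat cnj (transpose_mat X1) = transpose_mat (map_mat cnj X1)"
  by (intro eq_matI) auto

section \<open>Independence of the Hermitian form from the diagonalising basis\<close>

context real_pencil begin

definition diagonalises :: "complex mat \<Rightarrow> (nat \<Rightarrow> complex) \<Rightarrow> (nat \<Rightarrow> complex) \<Rightarrow> bool" where
  "diagonalises P a b \<longleftrightarrow> P \<in> carrier_mat n n \<and> det P \<noteq> 0 \<and>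
     transpose_mat P * (A * P) = mat_diag n a \<and> transpose_mat P * (B * P) = mat_diag n b"

definition max_entry :: "(nat \<Rightarrow> complex) \<Rightarrow> (nat \<Rightarrow> complex) \<Rightarrow> nat \<Rightarrow> complex" where
  "max_entry a b i = complex_of_real (max (cmod (a i)) (cmod (b i)))"

definition herm_on_basis :: "complex mat \<Rightarrow> complex mat \<Rightarrow> (nat \<Rightarrow> complex) \<Rightarrow> (nat \<Rightarrow> complex) \<Rightarrow> bool" where
  "herm_on_basis G P a b \<longleftrightarrow> G \<in> carrier_mat n n \<and> transpose_mat P * (G * map_mat cnj P) = mat_diag n (max_entry a b)"

lemma diagonalisesD: assumes "diagonalises P a b"
  shows "P \<in> carrier_mat n n" "det P \<noteq> 0" "transpose_mat P * (A * P) = mat_diag n a"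
    "transpose_mat P * (B * P) = mat_diag n b" "transpose_mat P \<in> carrier_mat n n"
  using assms by (auto simp: diagonalises_def)

lemma diagonalises_bil: assumes "diagonalises P a b" "i < n" "j < n"
  shows "bil A (col P i) (col P j) = (if i = j then a i else 0)"
    "bil B (col P i) (col P j) = (if i = j then b i else 0)"
  using bil_col[OF A diagonalisesD(1)[OF assms(1)] assms(2,3)] bil_col[OF B diagonalisesD(1)[OF assms(1)] assms(2,3)]
    diagonalisesD(3,4)[OF assms(1)] assms(2,3) by (auto simp: mat_diag_def)

lemma diagonalises_diag_basis: "diagonalises P a b \<Longrightarrow> diag_basis n A B P"
  using diagonalises_bil invertible_mat_iff_det[of P n] by (auto simp: diag_basis_def diagonalisesD)

lemma diag_basis_diagonalises:
  assumes "diag_basis n A B P"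
  shows "diagonalises P (\<lambda>i. bil A (col P i) (col P i)) (\<lambda>i. bil B (col P i) (col P i))"
proof -
  have P: "P \<in> carrier_mat n n" "invertible_mat P" using assms by (auto simp: diag_basis_def)
  have z: "bil A (col P i) (col P j) = 0" "bil B (col P i) (col P j) = 0" if "i < n" "j < n" "i \<noteq> j" for i j
    using assms that by (auto simp: diag_basis_def)
  have "transpose_mat P * (C * P) = mat_diag n (\<lambda>i. bil C (col P i) (col P i))"
    if C: "C \<in> carrier_mat n n" and z: "\<And>i j. i < n \<Longrightarrow> j < n \<Longrightarrow> i \<noteq> j \<Longrightarrow> bil C (col P i) (col P j) = 0" for C
  proof (rule eq_matI)
    fix i j assume "i < dim_row (mat_diag n (\<lambda>i. bil C (col P i) (col P i)))"
      "j < dim_col (mat_diag n (\<lambda>i. bil C (col P i) (col P i)))"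
    then have ij: "i < n" "j < n" by (auto simp: mat_diag_def)
    show "(transpose_mat P * (C * P)) $$ (i, j) = mat_diag n (\<lambda>i. bil C (col P i) (col P i)) $$ (i, j)"
      using bil_col[OF C P(1) ij] z[OF ij] ij by (cases "i = j") (auto simp: mat_diag_def)
  qed (use P C in \<open>auto simp: mat_diag_def\<close>)
  then show ?thesis using P A B z invertible_mat_iff_det[OF P(1)] by (auto simp: diagonalises_def)
qed

lemma herm_on_basis_iff:
  assumes "diagonalises P a b"
  shows "herm_on_basis G P a b \<longleftrightarrow> G \<in> carrier_mat n n \<and>
    (\<forall>i<n. \<forall>j<n. herm G (col P i) (col P j) =
       (if i = j then complex_of_real (max (cmod (bil A (col P i) (col P i))) (cmod (bil B (col P i) (col P i)))) else 0))"
    (is "_ \<longleftrightarrow> _ \<and> ?R")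
proof (cases "G \<in> carrier_mat n n")
  case True
  note P = diagonalisesD(1)[OF assms]
  have c: "transpose_mat P * (G * map_mat cnj P) \<in> carrier_mat n n" using True P by auto
  have "transpose_mat P * (G * map_mat cnj P) = mat_diag n (max_entry a b) \<longleftrightarrow>
    (\<forall>i<n. \<forall>j<n. (transpose_mat P * (G * map_mat cnj P)) $$ (i, j) = mat_diag n (max_entry a b) $$ (i, j))"
    using c by (auto simp: mat_diag_def intro!: eq_matI)
  also have "\<dots> \<longleftrightarrow> ?R"
    using herm_col[OF True P] diagonalises_bil[OF assms] by (auto simp: mat_diag_def max_entry_def)
  finally show ?thesis using True by (simp add: herm_on_basis_def)
qed (simp add: herm_on_basis_def)

lemma herm_gram_alt: "herm_gram n A B = (THE G. \<exists>P a b. diagonalises P a b \<and> herm_on_basis G P a b)"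
proof -
  have "(G \<in> carrier_mat n n \<and>
     (\<exists>P. diag_basis n A B P \<and>
        (\<forall>i<n. \<forall>j<n. herm G (col P i) (col P j) =
           (if i = j
            then complex_of_real (max (cmod (bil A (col P i) (col P i)))
                                      (cmod (bil B (col P i) (col P i))))
            else 0)))) \<longleftrightarrow> (\<exists>P a b. diagonalises P a b \<and> herm_on_basis G P a b)" for G
    using herm_on_basis_iff diag_basis_diagonalises diagonalises_diag_basis by blast
  then show ?thesis by (simp add: herm_gram_def)
qed

lemma diagonalises_det: assumes "diagonalises P a b"
  shows "(det P)\<^sup>2 * det (x \<cdot>\<^sub>m A - B) = (\<Prod>i<n. x * a i - b i)"
proof -
  note P = diagonalisesD[OF assms]
  have K: "x \<cdot>\<^sub>m A - B \<in> carrier_mat n n" by (rule minus_carrier_mat[OF B])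
  have "(x \<cdot>\<^sub>m A - B) * P = x \<cdot>\<^sub>m (A * P) - B * P" using A B P(1)
    by (simp add: minus_mult_distrib_mat[of _ n n _ _ n] mult_smult_assoc_mat[of _ n n _ n])
  then have "transpose_mat P * ((x \<cdot>\<^sub>m A - B) * P) = x \<cdot>\<^sub>m mat_diag n a - mat_diag n b"
    using A B P mult_minus_distrib_mat[of "transpose_mat P" n n "x \<cdot>\<^sub>m (A * P)" n "B * P"]
      mult_smult_distrib[of "transpose_mat P" n n "A * P" n x] by simp
  also have "\<dots> = mat_diag n (\<lambda>i. x * a i - b i)" by (intro eq_matI) (auto simp: mat_diag_def)
  finally have "det (transpose_mat P * ((x \<cdot>\<^sub>m A - B) * P)) = (\<Prod>i<n. x * a i - b i)"
    by (simp only: det_mat_diag)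
  moreover have "det (transpose_mat P * ((x \<cdot>\<^sub>m A - B) * P)) = det P * (det (x \<cdot>\<^sub>m A - B) * det P)"
    using det_mult[OF P(5) mult_carrier_mat[OF K P(1)]] det_mult[OF K P(1)] det_transpose[OF P(1)] by simp
  ultimately show ?thesis by (simp add: power2_eq_square mult_ac)
qed

text \<open>Evaluate \<open>diagonalises_det\<close> at a nonroot x and cancel the product of the x
  - \<theta>_i.\<close>

lemma canonical_prod: assumes "diagonalises P a (\<lambda>i. a i * \<theta> i)"
  shows "(\<Prod>i<n. a i) = e * (det P)\<^sup>2" "\<And>i. i < n \<Longrightarrow> a i \<noteq> 0"
proof -
  obtain x where x: "\<forall>i<n. x \<noteq> \<theta> i" using exists_nonroot by blast
  have "(det P)\<^sup>2 * (e * (\<Prod>i<n. x - \<theta> i)) = (\<Prod>i<n. a i * (x - \<theta> i))"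
    using diagonalises_det[OF assms, of x] unfolding det_pencil by (simp add: algebra_simps)
  also have "\<dots> = (\<Prod>i<n. a i) * (\<Prod>i<n. x - \<theta> i)" by (rule prod.distrib)
  finally have "((det P)\<^sup>2 * e) * (\<Prod>i<n. x - \<theta> i) = (\<Prod>i<n. a i) * (\<Prod>i<n. x - \<theta> i)" by (simp only: mult.assoc)
  moreover have nz: "(\<Prod>i<n. x - \<theta> i) \<noteq> 0" using x by simp
  ultimately have "(det P)\<^sup>2 * e = (\<Prod>i<n. a i)" unfolding mult_right_cancel[OF nz] by blast
  then show 1: "(\<Prod>i<n. a i) = e * (det P)\<^sup>2" by (simp add: mult.commute)
  have "(\<Prod>i<n. a i) \<noteq> 0" unfolding 1 using e0 diagonalisesD(2)[OF assms] by simp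
  then show "\<And>i. i < n \<Longrightarrow> a i \<noteq> 0" by simp
qed

lemma det_A: "det A = e"
proof -
  obtain P a where g: "diagonalises P a (\<lambda>i. a i * \<theta> i)" using eigenbasis by (auto simp: diagonalises_def)
  note P = diagonalisesD[OF g]
  have "det (transpose_mat P * (A * P)) = (\<Prod>i<n. a i)" unfolding P(3) by (rule det_mat_diag)
  moreover have "det (transpose_mat P * (A * P)) = (det P)\<^sup>2 * det A"
    using det_mult[OF P(5) mult_carrier_mat[OF A P(1)]] det_mult[OF A P(1)] det_transpose[OF P(1)]
    by (simp add: power2_eq_square)
  ultimately show ?thesis using canonical_prod(1)[OF g] P(2) by simp
qed

lemma diagonalises_nonzero: assumes "diagonalises P a b" "i < n" shows "a i \<noteq> 0"
proof -
  note P = diagonalisesD[OF assms(1)]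
  have "det (transpose_mat P * (A * P)) = (\<Prod>i<n. a i)" unfolding P(3) by (rule det_mat_diag)
  moreover have "det (transpose_mat P * (A * P)) = (det P)\<^sup>2 * e"
    using det_mult[OF P(5) mult_carrier_mat[OF A P(1)]] det_mult[OF A P(1)] det_transpose[OF P(1)] det_A
    by (simp add: power2_eq_square)
  ultimately have pr: "(\<Prod>i<n. a i) = (det P)\<^sup>2 * e" by (simp only:)
  have "(\<Prod>i<n. a i) \<noteq> 0" unfolding pr using e0 P(2) by simp
  then show ?thesis using assms(2) by simp
qed

lemma inv_facts: assumes P: "P \<in> carrier_mat n n" "det P \<noteq> (0::complex)"
  obtains Q where "Q \<in> carrier_mat n n" "P * Q = 1\<^sub>m n" "Q * P = 1\<^sub>m n"
    "transpose_mat Q * transpose_mat P = 1\<^sub>m n" "transpose_mat P * transpose_mat Q = 1\<^sub>m n"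
    "map_mat cnj P * map_mat cnj Q = 1\<^sub>m n" "map_mat cnj Q * map_mat cnj P = 1\<^sub>m n"
proof -
  obtain Q where Q: "Q \<in> carrier_mat n n" "P * Q = 1\<^sub>m n" "Q * P = 1\<^sub>m n"
    using mat_inverse_obtain[OF P] by metis
  have one: "map_mat cnj (1\<^sub>m n) = 1\<^sub>m n" by (intro eq_matI) auto
  show ?thesis
  proof (rule that[of Q])
    show "transpose_mat Q * transpose_mat P = 1\<^sub>m n"
      using transpose_mult[OF P(1) Q(1)] Q(2) by simp
    show "transpose_mat P * transpose_mat Q = 1\<^sub>m n"
      using transpose_mult[OF Q(1) P(1)] Q(3) by simp
    show "map_mat cnj P * map_mat cnj Q = 1\<^sub>m n"
      using map_mat_mult_cnj[OF P(1) Q(1)] Q(2) one by simp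
    show "map_mat cnj Q * map_mat cnj P = 1\<^sub>m n"
      using map_mat_mult_cnj[OF Q(1) P(1)] Q(3) one by simp
  qed (use Q in auto)
qed

lemma herm_on_basis_unique: assumes "diagonalises P a b" "herm_on_basis G P a b" "herm_on_basis G' P a b" shows "G = G'"
proof -
  note P = diagonalisesD[OF assms(1)]
  obtain Q where Q: "Q \<in> carrier_mat n n" "transpose_mat Q * transpose_mat P = 1\<^sub>m n"
    "map_mat cnj P * map_mat cnj Q = 1\<^sub>m n" using inv_facts[OF P(1,2)] by metis
  have "transpose_mat Q * ((transpose_mat P * (X1 * map_mat cnj P)) * map_mat cnj Q) = X1"
    if X1: "X1 \<in> carrier_mat n n" for X1
  proof -
    have c: "transpose_mat Q \<in> carrier_mat n n" "map_mat cnj P \<in> carrier_mat n n" "map_mat cnj Q \<in> carrier_mat n n"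
      using Q P by auto
    have "(transpose_mat P * (X1 * map_mat cnj P)) * map_mat cnj Q = transpose_mat P * (X1 * (map_mat cnj P * map_mat cnj Q))"
      using X1 P c by (simp add: assoc_square_mats[of _ _ "map_mat cnj Q"])
    also have "\<dots> = transpose_mat P * X1" using Q(3) X1 by simp
    also have "transpose_mat Q * (transpose_mat P * X1) = (transpose_mat Q * transpose_mat P) * X1"
      using assoc_square_mats[OF c(1) P(5) X1] by simp
    also have "\<dots> = X1" using Q(2) X1 by simp
    finally show ?thesis .
  qed
  then show ?thesis using assms(2,3) unfolding herm_on_basis_def by metis
qed

lemma herm_on_basis_exists: assumes "diagonalises P a b" shows "\<exists>G. herm_on_basis G P a b"
proof -
  note P = diagonalisesD[OF assms(1)]
  obtain Q where Q: "Q \<in> carrier_mat n n" "transpose_mat P * transpose_mat Q = 1\<^sub>m n"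
    "map_mat cnj Q * map_mat cnj P = 1\<^sub>m n" using inv_facts[OF P(1,2)] by metis
  have c: "transpose_mat Q \<in> carrier_mat n n" "map_mat cnj P \<in> carrier_mat n n" "map_mat cnj Q \<in> carrier_mat n n"
    "mat_diag n (max_entry a b) \<in> carrier_mat n n"
    using Q P by auto
  define G where "G = transpose_mat Q * (mat_diag n (max_entry a b) * map_mat cnj Q)"
  have dc: "mat_diag n (max_entry a b) * map_mat cnj Q \<in> carrier_mat n n" by (rule mult_carrier_mat[OF c(4,3)])
  have "G * map_mat cnj P = transpose_mat Q * (mat_diag n (max_entry a b) * (map_mat cnj Q * map_mat cnj P))"
    unfolding G_def using assoc_square_mats[OF c(1) dc c(2)] assoc_square_mats[OF c(4,3,2)] by simp
  then have "G * map_mat cnj P = transpose_mat Q * mat_diag n (max_entry a b)"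
    unfolding Q(3) using c(4) by simp
  then have "transpose_mat P * (G * map_mat cnj P) = mat_diag n (max_entry a b)"
    using assoc_square_mats[OF P(5) c(1,4)] Q(2) c(4) by simp
  moreover have "G \<in> carrier_mat n n" unfolding G_def using c(1) dc by auto
  ultimately show ?thesis by (auto simp: herm_on_basis_def)
qed

text \<open>This is the uniqueness behind the definite description in \<open>herm_gram\<close>. As
  the \<theta>_i are distinct, each column of the base change R has at most one nonzero entry, so
  the new basis is a reordering and rescaling of the old one. A scaling factor c multiplies |a| and
  |b| both by |c|^2, hence also their maximum, as it does for a Hermitian form.\<close>

lemma herm_on_basis_transfer:
  assumes g: "diagonalises P a (\<lambda>i. a i * \<theta> i)" and h: "herm_on_basis G P a (\<lambda>i. a i * \<theta> i)" and g': "diagonalises P' a' b'"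
  shows "herm_on_basis G P' a' b'"
proof -
  note P = diagonalisesD[OF g] and P' = diagonalisesD[OF g']
  have G: "G \<in> carrier_mat n n" using h by (simp add: herm_on_basis_def)
  obtain Q where Q: "Q \<in> carrier_mat n n" "P * Q = 1\<^sub>m n" using inv_facts[OF P(1,2)] by metis
  define R where "R = Q * P'"
  have R: "R \<in> carrier_mat n n" "transpose_mat R \<in> carrier_mat n n" "map_mat cnj R \<in> carrier_mat n n"
    using Q P' by (auto simp: R_def)
  have PR: "P' = P * R" unfolding R_def using assoc_square_mats[OF P(1) Q(1) P'(1)] Q(2) P'(1) by simp
  have "det P' = det P * det R" unfolding PR by (rule det_mult[OF P(1) R(1)])
  then have "det R \<noteq> 0" using P'(2) by auto
  then obtain S where S: "S \<in> carrier_mat n n" "transpose_mat S * transpose_mat R = 1\<^sub>m n"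
    using inv_facts[OF R(1)] by metis
  have cong: "transpose_mat P' * (C * map_mat s P') = transpose_mat R * ((transpose_mat P * (C * map_mat s P)) * map_mat s R)"
    if C: "C \<in> carrier_mat n n" and s: "map_mat s (P * R) = map_mat s P * map_mat s R" for C :: "complex mat" and s
  proof -
    have c: "map_mat s P \<in> carrier_mat n n" "map_mat s R \<in> carrier_mat n n" using P R by auto
    have cc: "C * map_mat s P \<in> carrier_mat n n" using C c by auto
    have cp: "transpose_mat P * (C * map_mat s P) \<in> carrier_mat n n" using cc P by auto
    have "transpose_mat P' * (C * map_mat s P') = (transpose_mat R * transpose_mat P) * ((C * map_mat s P) * map_mat s R)"
      unfolding PR s transpose_mult[OF P(1) R(1)] using assoc_square_mats[OF C c] by simp
    also have "\<dots> = transpose_mat R * (transpose_mat P * ((C * map_mat s P) * map_mat s R))"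
      by (rule assoc_square_mats[OF R(2) P(5)]) (use cc c in auto)
    also have "transpose_mat P * ((C * map_mat s P) * map_mat s R) = (transpose_mat P * (C * map_mat s P)) * map_mat s R"
      by (rule assoc_square_mats[symmetric, OF P(5) cc c(2)])
    finally show ?thesis .
  qed
  have mid: "map_mat (\<lambda>x. x) X1 = X1" for X1 :: "complex mat" by (intro eq_matI) auto
  have RA: "transpose_mat R * (mat_diag n a * R) = mat_diag n a'"
    using cong[OF A, of "\<lambda>x. x"] by (simp add: mid P(3) P'(3))
  have RB: "transpose_mat R * (mat_diag n (\<lambda>i. a i * \<theta> i) * R) = mat_diag n b'"
    using cong[OF B, of "\<lambda>x. x"] by (simp add: mid P(4) P'(4))
  have RG: "transpose_mat P' * (G * map_mat cnj P') = transpose_mat R * (mat_diag n (max_entry a (\<lambda>i. a i * \<theta> i)) * map_mat cnj R)"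
    using cong[OF G, of cnj, OF map_mat_mult_cnj[OF P(1) R(1)]] h by (simp add: herm_on_basis_def)
  \<comment> \<open>The root belonging to the j-th new vector: entry (l, j) of \<open>e1\<close>
    below reads a_l \<theta>_l R_lj = a_l R_lj \<rho>_j.\<close>
  define \<rho> where "\<rho> j = b' j / a' j" for j
  have "mat_diag n b' = mat_diag n a' * mat_diag n \<rho>"
    using diagonalises_nonzero[OF g'] by (subst mat_diag_diag) (auto simp: mat_diag_def \<rho>_def intro!: eq_matI)
  then have "transpose_mat R * (mat_diag n (\<lambda>i. a i * \<theta> i) * R) = transpose_mat R * (mat_diag n a * R) * mat_diag n \<rho>"
    by (simp add: RA RB)
  also have "\<dots> = transpose_mat R * ((mat_diag n a * R) * mat_diag n \<rho>)"
    by (rule assoc_square_mats[OF R(2) mult_carrier_mat[OF mat_diag_dim R(1)] mat_diag_dim])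
  finally have "transpose_mat S * (transpose_mat R * (mat_diag n (\<lambda>i. a i * \<theta> i) * R))
    = transpose_mat S * (transpose_mat R * ((mat_diag n a * R) * mat_diag n \<rho>))" by simp
  moreover have canc: "transpose_mat S * (transpose_mat R * X1) = X1" if "X1 \<in> carrier_mat n n" for X1
    using assoc_square_mats[OF _ R(2) that, of "transpose_mat S"] S that by simp
  ultimately have e1: "mat_diag n (\<lambda>i. a i * \<theta> i) * R = (mat_diag n a * R) * mat_diag n \<rho>"
    unfolding canc[OF mult_carrier_mat[OF mat_diag_dim R(1)]]
      canc[OF mult_carrier_mat[OF mult_carrier_mat[OF mat_diag_dim R(1)] mat_diag_dim]] by blast
  have R0: "R $$ (l, j) = 0 \<or> \<theta> l = \<rho> j" if "l < n" "j < n" for l j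
  proof -
    have "(mat_diag n (\<lambda>i. a i * \<theta> i) * R) $$ (l, j) = a l * \<theta> l * R $$ (l, j)"
      using that R by (simp add: mat_diag_mult_left[of _ n n])
    moreover have "((mat_diag n a * R) * mat_diag n \<rho>) $$ (l, j) = a l * R $$ (l, j) * \<rho> j"
      using that R by (simp add: mat_diag_mult_left[of _ n n] mat_diag_mult_right[of _ n n])
    ultimately show ?thesis using e1 canonical_prod(2)[OF g that(1)] by auto
  qed
  have single: "\<exists>l<n. \<forall>l'<n. l' \<noteq> l \<longrightarrow> R $$ (l', j) = 0" if j: "j < n" for j
  proof (cases "\<exists>l<n. R $$ (l, j) \<noteq> 0")
    case True
    then obtain l where l: "l < n" "R $$ (l, j) \<noteq> 0" by blast
    have "R $$ (l', j) = 0" if "l' < n" "l' \<noteq> l" for l'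
    proof (rule ccontr)
      assume "R $$ (l', j) \<noteq> 0"
      then have "\<theta> l' = \<theta> l" using R0[OF that(1) j] R0[OF l(1) j] l(2) by simp
      then show False using inj that l(1) by (auto simp: inj_on_def)
    qed
    then show ?thesis using l(1) by blast
  qed (use j in auto)
  then obtain \<pi> where \<pi>: "\<And>j. j < n \<Longrightarrow> \<pi> j < n" "\<And>j l. j < n \<Longrightarrow> l < n \<Longrightarrow> l \<noteq> \<pi> j \<Longrightarrow> R $$ (l, j) = 0"
    by metis
  have entry: "(transpose_mat R * (mat_diag n f * map_mat s R)) $$ (i, j) = R $$ (\<pi> i, i) * f (\<pi> i) * s (R $$ (\<pi> i, j))"
    if "i < n" "j < n" for f :: "nat \<Rightarrow> complex" and s i j
  proof -
    have "(transpose_mat R * (mat_diag n f * map_mat s R)) $$ (i, j) = (\<Sum>l<n. R $$ (l, i) * (f l * s (R $$ (l, j))))"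
      using that R by (simp add: mat_diag_mult_left[of _ n n] scalar_prod_def atLeast0LessThan)
    also have "\<dots> = (\<Sum>l\<in>{\<pi> i}. R $$ (l, i) * (f l * s (R $$ (l, j))))"
      using \<pi> that by (intro sum.mono_neutral_right) auto
    finally show ?thesis by simp
  qed
  have EA: "R $$ (\<pi> i, i) * a (\<pi> i) * R $$ (\<pi> i, j) = (if i = j then a' i else 0)" if "i < n" "j < n" for i j
    using entry[OF that, of a "\<lambda>x. x", unfolded mid RA] that by (auto simp: mat_diag_def)
  have EB: "R $$ (\<pi> i, i) * (a (\<pi> i) * \<theta> (\<pi> i)) * R $$ (\<pi> i, j) = (if i = j then b' i else 0)" if "i < n" "j < n" for i j
    using entry[OF that, of "\<lambda>i. a i * \<theta> i" "\<lambda>x. x", unfolded mid RB] that by (auto simp: mat_diag_def)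
  have "transpose_mat P' * (G * map_mat cnj P') = mat_diag n (max_entry a' b')"
    unfolding RG
  proof (rule eq_matI)
    fix i j assume "i < dim_row (mat_diag n (max_entry a' b'))" "j < dim_col (mat_diag n (max_entry a' b'))"
    then have ij: "i < n" "j < n" by (auto simp: mat_diag_def)
    show "(transpose_mat R * (mat_diag n (max_entry a (\<lambda>i. a i * \<theta> i)) * map_mat cnj R)) $$ (i, j) = mat_diag n (max_entry a' b') $$ (i, j)"
    proof (cases "i = j")
      case True
      have n1: "cmod (a' i) = (cmod (R $$ (\<pi> i, i)))\<^sup>2 * cmod (a (\<pi> i))"
        using EA[OF ij(1) ij(1)] by (simp add: power2_eq_square norm_mult[symmetric] mult_ac)
      have n2: "cmod (b' i) = (cmod (R $$ (\<pi> i, i)))\<^sup>2 * cmod (a (\<pi> i) * \<theta> (\<pi> i))"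
        using EB[OF ij(1) ij(1)] by (simp add: power2_eq_square norm_mult[symmetric] mult_ac)
      have "max_entry a' b' i = of_real ((cmod (R $$ (\<pi> i, i)))\<^sup>2) * max_entry a (\<lambda>i. a i * \<theta> i) (\<pi> i)"
        unfolding max_entry_def n1 n2 of_real_mult[symmetric] by (simp only: max_mult_distrib_left) simp
      also have "\<dots> = R $$ (\<pi> i, i) * max_entry a (\<lambda>i. a i * \<theta> i) (\<pi> i) * cnj (R $$ (\<pi> i, i))"
        unfolding complex_norm_square by (simp only: mult_ac)
      finally have "mat_diag n (max_entry a' b') $$ (i, j) = R $$ (\<pi> i, i) * max_entry a (\<lambda>i. a i * \<theta> i) (\<pi> i) * cnj (R $$ (\<pi> i, i))"
        using True ij by (simp add: mat_diag_def)
      then show ?thesis unfolding entry[OF ij] using True by simp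
    next
      case False
      have "R $$ (\<pi> i, i) * R $$ (\<pi> i, j) = 0"
        using EA[OF ij] False canonical_prod(2)[OF g \<pi>(1)[OF ij(1)]] by auto
      then show ?thesis using entry[OF ij, of "max_entry a (\<lambda>i. a i * \<theta> i)" cnj] False ij
        by (auto simp: mat_diag_def)
    qed
  qed (use R in \<open>auto simp: mat_diag_def\<close>)
  then show ?thesis using G by (simp add: herm_on_basis_def)
qed

lemma herm_gram_eq:
  assumes g: "diagonalises P a (\<lambda>i. a i * \<theta> i)" and h: "herm_on_basis G P a (\<lambda>i. a i * \<theta> i)"
  shows "herm_gram n A B = G"
  unfolding herm_gram_alt
proof (rule the_equality)
  show "\<exists>P a b. diagonalises P a b \<and> herm_on_basis G P a b" using g h by blast
next
  fix G' assume "\<exists>P a b. diagonalises P a b \<and> herm_on_basis G' P a b"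
  then obtain P' a' b' where g': "diagonalises P' a' b'" "herm_on_basis G' P' a' b'" by blast
  show "G' = G" by (rule herm_on_basis_unique[OF g'(1,2) herm_on_basis_transfer[OF g h g'(1)]])
qed

text \<open>A and B are real, so the conjugate basis diagonalises them too; independence of the
  basis then gives invariance under conjugation.\<close>

lemma herm_on_basis_real: assumes g: "diagonalises P a (\<lambda>i. a i * \<theta> i)" and h: "herm_on_basis G P a (\<lambda>i. a i * \<theta> i)"
  shows "map_mat cnj G = G"
proof -
  note P = diagonalisesD[OF g]
  have G: "G \<in> carrier_mat n n" using h by (simp add: herm_on_basis_def)
  have c: "map_mat cnj P \<in> carrier_mat n n" "map_mat cnj G \<in> carrier_mat n n" using P G by auto
  have 1: "transpose_mat (map_mat cnj P) * (C * map_mat cnj P) = mat_diag n (\<lambda>i. cnj (f i))"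
    if "C \<in> carrier_mat n n" "map_mat cnj C = C" "transpose_mat P * (C * P) = mat_diag n f" for C f
  proof -
    have "map_mat cnj (transpose_mat P * (C * P)) = transpose_mat (map_mat cnj P) * (C * map_mat cnj P)"
      using map_mat_mult_cnj[OF P(5), of "C * P"] map_mat_mult_cnj[OF that(1) P(1)] that P
      by (simp add: map_mat_cnj_transpose)
    then show ?thesis using that(3) by (simp add: map_mat_cnj_diag)
  qed
  have dc: "det (map_mat cnj P) \<noteq> 0" using P(2) by (simp add: cnj.hom_det)
  have g': "diagonalises (map_mat cnj P) (\<lambda>i. cnj (a i)) (\<lambda>i. cnj (a i * \<theta> i))"
    unfolding diagonalises_def using c dc 1[OF A Ac P(3)] 1[OF B Bc P(4)] by simp
  have "map_mat cnj (transpose_mat P * (G * map_mat cnj P)) = transpose_mat (map_mat cnj P) * (map_mat cnj G * map_mat cnj (map_mat cnj P))"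
    using map_mat_mult_cnj[OF P(5), of "G * map_mat cnj P"] map_mat_mult_cnj[OF G c(1)] G c
    by (simp add: map_mat_cnj_transpose)
  moreover have "transpose_mat P * (G * map_mat cnj P) = mat_diag n (max_entry a (\<lambda>i. a i * \<theta> i))"
    using h by (simp add: herm_on_basis_def)
  moreover have "map_mat cnj (mat_diag n (max_entry a (\<lambda>i. a i * \<theta> i))) = mat_diag n (max_entry (\<lambda>i. cnj (a i)) (\<lambda>i. cnj (a i * \<theta> i)))"
    by (simp add: map_mat_cnj_diag max_entry_def[abs_def] norm_mult)
  ultimately have "herm_on_basis (map_mat cnj G) (map_mat cnj P) (\<lambda>i. cnj (a i)) (\<lambda>i. cnj (a i * \<theta> i))"
    unfolding herm_on_basis_def using c(2) by (simp only: simp_thms)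
  from herm_on_basis_unique[OF g' this herm_on_basis_transfer[OF g h g']] show ?thesis .
qed

text \<open>In a diagonalising basis H is diagonal with entries |a_i| max(1, |\<theta>_i|), so for v
  = P y only |a_i y_i^2| has to be found. The hypothesis on \<open>w\<close> does this: at x =
  \<theta>_i the transformed pencil is diagonal with a zero in place i, and the rank one term has
  i-th coordinate a_i y_i, so \<open>det_diag_plus_rank_one\<close> isolates it.\<close>

lemma gram_values:
  assumes v: "v \<in> carrier_vec n" "conjugate v = v"
    and w: "\<And>i. i < n \<Longrightarrow> det (\<theta> i \<cdot>\<^sub>m A - B + mat n n (\<lambda>(r, q). (A *\<^sub>v v) $ r * (A *\<^sub>v v) $ q)) = - w i"
  shows "herm_gram n A B \<in> carrier_mat n n" "map_mat cnj (herm_gram n A B) = herm_gram n A B"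
    "det (herm_gram n A B) = of_real (cmod e * (\<Prod>i<n. max 1 (cmod (\<theta> i))))"
    "v \<bullet> (herm_gram n A B *\<^sub>v v) =
      of_real (\<Sum>i<n. max 1 (cmod (\<theta> i)) * cmod (w i) / (cmod e * (\<Prod>l\<in>{..<n}-{i}. cmod (\<theta> i - \<theta> l))))"
proof -
  obtain P a where g: "diagonalises P a (\<lambda>i. a i * \<theta> i)" using eigenbasis by (auto simp: diagonalises_def)
  note P = diagonalisesD[OF g]
  obtain G where h: "herm_on_basis G P a (\<lambda>i. a i * \<theta> i)" using herm_on_basis_exists[OF g] by blast
  have G: "G \<in> carrier_mat n n" and paired_polys: "transpose_mat P * (G * map_mat cnj P) = mat_diag n (max_entry a (\<lambda>i. a i * \<theta> i))"
    using h by (auto simp: herm_on_basis_def)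
  note eq = herm_gram_eq[OF g h]
  show "herm_gram n A B \<in> carrier_mat n n" using eq G by simp
  show "map_mat cnj (herm_gram n A B) = herm_gram n A B" using eq herm_on_basis_real[OF g h] by simp
  have dm: "max_entry a (\<lambda>i. a i * \<theta> i) i = of_real (cmod (a i) * max 1 (cmod (\<theta> i)))" for i
    unfolding max_entry_def by (simp add: norm_mult max_mult_distrib_left)
  have pa: "(\<Prod>i<n. cmod (a i)) = cmod e * (cmod (det P))\<^sup>2"
    using canonical_prod(1)[OF g] by (simp add: prod_norm norm_mult norm_power)
  have "det (transpose_mat P * (G * map_mat cnj P)) = det P * (det G * cnj (det P))"
    using det_mult[OF P(5), of "G * map_mat cnj P"] det_mult[OF G, of "map_mat cnj P"] P G det_transpose[OF P(1)]
    by (simp add: cnj.hom_det)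
  then have "det P * (det G * cnj (det P)) = of_real ((\<Prod>i<n. cmod (a i)) * (\<Prod>i<n. max 1 (cmod (\<theta> i))))"
    unfolding paired_polys det_mat_diag dm by (simp add: prod.distrib)
  then have "det G * of_real ((cmod (det P))\<^sup>2) = of_real (cmod e * (\<Prod>i<n. max 1 (cmod (\<theta> i)))) * of_real ((cmod (det P))\<^sup>2)"
    unfolding pa of_real_mult complex_norm_square by (simp only: mult_ac)
  moreover have nz: "complex_of_real ((cmod (det P))\<^sup>2) \<noteq> 0" using P(2) by simp
  ultimately show "det (herm_gram n A B) = of_real (cmod e * (\<Prod>i<n. max 1 (cmod (\<theta> i))))"
    unfolding eq mult_right_cancel[OF nz] by blast
  obtain Q where Q: "Q \<in> carrier_mat n n" "P * Q = 1\<^sub>m n" using inv_facts[OF P(1,2)] by metis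
  define y where "y = Q *\<^sub>v v"
  have y: "y \<in> carrier_vec n" using Q v by (simp add: y_def)
  have vy: "v = P *\<^sub>v y" unfolding y_def using assoc_mult_mat_vec[OF P(1) Q(1) v(1)] Q(2) v(1) by simp
  define u where "u = A *\<^sub>v v"
  have u: "u \<in> carrier_vec n" using A v by (simp add: u_def)
  define t where "t i = (\<Sum>r<n. P $$ (r, i) * u $ r)" for i
  have ty: "t i = a i * y $ i" if "i < n" for i
  proof -
    have "transpose_mat P *\<^sub>v u = (transpose_mat P * (A * P)) *\<^sub>v y"
      unfolding u_def vy using P(1,5) A y by (simp add: assoc_mult_mat_vec[of _ n n _ n])
    then have "(transpose_mat P *\<^sub>v u) $ i = (mat_diag n a *\<^sub>v y) $ i" using P(3) by simp
    moreover have "(transpose_mat P *\<^sub>v u) $ i = t i"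
      using that P u by (simp add: scalar_prod_def atLeast0LessThan t_def)
    moreover have "(mat_diag n a *\<^sub>v y) $ i = (\<Sum>j<n. (if i = j then a j else 0) * y $ j)"
      using that y by (simp add: scalar_prod_def atLeast0LessThan mat_diag_def)
    ultimately show ?thesis using that by (simp add: mult_delta_left)
  qed
  \<comment> \<open>One of the two factors a_i in (a_i y_i)^2 completes the product of the other a_l
    to e (det P)^2, and (det P)^2 cancels.\<close>
  have key: "a i * (y $ i)\<^sup>2 * e * (\<Prod>l\<in>{..<n}-{i}. \<theta> i - \<theta> l) = - w i" if i: "i < n" for i
  proof -
    let ?K = "\<theta> i \<cdot>\<^sub>m A - B" and ?U = "mat n n (\<lambda>(r, q). u $ r * u $ q)"
    have K: "?K \<in> carrier_mat n n" by (rule minus_carrier_mat[OF B])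
    have KU: "?K + ?U \<in> carrier_mat n n" by simp
    have "?K * P = \<theta> i \<cdot>\<^sub>m (A * P) - B * P" using A B P(1)
      by (simp add: minus_mult_distrib_mat[of _ n n _ _ n] mult_smult_assoc_mat[of _ n n _ n])
    then have e1: "transpose_mat P * (?K * P) = \<theta> i \<cdot>\<^sub>m mat_diag n a - mat_diag n (\<lambda>i. a i * \<theta> i)"
      using A B P mult_minus_distrib_mat[of "transpose_mat P" n n "\<theta> i \<cdot>\<^sub>m (A * P)" n "B * P"]
        mult_smult_distrib[of "transpose_mat P" n n "A * P" n "\<theta> i"] by simp
    have e2: "(transpose_mat P * (?U * P)) $$ (r, q) = t r * t q" if "r < n" "q < n" for r q
    proof -
      have "(transpose_mat P * (?U * P)) $$ (r, q) = (\<Sum>l<n. P $$ (l, r) * (\<Sum>l'<n. u $ l * u $ l' * P $$ (l', q)))"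
        using that P by (simp add: scalar_prod_def atLeast0LessThan)
      also have "\<dots> = (\<Sum>l<n. \<Sum>l'<n. (P $$ (l, r) * u $ l) * (P $$ (l', q) * u $ l'))"
        by (simp add: sum_distrib_left mult_ac)
      also have "\<dots> = t r * t q" unfolding t_def sum_product ..
      finally show ?thesis .
    qed
    have Uc: "?U \<in> carrier_mat n n" by simp
    have "(?K + ?U) * P = ?K * P + ?U * P" by (rule add_mult_distrib_mat[OF K Uc P(1)])
    then have "transpose_mat P * ((?K + ?U) * P) = transpose_mat P * (?K * P) + transpose_mat P * (?U * P)"
      using mult_add_distrib_mat[OF P(5) mult_carrier_mat[OF K P(1)] mult_carrier_mat[OF Uc P(1)]] by simp
    also have "\<dots> = mat n n (\<lambda>(r, q). (if r = q then a r * (\<theta> i - \<theta> r) else 0) + t r * t q)"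
      unfolding e1
    proof (rule eq_matI)
      fix r q assume "r < dim_row (mat n n (\<lambda>(r, q). (if r = q then a r * (\<theta> i - \<theta> r) else 0) + t r * t q))"
        "q < dim_col (mat n n (\<lambda>(r, q). (if r = q then a r * (\<theta> i - \<theta> r) else 0) + t r * t q))"
      then have rq: "r < n" "q < n" by auto
      have c: "transpose_mat P * (?U * P) \<in> carrier_mat n n" using P by auto
      show "(\<theta> i \<cdot>\<^sub>m mat_diag n a - mat_diag n (\<lambda>i. a i * \<theta> i) + transpose_mat P * (?U * P)) $$ (r, q)
        = mat n n (\<lambda>(r, q). (if r = q then a r * (\<theta> i - \<theta> r) else 0) + t r * t q) $$ (r, q)"
        using rq c e2[OF rq] by (subst index_add_mat) (auto simp: mat_diag_def algebra_simps)
    qed (use P in \<open>auto simp: mat_diag_def\<close>)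
    finally have "det (transpose_mat P * ((?K + ?U) * P)) = (t i)\<^sup>2 * (\<Prod>l\<in>{..<n}-{i}. a l * (\<theta> i - \<theta> l))"
      using det_diag_plus_rank_one[OF i, of "\<lambda>r. a r * (\<theta> i - \<theta> r)" t] by simp
    moreover have "det (transpose_mat P * ((?K + ?U) * P)) = (det P)\<^sup>2 * det (?K + ?U)"
      using det_mult[OF P(5) mult_carrier_mat[OF KU P(1)]] det_mult[OF KU P(1)] det_transpose[OF P(1)]
      by (simp add: power2_eq_square)
    moreover have "det (?K + ?U) = - w i" using w[OF i] by (simp add: u_def)
    ultimately have "(t i)\<^sup>2 * ((\<Prod>l\<in>{..<n}-{i}. a l) * (\<Prod>l\<in>{..<n}-{i}. \<theta> i - \<theta> l)) = - ((det P)\<^sup>2 * w i)"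
      by (simp add: prod.distrib)
    moreover have "a i * (\<Prod>l\<in>{..<n}-{i}. a l) = e * (det P)\<^sup>2"
      using canonical_prod(1)[OF g] i by (simp add: prod.remove[of "{..<n}" i])
    moreover have "(t i)\<^sup>2 = a i * (a i * (y $ i)\<^sup>2)" using ty[OF i] by (simp add: power2_eq_square mult_ac)
    ultimately have f: "(a i * (a i * (y $ i)\<^sup>2)) * ((\<Prod>l\<in>{..<n}-{i}. a l) * (\<Prod>l\<in>{..<n}-{i}. \<theta> i - \<theta> l)) = - ((det P)\<^sup>2 * w i)"
      and f2: "e * (det P)\<^sup>2 = a i * (\<Prod>l\<in>{..<n}-{i}. a l)" by simp_all
    have "(e * (det P)\<^sup>2) * (a i * (y $ i)\<^sup>2) * (\<Prod>l\<in>{..<n}-{i}. \<theta> i - \<theta> l) = - ((det P)\<^sup>2 * w i)"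
      unfolding f2 f[symmetric] by (simp only: mult_ac)
    then have "(det P)\<^sup>2 * (a i * (y $ i)\<^sup>2 * e * (\<Prod>l\<in>{..<n}-{i}. \<theta> i - \<theta> l)) = (det P)\<^sup>2 * (- w i)"
      by (simp add: mult_ac)
    moreover have nz: "(det P)\<^sup>2 \<noteq> 0" using P(2) by simp
    ultimately show ?thesis unfolding mult_left_cancel[OF nz] by blast
  qed
  have "v = conjugate v" using v(2) by simp
  also have "conjugate v = map_mat cnj P *\<^sub>v conjugate y"
    unfolding vy using P y by (intro eq_vecI) (auto simp: scalar_prod_def)
  finally have vc: "v = map_mat cnj P *\<^sub>v conjugate y" .
  have yc: "conjugate y \<in> carrier_vec n" using y by simp
  have Pc: "map_mat cnj P \<in> carrier_mat n n" using P by simp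
  have "v \<bullet> (G *\<^sub>v v) = (P *\<^sub>v y) \<bullet> (G *\<^sub>v (map_mat cnj P *\<^sub>v conjugate y))" using vc vy by metis
  also have "\<dots> = y \<bullet> (transpose_mat P *\<^sub>v (G *\<^sub>v (map_mat cnj P *\<^sub>v conjugate y)))"
  proof -
    have z: "G *\<^sub>v (map_mat cnj P *\<^sub>v conjugate y) \<in> carrier_vec n" (is "?z \<in> _")
      by (intro mult_mat_vec_carrier[OF G] mult_mat_vec_carrier[OF Pc] yc)
    have "(P *\<^sub>v y) \<bullet> ?z = ?z \<bullet> (P *\<^sub>v y)" by (rule comm_scalar_prod[OF mult_mat_vec_carrier[OF P(1) y] z])
    also have "\<dots> = (transpose_mat P *\<^sub>v ?z) \<bullet> y" by (rule transpose_vec_mult_scalar[OF P(1) y z, symmetric])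
    also have "\<dots> = y \<bullet> (transpose_mat P *\<^sub>v ?z)" by (rule comm_scalar_prod[OF mult_mat_vec_carrier[OF P(5) z] y])
    finally show ?thesis .
  qed
  also have "transpose_mat P *\<^sub>v (G *\<^sub>v (map_mat cnj P *\<^sub>v conjugate y)) = (transpose_mat P * (G * map_mat cnj P)) *\<^sub>v conjugate y"
    using P G Pc yc by (simp add: assoc_mult_mat_vec[of _ n n _ n])
  also have "y \<bullet> \<dots> = (\<Sum>i<n. y $ i * (max_entry a (\<lambda>i. a i * \<theta> i) i * cnj (y $ i)))"
    unfolding paired_polys using y by (simp add: scalar_prod_def atLeast0LessThan mat_diag_def mult_delta_left)
  also have "\<dots> = (\<Sum>i<n. of_real (max 1 (cmod (\<theta> i)) * cmod (w i) / (cmod e * (\<Prod>l\<in>{..<n}-{i}. cmod (\<theta> i - \<theta> l)))))"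
  proof (rule sum.cong[OF refl])
    fix i assume "i \<in> {..<n}"
    then have i: "i < n" by simp
    have nz: "(\<Prod>l\<in>{..<n}-{i}. cmod (\<theta> i - \<theta> l)) \<noteq> 0" using inj i by (auto simp: inj_on_def)
    have "cmod (a i) * (cmod (y $ i))\<^sup>2 * cmod e * (\<Prod>l\<in>{..<n}-{i}. cmod (\<theta> i - \<theta> l)) = cmod (w i)"
      using arg_cong[OF key[OF i], of cmod] by (simp add: norm_mult norm_power prod_norm)
    then have q: "cmod (a i) * (cmod (y $ i))\<^sup>2 = cmod (w i) / (cmod e * (\<Prod>l\<in>{..<n}-{i}. cmod (\<theta> i - \<theta> l)))"
      using nz e0 by (simp add: field_simps)
    have "y $ i * (max_entry a (\<lambda>i. a i * \<theta> i) i * cnj (y $ i))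
      = of_real (cmod (a i) * max 1 (cmod (\<theta> i))) * (y $ i * cnj (y $ i))"
      unfolding dm by (simp only: mult_ac)
    also have "\<dots> = of_real (max 1 (cmod (\<theta> i)) * (cmod (a i) * (cmod (y $ i))\<^sup>2))"
      unfolding complex_norm_square[symmetric] of_real_mult[symmetric] by (simp only: mult_ac)
    finally show "y $ i * (max_entry a (\<lambda>i. a i * \<theta> i) i * cnj (y $ i))
      = of_real (max 1 (cmod (\<theta> i)) * cmod (w i) / (cmod e * (\<Prod>l\<in>{..<n}-{i}. cmod (\<theta> i - \<theta> l))))"
      unfolding q by simp
  qed
  finally show "v \<bullet> (herm_gram n A B *\<^sub>v v) =
      of_real (\<Sum>i<n. max 1 (cmod (\<theta> i)) * cmod (w i) / (cmod e * (\<Prod>l\<in>{..<n}-{i}. cmod (\<theta> i - \<theta> l))))"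
    unfolding eq of_real_sum .
qed

end

section \<open>Integral pencils of prescribed determinant\<close>

lemma Gcd_bezout:
  fixes c :: "nat \<Rightarrow> int" shows "\<exists>e. (\<Sum>i<n. e i * c i) = Gcd (c ` {..<n})"
proof (induction n)
  case 0 then show ?case by simp
next
  case (Suc n)
  then obtain e where e: "(\<Sum>i<n. e i * c i) = Gcd (c ` {..<n})" by blast
  obtain u v where uv: "u * Gcd (c ` {..<n}) + v * c n = gcd (Gcd (c ` {..<n})) (c n)"
    using bezout_int by blast
  have "(\<Sum>i<Suc n. (if i < n then u * e i else v) * c i) = u * (\<Sum>i<n. e i * c i) + v * c n"
    by (simp add: sum_distrib_left mult.assoc)
  also have "\<dots> = Gcd (c ` {..<Suc n})" unfolding e uv by (simp add: lessThan_Suc gcd.commute)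
  finally show ?case by (rule exI[of _ "\<lambda>i. if i < n then u * e i else v"])
qed

text \<open>Turns content 1 into the Bezout relation that \<open>residue_form\<close> asks
  for.\<close>

lemma content_bezout:
  fixes p :: "int poly" assumes "content p = 1"
  shows "\<exists>e. (\<Sum>i\<le>degree p. e i * coeff p i) = 1"
proof -
  let ?G = "Gcd (coeff p ` {..<Suc (degree p)})"
  have "?G dvd coeff p i" for i
    by (cases "i \<le> degree p") (auto simp: coeff_eq_0 intro!: Gcd_dvd)
  then have "?G dvd content p" by (simp add: const_poly_dvd_iff const_poly_dvd_iff_dvd_content[symmetric])
  then have "?G = 1" using assms by (simp add: zdvd1_eq)
  then show ?thesis using Gcd_bezout[where n = "Suc (degree p)" and c = "coeff p"]
    by (simp only: lessThan_Suc_atMost)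
qed

section \<open>Integer polynomials evaluated at complex points\<close>

definition zpoly_at :: "complex \<Rightarrow> int poly \<Rightarrow> complex" where
  "zpoly_at x p = poly (map_poly of_int p) x"

lemma zpoly_at_pCons: "zpoly_at x (pCons a p) = of_int a + x * zpoly_at x p"
  by (cases "a = 0 \<and> p = 0") (simp_all add: zpoly_at_def map_poly_pCons)

lemma zpoly_at_0 [simp]: "zpoly_at x 0 = 0" by (simp add: zpoly_at_def)

lemma zpoly_at_add: "zpoly_at x (p + q) = zpoly_at x p + zpoly_at x q"
proof -
  have "map_poly complex_of_int (p + q) = map_poly of_int p + map_poly of_int q"
    by (rule poly_eqI) (simp add: coeff_map_poly)
  then show ?thesis by (simp add: zpoly_at_def)
qed

lemma zpoly_at_smult: "zpoly_at x (smult c q) = of_int c * zpoly_at x q"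
proof -
  have "map_poly complex_of_int (smult c q) = smult (of_int c) (map_poly of_int q)"
    by (rule poly_eqI) (simp add: coeff_map_poly)
  then show ?thesis by (simp add: zpoly_at_def)
qed

lemma zpoly_at_mult: "zpoly_at x (p * q) = zpoly_at x p * zpoly_at x q"
  by (induction p) (simp_all add: zpoly_at_add zpoly_at_smult zpoly_at_pCons algebra_simps)

lemma zpoly_at_1 [simp]: "zpoly_at x 1 = 1" unfolding one_pCons zpoly_at_pCons by simp

lemma zpoly_at_diff: "zpoly_at x (p - q) = zpoly_at x p - zpoly_at x q"
  using zpoly_at_add[of x "p - q" q] by simp

lemma zpoly_at_sum: "zpoly_at x (sum f I) = (\<Sum>i\<in>I. zpoly_at x (f i))"
  by (induction I rule: infinite_finite_induct) (simp_all add: zpoly_at_add)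

lemma zpoly_at_power: "zpoly_at x (p ^ n) = zpoly_at x p ^ n"
  by (induction n) (simp_all add: zpoly_at_mult)

lemma zpoly_at_monom: "zpoly_at x (monom a n) = of_int a * x ^ n"
  by (simp add: zpoly_at_def map_poly_monom poly_monom)

lemma zpoly_at_altdef: "degree p \<le> n \<Longrightarrow> zpoly_at x p = (\<Sum>i\<le>n. of_int (coeff p i) * x ^ i)"
proof -
  assume d: "degree p \<le> n"
  have "zpoly_at x p = (\<Sum>i\<le>n. zpoly_at x (monom (coeff p i) i))"
    unfolding zpoly_at_sum[symmetric] using poly_as_sum_of_monoms'[OF d] by simp
  then show ?thesis by (simp add: zpoly_at_monom)
qed

lemma zpoly_at_hom: "comm_ring_hom (zpoly_at x)"
  by unfold_locales (simp_all add: zpoly_at_add zpoly_at_mult)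

lemma zpoly_at_eqI: assumes "\<And>x. zpoly_at x p = zpoly_at x q" shows "p = q"
proof -
  have "map_poly complex_of_int p = map_poly of_int q"
    using assms unfolding zpoly_at_def by (intro poly_eq_poly_eq_iff[THEN iffD1] ext)
  then have "coeff (map_poly complex_of_int p) i = coeff (map_poly of_int q) i" for i by simp
  then show ?thesis by (intro poly_eqI) (simp add: coeff_map_poly)
qed

text \<open>Pseudo-division leaves a remainder of degree below deg r that vanishes at the deg r
  distinct roots of r, so it is zero. Gauss's lemma, with content 1 of r, removes the multiplier
  c.\<close>

lemma vanish_imp_dvd:
  fixes r p :: "int poly"
  assumes r: "content r = 1" and sqf: "rsquarefree (map_poly complex_of_int r)"
    and van: "\<And>x. zpoly_at x r = 0 \<Longrightarrow> zpoly_at x p = 0"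
  shows "r dvd p"
proof -
  have r0: "r \<noteq> 0" using r by auto
  obtain c q where cq: "c \<noteq> 0" "smult c p = r * q + pseudo_mod p r"
    using pseudo_mod(1)[OF r0, of p] by blast
  let ?R = "map_poly complex_of_int r"
  have dR: "degree ?R = degree r" by (rule degree_map_poly) auto
  have R0: "?R \<noteq> 0" using r0 dR by (metis degree_0 zpoly_at_def zpoly_at_eqI zpoly_at_0 poly_0)
  have card: "card {x. poly ?R x = 0} = degree r"
  proof -
    have "?R = smult (lead_coeff ?R) (\<Prod>z|poly ?R z = 0. [:- z, 1:])"
      using complex_poly_decompose_rsquarefree[OF sqf] by simp
    then have "degree ?R = degree (\<Prod>z|poly ?R z = 0. [:- z, 1:])"
      using R0 by (metis degree_smult_eq leading_coeff_0_iff)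
    also have "\<dots> = (\<Sum>z|poly ?R z = 0. degree [:- z, 1:])"
      by (rule degree_prod_eq_sum_degree) auto
    finally show ?thesis using dR by simp
  qed
  have "pseudo_mod p r = 0"
  proof (rule ccontr)
    assume n0: "pseudo_mod p r \<noteq> 0"
    then have d: "degree (pseudo_mod p r) < degree r" using pseudo_mod(2)[OF r0, of p] by auto
    let ?M = "map_poly complex_of_int (pseudo_mod p r)"
    have "poly ?M x = 0" if "poly ?R x = 0" for x
    proof -
      have "zpoly_at x (smult c p) = zpoly_at x r * zpoly_at x q + zpoly_at x (pseudo_mod p r)" by (simp add: cq(2) zpoly_at_add zpoly_at_mult)
      moreover have "zpoly_at x r = 0" using that by (simp add: zpoly_at_def)
      ultimately have "zpoly_at x (pseudo_mod p r) = 0" using van[of x] by (simp add: zpoly_at_smult)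
      then show ?thesis by (simp add: zpoly_at_def)
    qed
    then have sub: "{x. poly ?R x = 0} \<subseteq> {x. poly ?M x = 0}" by auto
    have M0: "?M \<noteq> 0" using n0 by (metis zpoly_at_def zpoly_at_eqI zpoly_at_0 poly_0)
    have "card {x. poly ?R x = 0} \<le> card {x. poly ?M x = 0}"
      by (rule card_mono[OF poly_roots_finite[OF M0] sub])
    also have "\<dots> \<le> degree ?M" by (rule card_poly_roots_bound[OF M0])
    also have "degree ?M = degree (pseudo_mod p r)" by (rule degree_map_poly) auto
    finally show False using card d by simp
  qed
  then have eq: "smult c p = r * q" using cq by simp
  have "content (smult c p) = content q" unfolding eq using r by (simp add: content_mult)
  then have cq': "content q = normalize c * content p" by (simp add: content_smult)
  have "c dvd content q" unfolding cq' by (rule dvd_mult2) simp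
  then have "[:c:] dvd q" by (simp add: const_poly_dvd_iff_dvd_content)
  then obtain G where "q = [:c:] * G" by (auto simp: dvd_def)
  then have "smult c p = smult c (r * G)" using eq by simp
  then have "smult c (p - r * G) = 0" by (simp add: smult_diff_right)
  then have "p = r * G" using cq(1) by simp
  then show ?thesis by simp
qed

lemma rat_common_denominator: "\<exists>N>0. \<forall>i. of_nat N * of_rat (coeff p i) \<in> (\<int> :: complex set)"
proof (induction p)
  case 0 then show ?case by (intro exI[of _ 1]) auto
next
  case (pCons a p)
  obtain N where N: "N > 0" "\<And>i. of_nat N * of_rat (coeff p i) \<in> (\<int> :: complex set)" using pCons by blast
  obtain u v where uv: "quotient_of a = (u, v)" by (cases "quotient_of a")
  have v: "v > 0" "a = of_int u / of_int v"
    using quotient_of_denom_pos[OF uv] quotient_of_div[OF uv] by auto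
  have av: "of_nat (nat v) * of_rat a = (of_int u :: complex)" using v by (simp add: of_rat_divide)
  have "of_nat (N * nat v) * of_rat (coeff (pCons a p) i) \<in> (\<int> :: complex set)" for i
  proof (cases i)
    case 0
    have "of_nat (N * nat v) * of_rat (coeff (pCons a p) i) = of_nat N * (of_int u :: complex)"
      using 0 av by (simp add: mult.assoc)
    then show ?thesis by (simp only: Ints_mult Ints_of_nat Ints_of_int)
  next
    case (Suc j)
    have "of_nat (N * nat v) * of_rat (coeff (pCons a p) i) = of_nat (nat v) * (of_nat N * of_rat (coeff p j) :: complex)"
      using Suc by (simp add: mult_ac)
    then show ?thesis using N(2)[of j] by (simp only: Ints_mult Ints_of_nat)
  qed
  then show ?case using N(1) v(1) by (intro exI[of _ "N * nat v"]) auto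
qed

lemma monic_eq_prod_roots:
  fixes p :: "complex poly"
  assumes "finite R" "card R = degree p" "lead_coeff p = 1" "\<And>x. x \<in> R \<Longrightarrow> poly p x = 0"
  shows "p = (\<Prod>z\<in>R. [:- z, 1:])"
proof (rule ccontr)
  let ?q = "\<Prod>z\<in>R. [:- z, 1:]"
  assume ne: "p \<noteq> ?q"
  then have d0: "p - ?q \<noteq> 0" by simp
  have dq: "degree ?q = card R" by (subst degree_prod_eq_sum_degree) auto
  have lq: "lead_coeff ?q = 1" by (simp add: lead_coeff_prod)
  have c0: "coeff (p - ?q) (degree p) = 0" using dq lq assms(2,3) by simp
  have "degree p > 0"
  proof (rule ccontr)
    assume "\<not> degree p > 0"
    then have "degree (p - ?q) = 0" "coeff (p - ?q) 0 = 0" using dq assms(2) c0 degree_diff_le[of p 0 ?q] by auto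
    then show False using d0 by (metis leading_coeff_0_iff)
  qed
  moreover have "degree (p - ?q) \<le> degree p" using dq assms(2) by (intro degree_diff_le) auto
  ultimately have lt: "degree (p - ?q) < degree p"
    using c0 d0 by (metis le_neq_implies_less leading_coeff_0_iff)
  have "R \<subseteq> {x. poly (p - ?q) x = 0}" using assms(1,4) by (auto simp: poly_prod prod_zero_iff)
  then have "card R \<le> card {x. poly (p - ?q) x = 0}" by (intro card_mono poly_roots_finite d0)
  also have "\<dots> \<le> degree (p - ?q)" by (rule card_poly_roots_bound[OF d0])
  finally show False using lt assms(2) by simp
qed

text \<open>det (xA - B) is det A times the characteristic polynomial of A^(-1) B, which is monic of
  degree m with m known roots.\<close>

lemma det_pencil_from_roots:
  fixes A B :: "complex mat"
  assumes A: "A \<in> carrier_mat m m" "det A \<noteq> 0" and B: "B \<in> carrier_mat m m"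
    and R: "finite R" "card R = m" "\<And>x. x \<in> R \<Longrightarrow> det (x \<cdot>\<^sub>m A - B) = 0"
  shows "det (x \<cdot>\<^sub>m A - B) = det A * (\<Prod>z\<in>R. x - z)"
proof -
  obtain Q where Q: "Q \<in> carrier_mat m m" "A * Q = 1\<^sub>m m" "Q * A = 1\<^sub>m m"
    using det_non_zero_imp_unit[OF A, of "()"] by (auto simp: Units_def ring_mat_def)
  define K where "K = Q * B"
  have K: "K \<in> carrier_mat m m" using Q B by (simp add: K_def)
  have AK: "A * K = B" unfolding K_def using assoc_mult_mat[OF A(1) Q(1) B] Q(2) B by simp
  have fac: "x \<cdot>\<^sub>m A - B = A * (x \<cdot>\<^sub>m 1\<^sub>m m - K)" for x
  proof -
    have "A * (x \<cdot>\<^sub>m 1\<^sub>m m - K) = A * (x \<cdot>\<^sub>m 1\<^sub>m m) - A * K"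
      by (rule mult_minus_distrib_mat[OF A(1) _ K]) simp
    also have "A * (x \<cdot>\<^sub>m 1\<^sub>m m) = x \<cdot>\<^sub>m A" using A by (subst mult_smult_distrib[of _ m m]) auto
    finally show ?thesis using AK by simp
  qed
  have ch: "comm_ring_hom (\<lambda>p. poly p (x::complex))" for x by unfold_locales auto
  have ecp: "det (x \<cdot>\<^sub>m 1\<^sub>m m - K) = poly (char_poly K) x" for x
  proof -
    have "map_mat (\<lambda>p. poly p x) (char_poly_matrix K) = x \<cdot>\<^sub>m 1\<^sub>m m - K"
      using K by (intro eq_matI) (auto simp: char_poly_matrix_def)
    then show ?thesis using comm_ring_hom.hom_det[OF ch, of x "char_poly_matrix K"] by (simp add: char_poly_def)
  qed
  have dm: "det (x \<cdot>\<^sub>m A - B) = det A * poly (char_poly K) x" for x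
    unfolding fac ecp[symmetric] by (rule det_mult[OF A(1) minus_carrier_mat[OF K]])
  have "char_poly K = (\<Prod>z\<in>R. [:- z, 1:])"
    by (rule monic_eq_prod_roots) (use R dm A(2) degree_monic_char_poly[OF K] in auto)
  then show ?thesis unfolding dm by (simp add: poly_prod)
qed

text \<open>The determinant vanishes at the m distinct roots of \<open>U\<close>, so it is \<kappa>
  U. The integral matrices \<open>Xm\<close> make it a divisor of r^m in Z[x], so its content is 1
  and \<kappa> is 1 or -1. Congruence of \<open>A0\<close> with the antitriangular Hankel matrix of
  tau(x^(a+b)) shows that \<kappa> has the sign (-1)^h.\<close>

lemma residue_det:
  fixes A0 B0 :: "nat \<Rightarrow> nat \<Rightarrow> int" and Xm :: "nat \<Rightarrow> nat \<Rightarrow> nat \<Rightarrow> int" and M :: "nat \<Rightarrow> nat \<Rightarrow> real"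
    and r :: "int poly"
  assumes U: "U = map_poly complex_of_int r" and RF: "residue_form U m" and m: "m = 2 * h + 1"
    and r: "content r = 1" and sqf: "rsquarefree U"
    and TX: "\<forall>x. \<forall>i<m. \<forall>j<m. (\<Sum>p<m. (x * of_int (A0 i p) - of_int (B0 i p)) * (\<Sum>l<m. of_int (Xm l p j) * x ^ l))
      = (if i = j then poly U x else 0)"
    and Xn: "\<forall>x. poly U x = 0 \<longrightarrow> (\<exists>d. (\<Sum>i<m. \<Sum>j<m. d i * (\<Sum>l<m. of_int (Xm l i j) * x ^ l) * d j) = 1)"
    and M: "\<forall>i<m. M i i \<noteq> 0" "\<forall>i<m. \<forall>a>i. M i a = 0"
    and AM: "\<forall>i<m. \<forall>j<m. of_int (A0 i j) = (\<Sum>a<m. \<Sum>b<m. of_real (M i a) * of_real (M j b) * residue_form.tau U m (monom 1 (a + b)))"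
  shows "det (mat m m (\<lambda>(i, j). x * of_int (A0 i j) - of_int (B0 i j))) = (- 1) ^ h * poly U x"
proof -
  interpret residue_form U m by (rule RF)
  define A where "A = mat m m (\<lambda>(i, j). complex_of_int (A0 i j))"
  define B where "B = mat m m (\<lambda>(i, j). complex_of_int (B0 i j))"
  have A: "A \<in> carrier_mat m m" and B: "B \<in> carrier_mat m m" by (auto simp: A_def B_def)
  have T: "mat m m (\<lambda>(i, j). x * of_int (A0 i j) - of_int (B0 i j)) = x \<cdot>\<^sub>m A - B" for x
    by (intro eq_matI) (auto simp: A_def B_def)
  define Xs where "Xs x = mat m m (\<lambda>(i, j). \<Sum>l<m. of_int (Xm l i j) * x ^ l)" for x :: complex
  have Xs: "Xs x \<in> carrier_mat m m" for x by (simp add: Xs_def)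
  have TXs: "(x \<cdot>\<^sub>m A - B) * Xs x = poly U x \<cdot>\<^sub>m 1\<^sub>m m" for x
  proof (rule eq_matI)
    fix i j assume "i < dim_row (poly U x \<cdot>\<^sub>m 1\<^sub>m m)" "j < dim_col (poly U x \<cdot>\<^sub>m 1\<^sub>m m)"
    then have ij: "i < m" "j < m" by auto
    have "((x \<cdot>\<^sub>m A - B) * Xs x) $$ (i, j) = (\<Sum>p<m. (x * of_int (A0 i p) - of_int (B0 i p)) * (\<Sum>l<m. of_int (Xm l p j) * x ^ l))"
      using ij by (simp add: A_def B_def Xs_def scalar_prod_def atLeast0LessThan)
    also have "\<dots> = (if i = j then poly U x else 0)" using TX ij by blast
    finally show "((x \<cdot>\<^sub>m A - B) * Xs x) $$ (i, j) = (poly U x \<cdot>\<^sub>m 1\<^sub>m m) $$ (i, j)" using ij by simp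
  qed (use A B in \<open>auto simp: Xs_def\<close>)
  \<comment> \<open>An invertible value at a root would force \<open>Xs x\<close> to vanish by
    \<open>TXs\<close>, against \<open>Xn\<close>.\<close>
  have root: "det (x \<cdot>\<^sub>m A - B) = 0" if x: "poly U x = 0" for x
  proof (rule ccontr)
    assume "det (x \<cdot>\<^sub>m A - B) \<noteq> 0"
    then obtain Q where Q: "Q \<in> carrier_mat m m" "Q * (x \<cdot>\<^sub>m A - B) = 1\<^sub>m m"
      using det_non_zero_imp_unit[OF minus_carrier_mat[OF B], of "x \<cdot>\<^sub>m A" "()"] by (auto simp: Units_def ring_mat_def)
    have "Q * ((x \<cdot>\<^sub>m A - B) * Xs x) = (Q * (x \<cdot>\<^sub>m A - B)) * Xs x"
      by (rule assoc_mult_mat[OF Q(1) minus_carrier_mat[OF B] Xs, symmetric])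
    then have "Xs x = Q * (0 \<cdot>\<^sub>m 1\<^sub>m m)" unfolding TXs x Q(2) using Xs[of x] by simp
    then have z: "Xs x = 0\<^sub>m m m" using Q(1) by (auto simp: mult_smult_distrib[of _ m m])
    have z': "(\<Sum>l<m. of_int (Xm l i j) * x ^ l) = 0" if "i < m" "j < m" for i j
      using arg_cong[OF z, of "\<lambda>M. M $$ (i, j)"] that by (simp add: Xs_def)
    obtain d where "(\<Sum>i<m. \<Sum>j<m. d i * (\<Sum>l<m. of_int (Xm l i j) * x ^ l) * d j) = (1::complex)"
      using Xn x by blast
    moreover have "(\<Sum>i<m. \<Sum>j<m. d i * (\<Sum>l<m. of_int (Xm l i j) * x ^ l) * d j) = (0::complex)"
      by (intro sum.neutral ballI) (simp add: z')
    ultimately show False by simp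
  qed
  have card: "finite {z. poly U z = 0}" "card {z. poly U z = 0} = m" "U = smult (lead_coeff U) (\<Prod>z|poly U z = 0. [:- z, 1:])"
  proof -
    show 1: "finite {z. poly U z = 0}" by (rule poly_roots_finite[OF U0])
    show 2: "U = smult (lead_coeff U) (\<Prod>z|poly U z = 0. [:- z, 1:])"
      using complex_poly_decompose_rsquarefree[OF sqf] by simp
    have "m = degree (smult (lead_coeff U) (\<Prod>z|poly U z = 0. [:- z, 1:]))" using 2 deg by metis
    also have "\<dots> = degree (\<Prod>z|poly U z = 0. [:- z, 1:])" using U0 by simp
    also have "\<dots> = (\<Sum>z|poly U z = 0. degree [:- z, 1:])"
      by (rule degree_prod_eq_sum_degree) auto
    finally show "card {z. poly U z = 0} = m" by simp
  qed
  define u where "u = lead_coeff U"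
  have u0: "u \<noteq> 0" using U0 by (simp add: u_def)
  obtain ur :: int where ur: "u = of_int ur" using Uint[of "degree U"] by (auto simp: u_def elim: Ints_cases)
  define Hk where "Hk = mat m m (\<lambda>(a, b). tau (monom 1 (a + b)))"
  define Mm where "Mm = mat m m (\<lambda>(i, a). complex_of_real (M i a))"
  have Hk: "Hk \<in> carrier_mat m m" and Mm: "Mm \<in> carrier_mat m m" by (auto simp: Hk_def Mm_def)
  have AMH: "A = Mm * (Hk * transpose_mat Mm)"
  proof (rule eq_matI)
    fix i j assume "i < dim_row (Mm * (Hk * transpose_mat Mm))" "j < dim_col (Mm * (Hk * transpose_mat Mm))"
    then have ij: "i < m" "j < m" using Mm by auto
    have "(Mm * (Hk * transpose_mat Mm)) $$ (i, j) = (\<Sum>a<m. of_real (M i a) * (\<Sum>b<m. tau (monom 1 (a + b)) * of_real (M j b)))"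
      using ij by (simp add: Mm_def Hk_def scalar_prod_def atLeast0LessThan)
    also have "\<dots> = of_int (A0 i j)" using AM ij by (simp add: sum_distrib_left mult_ac)
    finally show "A $$ (i, j) = (Mm * (Hk * transpose_mat Mm)) $$ (i, j)" using ij by (simp add: A_def)
  qed (use Mm in \<open>auto simp: A_def\<close>)
  have dMm: "det Mm = of_real (\<Prod>i<m. M i i)"
  proof -
    have "det Mm = prod_list (diag_mat Mm)"
      by (rule det_lower_triangular[OF _ Mm]) (use M(2) in \<open>auto simp: Mm_def\<close>)
    also have "diag_mat Mm = map (\<lambda>i. of_real (M i i)) [0..<m]"
      unfolding diag_mat_def by (rule map_cong) (auto simp: Mm_def)
    finally show ?thesis by (simp add: prod.list_conv_set_nth atLeast0LessThan)
  qed
  define \<mu> where "\<mu> = (\<Prod>i<m. M i i)"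
  have \<mu>0: "\<mu> \<noteq> 0" using M(1) by (simp add: \<mu>_def)
  have dHk: "det Hk = (- 1) ^ h * (1 / u) ^ m"
  proof -
    have "det Hk = (- 1) ^ (m * (m - 1) div 2) * (\<Prod>i<m. Hk $$ (i, m - 1 - i))"
      by (rule det_antitriangular[OF Hk]) (auto simp: Hk_def tau_monom)
    also have "(\<Prod>i<m. Hk $$ (i, m - 1 - i)) = (\<Prod>i<m. 1 / u)"
      by (intro prod.cong) (auto simp: Hk_def tau_monom_top[unfolded One_nat_def] u_def)
    also have "m * (m - 1) div 2 = h + 2 * (h * h)" by (simp add: m algebra_simps)
    finally show ?thesis by (simp add: power_add power_mult)
  qed
  have dA: "det A = (- 1) ^ h * of_real (\<mu>\<^sup>2) * (1 / u) ^ m"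
    unfolding AMH using det_mult[OF Mm mult_carrier_mat[OF Hk transpose_carrier_mat[THEN iffD2, OF Mm]]]
      det_mult[OF Hk transpose_carrier_mat[THEN iffD2, OF Mm]] det_transpose[OF Mm] dMm dHk
    by (simp add: \<mu>_def power2_eq_square mult_ac)
  have A0: "det A \<noteq> 0" unfolding dA using \<mu>0 u0 by simp
  define \<kappa> where "\<kappa> = det A / u"
  have detT: "det (x \<cdot>\<^sub>m A - B) = \<kappa> * poly U x" for x
  proof -
    have "det (x \<cdot>\<^sub>m A - B) = det A * (\<Prod>z|poly U z = 0. x - z)"
      by (rule det_pencil_from_roots[OF A A0 B card(1,2)]) (use root in auto)
    also have "poly U x = u * (\<Prod>z|poly U z = 0. x - z)"
      by (subst card(3)) (simp add: poly_prod u_def)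
    then have "det A * (\<Prod>z|poly U z = 0. x - z) = \<kappa> * poly U x" using u0 by (simp add: \<kappa>_def)
    finally show ?thesis .
  qed
  \<comment> \<open>det A brings m factors 1 / u and the division by u one more. As m + 1 is even,
    the sign of the leading coefficient does not matter.\<close>
  define \<nu> where "\<nu> = \<mu>\<^sup>2 / (real_of_int ur) ^ (m + 1)"
  have ur0: "ur \<noteq> 0" using u0 ur by auto
  have \<nu>: "\<kappa> = (- 1) ^ h * of_real \<nu>" "\<nu> > 0"
  proof -
    show "\<kappa> = (- 1) ^ h * of_real \<nu>"
      unfolding \<kappa>_def dA \<nu>_def ur by (simp add: field_simps)
    have "even (m + 1)" using m by simp
    then have "real_of_int ur ^ (m + 1) > 0" using ur0 by (simp add: zero_less_power_eq del: power_Suc)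
    then show "\<nu> > 0" unfolding \<nu>_def using \<mu>0 by simp
  qed
  define Ti where "Ti = mat m m (\<lambda>(i, j). [:- B0 i j, A0 i j:])"
  define Xi where "Xi = mat m m (\<lambda>(i, j). \<Sum>l<m. monom (Xm l i j) l)"
  have TiXi: "Ti \<in> carrier_mat m m" "Xi \<in> carrier_mat m m" by (auto simp: Ti_def Xi_def)
  have eT: "zpoly_at x (det Ti) = det (x \<cdot>\<^sub>m A - B)" for x
  proof -
    have "map_mat (zpoly_at x) Ti = x \<cdot>\<^sub>m A - B"
      by (intro eq_matI) (auto simp: Ti_def A_def B_def zpoly_at_pCons)
    then show ?thesis using comm_ring_hom.hom_det[OF zpoly_at_hom, of x Ti] by simp
  qed
  have eX: "zpoly_at x (det Xi) = det (Xs x)" for x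
  proof -
    have "map_mat (zpoly_at x) Xi = Xs x"
      by (intro eq_matI) (auto simp: Xi_def Xs_def zpoly_at_sum zpoly_at_monom)
    then show ?thesis using comm_ring_hom.hom_det[OF zpoly_at_hom, of x Xi] by simp
  qed
  have eU: "poly U x = zpoly_at x r" for x by (simp add: U zpoly_at_def)
  have prodTX: "det Ti * det Xi = r ^ m"
  proof (rule zpoly_at_eqI)
    fix x
    have "det (x \<cdot>\<^sub>m A - B) * det (Xs x) = det (poly U x \<cdot>\<^sub>m 1\<^sub>m m)"
      using det_mult[OF minus_carrier_mat[OF B] Xs, of "x \<cdot>\<^sub>m A" x] TXs[of x] by simp
    then show "zpoly_at x (det Ti * det Xi) = zpoly_at x (r ^ m)" by (simp add: zpoly_at_mult zpoly_at_power eT eX eU)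
  qed
  have "content (r ^ m) = 1" using r by (induction m) (simp_all add: content_mult)
  then have "content (det Ti) * content (det Xi) = 1" unfolding prodTX[symmetric] by (simp add: content_mult)
  then have "content (det Ti) dvd 1" by (intro dvdI[of _ _ "content (det Xi)"]) simp
  then have "normalize (content (det Ti)) = 1" by (rule is_unit_normalize)
  then have cT: "content (det Ti) = 1" by (simp only: normalize_content)
  \<comment> \<open>The coefficients of det Ti are integers and equal \<kappa> times those of r; the
    Bezout relation extracts \<kappa> from them as an integer.\<close>
  obtain e where e: "(\<Sum>i\<le>degree r. e i * coeff r i) = 1" using content_bezout[OF r] by blast
  have cTi: "of_int (coeff (det Ti) i) = \<kappa> * of_int (coeff r i)" for i
  proof -
    have "map_poly complex_of_int (det Ti) = smult \<kappa> (map_poly of_int r)"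
      by (intro poly_eq_poly_eq_iff[THEN iffD1] ext) (use eT detT eU in \<open>simp add: zpoly_at_def\<close>)
    then have "coeff (map_poly complex_of_int (det Ti)) i = coeff (smult \<kappa> (map_poly of_int r)) i" by simp
    then show ?thesis by (simp add: coeff_map_poly)
  qed
  have "\<kappa> = (\<Sum>i\<le>degree r. of_int (e i) * (\<kappa> * of_int (coeff r i)))"
  proof -
    have "(\<Sum>i\<le>degree r. of_int (e i) * (\<kappa> * of_int (coeff r i))) = \<kappa> * of_int (\<Sum>i\<le>degree r. e i * coeff r i)"
      by (simp add: sum_distrib_left mult_ac)
    then show ?thesis using e by simp
  qed
  also have "\<dots> = of_int (\<Sum>i\<le>degree r. e i * coeff (det Ti) i)" unfolding cTi[symmetric] by simp
  finally obtain z :: int where z: "\<kappa> = of_int z" by blast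
  have "det Ti = smult z r"
  proof (rule poly_eqI)
    fix i
    have "complex_of_int (coeff (det Ti) i) = of_int (z * coeff r i)" using cTi[of i] z by simp
    then show "coeff (det Ti) i = coeff (smult z r) i" by (simp only: of_int_eq_iff coeff_smult)
  qed
  then have "\<bar>z\<bar> = 1" using cT r by (simp add: content_smult)
  moreover have "\<nu> = 1"
  proof -
    have "cmod \<kappa> = \<nu>" using \<nu> by (simp add: norm_mult norm_power)
    moreover have "cmod \<kappa> = 1" using z \<open>\<bar>z\<bar> = 1\<close> by (simp flip: of_int_abs)
    ultimately show ?thesis by simp
  qed
  ultimately show ?thesis unfolding T detT using \<nu>(1) by simp
qed

text \<open>One shape shared by A, B and the pencil x A - B. The first k coordinates are isotropic,
  N couples them to the corner \<Gamma>, and C couples the corner to the block T.\<close>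

definition bordered_mat :: "nat \<Rightarrow> nat \<Rightarrow> (nat \<Rightarrow> nat \<Rightarrow> 'a::comm_ring_1) \<Rightarrow> (nat \<Rightarrow> nat \<Rightarrow> 'a) \<Rightarrow> (nat \<Rightarrow> nat \<Rightarrow> 'a) \<Rightarrow>
    (nat \<Rightarrow> nat \<Rightarrow> 'a) \<Rightarrow> 'a mat" where
  "bordered_mat k m N \<Gamma> C T = mat (2*k+1+m) (2*k+1+m) (\<lambda>(r, q).
     if r < 2*k+1 then
       if q < 2*k+1 then
         if r < k \<and> q < k then 0 else if r < k then N r (rev_index k q) else if q < k then N q (rev_index k r) else \<Gamma> (rev_index k r) (rev_index k q)
       else if r < k then 0 else C (rev_index k r) (q - (2*k+1))
     else if q < 2*k+1 then if q < k then 0 else C (rev_index k q) (r - (2*k+1))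
     else T (r - (2*k+1)) (q - (2*k+1)))"

lemma bordered_mat_carrier: "bordered_mat k m N \<Gamma> C T \<in> carrier_mat (2*k+1+m) (2*k+1+m)"
  by (simp add: bordered_mat_def)

lemma bordered_mat_four_block:
  "bordered_mat k m (shift_entry x) \<Gamma> C T = four_block_mat (border_mat k x \<Gamma>) (coupling_mat k m C) (transpose_mat (coupling_mat k m C)) (mat m m (\<lambda>(i, j). T i j))"
  by (rule eq_matI) (auto simp: bordered_mat_def border_mat_def coupling_mat_def)

lemma bordered_mat_transpose:
  assumes "\<And>a b. \<Gamma> a b = \<Gamma> b a" "\<And>i j. T i j = T j i"
  shows "transpose_mat (bordered_mat k m N \<Gamma> C T) = bordered_mat k m N \<Gamma> C T"
proof (rule eq_matI)
  fix i j assume "i < dim_row (bordered_mat k m N \<Gamma> C T)" "j < dim_col (bordered_mat k m N \<Gamma> C T)"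
  then have "i < 2*k+1+m" "j < 2*k+1+m" by (auto simp: bordered_mat_def)
  then show "transpose_mat (bordered_mat k m N \<Gamma> C T) $$ (i, j) = bordered_mat k m N \<Gamma> C T $$ (i, j)"
    using assms(1)[of "rev_index k i" "rev_index k j"] assms(2)[of "i - (2*k+1)" "j - (2*k+1)"] by (auto simp: bordered_mat_def)
qed (auto simp: bordered_mat_def)

text \<open>Both sides are polynomials in x. This lets determinant formulas obtained by dividing, by
  r(x) or by 1 - t x, be used at every x.\<close>

lemma det_eq_poly_of_cofinite:
  fixes P Q :: "complex mat"
  assumes P: "P \<in> carrier_mat n n" and Q: "Q \<in> carrier_mat n n" and S: "finite S"
    and eq: "\<And>x. x \<notin> S \<Longrightarrow> det (x \<cdot>\<^sub>m P - Q) = poly w x"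
  shows "det (x \<cdot>\<^sub>m P - Q) = poly w x"
proof -
  have ch: "comm_ring_hom (\<lambda>p. poly p (x::complex))" for x by unfold_locales auto
  define D where "D = det (mat n n (\<lambda>(i, j). [:- Q $$ (i, j), P $$ (i, j):]))"
  have D: "poly D x = det (x \<cdot>\<^sub>m P - Q)" for x
  proof -
    have "map_mat (\<lambda>p. poly p x) (mat n n (\<lambda>(i, j). [:- Q $$ (i, j), P $$ (i, j):])) = x \<cdot>\<^sub>m P - Q"
      using P Q by (intro eq_matI) auto
    then show ?thesis unfolding D_def
      using comm_ring_hom.hom_det[OF ch, of x "mat n n (\<lambda>(i, j). [:- Q $$ (i, j), P $$ (i, j):])"] by simp
  qed
  have "infinite (UNIV - S)" using S infinite_UNIV_char_0 by (rule Diff_infinite_finite)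
  moreover have "UNIV - S \<subseteq> {x. poly (D - w) x = 0}" using eq D by auto
  ultimately have "D - w = 0" using poly_roots_finite finite_subset by blast
  then show ?thesis using D[of x] by simp
qed

lemma sum_pairs:
  fixes f :: "nat \<Rightarrow> 'a::comm_monoid_add" and k :: nat
  shows "(\<Sum>i\<le>2*k+1. f i) = (\<Sum>a\<le>k. f (2*a) + f (2*a+1))"
  by (induction k) (simp_all add: add.assoc)

lemma map_of_rat_mult: "map_poly (of_rat :: rat \<Rightarrow> complex) (p * q) = map_poly of_rat p * map_poly of_rat q"
  by (rule poly_eqI) (simp add: coeff_map_poly coeff_mult of_rat_sum of_rat_mult)

lemma map_of_rat_diff: "map_poly (of_rat :: rat \<Rightarrow> complex) (p - q) = map_poly of_rat p - map_poly of_rat q"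
  by (rule poly_eqI) (simp add: coeff_map_poly of_rat_diff)

lemma map_of_rat_of_int: "map_poly (of_rat :: rat \<Rightarrow> complex) (map_poly of_int p) = map_poly of_int p"
  by (rule poly_eqI) (simp add: coeff_map_poly)

lemma Gcd_one_of_content:
  fixes s :: "int poly"
  assumes "content s = 1" "\<And>i. coeff s i \<noteq> 0 \<Longrightarrow> coeff s i \<in> S" shows "Gcd S = 1"
proof -
  have "Gcd S dvd coeff s i" for i
    using assms(2)[of i] by (cases "coeff s i = 0") auto
  then have "Gcd S dvd content s" by (simp add: const_poly_dvd_iff const_poly_dvd_iff_dvd_content[symmetric])
  then show ?thesis using assms(1) by (simp add: zdvd1_eq)
qed

text \<open>Eliminating the inner block leaves, up to sign, r times the corner value minus a
  polynomial Hp that agrees with F at the roots of r; the corner is chosen with value G = (Hp - F) /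
  r, which leaves -F. The vector w lies in the isotropic part, so (A + t B) w lives in the corner
  rows and is the coefficient vector of (1 + t x) s. The rank one change thus adds c ((1 + t x) s)^2
  to the corner value.\<close>

lemma integral_pencil_exists:
  fixes r s F :: "int poly" and V :: "rat poly" and t :: int
  assumes dr: "degree r = 2*h+1" and cr: "content r = 1" and sqf: "rsquarefree (map_poly complex_of_int r)"
    and ds: "degree s < k" and cs: "content s = 1"
    and dF: "degree F \<le> 2*k+1+(2*h+1)"
    and V: "map_poly of_int r dvd V\<^sup>2 - map_poly of_int F"
    and n: "n = 2*k+1+(2*h+1)"
  shows "\<exists>(A::int mat) B w. A \<in> carrier_mat n n \<and> B \<in> carrier_mat n n \<and> transpose_mat A = A \<and> transpose_mat B = B \<and>
    w \<in> carrier_vec n \<and> primitive_vec w \<and>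
    (\<forall>x c. det (x \<cdot>\<^sub>m map_mat complex_of_int A - map_mat of_int B
        + mat n n (\<lambda>(i, j). c * (of_int (((A + t \<cdot>\<^sub>m B) *\<^sub>v w) $ i) * of_int (((A + t \<cdot>\<^sub>m B) *\<^sub>v w) $ j))))
      = (- 1) ^ (h + k) * (c * (zpoly_at x ([:1, t:] * s))\<^sup>2 * zpoly_at x r - zpoly_at x F))"
proof -
  define m where "m = 2*h+1"
  define U where "U = map_poly complex_of_int r"
  define rq where "rq = map_poly rat_of_int r"
  have k0: "k > 0" using ds by simp
  have r0: "r \<noteq> 0" using cr by auto
  have U0: "U \<noteq> 0" using r0 by (auto simp: U_def poly_eq_iff coeff_map_poly)
  have rq0: "rq \<noteq> 0" using r0 by (auto simp: rq_def poly_eq_iff coeff_map_poly)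
  have dU: "degree U = m" unfolding U_def m_def dr[symmetric] by (rule degree_map_poly) auto
  have drq: "degree rq = m" unfolding rq_def m_def dr[symmetric] by (rule degree_map_poly) auto
  have eU: "poly U x = zpoly_at x r" for x by (simp add: U_def zpoly_at_def)
  obtain e where e: "(\<Sum>i\<le>degree r. e i * coeff r i) = 1" using content_bezout[OF cr] by blast
  have RF: "residue_form U m"
  proof
    show "degree U = m" by (rule dU)
    show "m > 0" by (simp add: m_def)
    show "coeff U i \<in> \<int>" for i by (simp add: U_def coeff_map_poly)
    have "(\<Sum>i\<le>m. complex_of_int (e i) * coeff U i) = of_int (\<Sum>i\<le>degree r. e i * coeff r i)"
      by (simp add: U_def coeff_map_poly m_def dr)
    then show "\<exists>e. (\<forall>i. e i \<in> \<int>) \<and> (\<Sum>i\<le>m. e i * coeff U i) = 1"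
      using e by (intro exI[of _ "\<lambda>i. of_int (e i)"]) simp
  qed
  \<comment> \<open>Reduction modulo r provides the degree bound on the square root.\<close>
  define V1 where "V1 = V mod rq"
  have dV1: "degree V1 < m" unfolding V1_def
    using degree_mod_less[OF rq0, of V] drq m_def by auto
  have V1: "rq dvd V1\<^sup>2 - map_poly of_int F"
  proof -
    have 1: "rq dvd V1 - V" by (simp add: V1_def mod_eq_dvd_iff[symmetric])
    have eq: "V1\<^sup>2 - map_poly of_int F = (V1 - V) * (V1 + V) + (V\<^sup>2 - map_poly of_int F)"
      by (simp add: power2_eq_square algebra_simps)
    show ?thesis unfolding eq by (intro dvd_add dvd_mult2 1 V[folded rq_def])
  qed
  have SR: "square_root_mod U m (map_poly of_rat V1) (map_poly of_int F) k h"
  proof -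
    interpret residue_form U m by (rule RF)
    show ?thesis
    proof
      show "m = 2 * h + 1" by (rule m_def)
      show "degree (map_poly of_rat V1 :: complex poly) < m" using dV1 degree_map_poly_le le_less_trans by blast
      show "\<exists>N>0. \<forall>i. of_nat N * coeff (map_poly of_rat V1) i \<in> (\<int> :: complex set)"
        using rat_common_denominator[of V1] by (simp add: coeff_map_poly)
      obtain q where "V1\<^sup>2 - map_poly of_int F = rq * q" using V1 by (auto simp: dvd_def)
      then have "map_poly (of_rat :: rat \<Rightarrow> complex) (V1\<^sup>2 - map_poly of_int F) = map_poly of_rat (rq * q)" by simp
      then have "(map_poly of_rat V1)\<^sup>2 - map_poly complex_of_int F = U * map_poly of_rat q"
        by (simp add: map_of_rat_mult map_of_rat_diff map_of_rat_of_int power2_eq_square rq_def U_def)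
      then show "U dvd (map_poly of_rat V1)\<^sup>2 - map_poly complex_of_int F" by simp
      show "coeff (map_poly complex_of_int F) i \<in> \<int>" for i by (simp add: coeff_map_poly)
      show "degree (map_poly complex_of_int F) \<le> 2 * k + 1 + m"
        using dF degree_map_poly_le[of complex_of_int F] by (simp add: m_def)
    qed
  qed
  obtain A0 B0 :: "nat \<Rightarrow> nat \<Rightarrow> int" and Xm :: "nat \<Rightarrow> nat \<Rightarrow> nat \<Rightarrow> int" and c :: "nat \<Rightarrow> nat \<Rightarrow> int" and M :: "nat \<Rightarrow> nat \<Rightarrow> real"
    where A0s: "\<forall>i j. A0 i j = A0 j i" and B0s: "\<forall>i j. B0 i j = B0 j i"
    and TX: "\<forall>x. \<forall>i<m. \<forall>j<m. (\<Sum>p<m. (x * of_int (A0 i p) - of_int (B0 i p)) * (\<Sum>l<m. of_int (Xm l p j) * x ^ l))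
      = (if i = j then poly U x else 0)"
    and CX: "\<forall>x. poly U x = 0 \<longrightarrow> (\<Sum>i<m. \<Sum>j<m. (\<Sum>p\<le>Suc k. of_int (c p i) * x ^ p) *
      (\<Sum>l<m. of_int (Xm l i j) * x ^ l) * (\<Sum>p\<le>Suc k. of_int (c p j) * x ^ p)) = poly (map_poly of_int F) x"
    and Xn: "\<forall>x. poly U x = 0 \<longrightarrow> (\<exists>d. (\<Sum>i<m. \<Sum>j<m. d i * (\<Sum>l<m. of_int (Xm l i j) * x ^ l) * d j) = 1)"
    and M: "\<forall>i<m. M i i \<noteq> 0" "\<forall>i<m. \<forall>a>i. M i a = 0"
    and AM: "\<forall>i<m. \<forall>j<m. of_int (A0 i j) = (\<Sum>a<m. \<Sum>b<m. of_real (M i a) * of_real (M j b) * residue_form.tau U m (monom 1 (a + b)))"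
    using square_root_mod.integral_pencil[OF SR] by (elim exE conjE) (rule that)
  have detT0: "det (mat m m (\<lambda>(i, j). x * of_int (A0 i j) - of_int (B0 i j))) = (- 1) ^ h * zpoly_at x r" for x
    using residue_det[OF U_def RF m_def cr sqf[folded U_def] TX Xn M AM] eU by simp
  define Hp where "Hp = (\<Sum>i<m. \<Sum>j<m. (\<Sum>p\<le>Suc k. monom (c p i) p) * (\<Sum>l<m. monom (Xm l i j) l) * (\<Sum>p\<le>Suc k. monom (c p j) p))"
  have eH: "zpoly_at x Hp = (\<Sum>i<m. \<Sum>j<m. (\<Sum>p\<le>Suc k. of_int (c p i) * x ^ p) *
      (\<Sum>l<m. of_int (Xm l i j) * x ^ l) * (\<Sum>p\<le>Suc k. of_int (c p j) * x ^ p))" for x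
    unfolding Hp_def by (simp only: zpoly_at_sum zpoly_at_mult zpoly_at_monom)
  have "r dvd Hp - F"
  proof (rule vanish_imp_dvd[OF cr sqf])
    fix x assume "zpoly_at x r = 0"
    then have "poly U x = 0" by (simp add: eU)
    then show "zpoly_at x (Hp - F) = 0" using CX eH by (simp add: zpoly_at_diff) (simp add: zpoly_at_def)
  qed
  then obtain G where G: "Hp - F = r * G" by (auto simp: dvd_def)
  have dH: "degree Hp \<le> 2*k+1+m"
  proof -
    have 1: "degree (\<Sum>p\<le>Suc k. monom (c p i) p) \<le> Suc k" for i
      by (intro degree_sum_le) (auto intro: order.trans[OF degree_monom_le])
    have 2: "degree (\<Sum>l<m. monom (Xm l i j) l) \<le> m - 1" for i j
      by (intro degree_sum_le) (auto intro: order.trans[OF degree_monom_le])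
    have "degree ((\<Sum>p\<le>Suc k. monom (c p i) p) * (\<Sum>l<m. monom (Xm l i j) l) * (\<Sum>p\<le>Suc k. monom (c p j) p)) \<le> 2*k+1+m" for i j
    proof -
      have "degree ((\<Sum>p\<le>Suc k. monom (c p i) p) * (\<Sum>l<m. monom (Xm l i j) l) * (\<Sum>p\<le>Suc k. monom (c p j) p))
        \<le> degree (\<Sum>p\<le>Suc k. monom (c p i) p) + degree (\<Sum>l<m. monom (Xm l i j) l) + degree (\<Sum>p\<le>Suc k. monom (c p j) p)"
        by (meson add_le_mono1 degree_mult_le order.trans)
      then show ?thesis using 1[of i] 1[of j] 2[of i j] by (simp add: m_def)
    qed
    then show ?thesis unfolding Hp_def by (intro degree_sum_le) auto
  qed
  have dG: "degree G \<le> 2*k+1"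
  proof (cases "G = 0")
    case False
    have "m + degree G = degree (r * G)" using r0 False dr by (simp add: degree_mult_eq m_def)
    also have "\<dots> \<le> 2*k+1+m" unfolding G[symmetric] using dH dF by (intro degree_diff_le) (auto simp: m_def)
    finally show ?thesis by simp
  qed simp
  \<comment> \<open>With g_i the coefficients of G, of degree at most 2k + 1, one has G = sum x^(2a)
    (g_(2a) + x g_(2a+1)). So the diagonal corner x GA - GB takes the value G(x) on (1, x, ...,
    x^k).\<close>
  define GA where "GA a b = (if a = b then coeff G (2*a+1) else 0)" for a b :: nat
  define GB where "GB a b = (if a = b then - coeff G (2*a) else 0)" for a b :: nat
  \<comment> \<open>The expansion has k + 2 terms but the corner only k + 1 rows: x CA - CB carries
    x c_(a+1) in row a and c_0 additionally in row 0.\<close>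
  define CA where "CA a j = c (Suc a) j" for a j :: nat
  define CB where "CB a j = (if a = 0 then - c 0 j else 0)" for a j :: nat
  define NA where "NA i a = (if a = i then 1 else 0 :: int)" for i a :: nat
  define NB where "NB i a = (if a = Suc i then 1 else 0 :: int)" for i a :: nat
  define A where "A = bordered_mat k m NA GA CA A0"
  define B where "B = bordered_mat k m NB GB CB B0"
  have nm: "n = 2*k+1+m" by (simp add: n m_def)
  have A: "A \<in> carrier_mat n n" and B: "B \<in> carrier_mat n n" unfolding A_def B_def nm by (rule bordered_mat_carrier)+
  have At: "transpose_mat A = A" unfolding A_def by (rule bordered_mat_transpose) (use A0s in \<open>auto simp: GA_def\<close>)
  have Bt: "transpose_mat B = B" unfolding B_def by (rule bordered_mat_transpose) (use B0s in \<open>auto simp: GB_def\<close>)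
  \<comment> \<open>The coefficients of s fit into the k isotropic coordinates because deg s <
    k.\<close>
  define w where "w = vec n (\<lambda>i. if i < k then coeff s i else 0)"
  have w: "w \<in> carrier_vec n" by (simp add: w_def)
  have wp: "primitive_vec w"
    unfolding primitive_vec_def
  proof (rule Gcd_one_of_content[OF cs])
    fix i assume "coeff s i \<noteq> 0"
    then have "i < k" using ds le_degree[of s i] by simp
    then have "i < n" "coeff s i = w $ i" by (auto simp: w_def nm)
    then show "coeff s i \<in> set\<^sub>v w" using w by (auto simp: vec_set_def)
  qed
  define \<nu> where "\<nu> a = coeff ([:1, t:] * s) a" for a
  define v where "v = (A + t \<cdot>\<^sub>m B) *\<^sub>v w"
  have v: "v $ i = (if k \<le> i \<and> i < 2*k+1 then \<nu> (rev_index k i) else 0)" if i: "i < n" for i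
  proof -
    have "v $ i = (\<Sum>q<n. (A $$ (i, q) + t * B $$ (i, q)) * w $ q)"
      using i A B w by (simp add: v_def scalar_prod_def atLeast0LessThan)
    also have "\<dots> = (\<Sum>q<k. (A $$ (i, q) + t * B $$ (i, q)) * coeff s q)"
      by (rule sum.mono_neutral_cong_right) (auto simp: w_def nm)
    also have "\<dots> = (\<Sum>q<k. (if k \<le> i \<and> i < 2*k+1 then (if rev_index k i = q then 1 else 0) + t * (if rev_index k i = Suc q then 1 else 0) else 0) * coeff s q)"
      using i by (intro sum.cong) (auto simp: A_def B_def bordered_mat_def nm NA_def NB_def)
    also have "\<dots> = (if k \<le> i \<and> i < 2*k+1 then \<nu> (rev_index k i) else 0)"
    proof (cases "k \<le> i \<and> i < 2*k+1")
      case True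
      define a where "a = rev_index k i"
      have ak: "a \<le> k" using True by (auto simp: a_def rev_index_def)
      have s1: "(\<Sum>q<k. (if a = q then 1 else 0) * coeff s q) = coeff s a"
        using ds by (cases "a < k") (auto simp: mult_delta_left coeff_eq_0)
      have s2: "(\<Sum>q<k. (if a = Suc q then 1 else 0) * coeff s q) = (case a of 0 \<Rightarrow> 0 | Suc a' \<Rightarrow> coeff s a')"
      proof (cases a)
        case (Suc a')
        then have "(\<Sum>q<k. (if a = Suc q then 1 else 0) * coeff s q) = (\<Sum>q<k. (if a' = q then 1 else 0) * coeff s q)" by simp
        then show ?thesis using Suc ak by (simp add: mult_delta_left)
      qed simp
      have "(\<Sum>q<k. ((if a = q then 1 else 0) + t * (if a = Suc q then 1 else 0)) * coeff s q)
        = (\<Sum>q<k. (if a = q then 1 else 0) * coeff s q) + t * (\<Sum>q<k. (if a = Suc q then 1 else 0) * coeff s q)"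
        unfolding sum_distrib_left sum.distrib[symmetric] by (intro sum.cong) (auto simp: algebra_simps)
      also have "\<dots> = \<nu> a" unfolding s1 s2 by (simp add: \<nu>_def coeff_pCons split: nat.splits)
      finally have "(\<Sum>q<k. ((if a = q then 1 else 0) + t * (if a = Suc q then 1 else 0)) * coeff s q) = \<nu> a" .
      then show ?thesis unfolding if_P[OF True] a_def[symmetric] .
    next
      case False
      then show ?thesis by (simp only: if_False mult_zero_left sum.neutral_const)
    qed
    finally show ?thesis .
  qed
  have e\<nu>: "(\<Sum>a\<le>k. x ^ a * of_int (\<nu> a)) = zpoly_at x ([:1, t:] * s)" for x
  proof -
    have "degree ([:1, t:] * s) \<le> degree [:1, t:] + degree s" by (rule degree_mult_le)
    also have "\<dots> \<le> k" using ds by (auto simp: degree_pCons_eq_if)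
    finally show ?thesis unfolding \<nu>_def by (subst zpoly_at_altdef[of _ k]) (simp_all add: mult.commute)
  qed
  have eG: "zpoly_at x G = (\<Sum>a\<le>k. x ^ a * x ^ a * (x * of_int (coeff G (2*a+1)) + of_int (coeff G (2*a))))" for x
  proof -
    have xx: "x ^ a * x ^ a = x ^ (2 * a)" for a by (simp add: mult_2 power_add)
    show ?thesis unfolding zpoly_at_altdef[OF dG] sum_pairs
      by (intro sum.cong refl) (simp only: xx, simp add: algebra_simps)
  qed
  \<comment> \<open>Away from the roots of r the inner block is invertible and
    \<open>det_block_pencil\<close> applies; \<open>all\<close> below removes the
    restriction.\<close>
  have main: "det (x \<cdot>\<^sub>m map_mat complex_of_int A - map_mat of_int B + mat n n (\<lambda>(i, j). cc * (of_int (v $ i) * of_int (v $ j))))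
      = (- 1) ^ (h + k) * (cc * (zpoly_at x ([:1, t:] * s))\<^sup>2 * zpoly_at x r - zpoly_at x F)" (is "?L x = ?R x") if x: "zpoly_at x r \<noteq> 0" for x cc
  proof -
    define Gx where "Gx a b = (x * of_int (GA a b) - of_int (GB a b)) + cc * (of_int (\<nu> a) * of_int (\<nu> b))" for a b
    define Cx where "Cx a j = x * of_int (CA a j) - of_int (CB a j)" for a j
    define Tx where "Tx i j = x * of_int (A0 i j) - of_int (B0 i j)" for i j
    have "x \<cdot>\<^sub>m map_mat complex_of_int A - map_mat of_int B + mat n n (\<lambda>(i, j). cc * (of_int (v $ i) * of_int (v $ j)))
      = bordered_mat k m (shift_entry x) Gx Cx Tx"
    proof (rule eq_matI)
      fix i j assume "i < dim_row (bordered_mat k m (shift_entry x) Gx Cx Tx)" "j < dim_col (bordered_mat k m (shift_entry x) Gx Cx Tx)"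
      then have ij: "i < n" "j < n" by (auto simp: bordered_mat_def nm)
      then have ij': "i < 2*k+1+m" "j < 2*k+1+m" by (auto simp: nm)
      have "(x \<cdot>\<^sub>m map_mat complex_of_int A - map_mat of_int B + mat n n (\<lambda>(i, j). cc * (of_int (v $ i) * of_int (v $ j)))) $$ (i, j)
        = x * of_int (A $$ (i, j)) - of_int (B $$ (i, j)) + cc * (of_int (v $ i) * of_int (v $ j))"
        using ij A B by simp
      also have "\<dots> = bordered_mat k m (shift_entry x) Gx Cx Tx $$ (i, j)"
        unfolding v[OF ij(1)] v[OF ij(2)] using ij'
        by (simp add: A_def B_def bordered_mat_def Gx_def Cx_def Tx_def NA_def NB_def shift_entry_def)
      finally show "(x \<cdot>\<^sub>m map_mat complex_of_int A - map_mat of_int B + mat n n (\<lambda>(i, j). cc * (of_int (v $ i) * of_int (v $ j)))) $$ (i, j)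
        = bordered_mat k m (shift_entry x) Gx Cx Tx $$ (i, j)" .
    qed (auto simp: bordered_mat_def nm)
    then have L: "?L x = det (bordered_mat k m (shift_entry x) Gx Cx Tx)" by simp
    define Xs where "Xs = mat m m (\<lambda>(i, j). \<Sum>l<m. of_int (Xm l i j) * x ^ l)"
    have Xs: "Xs \<in> carrier_mat m m" by (simp add: Xs_def)
    have T0: "mat m m (\<lambda>(i, j). Tx i j) \<in> carrier_mat m m" by simp
    have TXs: "mat m m (\<lambda>(i, j). Tx i j) * Xs = zpoly_at x r \<cdot>\<^sub>m 1\<^sub>m m"
    proof (rule eq_matI)
      fix i j assume "i < dim_row (zpoly_at x r \<cdot>\<^sub>m 1\<^sub>m m)" "j < dim_col (zpoly_at x r \<cdot>\<^sub>m 1\<^sub>m m)"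
      then have ij: "i < m" "j < m" by auto
      have "(mat m m (\<lambda>(i, j). Tx i j) * Xs) $$ (i, j)
        = (\<Sum>p<m. (x * of_int (A0 i p) - of_int (B0 i p)) * (\<Sum>l<m. of_int (Xm l p j) * x ^ l))"
        using ij by (simp add: Xs_def Tx_def scalar_prod_def atLeast0LessThan)
      also have "\<dots> = (if i = j then poly U x else 0)" using TX ij by blast
      finally show "(mat m m (\<lambda>(i, j). Tx i j) * Xs) $$ (i, j) = (zpoly_at x r \<cdot>\<^sub>m 1\<^sub>m m) $$ (i, j)" using ij eU by simp
    qed (auto simp: Xs_def)
    have q1: "(\<Sum>a\<le>k. \<Sum>b\<le>k. x ^ a * x ^ b * Gx a b) = zpoly_at x G + cc * (zpoly_at x ([:1, t:] * s))\<^sup>2"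
    proof -
      have "(\<Sum>a\<le>k. \<Sum>b\<le>k. x ^ a * x ^ b * Gx a b)
        = (\<Sum>a\<le>k. \<Sum>b\<le>k. x ^ a * x ^ b * (x * of_int (GA a b) - of_int (GB a b)))
        + (\<Sum>a\<le>k. \<Sum>b\<le>k. cc * ((x ^ a * of_int (\<nu> a)) * (x ^ b * of_int (\<nu> b))))"
        unfolding sum.distrib[symmetric] Gx_def by (intro sum.cong refl) (simp add: algebra_simps)
      also have "(\<Sum>a\<le>k. \<Sum>b\<le>k. x ^ a * x ^ b * (x * of_int (GA a b) - of_int (GB a b))) = zpoly_at x G"
      proof -
        have "(\<Sum>b\<le>k. x ^ a * x ^ b * (x * of_int (GA a b) - of_int (GB a b)))
          = x ^ a * x ^ a * (x * of_int (coeff G (2*a+1)) + of_int (coeff G (2*a)))" if "a \<le> k" for a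
        proof -
          have "(\<Sum>b\<le>k. x ^ a * x ^ b * (x * of_int (GA a b) - of_int (GB a b)))
            = (\<Sum>b\<in>{a}. x ^ a * x ^ b * (x * of_int (GA a b) - of_int (GB a b)))"
            using that by (intro sum.mono_neutral_right) (auto simp: GA_def GB_def)
          then show ?thesis by (simp add: GA_def GB_def)
        qed
        then show ?thesis unfolding eG by (intro sum.cong) auto
      qed
      also have "(\<Sum>a\<le>k. \<Sum>b\<le>k. cc * ((x ^ a * of_int (\<nu> a)) * (x ^ b * of_int (\<nu> b)))) = cc * (zpoly_at x ([:1, t:] * s))\<^sup>2"
        unfolding e\<nu>[symmetric] power2_eq_square sum_product by (simp add: sum_distrib_left)
      finally show ?thesis .
    qed
    have q2: "(\<Sum>a\<le>k. x ^ a * Cx a i) = (\<Sum>p\<le>Suc k. of_int (c p i) * x ^ p)" for i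
    proof -
      have "(\<Sum>a\<le>k. x ^ a * Cx a i) = (\<Sum>a\<le>k. of_int (c (Suc a) i) * x ^ Suc a + (if a = 0 then of_int (c 0 i) else 0))"
        by (intro sum.cong refl) (simp add: Cx_def CA_def CB_def algebra_simps)
      also have "\<dots> = (\<Sum>a\<le>k. of_int (c (Suc a) i) * x ^ Suc a) + of_int (c 0 i)"
        by (simp add: sum.distrib)
      also have "\<dots> = (\<Sum>p\<le>Suc k. of_int (c p i) * x ^ p)"
        by (subst sum.atMost_Suc_shift) simp
      finally show ?thesis .
    qed
    have q3: "(\<Sum>i<m. \<Sum>j<m. (\<Sum>a\<le>k. x ^ a * Cx a i) * Xs $$ (i, j) * (\<Sum>b\<le>k. x ^ b * Cx b j)) = zpoly_at x Hp"
      unfolding q2 eH by (intro sum.cong refl) (simp add: Xs_def)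
    have dT: "det (mat m m (\<lambda>(i, j). Tx i j)) = (- 1) ^ h * zpoly_at x r" unfolding Tx_def by (rule detT0)
    have "?L x = (- 1) ^ k * ((- 1) ^ h * zpoly_at x r) * (zpoly_at x G + cc * (zpoly_at x ([:1, t:] * s))\<^sup>2 - zpoly_at x Hp / zpoly_at x r)"
      unfolding L bordered_mat_four_block det_block_pencil[OF T0 Xs x TXs] q1 q3 dT ..
    also have "\<dots> = (- 1) ^ (h + k) * (zpoly_at x r * zpoly_at x G + cc * (zpoly_at x ([:1, t:] * s))\<^sup>2 * zpoly_at x r - zpoly_at x Hp)"
      using x by (simp add: power_add algebra_simps)
    also have "zpoly_at x r * zpoly_at x G = zpoly_at x Hp - zpoly_at x F" by (simp only: zpoly_at_mult[symmetric] G[symmetric] zpoly_at_diff)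
    finally show ?thesis by (simp add: algebra_simps)
  qed
  have all: "det (x \<cdot>\<^sub>m map_mat complex_of_int A - map_mat of_int B + mat n n (\<lambda>(i, j). cc * (of_int (v $ i) * of_int (v $ j))))
      = (- 1) ^ (h + k) * (cc * (zpoly_at x ([:1, t:] * s))\<^sup>2 * zpoly_at x r - zpoly_at x F)" for x cc
  proof -
    let ?P = "map_mat complex_of_int A"
    let ?Q = "map_mat complex_of_int B - mat n n (\<lambda>(i, j). cc * (of_int (v $ i) * of_int (v $ j)))"
    have PQ: "x \<cdot>\<^sub>m ?P - map_mat of_int B + mat n n (\<lambda>(i, j). cc * (of_int (v $ i) * of_int (v $ j))) = x \<cdot>\<^sub>m ?P - ?Q" for x
      using A B by (intro eq_matI) auto
    define wp where "wp = smult ((- 1) ^ (h + k)) (smult cc ((map_poly complex_of_int ([:1, t:] * s))\<^sup>2 * map_poly of_int r) - map_poly of_int F)"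
    have wp: "poly wp x = (- 1) ^ (h + k) * (cc * (zpoly_at x ([:1, t:] * s))\<^sup>2 * zpoly_at x r - zpoly_at x F)" for x
      by (simp add: wp_def zpoly_at_def mult.assoc del: mult_pCons_left)
    show ?thesis unfolding PQ wp[symmetric]
    proof (rule det_eq_poly_of_cofinite)
      show "finite {x. poly U x = 0}" by (rule poly_roots_finite[OF U0])
      fix x assume "x \<notin> {x. poly U x = 0}"
      then have "zpoly_at x r \<noteq> 0" by (simp add: eU)
      from main[OF this, of cc] show "det (x \<cdot>\<^sub>m ?P - ?Q) = poly wp x" unfolding PQ wp .
    qed (use A B in auto)
  qed
  show ?thesis
    by (intro exI[of _ A] exI[of _ B] exI[of _ w] conjI A B At Bt w wp allI) (rule all[unfolded v_def])
qed

section \<open>Galois conjugation\<close>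

definition qpoly_at :: "qbar \<Rightarrow> rat poly \<Rightarrow> qbar" where
  "qpoly_at x p = poly (map_poly to_ac p) x"

lemma qpoly_at_0 [simp]: "qpoly_at x 0 = 0" by (simp add: qpoly_at_def)

lemma qpoly_at_pCons: "qpoly_at x (pCons a p) = to_ac a + x * qpoly_at x p"
  by (cases "a = 0 \<and> p = 0") (simp_all add: qpoly_at_def map_poly_pCons)

lemma qpoly_at_add: "qpoly_at x (p + q) = qpoly_at x p + qpoly_at x q"
proof -
  have "map_poly to_ac (p + q) = map_poly to_ac p + map_poly to_ac q"
    by (rule poly_eqI) (simp add: coeff_map_poly)
  then show ?thesis by (simp add: qpoly_at_def)
qed

lemma qpoly_at_smult: "qpoly_at x (smult c q) = to_ac c * qpoly_at x q"
proof -
  have "map_poly to_ac (smult c q) = smult (to_ac c) (map_poly to_ac q)"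
    by (rule poly_eqI) (simp add: coeff_map_poly)
  then show ?thesis by (simp add: qpoly_at_def)
qed

lemma qpoly_at_mult: "qpoly_at x (p * q) = qpoly_at x p * qpoly_at x q"
  by (induction p) (simp_all add: qpoly_at_add qpoly_at_smult qpoly_at_pCons algebra_simps)

lemma qpoly_at_1 [simp]: "qpoly_at x 1 = 1" unfolding one_pCons qpoly_at_pCons by simp

lemma qpoly_at_uminus: "qpoly_at x (- p) = - qpoly_at x p" using qpoly_at_smult[of x "-1" p] by simp

lemma qpoly_at_diff: "qpoly_at x (p - q) = qpoly_at x p - qpoly_at x q"
  using qpoly_at_add[of x "p - q" q] by simp

text \<open>Powers of x can be divided out of an annihilating polynomial of a nonzero element. A
  nonzero constant term is what expresses the inverse of a as a polynomial in a.\<close>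

lemma algebraic_const: assumes "(a::qbar) \<noteq> 0"
  obtains p where "coeff p 0 \<noteq> 0" "qpoly_at a p = 0"
proof -
  obtain q :: "rat poly" where "q \<noteq> 0" "qpoly_at a q = 0" using alg_closure_algebraic[of a] by (auto simp: qpoly_at_def)
  then have "\<exists>p. coeff p 0 \<noteq> 0 \<and> qpoly_at a p = 0"
  proof (induction q)
    case 0 then show ?case by simp
  next
    case (pCons c q)
    then show ?case
    proof (cases "c = 0")
      case True
      then have "q \<noteq> 0" "qpoly_at a q = 0" using pCons.prems assms by (auto simp: qpoly_at_pCons)
      then show ?thesis using pCons.IH by blast
    next
      case False
      then show ?thesis using pCons.prems by (intro exI[of _ "pCons c q"]) simp
    qed
  qed
  then show ?thesis using that by blast
qed

text \<open>
  Such a set is the graph of an isomorphism between two subfields; by Zorn's lemma it extends to an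
  automorphism.
\<close>

definition partial_iso :: "(qbar \<times> qbar) set \<Rightarrow> bool" where
  "partial_iso G \<longleftrightarrow> (\<forall>c. (to_ac c, to_ac c) \<in> G) \<and>
     (\<forall>a b c d. (a, b) \<in> G \<longrightarrow> (c, d) \<in> G \<longrightarrow> (a - c, b - d) \<in> G \<and> (a * c, b * d) \<in> G) \<and>
     (\<forall>b. (0, b) \<in> G \<longrightarrow> b = 0)"

lemma partial_iso_const: "partial_iso G \<Longrightarrow> (to_ac k, to_ac k) \<in> G"
  and partial_iso_diff: "partial_iso G \<Longrightarrow> (a, b) \<in> G \<Longrightarrow> (c, d) \<in> G \<Longrightarrow> (a - c, b - d) \<in> G"
  and partial_iso_mult: "partial_iso G \<Longrightarrow> (a, b) \<in> G \<Longrightarrow> (c, d) \<in> G \<Longrightarrow> (a * c, b * d) \<in> G"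
  and partial_iso_zero_fst: "partial_iso G \<Longrightarrow> (0, b) \<in> G \<Longrightarrow> b = 0"
  by (auto simp: partial_iso_def)

lemma partial_iso_0: "partial_iso G \<Longrightarrow> (0, 0) \<in> G" and partial_iso_1: "partial_iso G \<Longrightarrow> (1, 1) \<in> G"
  using partial_iso_const[of G 0] partial_iso_const[of G 1] by auto

lemma partial_iso_add: "partial_iso G \<Longrightarrow> (a, b) \<in> G \<Longrightarrow> (c, d) \<in> G \<Longrightarrow> (a + c, b + d) \<in> G"
  using partial_iso_diff[of G a b "0 - c" "0 - d"] partial_iso_diff[of G 0 0 c d] partial_iso_0[of G] by simp

lemma partial_iso_sum: "partial_iso G \<Longrightarrow> (\<And>i. i \<in> I \<Longrightarrow> (f i, g i) \<in> G) \<Longrightarrow> (sum f I, sum g I) \<in> G"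
  by (induction I rule: infinite_finite_induct) (auto intro: partial_iso_add partial_iso_0)

lemma partial_iso_functional: "partial_iso G \<Longrightarrow> (a, b) \<in> G \<Longrightarrow> (a, b') \<in> G \<Longrightarrow> b = b'"
  using partial_iso_diff[of G a b a b'] partial_iso_zero_fst[of G "b - b'"] by simp

lemma partial_iso_qpoly_at: "partial_iso G \<Longrightarrow> (a, b) \<in> G \<Longrightarrow> (qpoly_at a p, qpoly_at b p) \<in> G"
  by (induction p) (auto simp: qpoly_at_pCons intro: partial_iso_0 partial_iso_add partial_iso_mult partial_iso_const)

text \<open>Closure under inverses follows from algebraicity: 1 / a is a rational polynomial w(a).
  The pair (a w(a) - 1, b w(b) - 1) lies in G with first entry 0, so b w(b) = 1 too.\<close>

lemma partial_iso_inverse: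
  assumes G: "partial_iso G" and ab: "(a, b) \<in> G" and a0: "a \<noteq> 0"
  shows "(inverse a, inverse b) \<in> G" "b \<noteq> 0"
proof -
  obtain p where p: "coeff p 0 \<noteq> 0" "qpoly_at a p = 0" using algebraic_const[OF a0] by blast
  obtain c q where pq: "p = pCons c q" by (cases p)
  define w where "w = smult (- inverse c) q"
  have c0: "c \<noteq> 0" using p pq by simp
  have ca: "to_ac c + a * qpoly_at a q = 0" using p(2) pq by (simp add: qpoly_at_pCons)
  then have ca': "a * qpoly_at a q = - to_ac c" by (simp add: eq_neg_iff_add_eq_0 add.commute)
  have w1: "a * qpoly_at a w = 1"
  proof -
    have "a * qpoly_at a w = - (inverse (to_ac c) * (a * qpoly_at a q))" by (simp add: w_def qpoly_at_smult qpoly_at_uminus)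
    then show ?thesis using c0 unfolding ca' by simp
  qed
  have ww: "(qpoly_at a w, qpoly_at b w) \<in> G" by (rule partial_iso_qpoly_at[OF G ab])
  have "(a * qpoly_at a w - 1, b * qpoly_at b w - 1) \<in> G"
    by (intro partial_iso_diff[OF G] partial_iso_mult[OF G] ab ww partial_iso_1[OF G])
  then have w2: "b * qpoly_at b w = 1" using w1 partial_iso_zero_fst[OF G] by force
  then show b0: "b \<noteq> 0" by auto
  have "inverse a = qpoly_at a w" "inverse b = qpoly_at b w"
    using w1 w2 by (auto intro: inverse_unique)
  then show "(inverse a, inverse b) \<in> G" using ww by simp
qed

lemma partial_iso_zero_iff: "partial_iso G \<Longrightarrow> (a, b) \<in> G \<Longrightarrow> a = 0 \<longleftrightarrow> b = 0"
  using partial_iso_inverse(2)[of G a b] partial_iso_zero_fst[of G b] by auto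

definition paired_polys :: "(qbar \<times> qbar) set \<Rightarrow> (qbar poly \<times> qbar poly) set" where
  "paired_polys G = {(p, q). \<forall>i. (coeff p i, coeff q i) \<in> G}"

lemma paired_polys_diff: "partial_iso G \<Longrightarrow> (p, q) \<in> paired_polys G \<Longrightarrow> (p', q') \<in> paired_polys G \<Longrightarrow> (p - p', q - q') \<in> paired_polys G"
  by (auto simp: paired_polys_def intro: partial_iso_diff)

lemma paired_polys_mult: "partial_iso G \<Longrightarrow> (p, q) \<in> paired_polys G \<Longrightarrow> (p', q') \<in> paired_polys G \<Longrightarrow> (p * p', q * q') \<in> paired_polys G"
  by (auto simp: paired_polys_def coeff_mult intro!: partial_iso_sum partial_iso_mult)

lemma paired_polys_monom: "partial_iso G \<Longrightarrow> (c, d) \<in> G \<Longrightarrow> (monom c n, monom d n) \<in> paired_polys G"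
  by (auto simp: paired_polys_def intro: partial_iso_0)

lemma paired_polys_degree: assumes "partial_iso G" "(p, q) \<in> paired_polys G" shows "degree p = degree q" "p = 0 \<longleftrightarrow> q = 0"
proof -
  have z: "coeff p i = 0 \<longleftrightarrow> coeff q i = 0" for i
    using partial_iso_zero_iff[OF assms(1)] assms(2) by (auto simp: paired_polys_def)
  show "degree p = degree q" unfolding degree_def by (simp add: z)
  show "p = 0 \<longleftrightarrow> q = 0" by (simp add: poly_eq_iff z)
qed

text \<open>Division by p and by q, carried out in parallel on u and v. Minimality of p prevents the
  left remainder, which vanishes at a, from being nonzero of degree below deg p.\<close>

lemma minimal_divides:
  assumes G: "partial_iso G" and pq: "(p, q) \<in> paired_polys G" "p \<noteq> 0" "poly p a = 0"
    and mini: "\<forall>y\<in>paired_polys G. fst y \<noteq> 0 \<longrightarrow> poly (fst y) a = 0 \<longrightarrow> degree p \<le> degree (fst y)"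
  shows "(u, v) \<in> paired_polys G \<Longrightarrow> poly u a = 0 \<Longrightarrow> q dvd v"
proof (induction "degree u" arbitrary: u v rule: less_induct)
  case less
  show ?case
  proof (cases "u = 0")
    case True
    then show ?thesis using paired_polys_degree(2)[OF G less.prems(1)] by simp
  next
    case False
    have d: "degree p \<le> degree u" using mini less.prems False by (auto dest: bspec)
    define c where "c = lead_coeff u * inverse (lead_coeff p)"
    define c' where "c' = lead_coeff v * inverse (lead_coeff q)"
    have du: "degree u = degree v" "degree p = degree q" using paired_polys_degree[OF G] less.prems(1) pq(1) by auto
    have "(lead_coeff u, lead_coeff v) \<in> G" "(lead_coeff p, lead_coeff q) \<in> G"
      using less.prems(1) pq(1) by (simp_all add: paired_polys_def du)
    then have cc: "(c, c') \<in> G" unfolding c_def c'_def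
      using pq(2) by (intro partial_iso_mult[OF G] partial_iso_inverse(1)[OF G]) auto
    define e where "e = degree u - degree p"
    define u' where "u' = u - monom c e * p"
    define v' where "v' = v - monom c' e * q"
    have uv': "(u', v') \<in> paired_polys G" unfolding u'_def v'_def
      by (intro paired_polys_diff[OF G] less.prems paired_polys_mult[OF G] paired_polys_monom[OF G] cc pq)
    have pu': "poly u' a = 0" using less.prems(2) pq(3) by (simp add: u'_def)
    have "coeff u' (degree u) = 0"
      using d pq(2) by (simp add: u'_def coeff_monom_mult c_def e_def)
    moreover have "degree u' \<le> degree u"
      unfolding u'_def using d degree_mult_le[of "monom c e" p] degree_monom_le[of c e]
      by (intro degree_diff_le) (auto simp: e_def)
    ultimately have "degree u' < degree u \<or> u' = 0"
      by (metis le_neq_implies_less leading_coeff_0_iff)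
    then have "q dvd v'"
    proof
      assume "degree u' < degree u"
      then show ?thesis using less.hyps uv' pu' by blast
    next
      assume "u' = 0"
      then show ?thesis using paired_polys_degree(2)[OF G uv'] by simp
    qed
    then have "q dvd v' + monom c' e * q" by simp
    then show ?thesis by (simp add: v'_def)
  qed
qed

definition adjoin :: "(qbar \<times> qbar) set \<Rightarrow> qbar \<Rightarrow> qbar \<Rightarrow> (qbar \<times> qbar) set" where
  "adjoin G a b = {(poly u a, poly v b) | u v. (u, v) \<in> paired_polys G}"

text \<open>The map sending u(a) to v(b) is well defined: if u(a) = 0, then q divides v by
  \<open>minimal_divides\<close>, and q(b) = 0.\<close>

lemma adjoin_partial_iso:
  assumes G: "partial_iso G" and pq: "(p, q) \<in> paired_polys G" "p \<noteq> 0" "poly p a = 0"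
    and mini: "\<forall>y\<in>paired_polys G. fst y \<noteq> 0 \<longrightarrow> poly (fst y) a = 0 \<longrightarrow> degree p \<le> degree (fst y)"
    and b: "poly q b = 0"
  shows "partial_iso (adjoin G a b)" "G \<subseteq> adjoin G a b" "(a, b) \<in> adjoin G a b"
proof -
  show sub: "G \<subseteq> adjoin G a b"
  proof
    fix x assume "x \<in> G"
    then obtain c d where x: "x = (c, d)" "(c, d) \<in> G" by (cases x) auto
    have "x = (poly (monom c 0) a, poly (monom d 0) b)" by (simp add: x poly_monom)
    then show "x \<in> adjoin G a b" unfolding adjoin_def using paired_polys_monom[OF G x(2)] by blast
  qed
  have "(a, b) = (poly (monom 1 1) a, poly (monom 1 1) b)" by (simp add: poly_monom)
  then show "(a, b) \<in> adjoin G a b" unfolding adjoin_def using paired_polys_monom[OF G partial_iso_1[OF G]] by blast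
  show "partial_iso (adjoin G a b)"
    unfolding partial_iso_def
  proof (intro conjI allI impI)
    show "(to_ac c, to_ac c) \<in> adjoin G a b" for c using sub partial_iso_const[OF G] by auto
  next
    fix x y z w assume "(x, y) \<in> adjoin G a b" "(z, w) \<in> adjoin G a b"
    then obtain u v u' v' where uv: "(u, v) \<in> paired_polys G" "(u', v') \<in> paired_polys G" "x = poly u a" "y = poly v b" "z = poly u' a" "w = poly v' b"
      by (auto simp: adjoin_def)
    have "(x - z, y - w) = (poly (u - u') a, poly (v - v') b)" "(x * z, y * w) = (poly (u * u') a, poly (v * v') b)"
      by (simp_all add: uv)
    then show "(x - z, y - w) \<in> adjoin G a b" "(x * z, y * w) \<in> adjoin G a b"
      unfolding adjoin_def using paired_polys_diff[OF G uv(1,2)] paired_polys_mult[OF G uv(1,2)] by blast+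
  next
    fix y assume "(0, y) \<in> adjoin G a b"
    then obtain u v where uv: "(u, v) \<in> paired_polys G" "poly u a = 0" "y = poly v b" by (auto simp: adjoin_def)
    have "q dvd v" by (rule minimal_divides[OF G pq mini uv(1,2)])
    then show "y = 0" using b uv(3) by (auto simp: dvd_def)
  qed
qed

lemma minimal_pair:
  assumes G: "partial_iso G"
  obtains p q where "(p, q) \<in> paired_polys G" "p \<noteq> 0" "poly p a = 0"
    "\<forall>y\<in>paired_polys G. fst y \<noteq> 0 \<longrightarrow> poly (fst y) a = 0 \<longrightarrow> degree p \<le> degree (fst y)"
proof -
  obtain r :: "rat poly" where r: "r \<noteq> 0" "poly (map_poly to_ac r) a = 0" using alg_closure_algebraic[of a] by blast
  let ?S = "\<lambda>x. x \<in> paired_polys G \<and> fst x \<noteq> 0 \<and> poly (fst x) a = 0"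
  have "(map_poly to_ac r, map_poly to_ac r) \<in> paired_polys G"
    by (auto simp: paired_polys_def coeff_map_poly intro: partial_iso_const[OF G])
  moreover have "map_poly to_ac r \<noteq> 0" using r(1) by (auto simp: poly_eq_iff coeff_map_poly)
  ultimately have ex: "?S (map_poly to_ac r, map_poly to_ac r)" using r(2) by simp
  obtain x where x: "?S x" "\<forall>y. ?S y \<longrightarrow> degree (fst x) \<le> degree (fst y)"
    using ex_has_least_nat[of ?S, OF ex, of "\<lambda>x. degree (fst x)"] by blast
  show ?thesis
    by (rule that[of "fst x" "snd x"]) (use x in auto)
qed

lemma root_degree_pos: "p \<noteq> 0 \<Longrightarrow> poly p a = 0 \<Longrightarrow> degree p > 0"
  by (rule ccontr) (auto elim!: degree_eq_zeroE)

text \<open>If an element a is missing from a maximal relation, its minimal polynomial there has a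
  partner of positive degree, and any root of the partner can serve as the image of a.\<close>

lemma partial_iso_total:
  assumes "partial_iso G0"
  obtains G where "partial_iso G" "G0 \<subseteq> G" "\<And>a. \<exists>b. (a, b) \<in> G"
proof -
  let ?A = "{G. partial_iso G \<and> G0 \<subseteq> G}"
  have "\<exists>M\<in>?A. \<forall>X1\<in>?A. M \<subseteq> X1 \<longrightarrow> X1 = M"
  proof (rule subset_Zorn_nonempty)
    show "?A \<noteq> {}" using assms by blast
    fix C assume C: "C \<noteq> {}" "subset.chain ?A C"
    have pr: "partial_iso X1" "G0 \<subseteq> X1" if "X1 \<in> C" for X1
      using C(2) that by (auto simp: subset.chain_def)
    have join: "\<exists>X1\<in>C. x \<in> X1 \<and> y \<in> X1" if xy: "x \<in> \<Union>C" "y \<in> \<Union>C" for x y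
    proof -
      obtain X1 X2 where X12: "X1 \<in> C" "x \<in> X1" "X2 \<in> C" "y \<in> X2" using xy by blast
      have "X1 \<subseteq> X2 \<or> X2 \<subseteq> X1" using C(2) X12 unfolding subset_chain_def by blast
      then show ?thesis using X12 by blast
    qed
    have "partial_iso (\<Union>C)"
      unfolding partial_iso_def
    proof (intro conjI allI impI)
      show "(to_ac c, to_ac c) \<in> \<Union>C" for c using C(1) pr partial_iso_const by blast
    next
      fix a b c d assume "(a, b) \<in> \<Union>C" "(c, d) \<in> \<Union>C"
      then obtain X1 where X1: "X1 \<in> C" "(a, b) \<in> X1" "(c, d) \<in> X1" using join by blast
      show "(a - c, b - d) \<in> \<Union>C" using X1 partial_iso_diff[OF pr(1)[OF X1(1)] X1(2,3)] by blast
      show "(a * c, b * d) \<in> \<Union>C" using X1 partial_iso_mult[OF pr(1)[OF X1(1)] X1(2,3)] by blast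
    next
      fix b assume "(0, b) \<in> \<Union>C"
      then show "b = 0" using pr(1) partial_iso_zero_fst by blast
    qed
    then show "\<Union>C \<in> ?A" using C(1) pr(2) by blast
  qed
  then obtain G where G: "partial_iso G" "G0 \<subseteq> G" and max: "\<And>X1. partial_iso X1 \<Longrightarrow> G0 \<subseteq> X1 \<Longrightarrow> G \<subseteq> X1 \<Longrightarrow> X1 = G" by auto
  have "\<exists>b. (a, b) \<in> G" for a
  proof -
    obtain p q where pq: "(p, q) \<in> paired_polys G" "p \<noteq> 0" "poly p a = 0"
      and mini: "\<forall>y\<in>paired_polys G. fst y \<noteq> 0 \<longrightarrow> poly (fst y) a = 0 \<longrightarrow> degree p \<le> degree (fst y)"
      using minimal_pair[OF G(1), of a] by metis
    have "degree q > 0" using root_degree_pos[OF pq(2,3)] paired_polys_degree(1)[OF G(1) pq(1)] by simp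
    then obtain b where b: "poly q b = 0" using alg_closed_imp_poly_has_root by blast
    note ad = adjoin_partial_iso[OF G(1) pq mini b]
    have "adjoin G a b = G" using ad G(2) by (intro max) auto
    then show ?thesis using ad(3) by auto
  qed
  then show ?thesis using that G by blast
qed

lemma galois_extend:
  assumes "partial_iso G0"
  obtains \<sigma> where "\<sigma> \<in> galois_group" "\<And>a b. (a, b) \<in> G0 \<Longrightarrow> \<sigma> a = b"
proof -
  obtain G where G: "partial_iso G" "G0 \<subseteq> G" "\<And>a. \<exists>b. (a, b) \<in> G" using partial_iso_total[OF assms] by metis
  define \<sigma> where "\<sigma> a = (SOME b. (a, b) \<in> G)" for a
  have s: "(a, \<sigma> a) \<in> G" for a unfolding \<sigma>_def using someI_ex[OF G(3)] .
  have u: "\<sigma> a = b" if "(a, b) \<in> G" for a b using partial_iso_functional[OF G(1) s that] .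
  have add: "\<sigma> (a + b) = \<sigma> a + \<sigma> b" for a b by (rule u[OF partial_iso_add[OF G(1) s s]])
  have mult: "\<sigma> (a * b) = \<sigma> a * \<sigma> b" for a b by (rule u[OF partial_iso_mult[OF G(1) s s]])
  have evs: "\<sigma> (qpoly_at a p) = qpoly_at (\<sigma> a) p" for a p by (rule u[OF partial_iso_qpoly_at[OF G(1) s]])
  have inj: "inj \<sigma>"
  proof (rule injI)
    fix a b assume "\<sigma> a = \<sigma> b"
    then have "(a - b, 0) \<in> G" using partial_iso_diff[OF G(1) s[of a] s[of b]] by simp
    then show "a = b" using partial_iso_zero_iff[OF G(1)] by force
  qed
  \<comment> \<open>The finite root set of a rational polynomial killing y is mapped injectively
    into itself, hence onto itself.\<close>
  have "\<exists>a. \<sigma> a = y" for y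
  proof -
    obtain p :: "rat poly" where p: "p \<noteq> 0" "qpoly_at y p = 0" using alg_closure_algebraic[of y] by (auto simp: qpoly_at_def)
    let ?R = "{x. qpoly_at x p = 0}"
    have "map_poly to_ac p \<noteq> 0" using p(1) by (auto simp: poly_eq_iff coeff_map_poly)
    then have fin: "finite ?R" unfolding qpoly_at_def by (rule poly_roots_finite)
    have "\<sigma> 0 = 0" by (rule u[OF partial_iso_0[OF G(1)]])
    then have "\<sigma> ` ?R \<subseteq> ?R" using evs[of _ p] by (auto simp flip: evs)
    then have "\<sigma> ` ?R = ?R" using fin inj by (intro endo_inj_surj) (auto intro: inj_on_subset)
    then have "y \<in> \<sigma> ` ?R" using p(2) by simp
    then show ?thesis by blast
  qed
  then have "bij \<sigma>" using inj by (metis bijI surjI)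
  then have "\<sigma> \<in> galois_group" using add mult by (simp add: galois_group_def)
  then show ?thesis using that u G(2) by blast
qed

text \<open>If z lies outside Q(x0), its minimal polynomial over that field has a second root b by
  separability. Sending z to b while fixing Q(x0) extends to an automorphism that moves z.\<close>

lemma galois_fixed:
  assumes fixed: "\<And>\<sigma>. \<sigma> \<in> galois_group \<Longrightarrow> \<sigma> x0 = x0 \<Longrightarrow> \<sigma> z = z"
  shows "\<exists>p. z = qpoly_at x0 p"
proof (rule ccontr)
  assume nz: "\<not> ?thesis"
  define G where "G = {(qpoly_at x0 p, qpoly_at x0 p) | p. True}"
  have mem: "(a, b) \<in> G \<longleftrightarrow> a = b \<and> (\<exists>p. a = qpoly_at x0 p)" for a b by (auto simp: G_def)
  have G: "partial_iso G"
    unfolding partial_iso_def mem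
  proof (intro conjI allI impI)
    show "\<exists>p. to_ac c = qpoly_at x0 p" for c by (rule exI[of _ "[:c:]"]) (simp add: qpoly_at_pCons)
    show "\<exists>p. a - c = qpoly_at x0 p" if "a = b \<and> (\<exists>p. a = qpoly_at x0 p)" "c = d \<and> (\<exists>p. c = qpoly_at x0 p)" for a b c d
      using that by (metis qpoly_at_diff)
    show "\<exists>p. a * c = qpoly_at x0 p" if "a = b \<and> (\<exists>p. a = qpoly_at x0 p)" "c = d \<and> (\<exists>p. c = qpoly_at x0 p)" for a b c d
      using that by (metis qpoly_at_mult)
  qed auto
  obtain p q where pq: "(p, q) \<in> paired_polys G" "p \<noteq> 0" "poly p z = 0"
    and mini: "\<forall>y\<in>paired_polys G. fst y \<noteq> 0 \<longrightarrow> poly (fst y) z = 0 \<longrightarrow> degree p \<le> degree (fst y)"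
    using minimal_pair[OF G, of z] by metis
  have qp: "q = p" using pq(1) by (auto simp: paired_polys_def mem intro: poly_eqI)
  have cf: "(coeff p i, coeff p i) \<in> G" for i using pq(1) qp by (auto simp: paired_polys_def)
  have "\<exists>b. poly p b = 0 \<and> b \<noteq> z"
  proof (rule ccontr)
    assume only: "\<not> ?thesis"
    obtain p1 where p1: "p = [:- z, 1:] * p1" using pq(3) by (metis poly_eq_0_iff_dvd dvd_def)
    have p10: "p1 \<noteq> 0" using p1 pq(2) by (metis mult_zero_right)
    have "degree ([:- z, 1:] * p1) = Suc (degree p1)" using p10 by (subst degree_mult_eq) auto
    then have dp: "degree p = Suc (degree p1)" using p1 by (metis (no_types))
    show False
    proof (cases "degree p1 = 0")
      case True
      then obtain c where c: "p1 = [:c:]" by (auto elim: degree_eq_zeroE)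
      have c0: "c \<noteq> 0" using p10 c by auto
      have pe: "p = [:- (z * c), c:]" by (rule trans[OF p1]) (simp add: c)
      have "coeff p 0 = - (z * c)" "coeff p 1 = c" by (simp_all add: pe)
      then have "(- (z * c), - (z * c)) \<in> G" "(c, c) \<in> G" using cf[of 0] cf[of 1] by auto
      then have "(0 - (- (z * c)) * inverse c, 0 - (- (z * c)) * inverse c) \<in> G"
        using c0 by (intro partial_iso_diff[OF G] partial_iso_mult[OF G] partial_iso_inverse(1)[OF G] partial_iso_0[OF G])
      then have "(z, z) \<in> G" using c0 by (simp add: mult.assoc)
      then show False using nz by (simp add: mem)
    next
      case False
      then obtain b where b: "poly p1 b = 0" using alg_closed_imp_poly_has_root[of p1] by auto
      then have "poly p b = 0" by (subst p1) (simp only: poly_mult mult_zero_right)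
      then have "b = z" using only by blast
      \<comment> \<open>A sole root would be a multiple one. The derivative, whose coefficients also
        lie in Q(x0), would then vanish at z and contradict the minimality of p.\<close>
      have "poly (pderiv p) z = 0" using b \<open>b = z\<close>
        by (subst p1, simp only: pderiv_mult poly_add poly_mult) (simp add: pderiv_pCons)
      then have dz: "poly (pderiv p) z = 0" .
      have "pderiv p \<noteq> 0" using dp by (simp add: pderiv_eq_0_iff)
      moreover have "(pderiv p, pderiv p) \<in> paired_polys G"
      proof -
        have "(of_nat (Suc i), of_nat (Suc i)) \<in> G" for i
          using partial_iso_const[OF G, of "of_nat (Suc i)"] by (simp only: to_ac_of_nat)
        then show ?thesis unfolding paired_polys_def using cf by (auto simp only: coeff_pderiv mem_Collect_eq prod.case intro: partial_iso_mult[OF G])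
      qed
      ultimately have "degree p \<le> degree (pderiv p)" using mini dz by (auto dest: bspec)
      then show False using dp by (simp add: degree_pderiv)
    qed
  qed
  then obtain b where b: "poly p b = 0" "b \<noteq> z" by blast
  note ad = adjoin_partial_iso[OF G pq mini b(1)[folded qp]]
  obtain \<sigma> where \<sigma>: "\<sigma> \<in> galois_group" "\<And>a c. (a, c) \<in> adjoin G z b \<Longrightarrow> \<sigma> a = c"
    using galois_extend[OF ad(1)] by metis
  have "(x0, x0) \<in> G" unfolding mem by (intro conjI refl exI[of _ "[:0, 1:]"]) (simp add: qpoly_at_pCons)
  then have "\<sigma> x0 = x0" using \<sigma>(2) ad(2) by blast
  then have "\<sigma> z = z" using fixed \<sigma>(1) by blast
  moreover have "\<sigma> z = b" using \<sigma>(2) ad(3) by blast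
  ultimately show False using b(2) by simp
qed

section \<open>Binary forms on an affine line\<close>

definition eval2 :: "'a::comm_ring_1 poly poly \<Rightarrow> 'a \<Rightarrow> 'a \<Rightarrow> 'a" where
  "eval2 P x y = poly (poly P [:y:]) x"

lemma eval2_add [simp]: "eval2 (P + Q) x y = eval2 P x y + eval2 Q x y"
  and eval2_diff [simp]: "eval2 (P - Q) x y = eval2 P x y - eval2 Q x y"
  and eval2_mult [simp]: "eval2 (P * Q) x y = eval2 P x y * eval2 Q x y"
  and eval2_power [simp]: "eval2 (P ^ k) x y = eval2 P x y ^ k"
  and eval2_uminus [simp]: "eval2 (- P) x y = - eval2 P x y"
  and eval2_0 [simp]: "eval2 0 x y = 0"
  and eval2_1 [simp]: "eval2 1 x y = 1"
  and eval2_const2 [simp]: "eval2 (const2 a) x y = a"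
  and eval2_var_x [simp]: "eval2 var_x x y = x"
  and eval2_var_y [simp]: "eval2 var_y x y = y"
  by (simp_all add: eval2_def const2_def var_x_def var_y_def)

lemma eval2_sum [simp]: "eval2 (sum f I) x y = (\<Sum>i\<in>I. eval2 (f i) x y)"
  by (induction I rule: infinite_finite_induct) simp_all

lemma eval2_prod [simp]: "eval2 (prod f I) x y = (\<Prod>i\<in>I. eval2 (f i) x y)"
  by (induction I rule: infinite_finite_induct) simp_all

lemma eval2_bform [simp]: "eval2 (bform d c) x y = bform_eval d c x y"
  by (simp add: bform_def bform_eval_def)

lemma const2_add: "const2 (a + b) = const2 a + const2 b"
  and const2_mult: "const2 (a * b) = const2 a * const2 b"
  and const2_0 [simp]: "const2 0 = 0"
  and const2_uminus: "const2 (- a) = - const2 a"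
  by (simp_all add: const2_def)

lemma const2_1 [simp]: "const2 1 = 1"
  unfolding const2_def one_pCons ..

definition is_form :: "nat \<Rightarrow> 'a::comm_ring_1 poly poly \<Rightarrow> bool" where
  "is_form d P \<longleftrightarrow> (\<exists>c. P = bform d c)"

lemma is_form_bform [simp]: "is_form d (bform d c)" by (auto simp: is_form_def)

lemma bform_add: "bform d (\<lambda>i. c i + e i) = bform d c + bform d e"
  by (simp add: bform_def const2_add algebra_simps sum.distrib)

lemma bform_smult: "bform d (\<lambda>i. a * c i) = const2 a * bform d c"
  by (simp add: bform_def const2_mult sum_distrib_left algebra_simps)

lemma is_form_0 [simp]: "is_form d 0"
  unfolding is_form_def by (rule exI[of _ "\<lambda>_. 0"]) (simp add: bform_def)

lemma is_form_add: "is_form d P \<Longrightarrow> is_form d Q \<Longrightarrow> is_form d (P + Q)"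
  unfolding is_form_def by (metis bform_add)

lemma is_form_const_mult: "is_form d P \<Longrightarrow> is_form d (const2 a * P)"
  unfolding is_form_def by (metis bform_smult)

lemma is_form_diff: "is_form d P \<Longrightarrow> is_form d Q \<Longrightarrow> is_form d (P - Q)"
  using is_form_add[of d P "const2 (- 1) * Q"] is_form_const_mult[of d Q "- 1"]
  by (simp add: const2_uminus)

lemma is_form_sum: "(\<And>i. i \<in> I \<Longrightarrow> is_form d (f i)) \<Longrightarrow> is_form d (sum f I)"
  by (induction I rule: infinite_finite_induct) (auto intro: is_form_add)

lemma is_form_monomial: "is_form (i + j) (const2 a * var_x ^ i * var_y ^ j)"
proof -
  have "bform (i + j) (\<lambda>l. if l = j then a else 0)
    = (\<Sum>l\<le>i + j. if l = j then const2 a * var_x ^ i * var_y ^ j else 0)"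
    unfolding bform_def by (intro sum.cong) auto
  also have "\<dots> = const2 a * var_x ^ i * var_y ^ j" by simp
  finally show ?thesis unfolding is_form_def by metis
qed

lemma is_form_mult: assumes "is_form d P" "is_form e Q" shows "is_form (d + e) (P * Q)"
proof -
  obtain a b where ab: "P = bform d a" "Q = bform e b" using assms by (auto simp: is_form_def)
  have "P * Q = (\<Sum>i\<le>d. \<Sum>j\<le>e. const2 (a i * b j) * var_x ^ ((d - i) + (e - j)) * var_y ^ (i + j))"
    unfolding ab bform_def sum_product by (intro sum.cong refl) (simp only: const2_mult power_add mult_ac)
  moreover have "is_form (d + e) (const2 (a i * b j) * var_x ^ ((d - i) + (e - j)) * var_y ^ (i + j))"
    if "i \<le> d" "j \<le> e" for i j
    using is_form_monomial[of "(d - i) + (e - j)" "i + j" "a i * b j"] that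
    by (simp add: add.commute add.left_commute)
  ultimately show ?thesis by (auto intro!: is_form_sum)
qed

lemma is_form_const: "is_form 0 (const2 a)" using is_form_monomial[of 0 0 a] by simp

lemma is_form_1 [simp]: "is_form 0 1" using is_form_const[of 1] by simp

lemma is_form_prod: "finite I \<Longrightarrow> (\<And>i. i \<in> I \<Longrightarrow> is_form (d i) (f i)) \<Longrightarrow> is_form (\<Sum>i\<in>I. d i) (prod f I)"
  by (induction I rule: finite_induct) (auto intro: is_form_mult)

lemma is_form_power: "is_form d P \<Longrightarrow> is_form (k * d) (P ^ k)"
  by (induction k) (auto intro: is_form_mult)

lemma is_form_linear: "is_form 1 (const2 b * var_x - const2 a * var_y)"
proof -
  have "is_form 1 (const2 b * var_x :: 'a poly poly)" "is_form 1 (const2 a * var_y :: 'a poly poly)"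
    using is_form_monomial[of 1 0 b] is_form_monomial[of 0 1 a] by simp_all
  then show ?thesis by (rule is_form_diff)
qed

lemma form_homogeneous:
  assumes "is_form d P" shows "eval2 P (l * x) (l * y) = l ^ d * eval2 P x y"
proof -
  obtain c where c: "P = bform d c" using assms by (auto simp: is_form_def)
  have "c i * (l * x) ^ (d - i) * (l * y) ^ i = l ^ d * (c i * x ^ (d - i) * y ^ i)" if "i \<le> d" for i
  proof -
    have "l ^ d = l ^ (d - i) * l ^ i" using that by (simp flip: power_add)
    then show ?thesis by (simp add: power_mult_distrib)
  qed
  then show ?thesis by (simp add: c bform_eval_def sum_distrib_left)
qed

lemma bform_coeff_eqI:
  fixes c e :: "nat \<Rightarrow> 'a::{idom,ring_char_0}"
  assumes "finite S" "\<And>x. x \<notin> S \<Longrightarrow> bform_eval d c x 1 = bform_eval d e x 1" and i: "i \<le> d"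
  shows "c i = e i"
proof -
  define p where "p c = (\<Sum>i\<le>d. monom (c i) (d - i))" for c :: "nat \<Rightarrow> 'a"
  have zpoly_at: "poly (p c) x = bform_eval d c x 1" for x c by (simp add: p_def bform_eval_def poly_sum poly_monom)
  have "p c - p e = 0"
  proof (rule ccontr)
    assume "p c - p e \<noteq> 0"
    then have "finite {x. poly (p c - p e) x = 0}" by (rule poly_roots_finite)
    moreover have "- S \<subseteq> {x. poly (p c - p e) x = 0}" using assms(2) by (auto simp: zpoly_at)
    ultimately have "finite (UNIV :: 'a set)" using assms(1) by (metis finite_Un finite_subset Compl_partition)
    then show False by (simp add: infinite_UNIV_char_0)
  qed
  then have "coeff (p c) (d - i) = coeff (p e) (d - i)" by simp
  moreover have "coeff (p c) (d - i) = c i" for c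
  proof -
    have "coeff (p c) (d - i) = (\<Sum>j\<le>d. if j = i then c j else 0)"
      unfolding p_def coeff_sum coeff_monom using i by (intro sum.cong) auto
    then show ?thesis using i by simp
  qed
  ultimately show ?thesis by simp
qed

lemma bform_cong: "(\<And>i. i \<le> d \<Longrightarrow> c i = e i) \<Longrightarrow> bform d c = bform d e"
  unfolding bform_def by (intro sum.cong) auto

lemma form_eqI:
  fixes P Q :: "'a::{idom,ring_char_0} poly poly"
  assumes "is_form d P" "is_form d Q" "finite S" "\<And>x. x \<notin> S \<Longrightarrow> eval2 P x 1 = eval2 Q x 1"
  shows "P = Q"
proof -
  obtain c e where ce: "P = bform d c" "Q = bform d e" using assms(1,2) by (auto simp: is_form_def)
  show ?thesis unfolding ce
    by (rule bform_cong, rule bform_coeff_eqI[OF assms(3)]) (use assms(4) in \<open>auto simp: ce\<close>)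
qed

lemma bform_inject:
  fixes c e :: "nat \<Rightarrow> 'a::{idom,ring_char_0}"
  assumes "bform d c = bform d e" "i \<le> d" shows "c i = e i"
proof (rule bform_coeff_eqI[of "{}"])
  show "bform_eval d c x 1 = bform_eval d e x 1" for x
    using arg_cong[OF assms(1), of "\<lambda>P. eval2 P x 1"] by simp
qed (use assms(2) in auto)

text \<open>The points (x, 1) and (\<xi>, 1 + t \<xi>) with \<xi> = x / (1 - t x) are proportional
  with factor 1 - t x.\<close>

lemma form_at_shifted:
  fixes P :: "'a::field poly poly"
  assumes P: "is_form d P" and tx: "1 - t * x \<noteq> 0"
  shows "eval2 P x 1 = (1 - t * x) ^ d * eval2 P (x / (1 - t * x)) (1 + t * (x / (1 - t * x)))"
proof -
  have "1 + t * (x / (1 - t * x)) = 1 / (1 - t * x)" using tx by (simp add: field_simps)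
  then have "x = (1 - t * x) * (x / (1 - t * x))" "1 = (1 - t * x) * (1 + t * (x / (1 - t * x)))"
    using tx by simp_all
  then show ?thesis using form_homogeneous[OF P] by metis
qed

lemma finite_bad_shift: "finite {x::'a::field. 1 - t * x = 0}"
proof (rule finite_subset)
  have "x = 1 / t" if "1 - t * x = 0" for x
  proof -
    have "t * x = 1" using that by simp
    then show ?thesis by (metis mult_zero_left nonzero_mult_div_cancel_left zero_neq_one)
  qed
  then show "{x. 1 - t * x = 0} \<subseteq> {1 / t}" by blast
qed simp

lemma form_eqI_shifted:
  fixes P Q :: "'a::field_char_0 poly poly"
  assumes P: "is_form d P" and Q: "is_form d Q"
    and eq: "\<And>x. eval2 P x (1 + t * x) = eval2 Q x (1 + t * x)"
  shows "P = Q"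
proof (rule form_eqI[OF P Q finite_bad_shift[of t]])
  fix x assume "x \<notin> {x. 1 - t * x = 0}"
  then have "1 - t * x \<noteq> 0" by simp
  show "eval2 P x 1 = eval2 Q x 1" unfolding form_at_shifted[OF P \<open>1 - t * x \<noteq> 0\<close>] form_at_shifted[OF Q \<open>1 - t * x \<noteq> 0\<close>] eq ..
qed

text \<open>Restriction of the form to the line y = 1 + t x, an affine chart of P^1 that misses only
  [1:t].\<close>

definition dehomogenize :: "'a::comm_ring_1 \<Rightarrow> nat \<Rightarrow> (nat \<Rightarrow> 'a) \<Rightarrow> 'a poly" where
  "dehomogenize t d c = (\<Sum>i\<le>d. smult (c i) ([:0, 1:] ^ (d - i) * [:1, t:] ^ i))"

lemma poly_dehomogenize: "poly (dehomogenize t d c) x = bform_eval d c x (1 + t * x)"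
  by (simp add: dehomogenize_def bform_eval_def poly_sum algebra_simps)

lemma degree_dehomogenize: "degree (dehomogenize t d c) \<le> d"
  unfolding dehomogenize_def
proof (rule degree_sum_le)
  fix i assume "i \<in> {..d}"
  then have i: "i \<le> d" by simp
  have "degree ([:0, 1:] ^ (d - i) * [:1, t:] ^ i) \<le> degree ([:0, 1::'a:] ^ (d - i)) + degree ([:1, t:] ^ i)"
    by (rule degree_mult_le)
  also have "\<dots> \<le> 1 * (d - i) + 1 * i"
    by (intro add_mono order.trans[OF degree_power_le] mult_le_mono1) (auto simp: degree_pCons_eq_if)
  finally have "degree ([:0, 1::'a:] ^ (d - i) * [:1, t:] ^ i) \<le> d" using i by simp
  then show "degree (smult (c i) ([:0, 1:] ^ (d - i) * [:1, t:] ^ i)) \<le> d"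
    by (rule order.trans[OF degree_smult_le])
qed simp

lemma coeff_dehomogenize_top: "coeff (dehomogenize t d c) d = bform_eval d c 1 t"
proof -
  have "coeff ([:0, 1:] ^ (d - i) * [:1, t:] ^ i) d = t ^ i" if "i \<le> d" for i
  proof -
    have "coeff ([:0, 1:] ^ (d - i) * [:1, t:] ^ i) d = coeff (monom 1 (d - i) * [:1, t:] ^ i) d"
      by (simp add: monom_altdef)
    also have "\<dots> = coeff ([:1, t:] ^ i) i" using that by (simp add: coeff_monom_mult)
    also have "\<dots> = t ^ i"
    proof (induction i)
      case (Suc i)
      have "degree ([:1, t:] ^ i) \<le> i"
        using degree_power_le[of "[:1, t:]" i] by (auto simp: degree_pCons_eq_if split: if_splits)
      then show ?case using Suc by (simp add: coeff_eq_0)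
    qed simp
    finally show ?thesis .
  qed
  then show ?thesis unfolding dehomogenize_def coeff_sum bform_eval_def by (intro sum.cong) auto
qed

lemma map_poly_dehomogenize: "map_poly of_int (dehomogenize t d c) = dehomogenize (of_int t :: 'a::{comm_ring_1,ring_char_0}) d (\<lambda>i. of_int (c i))"
  unfolding dehomogenize_def by (simp add: hom_distribs)

text \<open>Inverse to \<open>dehomogenize\<close>: the linear form y - t x equals 1 on the chosen
  line, so its powers fill up the degree.\<close>

definition homogenize :: "'a::comm_ring_1 \<Rightarrow> nat \<Rightarrow> 'a poly \<Rightarrow> 'a poly poly" where
  "homogenize t d p = (\<Sum>i\<le>d. const2 (coeff p i) * (var_x ^ i * (var_y - const2 t * var_x) ^ (d - i)))"

lemma is_form_homogenize: "is_form d (homogenize t d p)"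
  unfolding homogenize_def
proof (intro is_form_sum is_form_const_mult)
  fix i assume "i \<in> {..d}"
  have x: "is_form 1 (var_x :: 'a poly poly)" using is_form_monomial[of 1 0 1] by simp
  have "is_form 1 (var_y - const2 t * var_x)"
    using is_form_diff[OF _ is_form_const_mult[OF x]] is_form_monomial[of 0 1 1] by simp
  from is_form_mult[OF is_form_power[OF x, of i] is_form_power[OF this, of "d - i"]]
  show "is_form d (var_x ^ i * (var_y - const2 t * var_x) ^ (d - i))" using \<open>i \<in> {..d}\<close> by simp
qed

lemma eval2_homogenize:
  assumes "degree p \<le> d" shows "eval2 (homogenize t d p) x (1 + t * x) = poly p x"
proof -
  have "eval2 (homogenize t d p) x (1 + t * x) = (\<Sum>i\<le>d. coeff p i * x ^ i)"
    by (simp add: homogenize_def)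
  also have "\<dots> = poly p x" unfolding poly_altdef
    by (rule sum.mono_neutral_right) (use assms in \<open>auto simp: coeff_eq_0\<close>)
  finally show ?thesis .
qed

lemma dehomogenize_surj:
  fixes p :: "'a::{idom,ring_char_0} poly"
  assumes "degree p \<le> d" shows "\<exists>c. dehomogenize t d c = p"
proof -
  obtain c where c: "homogenize t d p = bform d c" using is_form_homogenize[of d t p] by (auto simp: is_form_def)
  have "poly (dehomogenize t d c) x = poly p x" for x
    using eval2_homogenize[OF assms, of t x] by (simp add: c poly_dehomogenize)
  then show ?thesis by (auto intro!: exI[of _ c] poly_ext)
qed

lemma dehomogenize_inject_field:
  fixes c e :: "nat \<Rightarrow> 'a::field_char_0"
  assumes "dehomogenize t d c = dehomogenize t d e" "i \<le> d" shows "c i = e i"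
proof -
  have "bform d c = bform d e"
    by (rule form_eqI_shifted[of d _ _ t]) (simp_all add: poly_dehomogenize[symmetric] assms)
  then show ?thesis using assms(2) by (rule bform_inject)
qed

lemma dehomogenize_inject_int:
  fixes c e :: "nat \<Rightarrow> int"
  assumes "dehomogenize t d c = dehomogenize t d e" "i \<le> d" shows "c i = e i"
proof -
  have "(of_int (c i) :: rat) = of_int (e i)"
    by (rule dehomogenize_inject_field[OF _ assms(2), of "of_int t"]) (simp flip: map_poly_dehomogenize add: assms(1))
  then show ?thesis by simp
qed

lemma dehomogenize_smult: "dehomogenize t d (\<lambda>i. a * c i) = smult a (dehomogenize t d c)"
  by (simp add: dehomogenize_def smult_sum2 mult.commute)

text \<open>The restriction is a bijection over Z from coefficient vectors onto polynomials of
  degree at most d, so divisibility by an integer passes in both directions.\<close>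

lemma content_dehomogenize: "content (dehomogenize t d c) = Gcd (c ` {..d})" for c :: "nat \<Rightarrow> int"
proof -
  have 1: "a dvd content (dehomogenize t d c)" if "\<forall>i\<le>d. a dvd c i" for a
  proof -
    have "dehomogenize t d c = dehomogenize t d (\<lambda>i. a * (c i div a))" unfolding dehomogenize_def
      by (intro sum.cong refl) (use that in simp)
    then show ?thesis by (simp add: dehomogenize_smult)
  qed
  have 2: "a dvd c i" if "a dvd content (dehomogenize t d c)" "i \<le> d" for a i
  proof -
    have "[:a:] dvd dehomogenize t d c" using that(1) by (simp add: const_poly_dvd_iff_dvd_content)
    then obtain p where p: "dehomogenize t d c = [:a:] * p" by (elim dvdE)
    show ?thesis
    proof (cases "a = 0")
      case True
      then have "dehomogenize t d c = dehomogenize t d (\<lambda>_. 0)" using p by (simp add: dehomogenize_def)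
      then have "c i = 0" using dehomogenize_inject_int[OF _ that(2), of t c "\<lambda>_. 0"] by simp
      then show ?thesis by simp
    next
      case False
      have pa: "dehomogenize t d c = smult a p" using p by simp
      then have "degree p \<le> d" using degree_dehomogenize[of t d c] False by simp
      then obtain e where "dehomogenize t d e = p" using dehomogenize_surj by blast
      then have "dehomogenize t d c = dehomogenize t d (\<lambda>i. a * e i)" by (simp add: dehomogenize_smult pa)
      then have "c i = a * e i" using dehomogenize_inject_int[OF _ that(2)] by blast
      then show ?thesis by simp
    qed
  qed
  show ?thesis
  proof (rule associated_eqI)
    show "content (dehomogenize t d c) dvd Gcd (c ` {..d})" by (rule Gcd_greatest) (use 2 in auto)
    show "Gcd (c ` {..d}) dvd content (dehomogenize t d c)" by (rule 1) (auto intro: Gcd_dvd)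
    show "normalize (content (dehomogenize t d c)) = content (dehomogenize t d c)" by (rule normalize_content)
  qed simp
qed

abbreviation lin_form :: "'a::comm_ring_1 \<Rightarrow> 'a \<Rightarrow> 'a poly poly" where
  "lin_form a b \<equiv> const2 b * var_x - const2 a * var_y"

text \<open>Restricting to the line \<open>y = 1 + t x\<close> loses no zero of a form that does not vanish at \<open>[1:t]\<close>.\<close>

lemma multiplicity_bform:
  fixes u :: "nat \<Rightarrow> qbar"
  assumes ut: "bform_eval m u 1 t \<noteq> 0" and ab: "(a, b) \<noteq> (0, 0)"
  shows "multiplicity (lin_form a b) (bform m u)
    = (if b = t * a then 0 else Polynomial.order (a / (b - t * a)) (dehomogenize t m u))"
proof (cases "b = t * a")
  case True
  then have a: "a \<noteq> 0" using ab by auto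
  have "\<not> lin_form a b ^ Suc 0 dvd bform m u"
  proof
    assume "lin_form a b ^ Suc 0 dvd bform m u"
    then obtain Q where Q: "bform m u = lin_form a b * Q" by (auto simp: dvd_def)
    have "eval2 (bform m u) a b = 0" unfolding Q by simp
    moreover have "eval2 (bform m u) (a * 1) (a * t) = a ^ m * bform_eval m u 1 t"
      unfolding form_homogeneous[OF is_form_bform] by simp
    ultimately show False using a ut by (simp add: True mult.commute)
  qed
  then show ?thesis using True by (intro trans[OF multiplicity_eqI[of _ 0]]) simp_all
next
  case False
  define s where "s = b - t * a"
  define x0 where "x0 = a / s"
  define p where "p = dehomogenize t m u"
  define k where "k = Polynomial.order x0 p"
  have s: "s \<noteq> 0" using False by (simp add: s_def)
  have p0: "p \<noteq> 0" using coeff_dehomogenize_top[of t m u] ut by (auto simp: p_def)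
  obtain q where q: "p = [:- x0, 1:] ^ k * q" "\<not> [:- x0, 1:] dvd q"
    using order_decomp[OF p0, of x0] by (auto simp: k_def)
  have q0: "q \<noteq> 0" using p0 q by auto
  have dq: "degree p = k + degree q" using q0 by (simp add: q(1) degree_mult_eq degree_power_eq)
  have dp: "degree p \<le> m" by (simp add: p_def degree_dehomogenize)
  have km: "k \<le> m" "degree q \<le> m - k" using dq dp by auto
  \<comment> \<open>Moves the representative (a, b) of the point onto the line y = 1 + t x, where x0
    is its coordinate; the scalar s is a unit.\<close>
  have ls: "lin_form a b = const2 s * lin_form x0 (1 + t * x0)"
  proof -
    have "a = s * x0" "b = s * (1 + t * x0)" using s by (simp_all add: x0_def s_def field_simps)
    then show ?thesis by (simp only: const2_mult right_diff_distrib mult.assoc)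
  qed
  have us: "const2 (inverse s) * const2 s = 1" using s by (simp flip: const2_mult)
  have fac: "bform m u = lin_form x0 (1 + t * x0) ^ k * homogenize t (m - k) q"
  proof (rule form_eqI_shifted[of m _ _ t])
    show "is_form m (lin_form x0 (1 + t * x0) ^ k * homogenize t (m - k) q)"
      using is_form_mult[OF is_form_power[OF is_form_linear, of k] is_form_homogenize[of "m - k" t q]] km by simp
    fix x
    have "eval2 (bform m u) x (1 + t * x) = poly p x" by (simp add: p_def poly_dehomogenize)
    also have "\<dots> = (x - x0) ^ k * poly q x" by (simp add: q(1))
    also have "\<dots> = eval2 (lin_form x0 (1 + t * x0) ^ k * homogenize t (m - k) q) x (1 + t * x)"
      unfolding eval2_mult eval2_power eval2_homogenize[OF km(2)] by (simp add: algebra_simps)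
    finally show "eval2 (bform m u) x (1 + t * x) = \<dots>" .
  qed simp
  have "multiplicity (lin_form a b) (bform m u) = k"
  proof (rule multiplicity_eqI)
    have "bform m u = lin_form a b ^ k * (const2 (inverse s) ^ k * homogenize t (m - k) q)"
      unfolding fac ls power_mult_distrib using arg_cong[OF us, of "\<lambda>z. z ^ k"]
      by (simp add: power_mult_distrib algebra_simps)
    then show "lin_form a b ^ k dvd bform m u" by (rule dvdI)
    show "\<not> lin_form a b ^ Suc k dvd bform m u"
    proof
      assume "lin_form a b ^ Suc k dvd bform m u"
      then obtain Q where Q: "bform m u = lin_form a b ^ Suc k * Q" by (auto simp: dvd_def)
      let ?l = "lin_form x0 (1 + t * x0)"
      have l0: "?l \<noteq> 0"
      proof
        assume "?l = 0"
        then have "eval2 ?l 1 0 = 0" "eval2 ?l 0 1 = 0" by simp_all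
        then show False by simp
      qed
      have "?l ^ k * homogenize t (m - k) q = ?l ^ k * (?l * const2 s ^ Suc k * Q)"
        using Q unfolding fac ls by (simp only: power_mult_distrib power_Suc mult_ac)
      then have "homogenize t (m - k) q = ?l * const2 s ^ Suc k * Q" using l0 by simp
      then have "eval2 (homogenize t (m - k) q) x0 (1 + t * x0) = eval2 (?l * const2 s ^ Suc k * Q) x0 (1 + t * x0)" by (rule arg_cong)
      then have "eval2 (homogenize t (m - k) q) x0 (1 + t * x0) = 0" by simp
      then have "poly q x0 = 0" unfolding eval2_homogenize[OF km(2)] .
      then show False using q(2) by (simp add: poly_eq_0_iff_dvd)
    qed
  qed
  then show ?thesis using False by (simp add: k_def p_def x0_def s_def)
qed

section \<open>Square roots modulo a squarefree polynomial\<close>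

lemma rat_poly_primitive:
  assumes "p \<noteq> 0"
  shows "\<exists>c q. c \<noteq> 0 \<and> content q = 1 \<and> p = smult c (map_poly rat_of_int q)"
proof -
  obtain N where N: "N > 0" "\<And>i. of_nat N * of_rat (coeff p i) \<in> (\<int> :: complex set)"
    using rat_common_denominator[of p] by blast
  define Q where "Q = map_poly (\<lambda>x. \<lfloor>of_nat N * x\<rfloor>) p"
  have cQ: "rat_of_int (coeff Q i) = of_nat N * coeff p i" for i
  proof -
    obtain k where "of_nat N * of_rat (coeff p i) = complex_of_int k" using N(2)[of i] by (auto elim: Ints_cases)
    then have "complex_of_rat (of_nat N * coeff p i) = of_rat (of_int k)" by (simp add: of_rat_mult)
    then have "of_nat N * coeff p i = of_int k" by (simp only: of_rat_eq_iff)
    then show ?thesis by (simp add: Q_def coeff_map_poly)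
  qed
  have "Q \<noteq> 0"
  proof
    assume "Q = 0"
    then have "coeff p i = 0" for i using cQ[of i] N(1) by simp
    then show False using assms by (simp add: poly_eq_iff)
  qed
  then have cont: "content Q \<noteq> 0" "content (primitive_part Q) = 1" by simp_all
  have "p = smult (of_int (content Q) / of_nat N) (map_poly of_int (primitive_part Q))"
  proof (rule poly_eqI)
    fix i
    have "coeff Q i = content Q * coeff (primitive_part Q) i"
      by (metis content_times_primitive_part coeff_smult)
    then have "of_nat N * coeff p i = of_int (content Q) * of_int (coeff (primitive_part Q) i)"
      using cQ[of i] by (metis of_int_mult)
    then show "coeff p i = coeff (smult (of_int (content Q) / of_nat N) (map_poly of_int (primitive_part Q))) i"
      using N(1) by (simp add: coeff_map_poly field_simps)
  qed
  then show ?thesis using cont N(1)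
    by (intro exI[of _ "of_int (content Q) / of_nat N"] exI[of _ "primitive_part Q"]) simp
qed

text \<open>A common prime factor q of p = q w and p' divides w q'. Dividing w contradicts
  squarefreeness, and dividing q' is impossible by degree in characteristic zero.\<close>

lemma squarefree_imp_coprime_pderiv:
  assumes "squarefree (p :: rat poly)" shows "algebraic_semidom_class.coprime p (pderiv p)"
proof (rule ccontr)
  assume nc: "\<not> algebraic_semidom_class.coprime p (pderiv p)"
  have p0: "p \<noteq> 0" using assms by auto
  have "\<not> is_unit (gcd p (pderiv p))" using nc by (simp only: is_unit_gcd not_False_eq_True)
  then obtain q where q: "q dvd gcd p (pderiv p)" "prime q" using prime_divisor_exists[of "gcd p (pderiv p)"] p0 by auto
  then have qp: "q dvd p" "q dvd pderiv p" by auto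
  obtain w where w: "p = q * w" using qp(1) by (elim dvdE)
  have "q dvd w * pderiv q" using qp(2) unfolding w pderiv_mult by (simp add: dvd_add_right_iff)
  then consider "q dvd w" | "q dvd pderiv q" using q(2) by (auto simp: prime_dvd_mult_iff)
  then show False
  proof cases
    case 1
    then have "q\<^sup>2 dvd p" unfolding w power2_eq_square by (rule mult_dvd_mono[OF dvd_refl])
    then have "q dvd 1" using assms squarefreeD by blast
    then show False using q(2) by (meson not_prime_unit)
  next
    case 2
    have "q \<noteq> 0" "\<not> is_unit q" using q(2) not_prime_0 not_prime_unit by metis+
    then have dq: "degree q > 0" using is_unit_iff_degree by blast
    then have "pderiv q \<noteq> 0" by (simp add: pderiv_eq_0_iff)
    then have "degree q \<le> degree (pderiv q)" using 2 by (simp add: dvd_imp_degree_le)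
    then show False using dq by (simp add: degree_pderiv)
  qed
qed

lemma rsquarefree_complex:
  assumes "squarefree (map_poly rat_of_int r)" shows "rsquarefree (map_poly complex_of_int r)"
  unfolding rsquarefree_roots
proof (intro allI notI)
  fix a assume a: "poly (map_poly complex_of_int r) a = 0 \<and> poly (pderiv (map_poly complex_of_int r)) a = 0"
  let ?r = "map_poly rat_of_int r"
  obtain u v where uv: "u * ?r + v * pderiv ?r = 1"
    using bezout_coefficients_fst_snd[of ?r "pderiv ?r"] squarefree_imp_coprime_pderiv[OF assms]
    by (auto simp: coprime_iff_gcd_eq_1)
  have m1: "map_poly (of_rat :: rat \<Rightarrow> complex) ?r = map_poly of_int r"
    by (rule poly_eqI) (simp add: coeff_map_poly)
  have m2: "map_poly (of_rat :: rat \<Rightarrow> complex) (pderiv ?r) = pderiv (map_poly of_int r)"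
    by (rule poly_eqI) (simp add: coeff_map_poly coeff_pderiv of_rat_mult of_rat_add)
  have "u * ?r - (- v) * pderiv ?r = 1" using uv by simp
  then have "map_poly of_rat (u * ?r - (- v) * pderiv ?r) = (1 :: complex poly)" by simp
  then have "map_poly of_rat u * map_poly of_int r - map_poly of_rat (- v) * pderiv (map_poly of_int r) = (1 :: complex poly)"
    unfolding map_of_rat_diff map_of_rat_mult m1 m2 .
  from arg_cong[OF this, of "\<lambda>p. poly p a"] show False using a by simp
qed

lemma order_squarefree_root:
  assumes "squarefree p" "qpoly_at a p = 0" shows "Polynomial.order a (map_poly to_ac p) = 1"
proof -
  obtain u v where uv: "u * p + v * pderiv p = 1"
    using bezout_coefficients_fst_snd[of p "pderiv p"] squarefree_imp_coprime_pderiv[OF assms(1)]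
    by (auto simp: coprime_iff_gcd_eq_1)
  have m2: "map_poly to_ac (pderiv p) = pderiv (map_poly to_ac p)"
  proof (rule poly_eqI)
    fix i
    have "to_ac (of_nat (Suc i) * coeff p (Suc i)) = of_nat (Suc i) * to_ac (coeff p (Suc i))"
      unfolding to_ac_mult to_ac_of_nat ..
    then show "coeff (map_poly to_ac (pderiv p)) i = coeff (pderiv (map_poly to_ac p)) i"
      by (simp add: coeff_map_poly coeff_pderiv del: to_ac_mult of_nat_Suc)
  qed
  have "qpoly_at x (u * p + v * pderiv p) = qpoly_at x u * qpoly_at x p + qpoly_at x v * poly (pderiv (map_poly to_ac p)) x" for x
    unfolding qpoly_at_add qpoly_at_mult by (simp add: qpoly_at_def m2)
  then have "qpoly_at x u * qpoly_at x p + qpoly_at x v * poly (pderiv (map_poly to_ac p)) x = 1" for x by (simp add: uv)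
  then have "\<not> (poly (map_poly to_ac p) x = 0 \<and> poly (pderiv (map_poly to_ac p)) x = 0)" for x
    by (metis add_0 qpoly_at_def mult_zero_right zero_neq_one)
  then have "rsquarefree (map_poly to_ac p)" unfolding rsquarefree_roots by blast
  moreover have "map_poly to_ac p \<noteq> 0" using \<open>rsquarefree (map_poly to_ac p)\<close> by (auto simp: rsquarefree_def)
  ultimately show ?thesis using assms(2) by (intro rsquarefree_root_order) (auto simp: qpoly_at_def)
qed

text \<open>A root x of a divisor d of r gives p with p^2 = F at x, so e = gcd(d, p^2 - F) is a
  factor of positive degree modulo which p works. The cofactor is handled by induction, and
  squarefreeness makes e and the cofactor coprime, so the two square roots glue.\<close>

lemma square_root_mod_glue:
  assumes r: "squarefree r" and roots: "\<And>x. qpoly_at x r = 0 \<Longrightarrow> \<exists>p. (qpoly_at x p)\<^sup>2 = qpoly_at x F"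
  shows "\<exists>V. r dvd V\<^sup>2 - F"
proof -
  have "d dvd r \<Longrightarrow> \<exists>V. d dvd V\<^sup>2 - F" for d
  proof (induction "degree d" arbitrary: d rule: less_induct)
    case less
    have d0: "d \<noteq> 0" using r less.prems by auto
    show ?case
    proof (cases "degree d = 0")
      case True
      then have "is_unit d" using d0 is_unit_iff_degree by blast
      then show ?thesis by (meson dvd_trans one_dvd)
    next
      case False
      have dmap: "degree (map_poly to_ac d) = degree d" by (rule degree_map_poly) simp
      obtain x where x: "qpoly_at x d = 0"
        using alg_closed_imp_poly_has_root[of "map_poly to_ac d"] False dmap by (auto simp: qpoly_at_def)
      have "qpoly_at x r = 0" using less.prems x by (auto simp: dvd_def qpoly_at_mult)
      then obtain p where p: "(qpoly_at x p)\<^sup>2 = qpoly_at x F" using roots by blast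
      define e where "e = gcd d (p\<^sup>2 - F)"
      have ed: "e dvd d" and eF: "e dvd p\<^sup>2 - F" by (simp_all add: e_def)
      obtain w where w: "d = e * w" using ed by (elim dvdE)
      obtain a b where ab: "a * d + b * (p\<^sup>2 - F) = e"
        using bezout_coefficients_fst_snd[of d "p\<^sup>2 - F"] by (auto simp: e_def)
      have "qpoly_at x e = 0" unfolding ab[symmetric] using x p by (simp add: qpoly_at_add qpoly_at_mult qpoly_at_diff power2_eq_square)
      have e0: "e \<noteq> 0" "w \<noteq> 0" using w d0 by auto
      have "degree e \<noteq> 0"
      proof
        assume "degree e = 0"
        then obtain c where c: "e = [:c:]" by (auto elim: degree_eq_zeroE)
        then show False using \<open>qpoly_at x e = 0\<close> e0 by (simp add: qpoly_at_pCons)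
      qed
      then have "degree w < degree d" using w e0 by (simp add: degree_mult_eq)
      moreover have "w dvd r" using w less.prems by (metis dvd_trans dvd_triv_right)
      ultimately obtain V' where V': "w dvd V'\<^sup>2 - F" using less.hyps by blast
      have "gcd e w dvd 1"
      proof (rule squarefreeD[OF r])
        have "gcd e w * gcd e w dvd e * w" by (intro mult_dvd_mono) simp_all
        then show "(gcd e w)\<^sup>2 dvd r" unfolding power2_eq_square using w less.prems dvd_trans by blast
      qed
      then have "gcd e w = 1" by (simp only: is_unit_gcd coprime_iff_gcd_eq_1)
      then obtain a b where ab: "a * e + b * w = 1"
        using bezout_coefficients_fst_snd[of e w] by auto
      define V where "V = p * (b * w) + V' * (a * e)"
      have be: "b * w = 1 - a * e" "a * e = 1 - b * w" using ab by (auto simp: algebra_simps)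
      have "V\<^sup>2 - F = (p\<^sup>2 - F) + e * (a * (V' - p) * (V + p))"
      proof -
        have "V = p + a * e * (V' - p)" unfolding V_def be(1) by (simp add: algebra_simps)
        then have "V - p = e * (a * (V' - p))" by (simp add: algebra_simps)
        then have "(V - p) * (V + p) = e * (a * (V' - p) * (V + p))" by (simp only: mult.assoc)
        moreover have "V\<^sup>2 - F = (p\<^sup>2 - F) + (V - p) * (V + p)" by (simp add: power2_eq_square algebra_simps)
        ultimately show ?thesis by simp
      qed
      then have 1: "e dvd V\<^sup>2 - F" using dvd_add[OF eF dvd_triv_left] by (simp only:)
      have "V\<^sup>2 - F = (V'\<^sup>2 - F) + w * (b * (p - V') * (V + V'))"
      proof -
        have "V = V' + b * w * (p - V')" unfolding V_def be(2) by (simp add: algebra_simps)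
        then have "V - V' = w * (b * (p - V'))" by (simp add: algebra_simps)
        then have "(V - V') * (V + V') = w * (b * (p - V') * (V + V'))" by (simp only: mult.assoc)
        moreover have "V\<^sup>2 - F = (V'\<^sup>2 - F) + (V - V') * (V + V')" by (simp add: power2_eq_square algebra_simps)
        ultimately show ?thesis by simp
      qed
      then have 2: "w dvd V\<^sup>2 - F" using dvd_add[OF V' dvd_triv_left] by (simp only:)
      have "algebraic_semidom_class.coprime e w" unfolding coprime_iff_gcd_eq_1 by fact
      then have "e * w dvd V\<^sup>2 - F" by (rule divides_mult[OF 1 2])
      then show ?thesis by (intro exI[of _ V]) (simp only: w)
    qed
  qed
  from this[OF dvd_refl] show ?thesis .
qed

text \<open>By Gauss's lemma the rational decomposition descends to primitive integral factors up to
  a rational constant. Comparing contents shows that the constant is a sign, which is absorbed into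
  r.\<close>

lemma squarefree_decomposition_int:
  assumes P: "content (P :: int poly) = 1"
  shows "\<exists>r s. P = r * s\<^sup>2 \<and> content r = 1 \<and> content s = 1 \<and> squarefree (map_poly rat_of_int r)"
proof -
  let ?m = "map_poly rat_of_int"
  have P0: "P \<noteq> 0" using P by auto
  define r0 where "r0 = squarefree_part (?m P)"
  define s0 where "s0 = square_part (?m P)"
  have dec: "?m P = r0 * s0\<^sup>2" unfolding r0_def s0_def by (rule squarefree_decompose)
  have sf: "squarefree r0" unfolding r0_def by (rule squarefree_squarefree_part)
  have nz: "r0 \<noteq> 0" "s0 \<noteq> 0" using dec P0 by auto
  obtain c r where r: "c \<noteq> 0" "content r = 1" "r0 = smult c (?m r)" using rat_poly_primitive[OF nz(1)] by blast
  obtain c' s where s: "c' \<noteq> 0" "content s = 1" "s0 = smult c' (?m s)" using rat_poly_primitive[OF nz(2)] by blast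
  have "?m P = smult (c * c'\<^sup>2) (?m (r * s\<^sup>2))"
    unfolding dec r(3) s(3) by (simp add: hom_distribs power2_eq_square algebra_simps)
  moreover obtain a b where qab: "quotient_of (c * c'\<^sup>2) = (a, b)" by (cases "quotient_of (c * c'\<^sup>2)")
  have ab: "b > 0" "c * c'\<^sup>2 = of_int a / of_int b"
    using quotient_of_denom_pos[OF qab] quotient_of_div[OF qab] by simp_all
  ultimately have "?m P = smult (of_int a / of_int b) (?m (r * s\<^sup>2))" by (simp only:)
  then have "smult (of_int b) (?m P) = smult (of_int a) (?m (r * s\<^sup>2))" using ab(1) by simp
  then have "?m (smult b P) = ?m (smult a (r * s\<^sup>2))" by (simp only: hom_distribs)
  then have eq: "smult b P = smult a (r * s\<^sup>2)" by simp
  have crs: "content (r * s\<^sup>2) = 1" by (simp add: content_mult r(2) s(2) power2_eq_square)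
  have "content (smult b P) = content (smult a (r * s\<^sup>2))" by (simp only: eq)
  then have "\<bar>a\<bar> = b" using ab(1) by (simp only: content_smult P crs) simp
  then have "a = b \<or> a = - b" by linarith
  have sfr: "squarefree (?m r)" by (rule squarefree_mono[OF _ sf], subst r(3), rule dvd_smult, rule dvd_refl)
  from \<open>a = b \<or> a = - b\<close> show ?thesis
  proof
    assume "a = b"
    then have "smult b (P - r * s\<^sup>2) = 0" using eq by (simp add: smult_diff_right)
    then have "P = r * s\<^sup>2" using ab(1) by simp
    then show ?thesis using r(2) s(2) sfr by blast
  next
    assume "a = - b"
    then have "smult b (P - (- r * s\<^sup>2)) = 0" using eq by (simp add: smult_add_right)
    then have "P - (- r * s\<^sup>2) = 0" using ab(1) by (simp only: smult_eq_0_iff) simp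
    then have "P = - r * s\<^sup>2" by (simp only: right_minus_eq)
    moreover have "squarefree (?m (- r))" using sfr by (simp add: hom_distribs)
    moreover have "content (- r) = 1" using r(2) content_smult[of "- 1" r] by simp
    ultimately show ?thesis using s(2) by blast
  qed
qed

section \<open>Rational divisors on the curve\<close>

lemma double_cover_wproj [simp]: "double_cover (wproj_point g x y z) = proj_point x y"
  unfolding double_cover_def wproj_point_def proj_point_def by force

lemma proj_point_self: "(x, y) \<in> proj_point x y"
  unfolding proj_point_def by (auto intro!: exI[of _ 1])

lemma proj_point_scale: assumes "s \<noteq> 0" shows "proj_point (s * x) (s * y) = proj_point x y"
proof -
  have "\<exists>t'. (t * x, t * y) = (t' * (s * x), t' * (s * y)) \<and> t' \<noteq> 0" if "t \<noteq> 0" for t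
    by (rule exI[of _ "t / s"]) (use assms that in simp)
  moreover have "\<exists>t'. (t * (s * x), t * (s * y)) = (t' * x, t' * y) \<and> t' \<noteq> 0" if "t \<noteq> 0" for t
    by (rule exI[of _ "t * s"]) (use assms that in simp)
  ultimately show ?thesis unfolding proj_point_def by blast
qed

lemma proj_point_eq_iff:
  assumes "(x, y) \<noteq> (0, 0)" "(a, b) \<noteq> (0, 0)"
  shows "proj_point x y = proj_point a b \<longleftrightarrow> x * b = y * a"
proof
  assume "proj_point x y = proj_point a b"
  then have "(a, b) \<in> proj_point x y" using proj_point_self by blast
  then show "x * b = y * a" by (auto simp: proj_point_def)
next
  assume eq: "x * b = y * a"
  have "\<exists>s. s \<noteq> 0 \<and> a = s * x \<and> b = s * y"
  proof (cases "x = 0")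
    case True
    then have "y \<noteq> 0" "a = 0" using assms(1) eq by auto
    then show ?thesis using assms(2) True by (intro exI[of _ "b / y"]) auto
  next
    case False
    then have "a \<noteq> 0" using eq assms(2) by auto
    then show ?thesis using False eq by (intro exI[of _ "a / x"]) (auto simp: field_simps)
  qed
  then show "proj_point x y = proj_point a b" by (metis proj_point_scale)
qed

lemma wproj_scale:
  assumes "s \<noteq> 0" shows "wproj_point g (s * x) (s * y) (s ^ (g + 1) * z) = wproj_point g x y z"
proof -
  have "\<exists>t'. (t * x, t * y, t ^ (g + 1) * z) = (t' * (s * x), t' * (s * y), t' ^ (g + 1) * (s ^ (g + 1) * z)) \<and> t' \<noteq> 0" if "t \<noteq> 0" for t
    by (rule exI[of _ "t / s"]) (use assms that in \<open>simp add: power_divide\<close>)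
  moreover have "\<exists>t'. (t * (s * x), t * (s * y), t ^ (g + 1) * (s ^ (g + 1) * z)) = (t' * x, t' * y, t' ^ (g + 1) * z) \<and> t' \<noteq> 0" if "t \<noteq> 0" for t
    by (rule exI[of _ "t * s"]) (use assms that in \<open>simp add: power_mult_distrib\<close>)
  ultimately show ?thesis unfolding wproj_point_def by blast
qed

text \<open>The normalisation y = 1 + t x uses up the weighted scaling: a point not above [1:t] is
  given by a unique pair (x, z).\<close>

definition affine_point :: "nat \<Rightarrow> qbar \<Rightarrow> qbar \<Rightarrow> qbar \<Rightarrow> wpoint" where
  "affine_point g t x z = wproj_point g x (1 + t * x) z"

lemma affine_point_inject:
  assumes "affine_point g t x z = affine_point g t x' z'" shows "x = x' \<and> z = z'"
proof -
  have "(x', 1 + t * x', z') \<in> wproj_point g x' (1 + t * x') z'"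
    unfolding wproj_point_def by (auto intro!: exI[of _ 1])
  also have "wproj_point g x' (1 + t * x') z' = wproj_point g x (1 + t * x) z"
    using assms by (simp only: affine_point_def)
  finally obtain s where s: "x' = s * x" "1 + t * x' = s * (1 + t * x)" "z' = s ^ (g + 1) * z"
    by (auto simp: wproj_point_def)
  have "s = 1" using s(2) unfolding s(1) by (simp add: algebra_simps)
  then show ?thesis using s by simp
qed

definition abscissa :: "qbar \<Rightarrow> wpoint \<Rightarrow> qbar" where
  "abscissa t P = (THE x. (x, 1 + t * x) \<in> double_cover P)"

lemma abscissa_affine_point [simp]: "abscissa t (affine_point g t x z) = x"
  unfolding abscissa_def
proof (rule the_equality)
  show "(x, 1 + t * x) \<in> double_cover (affine_point g t x z)"
    by (simp add: affine_point_def proj_point_self)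
  fix x' assume "(x', 1 + t * x') \<in> double_cover (affine_point g t x z)"
  then obtain s where s: "x' = s * x" "1 + t * x' = s * (1 + t * x)"
    by (auto simp: affine_point_def proj_point_def)
  have "s = 1" using s(2) unfolding s(1) by (simp add: algebra_simps)
  then show "x' = x" using s by simp
qed

definition avoids :: "qbar \<Rightarrow> wpoint \<Rightarrow> bool" where
  "avoids t P \<longleftrightarrow> (\<forall>(x, y)\<in>double_cover P. y \<noteq> t * x)"

lemma curve_point_affine:
  assumes P: "P \<in> curve_points g f" "avoids t P"
  shows "\<exists>x z. P = affine_point g t x z \<and> z\<^sup>2 = poly (dehomogenize t (2 * g + 2) (\<lambda>i. of_int (f i))) x"
proof -
  obtain x y z where xyz: "P = wproj_point g x y z" "z\<^sup>2 = bform_eval (2 * g + 2) (\<lambda>i. of_int (f i)) x y"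
    using P(1) by (auto simp: curve_points_def)
  have "y \<noteq> t * x" using P(2) proj_point_self[of x y] by (auto simp: avoids_def xyz(1))
  define s where "s = 1 / (y - t * x)"
  have s: "s \<noteq> 0" "s * y = 1 + t * (s * x)"
    using \<open>y \<noteq> t * x\<close> by (auto simp: s_def field_simps)
  have "P = affine_point g t (s * x) (s ^ (g + 1) * z)"
    unfolding xyz(1) affine_point_def s(2)[symmetric] wproj_scale[OF s(1)] ..
  moreover have "(s ^ (g + 1) * z)\<^sup>2 = poly (dehomogenize t (2 * g + 2) (\<lambda>i. of_int (f i))) (s * x)"
  proof -
    have "(s ^ (g + 1) * z)\<^sup>2 = s ^ (2 * g + 2) * z\<^sup>2"
    proof -
      have e: "(g + 1) * 2 = 2 * g + 2" by simp
      show ?thesis unfolding power_mult_distrib power_mult[symmetric] e ..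
    qed
    also have "\<dots> = bform_eval (2 * g + 2) (\<lambda>i. of_int (f i)) (s * x) (s * y)"
      using form_homogeneous[OF is_form_bform, of "2 * g + 2" "\<lambda>i. of_int (f i)" s x y] by (simp add: xyz(2))
    finally show ?thesis by (simp add: poly_dehomogenize s(2))
  qed
  ultimately show ?thesis by blast
qed

text \<open>A point lies above at most one [1:t]. Its image in P^1 exists, since x = y = 0 would
  force z = 0 by the equation of the curve.\<close>

lemma finite_not_avoids:
  assumes "P \<in> curve_points g f" shows "finite {t::int. \<not> avoids (of_int t) P}"
proof -
  obtain x y z where xyz: "P = wproj_point g x y z" "z\<^sup>2 = bform_eval (2 * g + 2) (\<lambda>i. of_int (f i)) x y" "(x, y, z) \<noteq> (0, 0, 0)"
    using assms by (auto simp: curve_points_def)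
  have xy: "(x, y) \<noteq> (0, 0)"
  proof
    assume a: "(x, y) = (0, 0)"
    have "bform_eval (2 * g + 2) (\<lambda>i. of_int (f i)) x y = 0"
      unfolding bform_eval_def by (rule sum.neutral) (use a in auto)
    then show False using xyz a by simp
  qed
  have y: "y = of_int t * x" if t: "\<not> avoids (of_int t) P" for t
  proof -
    obtain s where "s \<noteq> 0" "s * y = of_int t * (s * x)"
      using t by (auto simp: avoids_def xyz(1) proj_point_def)
    then show ?thesis by simp
  qed
  have "t = t'" if "\<not> avoids (of_int t) P" "\<not> avoids (of_int t') P" for t t'
    using y[OF that(1)] y[OF that(2)] xy by auto
  then have "{t::int. \<not> avoids (of_int t) P} = {} \<or> (\<exists>t0. {t::int. \<not> avoids (of_int t) P} \<subseteq> {t0})" by blast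
  then show ?thesis by (auto intro: finite_subset)
qed

text \<open>Each point of D excludes finitely many t, and u(1, t) is a nonzero polynomial in
  t.\<close>

lemma exists_avoiding_shift:
  assumes D: "set_mset D \<subseteq> curve_points g f" and u: "i \<le> m" "(u::nat \<Rightarrow> int) i \<noteq> 0"
  shows "\<exists>t::int. (\<forall>P\<in>#D. avoids (of_int t) P) \<and> bform_eval m u 1 t \<noteq> 0"
proof -
  define q where "q = (\<Sum>i\<le>m. monom (u i) i)"
  have "coeff q i = u i"
  proof -
    have "coeff q i = (\<Sum>j\<le>m. if j = i then u j else 0)"
      unfolding q_def coeff_sum coeff_monom by (intro sum.cong) auto
    then show ?thesis using u(1) by simp
  qed
  then have "q \<noteq> 0" using u(2) by auto
  then have "finite {t. poly q t = 0}" by (rule poly_roots_finite)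
  moreover have "finite (\<Union>P\<in>set_mset D. {t::int. \<not> avoids (of_int t) P})"
    using finite_not_avoids D by (intro finite_UN_I) auto
  ultimately have "finite ({t. poly q t = 0} \<union> (\<Union>P\<in>set_mset D. {t::int. \<not> avoids (of_int t) P}))" by simp
  from ex_new_if_finite[OF infinite_UNIV_int this]
  obtain t :: int where t: "poly q t \<noteq> 0" "\<forall>P\<in>#D. avoids (of_int t) P" by auto
  have "poly q t = bform_eval m u 1 t" by (simp add: q_def bform_eval_def poly_sum poly_monom)
  then show ?thesis using t by auto
qed

lemma count_pushforward:
  assumes D: "set_mset D \<subseteq> curve_points g f" and t: "\<forall>P\<in>#D. avoids t P" and ab: "(a, b) \<noteq> (0, 0)"
  shows "count (image_mset double_cover D) (proj_point a b)
    = (if b = t * a then 0 else count (image_mset (abscissa t) D) (a / (b - t * a)))"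
proof -
  have iff: "double_cover P = proj_point a b \<longleftrightarrow> b \<noteq> t * a \<and> abscissa t P = a / (b - t * a)" if P: "P \<in># D" for P
  proof -
    obtain x z where x: "P = affine_point g t x z" using curve_point_affine P D t by blast
    have "double_cover P = proj_point a b \<longleftrightarrow> x * b = (1 + t * x) * a"
      unfolding x affine_point_def double_cover_wproj by (rule proj_point_eq_iff[OF _ ab]) auto
    also have "\<dots> \<longleftrightarrow> x * (b - t * a) = a" by (auto simp: algebra_simps)
    also have "\<dots> \<longleftrightarrow> b \<noteq> t * a \<and> x = a / (b - t * a)"
    proof (cases "b = t * a")
      case True
      then have "a \<noteq> 0" using ab by auto
      then show ?thesis using True by simp
    qed (simp add: nonzero_eq_divide_eq)
    finally show ?thesis by (simp add: x)
  qed
  have "double_cover -` {proj_point a b} \<inter> set_mset D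
    = (if b = t * a then {} else abscissa t -` {a / (b - t * a)} \<inter> set_mset D)"
    using iff by auto
  then show ?thesis by (simp add: count_image_mset)
qed

text \<open>In the chart both defining conditions concern one polynomial: the gcd is its content,
  and the multiplicities along linear forms are its orders at the abscissae of D.\<close>

lemma pushforward_form_iff:
  assumes D: "set_mset D \<subseteq> curve_points g f" and t: "\<forall>P\<in>#D. avoids (of_int t) P"
    and ut: "bform_eval (size D) u 1 t \<noteq> 0"
  shows "pushforward_form D u \<longleftrightarrow> content (dehomogenize t (size D) u) = 1 \<and>
    (\<forall>x. Polynomial.order x (map_poly of_int (dehomogenize t (size D) u)) = count (image_mset (abscissa (of_int t)) D) x)"
proof -
  let ?u = "\<lambda>i. of_int (u i) :: qbar" and ?t = "of_int t :: qbar"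
  have "bform_eval (size D) ?u 1 ?t = of_int (bform_eval (size D) u 1 t)" by (simp add: bform_eval_def)
  then have ut': "bform_eval (size D) ?u 1 ?t \<noteq> 0" using ut by simp
  have m: "multiplicity (lin_form a b) (bform (size D) ?u)
     = (if b = ?t * a then 0 else Polynomial.order (a / (b - ?t * a)) (map_poly of_int (dehomogenize t (size D) u)))"
    if "(a, b) \<noteq> (0, 0)" for a b
    unfolding map_poly_dehomogenize by (rule multiplicity_bform[OF ut' that])
  have "(\<forall>a b. (a, b) \<noteq> (0, 0) \<longrightarrow> multiplicity (lin_form a b) (bform (size D) ?u)
       = count (image_mset double_cover D) (proj_point a b))
    \<longleftrightarrow> (\<forall>x. Polynomial.order x (map_poly of_int (dehomogenize t (size D) u)) = count (image_mset (abscissa ?t) D) x)"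
    (is "?L \<longleftrightarrow> ?R")
  proof
    assume L: ?L
    show ?R
    proof
      fix x
      have ne: "(x, 1 + ?t * x) \<noteq> (0, 0)" by auto
      have "1 + ?t * x - ?t * x = 1" by simp
      moreover have "multiplicity (lin_form x (1 + ?t * x)) (bform (size D) ?u)
       = count (image_mset double_cover D) (proj_point x (1 + ?t * x))" using L ne by blast
      ultimately show "Polynomial.order x (map_poly of_int (dehomogenize t (size D) u)) = count (image_mset (abscissa ?t) D) x"
        unfolding m[OF ne] count_pushforward[OF D t ne] by simp
    qed
  next
    assume ?R
    then show ?L using m count_pushforward[OF D t] by (metis (no_types, lifting))
  qed
  then show ?thesis unfolding pushforward_form_def content_dehomogenize by blast
qed

section \<open>The Galois action on points, and rationality of the push-forward\<close>

lemma galois_add: "\<sigma> \<in> galois_group \<Longrightarrow> \<sigma> (a + b) = \<sigma> a + \<sigma> b"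
  and galois_mult: "\<sigma> \<in> galois_group \<Longrightarrow> \<sigma> (a * b) = \<sigma> a * \<sigma> b"
  and galois_bij: "\<sigma> \<in> galois_group \<Longrightarrow> bij \<sigma>"
  by (auto simp: galois_group_def)

lemma galois_0: "\<sigma> \<in> galois_group \<Longrightarrow> \<sigma> 0 = 0" using galois_add[of \<sigma> 0 0] by simp

lemma galois_eq_0_iff: "\<sigma> \<in> galois_group \<Longrightarrow> \<sigma> a = 0 \<longleftrightarrow> a = 0"
  using galois_0 galois_bij by (metis bij_pointE)

lemma galois_1: assumes "\<sigma> \<in> galois_group" shows "\<sigma> 1 = 1"
  using galois_mult[OF assms, of 1 1] galois_eq_0_iff[OF assms, of 1] by simp

lemma galois_uminus: assumes "\<sigma> \<in> galois_group" shows "\<sigma> (- a) = - \<sigma> a"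
  using galois_add[OF assms, of a "- a"] galois_0[OF assms] by (simp add: eq_neg_iff_add_eq_0 add.commute)

lemma galois_diff: assumes "\<sigma> \<in> galois_group" shows "\<sigma> (a - b) = \<sigma> a - \<sigma> b"
  using galois_add[OF assms, of a "- b"] galois_uminus[OF assms, of b] by simp

lemma galois_power: assumes "\<sigma> \<in> galois_group" shows "\<sigma> (a ^ k) = \<sigma> a ^ k"
  by (induction k) (simp_all add: galois_1[OF assms] galois_mult[OF assms])

lemma galois_of_nat: assumes "\<sigma> \<in> galois_group" shows "\<sigma> (of_nat k) = of_nat k"
  by (induction k) (simp_all add: galois_0[OF assms] galois_1[OF assms] galois_add[OF assms])

lemma galois_of_int: assumes "\<sigma> \<in> galois_group" shows "\<sigma> (of_int k) = of_int k"
  by (cases k) (simp_all add: galois_of_nat[OF assms] galois_uminus[OF assms] galois_add[OF assms] galois_1[OF assms] del: of_nat_Suc)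

lemma galois_poly:
  assumes "\<sigma> \<in> galois_group" shows "\<sigma> (poly (map_poly of_int p) x) = poly (map_poly of_int p) (\<sigma> x)"
proof (induction p)
  case (pCons a p)
  have "map_poly of_int (pCons a p) = pCons (of_int a) (map_poly of_int p :: qbar poly)" by (rule map_poly_pCons) (use pCons in simp)
  then show ?case by (simp add: galois_add[OF assms] galois_mult[OF assms] galois_of_int[OF assms] pCons.IH)
qed (simp add: galois_0[OF assms])

lemma galois_act_wproj:
  assumes s: "\<sigma> \<in> galois_group" shows "galois_act \<sigma> (wproj_point g x y z) = wproj_point g (\<sigma> x) (\<sigma> y) (\<sigma> z)"
proof (intro equalityI subsetI)
  fix p assume "p \<in> galois_act \<sigma> (wproj_point g x y z)"
  then obtain t where t: "t \<noteq> 0" "p = (\<sigma> (t * x), \<sigma> (t * y), \<sigma> (t ^ (g + 1) * z))"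
    by (auto simp: galois_act_def wproj_point_def)
  then show "p \<in> wproj_point g (\<sigma> x) (\<sigma> y) (\<sigma> z)"
    unfolding wproj_point_def galois_mult[OF s] galois_power[OF s] using galois_eq_0_iff[OF s, of t] by blast
next
  fix p assume "p \<in> wproj_point g (\<sigma> x) (\<sigma> y) (\<sigma> z)"
  then obtain t' where t': "t' \<noteq> 0" "p = (t' * \<sigma> x, t' * \<sigma> y, t' ^ (g + 1) * \<sigma> z)" by (auto simp: wproj_point_def)
  obtain t where t: "t' = \<sigma> t" using galois_bij[OF s] by (metis bij_pointE)
  have "p = (\<lambda>(x, y, z). (\<sigma> x, \<sigma> y, \<sigma> z)) (t * x, t * y, t ^ (g + 1) * z)"
    by (simp add: t'(2) t galois_mult[OF s] galois_power[OF s])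
  moreover have "t \<noteq> 0" using t'(1) galois_0[OF s] t by auto
  ultimately show "p \<in> galois_act \<sigma> (wproj_point g x y z)"
    unfolding galois_act_def wproj_point_def by blast
qed

lemma galois_act_affine:
  assumes s: "\<sigma> \<in> galois_group"
  shows "galois_act \<sigma> (affine_point g (of_int t) x z) = affine_point g (of_int t) (\<sigma> x) (\<sigma> z)"
  unfolding affine_point_def galois_act_wproj[OF s]
  by (simp add: galois_add[OF s] galois_mult[OF s] galois_of_int[OF s] galois_1[OF s])

lemma inj_galois_act: assumes "\<sigma> \<in> galois_group" shows "inj (galois_act \<sigma>)"
proof -
  have "inj \<sigma>" using galois_bij[OF assms] by (rule bij_is_inj)
  then have "inj (\<lambda>(x, y, z). (\<sigma> x, \<sigma> y, \<sigma> z))" by (intro injI) (auto dest: injD)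
  then show ?thesis unfolding galois_act_def by (intro injI) (simp only: inj_image_eq_iff)
qed

text \<open>As t is an integer, conjugation respects the normalisation y = 1 + t x and so commutes
  with taking abscissae.\<close>

lemma abscissae_galois_invariant:
  assumes D: "effective_divisor g f D" and t: "\<forall>P\<in>#D. avoids (of_int t) P" and s: "\<sigma> \<in> galois_group"
  shows "image_mset \<sigma> (image_mset (abscissa (of_int t)) D) = image_mset (abscissa (of_int t)) D"
proof -
  have "image_mset \<sigma> (image_mset (abscissa (of_int t)) D) = image_mset (abscissa (of_int t) \<circ> galois_act \<sigma>) D"
    unfolding multiset.map_comp
  proof (rule image_mset_cong)
    fix P assume "P \<in># D"
    then have "P \<in> curve_points g f" "avoids (of_int t) P" using D t by (auto simp: effective_divisor_def)
    then obtain x z where "P = affine_point g (of_int t) x z" using curve_point_affine[of P g f "of_int t"] by blast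
    then show "(\<sigma> \<circ> abscissa (of_int t)) P = (abscissa (of_int t) \<circ> galois_act \<sigma>) P"
      by (simp add: galois_act_affine[OF s])
  qed
  also have "\<dots> = image_mset (abscissa (of_int t)) (image_mset (galois_act \<sigma>) D)" by (simp add: multiset.map_comp)
  also have "image_mset (galois_act \<sigma>) D = D" using D s by (simp add: effective_divisor_def)
  finally show ?thesis .
qed

lemma map_poly_galois_prod:
  assumes s: "\<sigma> \<in> galois_group"
  shows "map_poly \<sigma> (\<Prod>x\<in>#A. [:- x, 1:]) = (\<Prod>x\<in>#image_mset \<sigma> A. [:- x, 1:])"
proof (induction A)
  case empty then show ?case by (simp add: galois_1[OF s] map_poly_1')
next
  case (add x A)
  have "map_poly \<sigma> ([:- x, 1:] * p) = [:- \<sigma> x, 1:] * map_poly \<sigma> p" for p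
    by (rule poly_eqI)
      (simp add: coeff_map_poly galois_0[OF s] coeff_pCons galois_add[OF s] galois_diff[OF s] galois_mult[OF s] galois_uminus[OF s] split: nat.split)
  then show ?case using add by simp
qed

lemma prod_linear:
  fixes A :: "'a::field multiset"
  shows "(\<Prod>x\<in>#A. [:- x, 1:]) \<noteq> 0" (is ?A) "degree (\<Prod>x\<in>#A. [:- x, 1:]) = size A" (is ?B)
    "Polynomial.order a (\<Prod>x\<in>#A. [:- x, 1:]) = count A a" (is ?C)
proof -
  have "?A \<and> ?B \<and> ?C"
  proof (induction A)
    case (add x A)
    let ?p = "\<Prod>x\<in>#A. [:- x, 1:]"
    have nz: "[:- x, 1:] * ?p \<noteq> 0" using add by (simp del: mult_pCons_left)
    have o: "Polynomial.order a [:- x, 1:] = (if x = a then 1 else 0)"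
      using order_power_n_n[of a 1] by (auto intro: order_0I)
    have "Polynomial.order a ([:- x, 1:] * ?p) = count (add_mset x A) a"
      unfolding order_mult[OF nz] o using add by (simp only: count_add_mset split: if_split) simp
    moreover have "degree ([:- x, 1:] * ?p) = size (add_mset x A)"
      using add nz by (subst degree_mult_eq) auto
    ultimately show ?case using nz by (simp only: image_mset_add_mset prod_mset.add_mset) simp
  qed (auto intro: order_0I)
  then show ?A ?B ?C by auto
qed

text \<open>Gives meaning to the \<open>SOME\<close> in \<open>divisor_height\<close>. The monic
  polynomial with the abscissae of D as roots has Galois-invariant, hence rational, coefficients; a
  primitive integral multiple of it comes from a form.\<close>

lemma pushforward_form_exists:
  assumes D: "effective_divisor g f D"
  shows "\<exists>u. pushforward_form D u"
proof -
  have Dc: "set_mset D \<subseteq> curve_points g f" using D by (simp add: effective_divisor_def)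
  obtain t :: int where t: "\<forall>P\<in>#D. avoids (of_int t) P"
    using exists_avoiding_shift[OF Dc, of 0 0 "\<lambda>_. 1"] by auto
  define M where "M = image_mset (abscissa (of_int t)) D"
  define q where "q = (\<Prod>x\<in>#M. [:- x, 1:])"
  have q: "q \<noteq> 0" "degree q = size D" "\<And>x. Polynomial.order x q = count M x"
    unfolding q_def prod_linear(2,3) by (rule prod_linear(1)) (simp_all add: M_def)
  have "\<exists>c. coeff q i = to_ac c" for i
  proof -
    have "\<sigma> (coeff q i) = coeff q i" if s: "\<sigma> \<in> galois_group" for \<sigma>
    proof -
      have "map_poly \<sigma> q = q"
        unfolding q_def map_poly_galois_prod[OF s] unfolding M_def abscissae_galois_invariant[OF D t s] ..
      then show ?thesis using coeff_map_poly[of \<sigma> q i, OF galois_0[OF s]] by simp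
    qed
    \<comment> \<open>The base point 0 is fixed by all automorphisms, so the field Q(x0) of
      \<open>galois_fixed\<close> is here Q itself.\<close>
    then obtain p where "coeff q i = qpoly_at 0 p" using galois_fixed[of 0 "coeff q i"] by blast
    then have "coeff q i = to_ac (coeff p 0)" by (simp add: qpoly_at_def poly_0_coeff_0 coeff_map_poly)
    then show ?thesis by blast
  qed
  then obtain c where c: "\<And>i. coeff q i = to_ac (c i)" by metis
  define q0 where "q0 = (\<Sum>i\<le>degree q. monom (c i) i)"
  have cq0: "coeff q0 i = (if i \<le> degree q then c i else 0)" for i
  proof -
    have "coeff q0 i = (\<Sum>j\<le>degree q. if j = i then c j else 0)"
      unfolding q0_def coeff_sum coeff_monom by (intro sum.cong) auto
    then show ?thesis by simp
  qed
  have mq0: "map_poly to_ac q0 = q"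
    by (rule poly_eqI) (auto simp: coeff_map_poly cq0 c[symmetric] coeff_eq_0)
  then have "q0 \<noteq> 0" using q(1) by auto
  then obtain a Q where Q: "a \<noteq> 0" "content Q = 1" "q0 = smult a (map_poly rat_of_int Q)"
    using rat_poly_primitive by blast
  have qQ: "q = smult (to_ac a) (map_poly of_int Q)"
    unfolding mq0[symmetric] Q(3) by (rule poly_eqI) (simp add: coeff_map_poly)
  have a0: "to_ac a \<noteq> (0::qbar)" using Q(1) by simp
  have dQ: "degree Q = size D" using q(2) a0 by (simp add: qQ)
  obtain u where u: "dehomogenize t (size D) u = Q" using dehomogenize_surj[of Q "size D" t] dQ by auto
  have "Q \<noteq> 0" using Q(2) by auto
  then have "bform_eval (size D) u 1 t \<noteq> 0"
    using coeff_dehomogenize_top[of t "size D" u] u dQ by (metis leading_coeff_0_iff)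
  then have "pushforward_form D u"
    unfolding pushforward_form_iff[OF Dc t \<open>bform_eval (size D) u 1 t \<noteq> 0\<close>] u
    using Q(2) q(3) order_smult[OF a0] by (simp add: qQ M_def)
  then show ?thesis by blast
qed

text \<open>A Galois conjugation that swaps the two points above \<open>x\<close> forces \<open>D\<close> to contain them equally often.\<close>

lemma ordinate_in_field:
  assumes D: "effective_divisor g f D" and t: "\<forall>P\<in>#D. avoids (of_int t) P"
    and odd: "odd (count (image_mset (abscissa (of_int t)) D) x)"
  shows "\<exists>p. (qpoly_at x p)\<^sup>2 = poly (map_poly of_int (dehomogenize t (2 * g + 2) f)) x"
proof -
  let ?t = "of_int t :: qbar" and ?F = "map_poly of_int (dehomogenize t (2 * g + 2) f) :: qbar poly"
  have aff: "\<exists>x z. P = affine_point g ?t x z \<and> z\<^sup>2 = poly ?F x" if "P \<in># D" for P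
  proof -
    have "P \<in> curve_points g f" "avoids ?t P" using that D t by (auto simp: effective_divisor_def)
    then show ?thesis unfolding map_poly_dehomogenize by (rule curve_point_affine)
  qed
  have "x \<in># image_mset (abscissa ?t) D" using odd by (metis count_eq_zero_iff even_zero)
  then obtain P where P: "P \<in># D" "abscissa ?t P = x" by auto
  obtain z where z: "P = affine_point g ?t x z" "z\<^sup>2 = poly ?F x" using aff[OF P(1)] P(2) by auto
  define P' where "P' = affine_point g ?t x (- z)"
  have sub: "abscissa ?t -` {x} \<inter> set_mset D \<subseteq> {P, P'}"
  proof
    fix Q assume Q: "Q \<in> abscissa ?t -` {x} \<inter> set_mset D"
    then obtain z' where z': "Q = affine_point g ?t x z'" "z'\<^sup>2 = poly ?F x" using aff[of Q] by auto
    have "z' = z \<or> z' = - z" using z'(2) z(2) by (metis power2_eq_iff)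
    then show "Q \<in> {P, P'}" using z'(1) z(1) by (auto simp: P'_def)
  qed
  have "\<sigma> z = z" if s: "\<sigma> \<in> galois_group" "\<sigma> x = x" for \<sigma>
  proof (rule ccontr)
    assume ne: "\<sigma> z \<noteq> z"
    have "(\<sigma> z)\<^sup>2 = z\<^sup>2" using galois_power[OF s(1), of z 2] galois_poly[OF s(1), of "dehomogenize t (2 * g + 2) f" x]
      by (simp add: z(2) s(2))
    then have sz: "\<sigma> z = - z" using ne by (auto simp: power2_eq_iff)
    have sP: "galois_act \<sigma> P = P'" unfolding z(1) P'_def galois_act_affine[OF s(1)] by (simp add: s(2) sz)
    have PP': "P \<noteq> P'"
    proof
      assume "P = P'"
      then have "z = - z" using affine_point_inject unfolding z(1) P'_def by blast
      then show False using ne sz by simp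
    qed
    have "count D P' = count (image_mset (galois_act \<sigma>) D) (galois_act \<sigma> P)"
      using D s(1) by (simp add: effective_divisor_def sP)
    also have "\<dots> = count D P" using inj_galois_act[OF s(1)] by (induction D) (auto simp: inj_eq)
    finally have eq: "count D P' = count D P" .
    have "count (image_mset (abscissa ?t) D) x = sum (count D) (abscissa ?t -` {x} \<inter> set_mset D)"
      by (rule count_image_mset)
    also have "\<dots> = sum (count D) {P, P'}"
    proof (rule sum.mono_neutral_left[OF _ sub], simp, rule ballI)
      fix Q assume Q: "Q \<in> {P, P'} - abscissa ?t -` {x} \<inter> set_mset D"
      then have "abscissa ?t Q = x" using z(1) by (auto simp: P'_def)
      then show "count D Q = 0" using Q by (auto simp: not_in_iff)
    qed
    also have "\<dots> = 2 * count D P" using PP' eq by simp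
    finally show False using odd by simp
  qed
  then obtain p where "z = qpoly_at x p" using galois_fixed[of x z] by blast
  then show ?thesis using z(2) by auto
qed

text \<open>A root of r occurs among the abscissae of D once plus twice its order in s, an odd
  number, so \<open>ordinate_in_field\<close> yields a square root of f there and
  \<open>square_root_mod_glue\<close> joins them. With k = deg s + 1 the equation 2g - 1 = deg r + 2
  deg s becomes deg r = 2h + 1, h + k = g.\<close>

lemma divisor_reduction:
  assumes g: "g \<ge> 1" and D: "effective_divisor g f D" and m: "size D = 2 * g - 1" and u: "pushforward_form D u"
  shows "\<exists>(t::int) r s V h k. dehomogenize t (2 * g - 1) u = r * s\<^sup>2 \<and> degree r = 2 * h + 1 \<and> content r = 1 \<and> content s = 1
     \<and> degree s < k \<and> h + k = g \<and> squarefree (map_poly rat_of_int r)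
     \<and> map_poly rat_of_int r dvd V\<^sup>2 - map_poly rat_of_int (dehomogenize t (2 * g + 2) f)"
proof -
  have Dc: "set_mset D \<subseteq> curve_points g f" using D by (simp add: effective_divisor_def)
  have "\<exists>i\<le> size D. u i \<noteq> 0"
  proof (rule ccontr)
    assume "\<not> ?thesis"
    then have "Gcd (u ` {..size D}) = 0" by auto
    moreover have "Gcd (u ` {..size D}) = 1" using u by (simp only: pushforward_form_def)
    ultimately show False by simp
  qed
  then obtain t :: int where t: "\<forall>P\<in>#D. avoids (of_int t) P" and ut: "bform_eval (size D) u 1 t \<noteq> 0"
    using exists_avoiding_shift[OF Dc] by blast
  define P where "P = dehomogenize t (size D) u"
  have P: "content P = 1"
    "\<And>x. Polynomial.order x (map_poly of_int P) = count (image_mset (abscissa (of_int t)) D) x"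
    using u unfolding pushforward_form_iff[OF Dc t ut] P_def by blast+
  have "coeff P (size D) \<noteq> 0" using ut by (simp add: P_def coeff_dehomogenize_top)
  then have dP: "degree P = 2 * g - 1"
    using degree_dehomogenize[of t "size D" u] le_degree[of P "size D"] m by (simp add: P_def)
  obtain r s where rs: "P = r * s\<^sup>2" "content r = 1" "content s = 1" "squarefree (map_poly rat_of_int r)"
    using squarefree_decomposition_int[OF P(1)] by blast
  have nz: "r \<noteq> 0" "s \<noteq> 0" using rs(2,3) by auto
  have deg: "2 * g - 1 = degree r + 2 * degree s"
    using dP nz by (simp add: rs(1) degree_mult_eq degree_power_eq)
  define k where "k = degree s + 1"
  define h where "h = g - k"
  have hk: "degree r = 2 * h + 1" "h + k = g"
    using deg g by (auto simp: k_def h_def)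
  let ?r = "map_poly rat_of_int r" and ?F = "map_poly rat_of_int (dehomogenize t (2 * g + 2) f)"
  have zpoly_at: "qpoly_at x (map_poly rat_of_int p) = poly (map_poly of_int p) x" for x p
  proof -
    have "map_poly to_ac (map_poly rat_of_int p) = map_poly of_int p"
      by (rule poly_eqI) (simp add: coeff_map_poly)
    then show ?thesis by (simp add: qpoly_at_def)
  qed
  have "\<exists>V. ?r dvd V\<^sup>2 - ?F"
  proof (rule square_root_mod_glue[OF rs(4)])
    fix x assume x: "qpoly_at x ?r = 0"
    have tr: "map_poly to_ac ?r = map_poly of_int r" by (rule poly_eqI) (simp add: coeff_map_poly)
    have o1: "Polynomial.order x (map_poly of_int r) = 1" using order_squarefree_root[OF rs(4) x] by (simp only: tr)
    let ?s = "map_poly of_int s :: qbar poly"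
    have Pm: "map_poly of_int P = map_poly of_int r * (?s * ?s)"
      by (simp add: rs(1) power2_eq_square hom_distribs)
    have ne: "map_poly of_int r * (?s * ?s) \<noteq> 0" "?s * ?s \<noteq> 0" using nz by simp_all
    have "count (image_mset (abscissa (of_int t)) D) x = 1 + 2 * Polynomial.order x ?s"
      unfolding P(2)[symmetric] Pm order_mult[OF ne(1)] order_mult[OF ne(2)] o1 by simp
    then show "\<exists>p. (qpoly_at x p)\<^sup>2 = qpoly_at x ?F"
      unfolding zpoly_at by (intro ordinate_in_field[OF D t]) simp
  qed
  then obtain V where "?r dvd V\<^sup>2 - ?F" by blast
  moreover have "dehomogenize t (2 * g - 1) u = r * s\<^sup>2" using rs(1) m by (simp add: P_def)
  moreover have "degree s < k" by (simp add: k_def)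
  ultimately show ?thesis using hk rs(2,3,4) by blast
qed

section \<open>Roots, discriminant and heights\<close>

text \<open>Otherwise y divides the form with a cofactor of positive degree. Both factors vanish at
  the origin, so neither is a unit.\<close>

lemma lead_coeff_nonzero:
  assumes irr: "comm_semiring_1_class.irreducible (bform n (\<lambda>i. of_int (f i)) :: rat poly poly)" and n: "n \<ge> 2"
  shows "f 0 \<noteq> 0"
proof
  assume f0: "f 0 = 0"
  obtain k where k: "n = Suc k" "k \<ge> 1" using n by (cases n) auto
  let ?c = "\<lambda>i. of_int (f i) :: rat"
  have "bform n ?c = (\<Sum>i\<le>k. const2 (?c (Suc i)) * var_x ^ (k - i) * var_y ^ Suc i)"
    unfolding bform_def k(1) sum.atMost_Suc_shift by (simp add: f0)
  also have "\<dots> = var_y * bform k (\<lambda>i. ?c (Suc i))"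
    unfolding bform_def sum_distrib_left by (intro sum.cong) (simp_all add: mult_ac)
  finally have "var_y dvd (1::rat poly poly) \<or> bform k (\<lambda>i. ?c (Suc i)) dvd 1"
    using irr by (intro irreducibleD)
  moreover have "\<not> P dvd (1::rat poly poly)" if "eval2 P 0 0 = 0" for P
  proof
    assume "P dvd 1"
    then obtain Q where "1 = P * Q" by (elim dvdE)
    then have "eval2 1 0 0 = eval2 (P * Q) (0::rat) 0" by simp
    then show False using that by simp
  qed
  moreover have "eval2 (bform k (\<lambda>i. ?c (Suc i))) 0 0 = 0"
  proof -
    have "(0::rat) ^ k = 0" using k(2) by simp
    then show ?thesis using form_homogeneous[OF is_form_bform, of k "\<lambda>i. ?c (Suc i)" 0 0 0]
      by (simp only: mult_zero_left)
  qed
  moreover have "eval2 (var_y :: rat poly poly) 0 0 = 0" by simp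
  ultimately show False by blast
qed

lemma prod_pairs:
  fixes \<theta> :: "nat \<Rightarrow> 'a::comm_ring_1"
  shows "(\<Prod>j<n. \<Prod>i\<in>{..<n} - {j}. \<theta> j - \<theta> i) = (\<Prod>j<n. \<Prod>i<j. - (\<theta> i - \<theta> j)\<^sup>2)"
proof (induction n)
  case (Suc n)
  have "(\<Prod>j<Suc n. \<Prod>i\<in>{..<Suc n} - {j}. \<theta> j - \<theta> i)
    = (\<Prod>j<n. \<Prod>i\<in>insert n ({..<n} - {j}). \<theta> j - \<theta> i) * (\<Prod>i<n. \<theta> n - \<theta> i)"
  proof -
    have "{..<Suc n} - {j} = insert n ({..<n} - {j})" if "j < n" for j using that by auto
    moreover have "{..<Suc n} - {n} = {..<n}" by auto
    ultimately show ?thesis by simp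
  qed
  also have "\<dots> = (\<Prod>j<n. \<Prod>i\<in>{..<n} - {j}. \<theta> j - \<theta> i) * ((\<Prod>i<n. \<theta> i - \<theta> n) * (\<Prod>i<n. \<theta> n - \<theta> i))"
    by (simp add: prod.distrib mult_ac)
  also have "(\<Prod>i<n. \<theta> i - \<theta> n) * (\<Prod>i<n. \<theta> n - \<theta> i) = (\<Prod>i<n. - (\<theta> i - \<theta> n)\<^sup>2)"
    unfolding prod.distrib[symmetric] by (intro prod.cong) (simp_all add: power2_eq_square algebra_simps)
  finally show ?case by (simp add: Suc)
qed simp

lemma prod_pairs_product:
  fixes \<alpha> :: "nat \<Rightarrow> 'a::comm_ring_1"
  shows "(\<Prod>j<n. \<Prod>i<j. \<alpha> i * \<alpha> j) = (\<Prod>i<n. \<alpha> i) ^ (n - 1)"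
proof (induction n)
  case (Suc n)
  have "(\<Prod>j<Suc n. \<Prod>i<j. \<alpha> i * \<alpha> j) = (\<Prod>i<n. \<alpha> i) ^ (n - 1) * ((\<Prod>i<n. \<alpha> i) * \<alpha> n ^ n)"
    unfolding prod.lessThan_Suc Suc by (simp add: prod.distrib)
  also have "\<dots> = (\<Prod>i<Suc n. \<alpha> i) ^ (Suc n - 1)"
    by (cases n) (simp_all add: power_mult_distrib mult_ac)
  finally show ?case .
qed simp

lemma prod_pairs_square:
  fixes a b :: "nat \<Rightarrow> nat \<Rightarrow> 'a::comm_ring_1"
  shows "(\<Prod>j<n. \<Prod>i<j. (a i j)\<^sup>2 * b i j) = (\<Prod>j<n. \<Prod>i<j. a i j)\<^sup>2 * (\<Prod>j<n. \<Prod>i<j. b i j)"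
  by (simp only: prod.distrib prod_power_distrib)

text \<open>For the definite description in \<open>disc\<close>. If the roots are distinct, the
  product over ordered pairs depends only on the set of roots; otherwise both sides are 0.\<close>

lemma roots_square_prod_unique:
  fixes \<theta> \<theta>' :: "nat \<Rightarrow> complex"
  assumes eq: "\<And>x. (\<Prod>i<n. x - \<theta> i) = (\<Prod>i<n. x - \<theta>' i)"
  shows "(\<Prod>j<n. \<Prod>i<j. (\<theta> i - \<theta> j)\<^sup>2) = (\<Prod>j<n. \<Prod>i<j. (\<theta>' i - \<theta>' j)\<^sup>2)"
proof -
  have S: "\<theta> ` {..<n} = {x. (\<Prod>i<n. x - \<theta> i) = 0}" for \<theta> :: "nat \<Rightarrow> complex" by auto
  have im: "\<theta> ` {..<n} = \<theta>' ` {..<n}" unfolding S eq ..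
  have inj: "inj_on \<theta> {..<n} \<longleftrightarrow> card (\<theta> ` {..<n}) = n" for \<theta> :: "nat \<Rightarrow> complex"
    by (metis card_image card_lessThan eq_card_imp_inj_on finite_lessThan)
  show ?thesis
  proof (cases "inj_on \<theta> {..<n}")
    case True
    then have True': "inj_on \<theta>' {..<n}" using inj im by metis
    have full: "(\<Prod>j<n. \<Prod>i\<in>{..<n} - {j}. \<theta> j - \<theta> i) = (\<Prod>a\<in>\<theta> ` {..<n}. \<Prod>b\<in>\<theta> ` {..<n} - {a}. a - b)"
      if i: "inj_on \<theta> {..<n}" for \<theta> :: "nat \<Rightarrow> complex"
      unfolding prod.reindex[OF i] o_def
    proof (rule prod.cong[OF refl])
      fix j assume j: "j \<in> {..<n}"
      have "\<theta> ` {..<n} - {\<theta> j} = \<theta> ` ({..<n} - {j})" using i j by (auto dest: inj_onD)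
      then show "(\<Prod>i\<in>{..<n} - {j}. \<theta> j - \<theta> i) = (\<Prod>b\<in>\<theta> ` {..<n} - {\<theta> j}. \<theta> j - b)"
        using prod.reindex[of \<theta> "{..<n} - {j}" "\<lambda>b. \<theta> j - b"] inj_on_subset[OF i] by (simp add: o_def)
    qed
    have "(\<Prod>j<n. \<Prod>i<j. - (\<theta> i - \<theta> j)\<^sup>2) = (\<Prod>j<n. \<Prod>i<j. - (\<theta>' i - \<theta>' j)\<^sup>2)"
      unfolding prod_pairs[symmetric] full[OF True] full[OF True'] im ..
    moreover have "(\<Prod>j<n. \<Prod>i<j. - (\<theta> i - \<theta> j)\<^sup>2) = (\<Prod>j<n. \<Prod>i<j. - 1) * (\<Prod>j<n. \<Prod>i<j. (\<theta> i - \<theta> j)\<^sup>2)"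
      for \<theta> :: "nat \<Rightarrow> complex"
      unfolding prod.distrib[symmetric] by (intro prod.cong refl) simp
    moreover have "(\<Prod>j<n. \<Prod>i<j. - 1 :: complex) \<noteq> 0" by simp
    ultimately show ?thesis by simp
  next
    case False
    then have False': "\<not> inj_on \<theta>' {..<n}" using inj im by metis
    have z: "(\<Prod>j<n. \<Prod>i<j. (\<theta> i - \<theta> j)\<^sup>2) = 0" if "\<not> inj_on \<theta> {..<n}" for \<theta> :: "nat \<Rightarrow> complex"
    proof -
      obtain i j where ij: "i < n" "j < n" "i \<noteq> j" "\<theta> i = \<theta> j" using \<open>\<not> inj_on \<theta> {..<n}\<close> by (auto simp: inj_on_def)
      have "\<exists>j<n. \<exists>i<j. \<theta> i = \<theta> j"
        using ij by (metis linorder_neqE_nat)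
      then show ?thesis by auto
    qed
    show ?thesis by (simp only: z[OF False] z[OF False'])
  qed
qed

text \<open>Since f_0 is nonzero, so is every \<alpha>_i, and any factorisation has the same roots
  \<beta>_i / \<alpha>_i up to order. Each \<alpha>_i occurs in n - 1 pairs, which after squaring
  produces f_0^(2n-2).\<close>

lemma disc_eq:
  fixes \<theta> :: "nat \<Rightarrow> complex"
  assumes f0: "f 0 \<noteq> 0" and n: "n > 0"
    and roots: "\<And>x. bform_eval n (\<lambda>i. of_int (f i)) x 1 = of_int (f 0) * (\<Prod>i<n. x - \<theta> i)"
  shows "disc n f = of_int (f 0) ^ (2 * n - 2) * (\<Prod>j<n. \<Prod>i<j. (\<theta> i - \<theta> j)\<^sup>2)"
  unfolding disc_def
proof (rule the_equality)
  let ?c = "\<lambda>i. of_int (f i) :: complex"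
  have val: "(\<Prod>j<n. \<Prod>i<j. (\<alpha> i * \<beta> j - \<alpha> j * \<beta> i)\<^sup>2) = of_int (f 0) ^ (2 * n - 2) * (\<Prod>j<n. \<Prod>i<j. (\<theta> i - \<theta> j)\<^sup>2)"
    if fac: "bform n ?c = (\<Prod>i<n. const2 (\<alpha> i) * var_x - const2 (\<beta> i) * var_y)" for \<alpha> \<beta> :: "nat \<Rightarrow> complex"
  proof -
    have zpoly_at: "bform_eval n ?c x y = (\<Prod>i<n. \<alpha> i * x - \<beta> i * y)" for x y
      using arg_cong[OF fac, of "\<lambda>P. eval2 P x y"] by simp
    have "bform_eval n ?c 1 0 = (\<Sum>i\<le>n. if i = 0 then ?c i else 0)"
      unfolding bform_eval_def by (intro sum.cong) auto
    then have pa: "(\<Prod>i<n. \<alpha> i) = of_int (f 0)" using zpoly_at[of 1 0] by simp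
    have a0: "\<alpha> i \<noteq> 0" if "i < n" for i
    proof
      assume "\<alpha> i = 0"
      then have "(\<Prod>i<n. \<alpha> i) = 0" using that by auto
      then show False using pa f0 by simp
    qed
    define \<theta>' where "\<theta>' i = \<beta> i / \<alpha> i" for i
    have b: "\<beta> i = \<alpha> i * \<theta>' i" if "i < n" for i using a0[OF that] by (simp add: \<theta>'_def)
    have "(\<Prod>i<n. x - \<theta>' i) = (\<Prod>i<n. x - \<theta> i)" for x
    proof -
      have "bform_eval n ?c x 1 = (\<Prod>i<n. \<alpha> i * (x - \<theta>' i))"
        unfolding zpoly_at by (intro prod.cong refl) (simp add: b right_diff_distrib)
      also have "\<dots> = of_int (f 0) * (\<Prod>i<n. x - \<theta>' i)" by (simp add: prod.distrib pa)
      finally show ?thesis using roots[of x] f0 by simp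
    qed
    then have same: "(\<Prod>j<n. \<Prod>i<j. (\<theta>' i - \<theta>' j)\<^sup>2) = (\<Prod>j<n. \<Prod>i<j. (\<theta> i - \<theta> j)\<^sup>2)"
      by (rule roots_square_prod_unique)
    have "(\<Prod>j<n. \<Prod>i<j. (\<alpha> i * \<beta> j - \<alpha> j * \<beta> i)\<^sup>2) = (\<Prod>j<n. \<Prod>i<j. (\<alpha> i * \<alpha> j)\<^sup>2 * (\<theta>' i - \<theta>' j)\<^sup>2)"
    proof (intro prod.cong refl)
      fix j i assume "j \<in> {..<n}" "i \<in> {..<j}"
      then have "i < n" "j < n" by auto
      then show "(\<alpha> i * \<beta> j - \<alpha> j * \<beta> i)\<^sup>2 = (\<alpha> i * \<alpha> j)\<^sup>2 * (\<theta>' i - \<theta>' j)\<^sup>2"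
        unfolding b[OF \<open>i < n\<close>] b[OF \<open>j < n\<close>] by (simp add: power2_eq_square algebra_simps)
    qed
    also have "\<dots> = (\<Prod>j<n. \<Prod>i<j. \<alpha> i * \<alpha> j)\<^sup>2 * (\<Prod>j<n. \<Prod>i<j. (\<theta>' i - \<theta>' j)\<^sup>2)"
      by (rule prod_pairs_square)
    also have "(\<Prod>j<n. \<Prod>i<j. \<alpha> i * \<alpha> j)\<^sup>2 = of_int (f 0) ^ (2 * n - 2)"
    proof -
      have "(n - 1) * 2 = 2 * n - 2" using n by simp
      then show ?thesis unfolding prod_pairs_product pa power_mult[symmetric] by simp
    qed
    finally show ?thesis by (simp only: same)
  qed
  show "d = of_int (f 0) ^ (2 * n - 2) * (\<Prod>j<n. \<Prod>i<j. (\<theta> i - \<theta> j)\<^sup>2)"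
    if "\<exists>\<alpha> \<beta>. bform n ?c = (\<Prod>i<n. const2 (\<alpha> i) * var_x - const2 (\<beta> i) * var_y) \<and>
      d = (\<Prod>j<n. \<Prod>i<j. (\<alpha> i * \<beta> j - \<alpha> j * \<beta> i)\<^sup>2)" for d
    using that val by blast
  define \<alpha> where "\<alpha> i = (if i = 0 then of_int (f 0) else 1 :: complex)" for i :: nat
  have pa: "(\<Prod>i<n. \<alpha> i) = of_int (f 0)"
    using n unfolding \<alpha>_def by (subst prod.delta) auto
  have fac: "bform n ?c = (\<Prod>i<n. const2 (\<alpha> i) * var_x - const2 (\<alpha> i * \<theta> i) * var_y)"
  proof (rule form_eqI[of n _ _ "{}"])
    show "is_form n (\<Prod>i<n. const2 (\<alpha> i) * var_x - const2 (\<alpha> i * \<theta> i) * var_y)"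
      using is_form_prod[of "{..<n}" "\<lambda>_. 1", OF _ is_form_linear] by simp
    fix x
    have "eval2 (\<Prod>i<n. const2 (\<alpha> i) * var_x - const2 (\<alpha> i * \<theta> i) * var_y) x 1 = (\<Prod>i<n. \<alpha> i * (x - \<theta> i))"
      by (simp add: right_diff_distrib)
    then show "eval2 (bform n ?c) x 1 = eval2 (\<Prod>i<n. const2 (\<alpha> i) * var_x - const2 (\<alpha> i * \<theta> i) * var_y) x 1"
      using roots[of x] by (simp add: prod.distrib pa)
  qed simp_all
  show "\<exists>\<alpha> \<beta>. bform n ?c = (\<Prod>i<n. const2 (\<alpha> i) * var_x - const2 (\<beta> i) * var_y) \<and>
      of_int (f 0) ^ (2 * n - 2) * (\<Prod>j<n. \<Prod>i<j. (\<theta> i - \<theta> j)\<^sup>2) = (\<Prod>j<n. \<Prod>i<j. (\<alpha> i * \<beta> j - \<alpha> j * \<beta> i)\<^sup>2)"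
    by (intro exI[of _ \<alpha>] exI[of _ "\<lambda>i. \<alpha> i * \<theta> i"] conjI fac val[OF fac, symmetric])
qed

lemma max_coeff_ge: "i \<le> n \<Longrightarrow> \<bar>f i\<bar> \<le> max_coeff n f"
  unfolding max_coeff_def by (rule Max_ge) auto

lemma sum_list_square_le:
  fixes xs :: "complex list"
  assumes "\<And>a. a \<in> set xs \<Longrightarrow> cmod a \<le> H" shows "(\<Sum>a\<leftarrow>xs. (cmod a)\<^sup>2) \<le> real (length xs) * H\<^sup>2"
  using assms
proof (induction xs)
  case (Cons a xs)
  have "(cmod a)\<^sup>2 \<le> H\<^sup>2" using Cons.prems[of a] by (intro power_mono) auto
  then show ?case using Cons by (simp add: algebra_simps)
qed simp

text \<open>The left side of the bound is the Mahler measure of the form, which Landau's inequality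
  bounds by the Euclidean norm of the coefficients; n + 1 is a coarse substitute for sqrt (n +
  1).\<close>

lemma form_roots:
  assumes f0: "f 0 \<noteq> 0"
  shows "\<exists>\<theta>::nat \<Rightarrow> complex. (\<forall>x. bform_eval n (\<lambda>i. of_int (f i)) x 1 = of_int (f 0) * (\<Prod>i<n. x - \<theta> i)) \<and>
    cmod (of_int (f 0)) * (\<Prod>i<n. max 1 (cmod (\<theta> i))) \<le> (real n + 1) * real_of_int (max_coeff n f)"
proof -
  let ?c = "\<lambda>i. of_int (f i) :: complex"
  define p where "p = dehomogenize 0 n ?c"
  have pe: "poly p x = bform_eval n ?c x 1" for x by (simp add: p_def poly_dehomogenize)
  have "coeff p n = (\<Sum>i\<le>n. if i = 0 then ?c i else 0)"
    unfolding p_def coeff_dehomogenize_top bform_eval_def by (intro sum.cong) auto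
  then have cn: "coeff p n = of_int (f 0)" by simp
  have dp: "degree p = n"
    using degree_dehomogenize[of 0 n ?c] le_degree[of p n] cn f0 by (simp add: p_def)
  have p0: "p \<noteq> 0" using cn f0 by auto
  define as where "as = complex_roots_complex p"
  have as: "smult (of_int (f 0)) (\<Prod>a\<leftarrow>as. [:- a, 1:]) = p" "length as = n"
    using complex_roots[of p] by (simp_all add: as_def dp cn)
  define \<theta> where "\<theta> i = as ! i" for i
  have "bform_eval n ?c x 1 = of_int (f 0) * (\<Prod>i<n. x - \<theta> i)" for x
  proof -
    have "bform_eval n ?c x 1 = of_int (f 0) * poly (\<Prod>a\<leftarrow>as. [:- a, 1:]) x"
      unfolding pe[symmetric] as(1)[symmetric] by simp
    also have "poly (\<Prod>a\<leftarrow>as. [:- a, 1:]) x = (\<Prod>a\<leftarrow>as. x - a)" by (induction as) (simp_all add: algebra_simps)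
    also have "\<dots> = (\<Prod>i<n. x - \<theta> i)" by (simp add: prod.list_conv_set_nth as(2) \<theta>_def atLeast0LessThan cong: prod.cong_simp)
    finally show ?thesis .
  qed
  moreover have "cmod (of_int (f 0)) * (\<Prod>i<n. max 1 (cmod (\<theta> i))) \<le> (real n + 1) * real_of_int (max_coeff n f)"
  proof -
    let ?H = "real_of_int (max_coeff n f)"
    have H0: "?H \<ge> 0" using max_coeff_ge[of 0 n f] by simp
    have "cmod (of_int (f 0)) * (\<Prod>i<n. max 1 (cmod (\<theta> i))) = mahler_measure_poly p"
      unfolding mahler_measure_poly_def as_def[symmetric]
      by (simp add: dp cn prod.list_conv_set_nth as(2) \<theta>_def atLeast0LessThan cong: prod.cong_simp)
    also have "\<dots> \<le> l2norm_complex p" by (rule Landau_inequality)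
    also have "\<dots> \<le> (real n + 1) * ?H"
    proof (rule real_le_lsqrt)
      have c: "cmod (coeff p j) \<le> ?H" for j
      proof -
        have "coeff p j = (\<Sum>i\<le>n. if n - i = j then ?c i else 0)"
          unfolding p_def dehomogenize_def coeff_sum
        proof (intro sum.cong refl)
          fix i
          have "[:0, 1:] ^ (n - i) * [:1, 0:] ^ i = (monom 1 (n - i) :: complex poly)" by (simp add: monom_altdef flip: one_pCons)
          then show "coeff (smult (?c i) ([:0, 1:] ^ (n - i) * [:1, 0:] ^ i)) j = (if n - i = j then ?c i else 0)"
            by (simp only: coeff_smult coeff_monom) simp
        qed
        also have "\<dots> = (\<Sum>i\<le>n. if i = n - j then (if j \<le> n then ?c (n - j) else 0) else 0)"
          by (intro sum.cong refl) auto
        also have "\<dots> = (if j \<le> n then ?c (n - j) else 0)" by simp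
        finally have "cmod (coeff p j) = (if j \<le> n then real_of_int \<bar>f (n - j)\<bar> else 0)" by simp
        moreover have "real_of_int \<bar>f (n - j)\<bar> \<le> ?H" using max_coeff_ge[of "n - j" n f] by (simp only: of_int_le_iff)
        ultimately show ?thesis using H0 by simp
      qed
      have "norm2 p \<le> real (length (coeffs p)) * ?H\<^sup>2"
        by (rule sum_list_square_le) (use c in \<open>auto simp: coeffs_def split: if_splits\<close>)
      also have "\<dots> = (real n + 1) * ?H\<^sup>2" using p0 dp by (simp add: length_coeffs_degree)
      also have "\<dots> \<le> (real n + 1)\<^sup>2 * ?H\<^sup>2"
        by (intro mult_right_mono self_le_power) auto
      finally show "norm2 p \<le> ((real n + 1) * ?H)\<^sup>2" by (simp add: power_mult_distrib)
      show "0 \<le> (real n + 1) * ?H" using H0 by simp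
    qed
    finally show ?thesis .
  qed
  ultimately show ?thesis by blast
qed

lemma form_family_roots:
  assumes f: "f \<in> form_family n \<delta> Xb" and n: "n \<ge> 2"
  shows "\<exists>\<theta>::nat \<Rightarrow> complex. f 0 \<noteq> 0 \<and> inj_on \<theta> {..<n} \<and>
    (\<forall>x. bform_eval n (\<lambda>i. of_int (f i)) x 1 = of_int (f 0) * (\<Prod>i<n. x - \<theta> i)) \<and>
    cmod (of_int (f 0)) * (\<Prod>i<n. max 1 (cmod (\<theta> i))) \<le> (real n + 1) * real_of_int (max_coeff n f) \<and>
    cmod (disc n f) = cmod (of_int (f 0)) ^ (2 * n - 2) * (\<Prod>j<n. \<Prod>i\<in>{..<n} - {j}. cmod (\<theta> j - \<theta> i))"
proof -
  have f0: "f 0 \<noteq> 0" using f n by (intro lead_coeff_nonzero[of n]) (auto simp: form_family_def)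
  obtain \<theta> :: "nat \<Rightarrow> complex" where th: "\<And>x. bform_eval n (\<lambda>i. of_int (f i)) x 1 = of_int (f 0) * (\<Prod>i<n. x - \<theta> i)"
    and M: "cmod (of_int (f 0)) * (\<Prod>i<n. max 1 (cmod (\<theta> i))) \<le> (real n + 1) * real_of_int (max_coeff n f)"
    using form_roots[of f n, OF f0] by blast
  have d: "disc n f = of_int (f 0) ^ (2 * n - 2) * (\<Prod>j<n. \<Prod>i<j. (\<theta> i - \<theta> j)\<^sup>2)"
    using n by (intro disc_eq[OF f0 _ th]) auto
  have "disc n f \<noteq> 0" using f by (simp add: form_family_def)
  then have ne: "\<theta> i \<noteq> \<theta> j" if "i < j" "j < n" for i j using that d by auto
  have "inj_on \<theta> {..<n}"
  proof (rule inj_onI)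
    fix i j assume "i \<in> {..<n}" "j \<in> {..<n}" "\<theta> i = \<theta> j"
    then show "i = j" using ne[of i j] ne[of j i] by (cases i j rule: linorder_cases) auto
  qed
  moreover have "cmod (disc n f) = cmod (of_int (f 0)) ^ (2 * n - 2) * (\<Prod>j<n. \<Prod>i\<in>{..<n} - {j}. cmod (\<theta> j - \<theta> i))"
  proof -
    have "cmod (\<Prod>j<n. \<Prod>i\<in>{..<n} - {j}. \<theta> j - \<theta> i) = cmod (\<Prod>j<n. \<Prod>i<j. (\<theta> i - \<theta> j)\<^sup>2)"
      unfolding prod_pairs by (simp add: prod_norm[symmetric])
    then show ?thesis unfolding d by (simp add: norm_mult norm_power prod_norm[symmetric])
  qed
  ultimately show ?thesis using f0 th M by blast
qed

text \<open>Split the product over ordered pairs as D^2 R, with D the factors at i and R the pairs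
  avoiding i. Each of the (n-1)(n-2) factors of R is at most 2 mm_j mm_l, and every index other than
  i occurs in 2(n-2) of them; the powers of mm_i on the left complete these to powers of the Mahler
  measure.\<close>

lemma separation_bound:
  fixes \<theta> :: "nat \<Rightarrow> complex" and n :: nat and a :: real
  defines "mm \<equiv> \<lambda>i. max 1 (cmod (\<theta> i))"
  assumes i: "i < n" and n: "n \<ge> 3" and a: "a \<ge> 0"
  shows "mm i ^ (2 * (n - 2)) * (a ^ (2 * n - 2) * (\<Prod>j<n. \<Prod>l\<in>{..<n} - {j}. cmod (\<theta> j - \<theta> l)))
    \<le> 2 ^ ((n - 2) * (n - 1)) * (a * (\<Prod>l\<in>{..<n} - {i}. cmod (\<theta> i - \<theta> l)))\<^sup>2 * (a * (\<Prod>j<n. mm j)) ^ (2 * (n - 2))"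
proof -
  define N where "N = {..<n} - {i}"
  define c where "c a b = cmod (\<theta> a - \<theta> b)" for a b
  define D where "D = (\<Prod>l\<in>N. c i l)"
  define P where "P = (\<Prod>l\<in>N. mm l)"
  define R where "R = (\<Prod>j\<in>N. \<Prod>l\<in>N - {j}. c j l)"
  have fN: "finite N" and cN: "card N = n - 1" using i by (simp_all add: N_def)
  have m1: "mm l \<ge> 1" for l by (simp add: mm_def)
  have un: "{..<n} = insert i N" "i \<notin> N" using i by (auto simp: N_def)
  have full: "(\<Prod>j<n. \<Prod>l\<in>{..<n} - {j}. c j l) = D\<^sup>2 * R"
  proof -
    have "(\<Prod>j<n. \<Prod>l\<in>{..<n} - {j}. c j l) = D * (\<Prod>j\<in>N. \<Prod>l\<in>{..<n} - {j}. c j l)"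
      unfolding D_def N_def using i by (subst prod.remove[of "{..<n}" i]) auto
    also have "(\<Prod>j\<in>N. \<Prod>l\<in>{..<n} - {j}. c j l) = (\<Prod>j\<in>N. c j i * (\<Prod>l\<in>N - {j}. c j l))"
    proof (rule prod.cong[OF refl])
      fix j assume "j \<in> N"
      then have "{..<n} - {j} = insert i (N - {j})" "i \<notin> N - {j}" using i by (auto simp: N_def)
      then show "(\<Prod>l\<in>{..<n} - {j}. c j l) = c j i * (\<Prod>l\<in>N - {j}. c j l)" using fN by simp
    qed
    also have "\<dots> = D * R" unfolding prod.distrib D_def R_def by (simp add: c_def norm_minus_commute)
    finally show ?thesis by (simp add: power2_eq_square)
  qed
  have R: "R \<le> 2 ^ ((n - 2) * (n - 1)) * P ^ (2 * (n - 2))"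
  proof -
    have "R \<le> (\<Prod>j\<in>N. 2 ^ (n - 2) * mm j ^ (n - 3) * P)"
      unfolding R_def
    proof (rule prod_mono, intro conjI)
      fix j assume j: "j \<in> N"
      show "0 \<le> (\<Prod>l\<in>N - {j}. c j l)" by (intro prod_nonneg) (simp add: c_def)
      have "(\<Prod>l\<in>N - {j}. c j l) \<le> (\<Prod>l\<in>N - {j}. 2 * mm j * mm l)"
      proof (rule prod_mono, intro conjI)
        fix l
        show "0 \<le> c j l" by (simp add: c_def)
        have "c j l \<le> cmod (\<theta> j) + cmod (\<theta> l)" unfolding c_def by (rule norm_triangle_ineq4)
        also have "\<dots> \<le> mm j + mm l" by (intro add_mono) (simp_all add: mm_def)
        also have "\<dots> \<le> mm j * mm l + mm j * mm l"
          using m1[of j] m1[of l] by (intro add_mono) (simp_all add: mult_le_cancel_left1 mult_le_cancel_right1)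
        finally show "c j l \<le> 2 * mm j * mm l" by simp
      qed
      also have "\<dots> = (2 * mm j) ^ (n - 2) * (\<Prod>l\<in>N - {j}. mm l)"
        using j fN cN by (simp add: prod.distrib diff_diff_eq numeral_2_eq_2)
      \<comment> \<open>One factor mm_j is split off to complete the product over the remaining
        indices to P.\<close>
      also have "(2 * mm j) ^ (n - 2) = 2 ^ (n - 2) * mm j ^ (n - 3) * mm j"
      proof -
        have "n - 2 = Suc (n - 3)" using n by simp
        then show ?thesis by (simp add: power_mult_distrib)
      qed
      also have "2 ^ (n - 2) * mm j ^ (n - 3) * mm j * (\<Prod>l\<in>N - {j}. mm l) = 2 ^ (n - 2) * mm j ^ (n - 3) * P"
        unfolding P_def using prod.remove[OF fN j, of mm] by simp
      finally show "(\<Prod>l\<in>N - {j}. c j l) \<le> 2 ^ (n - 2) * mm j ^ (n - 3) * P" .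
    qed
    also have "\<dots> = (2 ^ (n - 2)) ^ (n - 1) * (P ^ (n - 3) * P ^ (n - 1))"
      by (simp add: prod.distrib cN prod_power_distrib P_def)
    also have "P ^ (n - 3) * P ^ (n - 1) = P ^ (2 * (n - 2))"
    proof -
      have "(n - 3) + (n - 1) = 2 * (n - 2)" using n by simp
      then show ?thesis by (simp flip: power_add)
    qed
    finally show ?thesis by (simp add: power_mult)
  qed
  have pm: "(\<Prod>j<n. mm j) = mm i * P" using un(2) fN by (subst un(1)) (simp add: P_def)
  have ap: "a ^ (2 * n - 2) = a\<^sup>2 * a ^ (2 * (n - 2))"
  proof -
    have "2 * n - 2 = 2 + 2 * (n - 2)" using n by simp
    then show ?thesis by (simp only: power_add)
  qed
  have "mm i ^ (2 * (n - 2)) * (a ^ (2 * n - 2) * (D\<^sup>2 * R))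
    \<le> mm i ^ (2 * (n - 2)) * (a ^ (2 * n - 2) * (D\<^sup>2 * (2 ^ ((n - 2) * (n - 1)) * P ^ (2 * (n - 2)))))"
    using R a m1[of i] by (intro mult_left_mono) auto
  also have "\<dots> = 2 ^ ((n - 2) * (n - 1)) * (a * D)\<^sup>2 * (a * (mm i * P)) ^ (2 * (n - 2))"
    unfolding ap power_mult_distrib by (simp only: mult_ac)
  finally show ?thesis unfolding full[unfolded c_def] pm D_def N_def c_def .
qed

lemma bform_eval_bound:
  fixes u :: "nat \<Rightarrow> int"
  shows "cmod (bform_eval d (\<lambda>i. of_int (u i)) z 1) \<le> (real d + 1) * real_of_int (max_coeff d u) * max 1 (cmod z) ^ d"
proof -
  have "cmod (bform_eval d (\<lambda>i. of_int (u i)) z 1) \<le> (\<Sum>i\<le>d. cmod (of_int (u i) * z ^ (d - i)))"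
    unfolding bform_eval_def by (rule order.trans[OF norm_sum]) simp
  also have "\<dots> \<le> (\<Sum>i\<le>d. real_of_int (max_coeff d u) * max 1 (cmod z) ^ d)"
  proof (rule sum_mono)
    fix i assume "i \<in> {..d}"
    then have "\<bar>u i\<bar> \<le> max_coeff d u" unfolding max_coeff_def by (intro Max_ge) auto
    moreover have "cmod z ^ (d - i) \<le> max 1 (cmod z) ^ d"
    proof -
      have "cmod z ^ (d - i) \<le> max 1 (cmod z) ^ (d - i)" by (intro power_mono) auto
      also have "\<dots> \<le> max 1 (cmod z) ^ d" by (intro power_increasing) auto
      finally show ?thesis .
    qed
    ultimately show "cmod (of_int (u i) * z ^ (d - i)) \<le> real_of_int (max_coeff d u) * max 1 (cmod z) ^ d"
      unfolding norm_mult norm_power by (intro mult_mono) auto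
  qed
  finally show ?thesis by (simp add: mult.assoc algebra_simps)
qed

text \<open>In the constant, one factor n counts the summands of S, the other comes from the bound
  on U, and 2^(n * n) absorbs the power of 2 in \<open>separation_bound\<close>. The coefficient of
  log X is n(n-2) - 1 - n(n-1) + n \<delta> / 2 = -(n+1) + n \<delta> / 2.\<close>

lemma height_inequality:
  fixes \<theta> :: "nat \<Rightarrow> complex" and n :: nat and a Hu Xb \<delta> d :: real and U :: "nat \<Rightarrow> complex"
  defines "mm \<equiv> \<lambda>i. max 1 (cmod (\<theta> i))"
  defines "S \<equiv> (\<Sum>i<n. mm i * cmod (U i) / (a * (\<Prod>l\<in>{..<n} - {i}. cmod (\<theta> i - \<theta> l))))"
  defines "M \<equiv> a * (\<Prod>i<n. mm i)"
  defines "d \<equiv> a ^ (2 * n - 2) * (\<Prod>j<n. \<Prod>l\<in>{..<n} - {j}. cmod (\<theta> j - \<theta> l))"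
  assumes n: "n \<ge> 3" and a: "a > 0" and inj: "inj_on \<theta> {..<n}"
    and U: "\<And>i. i < n \<Longrightarrow> cmod (U i) \<le> real n * Hu * mm i ^ (n - 3)" and U0: "i0 < n" "U i0 \<noteq> 0"
    and Hu: "Hu \<ge> 1" and X1: "Xb > 1" and \<delta>: "\<delta> > 0"
    and M: "M \<le> (real n + 1) * Xb" and d: "d \<ge> Xb powr (2 * real n - 2 - \<delta>)"
  shows "real n * ln S - ln M \<le> real n * ln Hu - (real n + 1) * ln Xb + real n * \<delta> * ln Xb
    + (real n * ln (real n * real n * 2 ^ (n * n)) + (real n * (real n - 2) - 1) * ln (real n + 1))"
proof -
  define \<Delta> where "\<Delta> i = a * (\<Prod>l\<in>{..<n} - {i}. cmod (\<theta> i - \<theta> l))" for i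
  define C where "C = (2::real) ^ (n * n)"
  have \<Delta>0: "\<Delta> i > 0" if "i < n" for i
  proof -
    have "\<theta> i \<noteq> \<theta> l" if "l \<in> {..<n} - {i}" for l using inj that \<open>i < n\<close> by (auto dest: inj_onD)
    then show ?thesis unfolding \<Delta>_def using a by (intro mult_pos_pos prod_pos) auto
  qed
  have m1: "mm i \<ge> 1" for i by (simp add: mm_def)
  have M0: "M > 0" unfolding M_def using a m1 by (intro mult_pos_pos prod_pos) (auto simp: mm_def)
  have d0: "d > 0" using d X1 by (metis powr_gt_zero less_le_trans less_numeral_extra(1) less_trans less_irrefl)
  have C0: "C > 0" by (simp add: C_def)
  \<comment> \<open>The power n - 2 is exactly what a summand of S carries: one factor from the
    Hermitian form and n - 3 from the size of U at a root.\<close>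
  have sep: "mm i ^ (n - 2) / \<Delta> i \<le> C * M ^ (n - 2) / sqrt d" if i: "i < n" for i
  proof -
    have "(mm i ^ (n - 2) * sqrt d)\<^sup>2 = mm i ^ (2 * (n - 2)) * d"
      using d0 by (simp add: power_mult_distrib mult.commute flip: power_mult)
    also have "\<dots> \<le> 2 ^ ((n - 2) * (n - 1)) * (\<Delta> i)\<^sup>2 * M ^ (2 * (n - 2))"
      unfolding d_def \<Delta>_def M_def mm_def by (rule separation_bound[OF i n]) (use a in simp)
    also have "\<dots> \<le> C\<^sup>2 * (\<Delta> i)\<^sup>2 * M ^ (2 * (n - 2))"
    proof -
      have "(n - 2) * (n - 1) \<le> n * n * 2" by (rule order.trans[OF mult_le_mono[of "n - 2" n "n - 1" n]]) auto
      then have "(2::real) ^ ((n - 2) * (n - 1)) \<le> C\<^sup>2"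
        unfolding C_def power_mult[symmetric] by (intro power_increasing) auto
      then show ?thesis using M0 by (intro mult_right_mono) auto
    qed
    also have "\<dots> = (C * \<Delta> i * M ^ (n - 2))\<^sup>2"
      by (simp add: power_mult_distrib mult.commute flip: power_mult)
    finally have "mm i ^ (n - 2) * sqrt d \<le> C * \<Delta> i * M ^ (n - 2)"
      by (rule power2_le_imp_le) (use C0 \<Delta>0[OF i] M0 in simp)
    then show ?thesis using \<Delta>0[OF i] d0 by (simp add: field_simps)
  qed
  define T where "T = real n * real n * C * Hu * M ^ (n - 2) / sqrt d"
  have "S \<le> (\<Sum>i<n. real n * Hu * (C * M ^ (n - 2) / sqrt d))"
    unfolding S_def
  proof (rule sum_mono)
    fix i assume "i \<in> {..<n}"
    then have i: "i < n" by simp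
    have "mm i * cmod (U i) / \<Delta> i \<le> mm i * (real n * Hu * mm i ^ (n - 3)) / \<Delta> i"
      using U[OF i] m1[of i] \<Delta>0[OF i] by (intro divide_right_mono mult_left_mono) auto
    also have "\<dots> = real n * Hu * (mm i ^ (n - 2) / \<Delta> i)"
    proof -
      have "n - 2 = Suc (n - 3)" using n by simp
      then show ?thesis by simp
    qed
    also have "\<dots> \<le> real n * Hu * (C * M ^ (n - 2) / sqrt d)"
      using sep[OF i] Hu by (intro mult_left_mono) auto
    finally show "mm i * cmod (U i) / (a * (\<Prod>l\<in>{..<n} - {i}. cmod (\<theta> i - \<theta> l))) \<le> real n * Hu * (C * M ^ (n - 2) / sqrt d)"
      unfolding \<Delta>_def .
  qed
  also have "\<dots> = T" by (simp add: T_def)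
  finally have ST: "S \<le> T" .
  have S0: "S > 0"
  proof -
    have nn: "mm i * cmod (U i) / \<Delta> i \<ge> 0" if "i < n" for i
      using m1[of i] \<Delta>0[OF that] by (intro divide_nonneg_nonneg mult_nonneg_nonneg) auto
    have "0 < mm i0 * cmod (U i0) / \<Delta> i0" using m1[of i0] \<Delta>0[OF U0(1)] U0(2) by (intro divide_pos_pos mult_pos_pos) auto
    also have "\<dots> \<le> S" unfolding S_def \<Delta>_def[symmetric]
      by (rule member_le_sum) (use U0(1) nn in auto)
    finally show ?thesis .
  qed
  let ?L = "ln Xb"
  have L0: "?L > 0" using X1 by simp
  have "ln S \<le> ln T" using ST S0 by simp
  also have "ln T = ln (real n * real n * C) + ln Hu + (real n - 2) * ln M - ln d / 2"
  proof -
    have "ln T = ln (real n * real n * C * Hu * M ^ (n - 2)) - ln (sqrt d)"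
      unfolding T_def using n C0 Hu M0 d0 by (subst ln_divide_pos) auto
    also have "ln (real n * real n * C * Hu * M ^ (n - 2)) = ln (real n * real n * C) + ln Hu + ln (M ^ (n - 2))"
      using n C0 Hu M0 by (simp add: ln_mult)
    also have "ln (M ^ (n - 2)) = (real n - 2) * ln M" using n M0 by (simp add: ln_realpow of_nat_diff)
    finally show ?thesis using d0 by (simp add: ln_sqrt)
  qed
  finally have lS: "ln S \<le> ln (real n * real n * C) + ln Hu + (real n - 2) * ln M - ln d / 2" .
  have lM: "ln M \<le> ln (real n + 1) + ?L"
  proof -
    have "ln M \<le> ln ((real n + 1) * Xb)" using M M0 by simp
    then show ?thesis using X1 by (simp add: ln_mult)
  qed
  have ld: "(2 * real n - 2 - \<delta>) * ?L \<le> ln d"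
  proof -
    have "ln (Xb powr (2 * real n - 2 - \<delta>)) = (2 * real n - 2 - \<delta>) * ?L" using X1 by (simp add: ln_powr)
    moreover have "ln (Xb powr (2 * real n - 2 - \<delta>)) \<le> ln d" using d X1 d0 by (subst ln_le_cancel_iff) auto
    ultimately show ?thesis by simp
  qed
  have n3: "real n \<ge> 3" using n by simp
  \<comment> \<open>The total coefficient of ln M must be nonnegative for the upper bound
    \<open>lM\<close> to be inserted.\<close>
  have q: "real n * (real n - 2) - 1 \<ge> 0"
  proof -
    have "3 * 1 \<le> real n * (real n - 2)" using n3 by (intro mult_mono) auto
    then show ?thesis by simp
  qed
  have "real n * ln S - ln M
    \<le> real n * (ln (real n * real n * C) + ln Hu + (real n - 2) * ln M - ln d / 2) - ln M"
    using mult_left_mono[OF lS, of "real n"] by simp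
  also have "\<dots> = real n * ln (real n * real n * C) + real n * ln Hu + (real n * (real n - 2) - 1) * ln M - real n / 2 * ln d"
    by (simp add: algebra_simps)
  also have "\<dots> \<le> real n * ln (real n * real n * C) + real n * ln Hu + (real n * (real n - 2) - 1) * (ln (real n + 1) + ?L)
      - real n / 2 * ((2 * real n - 2 - \<delta>) * ?L)"
    using mult_left_mono[OF lM q] mult_left_mono[OF ld, of "real n / 2"] by simp
  also have "\<dots> = real n * ln Hu - (real n + 1) * ?L + real n * \<delta> * ?L / 2
    + (real n * ln (real n * real n * C) + (real n * (real n - 2) - 1) * ln (real n + 1))"
    by (simp add: field_simps)
  \<comment> \<open>The estimate gives n \<delta> / 2; the other half is given away.\<close>
  also have "\<dots> \<le> real n * ln Hu - (real n + 1) * ?L + real n * \<delta> * ?L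
    + (real n * ln (real n * real n * C) + (real n * (real n - 2) - 1) * ln (real n + 1))"
  proof -
    have "real n * \<delta> * ?L \<ge> 0" using \<delta> L0 by simp
    then show ?thesis by linarith
  qed
  finally show ?thesis unfolding C_def .
qed

section \<open>The pair of matrices attached to a divisor\<close>

text \<open>Every term of the Leibniz formula is a product of n linear forms. Homogeneity allows
  \<open>exists_pair\<close> to compare with f on the line y = 1 only.\<close>

lemma is_form_pencil_det:
  assumes A: "A \<in> carrier_mat n n" and B: "B \<in> carrier_mat n n"
  shows "is_form n (pencil_det n A B)"
proof -
  let ?M = "var_x \<cdot>\<^sub>m map_mat const2 A - var_y \<cdot>\<^sub>m map_mat const2 B"
  have M: "?M \<in> carrier_mat n n" using A B by auto
  have prod: "is_form n (\<Prod>i = 0..<n. ?M $$ (i, p i))" if "p permutes {0..<n}" for p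
  proof -
    have "is_form (\<Sum>i = 0..<n. 1) (\<Prod>i = 0..<n. ?M $$ (i, p i))"
    proof (rule is_form_prod)
      fix i assume i: "i \<in> {0..<n}"
      then have "p i \<in> {0..<n}" using permutes_in_image[OF that] by simp
      then have "?M $$ (i, p i) = const2 (A $$ (i, p i)) * var_x - const2 (B $$ (i, p i)) * var_y"
        using A B i by (simp add: mult.commute)
      then show "is_form 1 (?M $$ (i, p i))" using is_form_linear by simp
    qed simp
    then show ?thesis by simp
  qed
  have sgn: "is_form n (signof p * P)" if "is_form n P" for p :: "nat \<Rightarrow> nat" and P :: "'a poly poly"
    using is_form_const_mult[OF that, of "signof p"] that is_form_const_mult[OF that, of "- 1"]
    by (auto simp: sign_def const2_uminus)
  have "is_form n (Determinant.det ?M)"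
    unfolding det_def'[OF M] by (intro is_form_sum sgn prod) simp
  then have "is_form n (const2 ((- 1) ^ (n * (n - 1) div 2)) * Determinant.det ?M)" by (rule is_form_const_mult)
  moreover have "const2 ((- 1) ^ k) = ((- 1) ^ k :: 'a poly poly)" for k
    by (induction k) (simp_all add: const2_uminus const2_mult)
  ultimately show ?thesis by (simp only: pencil_det_def)
qed

lemma eval2_pencil_det:
  assumes A: "A \<in> carrier_mat n n" and B: "B \<in> carrier_mat n n"
  shows "eval2 (pencil_det n A B) x y = (- 1) ^ (n * (n - 1) div 2) * Determinant.det (x \<cdot>\<^sub>m A - y \<cdot>\<^sub>m B)"
proof -
  interpret h: comm_ring_hom "\<lambda>P. eval2 P x y" by unfold_locales simp_all
  have "map_mat (\<lambda>P. eval2 P x y) (var_x \<cdot>\<^sub>m map_mat const2 A - var_y \<cdot>\<^sub>m map_mat const2 B) = x \<cdot>\<^sub>m A - y \<cdot>\<^sub>m B"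
    using A B by (intro eq_matI) auto
  then show ?thesis unfolding pencil_det_def by (simp add: h.hom_det[symmetric])
qed

lemma zpoly_at_dehomogenize: "zpoly_at x (dehomogenize t d c) = bform_eval d (\<lambda>i. of_int (c i)) x (1 + of_int t * x)"
  unfolding zpoly_at_def map_poly_dehomogenize poly_dehomogenize ..

text \<open>Replacing \<open>A\<close> by \<open>A + t B\<close> undoes the substitution \<open>y = 1 + t x\<close> in the pencil.\<close>

lemma unshift_pencil:
  fixes A0 B :: "int mat" and v :: "int vec"
  assumes A0: "A0 \<in> carrier_mat n n" and B: "B \<in> carrier_mat n n" and n: "n = m + 3"
    and det: "\<And>x c. det (x \<cdot>\<^sub>m map_mat complex_of_int A0 - map_mat of_int B
        + mat n n (\<lambda>(i, j). c * (of_int (v $ i) * of_int (v $ j))))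
      = e * (c * (1 + of_int t * x)\<^sup>2 * zpoly_at x (dehomogenize t m u) - zpoly_at x (dehomogenize t n f))"
  shows "det (x \<cdot>\<^sub>m map_mat complex_of_int (A0 + t \<cdot>\<^sub>m B) - map_mat of_int B
        + mat n n (\<lambda>(i, j). c * (of_int (v $ i) * of_int (v $ j))))
      = e * (c * bform_eval m (\<lambda>i. of_int (u i)) x 1 - bform_eval n (\<lambda>i. of_int (f i)) x 1)"
proof -
  let ?P = "map_mat complex_of_int (A0 + t \<cdot>\<^sub>m B)"
  let ?R = "mat n n (\<lambda>(i, j). c * (complex_of_int (v $ i) * of_int (v $ j)))"
  let ?Q = "map_mat complex_of_int B - ?R"
  let ?u = "\<lambda>i. complex_of_int (u i)" and ?f = "\<lambda>i. complex_of_int (f i)" and ?t = "complex_of_int t"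
  have PQ: "x \<cdot>\<^sub>m ?P - map_mat of_int B + ?R = x \<cdot>\<^sub>m ?P - ?Q" for x
    using A0 B by (intro eq_matI) auto
  define wp where "wp = smult e (smult c (dehomogenize 0 m ?u) - dehomogenize 0 n ?f)"
  have wp: "poly wp x = e * (c * bform_eval m ?u x 1 - bform_eval n ?f x 1)" for x
    by (simp add: wp_def poly_dehomogenize)
  show ?thesis unfolding PQ wp[symmetric]
  proof (rule det_eq_poly_of_cofinite)
    show "finite {x. 1 - ?t * x = 0}" by (rule finite_bad_shift)
    fix x assume "x \<notin> {x. 1 - ?t * x = 0}"
    then have q0: "1 - ?t * x \<noteq> 0" by simp
    define q where "q = 1 - ?t * x"
    define \<xi> where "\<xi> = x / q"
    have q: "q \<noteq> 0" using q0 by (simp add: q_def)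
    \<comment> \<open>x (A0 + t B) - B = x A0 - (1 - t x) B, and x = q \<xi>.\<close>
    have "x \<cdot>\<^sub>m ?P - ?Q = q \<cdot>\<^sub>m (\<xi> \<cdot>\<^sub>m map_mat complex_of_int A0 - map_mat of_int B
        + mat n n (\<lambda>(i, j). (c / q) * (of_int (v $ i) * of_int (v $ j))))"
    proof (rule eq_matI)
      fix i j assume "i < dim_row (q \<cdot>\<^sub>m (\<xi> \<cdot>\<^sub>m map_mat complex_of_int A0 - map_mat of_int B
        + mat n n (\<lambda>(i, j). (c / q) * (of_int (v $ i) * of_int (v $ j)))))"
        "j < dim_col (q \<cdot>\<^sub>m (\<xi> \<cdot>\<^sub>m map_mat complex_of_int A0 - map_mat of_int B
        + mat n n (\<lambda>(i, j). (c / q) * (of_int (v $ i) * of_int (v $ j)))))"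
      then have ij: "i < n" "j < n" by auto
      have "(x \<cdot>\<^sub>m ?P - ?Q) $$ (i, j) = x * (of_int (A0 $$ (i, j)) + ?t * of_int (B $$ (i, j)))
          - (of_int (B $$ (i, j)) - c * (of_int (v $ i) * of_int (v $ j)))"
        using ij A0 B by simp
      also have "\<dots> = x * of_int (A0 $$ (i, j)) - q * of_int (B $$ (i, j)) + c * (of_int (v $ i) * of_int (v $ j))"
        by (simp add: q_def algebra_simps)
      also have "\<dots> = q * (\<xi> * of_int (A0 $$ (i, j)) - of_int (B $$ (i, j)) + (c / q) * (of_int (v $ i) * of_int (v $ j)))"
        using q by (simp add: \<xi>_def distrib_left right_diff_distrib)
      finally show "(x \<cdot>\<^sub>m ?P - ?Q) $$ (i, j) = (q \<cdot>\<^sub>m (\<xi> \<cdot>\<^sub>m map_mat complex_of_int A0 - map_mat of_int B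
        + mat n n (\<lambda>(i, j). (c / q) * (of_int (v $ i) * of_int (v $ j))))) $$ (i, j)"
        using ij A0 B by simp
    qed (use A0 B in auto)
    then have "det (x \<cdot>\<^sub>m ?P - ?Q) = q ^ n * det (\<xi> \<cdot>\<^sub>m map_mat complex_of_int A0 - map_mat of_int B
        + mat n n (\<lambda>(i, j). (c / q) * (of_int (v $ i) * of_int (v $ j))))"
      using A0 B by (simp add: det_smult)
    also have "\<dots> = q ^ n * (e * ((c / q) * (1 + ?t * \<xi>)\<^sup>2 * zpoly_at \<xi> (dehomogenize t m u) - zpoly_at \<xi> (dehomogenize t n f)))"
      by (simp only: det)
    \<comment> \<open>The exponents match because n = m + 3: c / q and (1 + t \<xi>)^2 use up three
      factors q, leaving q^m, which restores u(x, 1).\<close>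
    also have "1 + ?t * \<xi> = 1 / q" using q by (simp add: \<xi>_def q_def field_simps)
    also have "q ^ n * (e * ((c / q) * (1 / q)\<^sup>2 * zpoly_at \<xi> (dehomogenize t m u) - zpoly_at \<xi> (dehomogenize t n f)))
      = e * (c * (q ^ m * zpoly_at \<xi> (dehomogenize t m u)) - q ^ n * zpoly_at \<xi> (dehomogenize t n f))"
      using q by (simp add: n power_add power2_eq_square power3_eq_cube field_simps)
    also have "q ^ m * zpoly_at \<xi> (dehomogenize t m u) = bform_eval m ?u x 1"
      using form_at_shifted[OF is_form_bform q0, of m ?u] by (simp add: zpoly_at_dehomogenize q_def \<xi>_def)
    also have "q ^ n * zpoly_at \<xi> (dehomogenize t n f) = bform_eval n ?f x 1"
      using form_at_shifted[OF is_form_bform q0, of n ?f] by (simp add: zpoly_at_dehomogenize q_def \<xi>_def)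
    finally show "det (x \<cdot>\<^sub>m ?P - ?Q) = poly wp x" by (simp only: wp)
  qed (use A0 B in auto)
qed

lemma exists_pair:
  assumes g: "g \<ge> 1" and n: "n = 2 * g + 2" and D: "effective_divisor g f D" and m: "size D = 2 * g - 1"
    and u: "pushforward_form D u"
  shows "\<exists>A B w. (A, B) \<in> V_int n f \<and> w \<in> carrier_vec n \<and> primitive_vec w \<and>
    (\<forall>x c. det (x \<cdot>\<^sub>m map_mat complex_of_int A - map_mat of_int B
        + mat n n (\<lambda>(i, j). c * (of_int ((A *\<^sub>v w) $ i) * of_int ((A *\<^sub>v w) $ j))))
      = (- 1) ^ g * (c * bform_eval (2 * g - 1) (\<lambda>i. of_int (u i)) x 1 - bform_eval n (\<lambda>i. of_int (f i)) x 1))"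
proof -
  obtain t :: int and r s V h k where red: "dehomogenize t (2 * g - 1) u = r * s\<^sup>2" "degree r = 2 * h + 1" "content r = 1" "content s = 1"
     "degree s < k" "h + k = g" "squarefree (map_poly rat_of_int r)"
     "map_poly rat_of_int r dvd V\<^sup>2 - map_poly rat_of_int (dehomogenize t (2 * g + 2) f)"
    using divisor_reduction[OF g D m u] by blast
  have nn: "n = 2 * k + 1 + (2 * h + 1)" using n red(6) by simp
  have nm: "n = (2 * g - 1) + 3" using n g by simp
  have dF: "degree (dehomogenize t n f) \<le> 2 * k + 1 + (2 * h + 1)" using degree_dehomogenize[of t n f] unfolding nn .
  obtain A0 B w where A0: "A0 \<in> carrier_mat n n" "B \<in> carrier_mat n n" "transpose_mat A0 = A0" "transpose_mat B = B"
    and w: "w \<in> carrier_vec n" "primitive_vec w"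
    and det: "\<forall>x c. det (x \<cdot>\<^sub>m map_mat complex_of_int A0 - map_mat of_int B
        + mat n n (\<lambda>(i, j). c * (of_int (((A0 + t \<cdot>\<^sub>m B) *\<^sub>v w) $ i) * of_int (((A0 + t \<cdot>\<^sub>m B) *\<^sub>v w) $ j))))
      = (- 1) ^ (h + k) * (c * (zpoly_at x ([:1, t:] * s))\<^sup>2 * zpoly_at x r - zpoly_at x (dehomogenize t n f))"
    using integral_pencil_exists[OF red(2,3) rsquarefree_complex[OF red(7)] red(5,4) dF red(8)[folded n] nn, of t] by blast
  define A where "A = A0 + t \<cdot>\<^sub>m B"
  have A: "A \<in> carrier_mat n n" "transpose_mat A = A"
  proof -
    show "A \<in> carrier_mat n n" using A0 by (simp add: A_def)
    have "A0 $$ (j, i) = A0 $$ (i, j)" "B $$ (j, i) = B $$ (i, j)" if "i < n" "j < n" for i j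
      using that A0 index_transpose_mat(1)[of i A0 j] index_transpose_mat(1)[of i B j] by auto
    then show "transpose_mat A = A" using A0(1,2) by (intro eq_matI) (auto simp: A_def)
  qed
  have "det (x \<cdot>\<^sub>m map_mat complex_of_int A0 - map_mat of_int B
        + mat n n (\<lambda>(i, j). c * (of_int ((A *\<^sub>v w) $ i) * of_int ((A *\<^sub>v w) $ j))))
      = (- 1) ^ g * (c * (1 + of_int t * x)\<^sup>2 * zpoly_at x (dehomogenize t (2 * g - 1) u) - zpoly_at x (dehomogenize t n f))" for x c
    unfolding A_def det[rule_format] red(1,6) zpoly_at_mult zpoly_at_power
    by (simp add: zpoly_at_pCons power_mult_distrib mult_ac)
  from unshift_pencil[OF A0(1,2) nm this]
  have all: "det (x \<cdot>\<^sub>m map_mat complex_of_int A - map_mat of_int B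
        + mat n n (\<lambda>(i, j). c * (of_int ((A *\<^sub>v w) $ i) * of_int ((A *\<^sub>v w) $ j))))
      = (- 1) ^ g * (c * bform_eval (2 * g - 1) (\<lambda>i. of_int (u i)) x 1 - bform_eval n (\<lambda>i. of_int (f i)) x 1)" for x c
    unfolding A_def .
  have "pencil_det n A B = bform n f"
  proof (rule form_eqI[OF is_form_pencil_det[OF A(1) A0(2)] is_form_bform, of "{}"])
    fix x :: int
    have "map_mat complex_of_int (x \<cdot>\<^sub>m A - 1 \<cdot>\<^sub>m B)
      = of_int x \<cdot>\<^sub>m map_mat complex_of_int A - map_mat of_int B
        + mat n n (\<lambda>(i, j). 0 * (of_int ((A *\<^sub>v w) $ i) * of_int ((A *\<^sub>v w) $ j)))"
      using A A0 by (intro eq_matI) auto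
    then have "complex_of_int (det (x \<cdot>\<^sub>m A - 1 \<cdot>\<^sub>m B)) = (- 1) ^ g * (0 - bform_eval n (\<lambda>i. of_int (f i)) (of_int x) 1)"
      unfolding of_int_hom.hom_det[symmetric] by (simp only: all) (simp only: mult_zero_left)
    also have "\<dots> = of_int ((- 1) ^ (g + 1) * bform_eval n f x 1)" by (simp add: bform_eval_def)
    finally have d: "det (x \<cdot>\<^sub>m A - 1 \<cdot>\<^sub>m B) = (- 1) ^ (g + 1) * bform_eval n f x 1" by (simp only: of_int_eq_iff)
    \<comment> \<open>n(n-1)/2 = (g+1)(2g+1) has the parity of g + 1, so the sign in
      \<open>pencil_det\<close> cancels that of the pencil.\<close>
    have sg: "(- 1 :: int) ^ (n * (n - 1) div 2) * (- 1) ^ (g + 1) = 1"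
    proof -
      have "n * (n - 1) div 2 = (g + 1) * (2 * g + 1)" by (simp add: n)
      then have "n * (n - 1) div 2 + (g + 1) = 2 * ((g + 1) * (g + 1))" by (simp add: algebra_simps)
      then show ?thesis unfolding power_add[symmetric] by (simp add: power_mult)
    qed
    show "eval2 (pencil_det n A B) x 1 = eval2 (bform n f) x 1"
      unfolding eval2_pencil_det[OF A(1) A0(2)] d mult.assoc[symmetric] sg by simp
  qed simp
  then have "(A, B) \<in> V_int n f" using A A0 by (simp add: V_int_def)
  then show ?thesis using w all by blast
qed

text \<open>Instances of \<open>gram_values\<close>: c = 0 gives the pencil and c = 1 its rank one
  change. The Hermitian Gram matrix is fixed by conjugation, so the real parts in
  \<open>H_gram\<close> are the matrix itself.\<close>

lemma H_gram_values:
  fixes A B :: "int mat" and w :: "int vec" and n :: nat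
  defines "H \<equiv> H_gram n (map_mat real_of_int A) (map_mat real_of_int B)"
  assumes AB: "A \<in> carrier_mat n n" "B \<in> carrier_mat n n" "transpose_mat A = A" "transpose_mat B = B" and w: "w \<in> carrier_vec n"
    and inj: "inj_on \<theta> {..<n}" and e: "e \<noteq> 0"
    and det: "\<And>x c. det (x \<cdot>\<^sub>m map_mat complex_of_int A - map_mat of_int B
        + mat n n (\<lambda>(i, j). c * (of_int ((A *\<^sub>v w) $ i) * of_int ((A *\<^sub>v w) $ j))))
      = e * (\<Prod>i<n. x - \<theta> i) + c * z x"
  shows "det H = cmod e * (\<Prod>i<n. max 1 (cmod (\<theta> i)))"
    "bil H (map_vec real_of_int w) (map_vec real_of_int w)
      = (\<Sum>i<n. max 1 (cmod (\<theta> i)) * cmod (z (\<theta> i)) / (cmod e * (\<Prod>l\<in>{..<n}-{i}. cmod (\<theta> i - \<theta> l))))"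
proof -
  let ?A = "map_mat complex_of_int A" and ?B = "map_mat complex_of_int B"
  interpret real_pencil n ?A ?B e \<theta>
  proof
    show "?A \<in> carrier_mat n n" "?B \<in> carrier_mat n n" using AB by auto
    show "transpose_mat ?A = ?A" "transpose_mat ?B = ?B"
      using AB(3,4) by (metis map_mat_transpose)+
    show "map_mat cnj ?A = ?A" "map_mat cnj ?B = ?B" by (auto intro!: eq_matI)
    fix x
    have "x \<cdot>\<^sub>m ?A - ?B = x \<cdot>\<^sub>m ?A - ?B + mat n n (\<lambda>(i, j). 0 * (of_int ((A *\<^sub>v w) $ i) * of_int ((A *\<^sub>v w) $ j)))"
      using AB by (intro eq_matI) auto
    then show "det (x \<cdot>\<^sub>m ?A - ?B) = e * (\<Prod>i<n. x - \<theta> i)" using det[of x 0] by simp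
  qed (fact inj e)+
  let ?v = "map_vec complex_of_int w"
  have v: "?v \<in> carrier_vec n" "conjugate ?v = ?v" using w by (auto intro!: eq_vecI)
  have Av: "(?A *\<^sub>v ?v) $ i = of_int ((A *\<^sub>v w) $ i)" if "i < n" for i
    using that AB(1) w by (simp add: scalar_prod_def)
  have gv: "det (\<theta> i \<cdot>\<^sub>m ?A - ?B + mat n n (\<lambda>(r, q). (?A *\<^sub>v ?v) $ r * (?A *\<^sub>v ?v) $ q)) = - (- z (\<theta> i))" if i: "i < n" for i
  proof -
    have "mat n n (\<lambda>(r, q). (?A *\<^sub>v ?v) $ r * (?A *\<^sub>v ?v) $ q) = mat n n (\<lambda>(i, j). 1 * (of_int ((A *\<^sub>v w) $ i) * of_int ((A *\<^sub>v w) $ j)))"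
      by (intro eq_matI) (auto simp: Av)
    moreover have "(\<Prod>l<n. \<theta> i - \<theta> l) = 0" using i by auto
    ultimately show ?thesis using det[of "\<theta> i" 1] by simp
  qed
  let ?G = "herm_gram n ?A ?B"
  have gr: "?G \<in> carrier_mat n n" "map_mat cnj ?G = ?G"
    "det ?G = of_real (cmod e * (\<Prod>i<n. max 1 (cmod (\<theta> i))))"
    "?v \<bullet> (?G *\<^sub>v ?v) = of_real (\<Sum>i<n. max 1 (cmod (\<theta> i)) * cmod (- z (\<theta> i)) / (cmod e * (\<Prod>l\<in>{..<n}-{i}. cmod (\<theta> i - \<theta> l))))"
    by (rule gram_values(1)[OF v gv], assumption)
      (rule gram_values(2)[OF v gv], assumption, rule gram_values(3)[OF v gv], assumption, rule gram_values(4)[OF v gv], assumption)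
  have cr: "map_mat complex_of_real (map_mat real_of_int M) = map_mat complex_of_int M" for M :: "int mat"
    by (intro eq_matI) auto
  have H: "H = map_mat Re ?G" unfolding H_def H_gram_def cr ..
  have HG: "map_mat complex_of_real H = ?G"
  proof (rule eq_matI)
    fix i j assume ij: "i < dim_row ?G" "j < dim_col ?G"
    have "cnj (?G $$ (i, j)) = ?G $$ (i, j)" using arg_cong[OF gr(2), of "\<lambda>M. M $$ (i, j)"] ij by simp
    then have "Im (?G $$ (i, j)) = 0" by (metis complex_cnj_cancel_iff Reals_cnj_iff complex_is_Real_iff)
    then show "map_mat complex_of_real H $$ (i, j) = ?G $$ (i, j)" using ij by (simp add: H complex_eq_iff)
  qed (simp_all add: H)
  have Hc: "H \<in> carrier_mat n n" using gr(1) by (simp add: H)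
  have "complex_of_real (det H) = det ?G" unfolding HG[symmetric] of_real_hom.hom_det ..
  then show "det H = cmod e * (\<Prod>i<n. max 1 (cmod (\<theta> i)))" unfolding gr(3) by (simp only: of_real_eq_iff)
  let ?w = "map_vec real_of_int w"
  have "complex_of_real (bil H ?w ?w) = ?v \<bullet> (map_mat complex_of_real H *\<^sub>v ?v)"
    using Hc w by (simp add: bil_def scalar_prod_def)
  also have "\<dots> = of_real (\<Sum>i<n. max 1 (cmod (\<theta> i)) * cmod (- z (\<theta> i)) / (cmod e * (\<Prod>l\<in>{..<n}-{i}. cmod (\<theta> i - \<theta> l))))"
    unfolding HG gr(4) ..
  finally show "bil H ?w ?w = (\<Sum>i<n. max 1 (cmod (\<theta> i)) * cmod (z (\<theta> i)) / (cmod e * (\<Prod>l\<in>{..<n}-{i}. cmod (\<theta> i - \<theta> l))))"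
    by (simp only: of_real_eq_iff norm_minus_cancel)
qed

theorem theorem6p4:
  fixes g n :: nat
  assumes "g \<ge> 1" and "n = 2 * g + 2"
  shows "\<exists>\<kappa>::real. \<forall>(Xb::real) (\<delta>::real) f D.
    Xb > 0 \<longrightarrow> \<delta> > 0 \<longrightarrow>
    f \<in> form_family n \<delta> Xb \<longrightarrow>
    effective_divisor g f D \<longrightarrow> size D = 2 * g - 1 \<longrightarrow>
    (\<exists>A B w. (A, B) \<in> V_int n f \<and> w \<in> carrier_vec n \<and> primitive_vec w \<and>
      (let H = H_gram n (map_mat real_of_int A) (map_mat real_of_int B);
           v = map_vec real_of_int w
       in real n * ln (bil H v v) - ln (Determinant.det H)
          \<le> real n * divisor_height D - (real n + 1) * ln Xb + real n * \<delta> * ln Xb + \<kappa>))"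
proof -
  let ?\<kappa> = "real n * ln (real n * real n * 2 ^ (n * n)) + (real n * (real n - 2) - 1) * ln (real n + 1)"
  have "\<exists>A B w. (A, B) \<in> V_int n f \<and> w \<in> carrier_vec n \<and> primitive_vec w \<and>
      (let H = H_gram n (map_mat real_of_int A) (map_mat real_of_int B);
           v = map_vec real_of_int w
       in real n * ln (bil H v v) - ln (Determinant.det H)
          \<le> real n * divisor_height D - (real n + 1) * ln Xb + real n * \<delta> * ln Xb + ?\<kappa>)"
    if \<delta>: "\<delta> > 0" and f: "f \<in> form_family n \<delta> Xb" and D: "effective_divisor g f D" and m: "size D = 2 * g - 1"
    for Xb \<delta> :: real and f D
  proof -
    define u where "u = (SOME u. pushforward_form D u)"
    have u: "pushforward_form D u"
      unfolding u_def by (rule someI_ex[OF pushforward_form_exists[OF D]])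
    \<comment> \<open>The degree 2g - 1 of D, in the shape used by the estimates.\<close>
    define d where "d = n - 3"
    have nd: "n \<ge> 3" "size D = d" "d < n" "2 * g - 1 = d" using assms m by (auto simp: d_def)
    let ?u = "\<lambda>i. complex_of_int (u i)"
    obtain A B w where AB: "(A, B) \<in> V_int n f" and w: "w \<in> carrier_vec n" "primitive_vec w"
      and det: "\<forall>x c. det (x \<cdot>\<^sub>m map_mat complex_of_int A - map_mat of_int B
        + mat n n (\<lambda>(i, j). c * (of_int ((A *\<^sub>v w) $ i) * of_int ((A *\<^sub>v w) $ j))))
      = (- 1) ^ g * (c * bform_eval (2 * g - 1) ?u x 1 - bform_eval n (\<lambda>i. of_int (f i)) x 1)"
      using exists_pair[OF assms D m u] by blast
    have n2: "n \<ge> 2" using nd by simp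
    obtain \<theta> :: "nat \<Rightarrow> complex" where f0: "f 0 \<noteq> 0" and inj: "inj_on \<theta> {..<n}"
      and roots: "\<forall>x. bform_eval n (\<lambda>i. of_int (f i)) x 1 = of_int (f 0) * (\<Prod>i<n. x - \<theta> i)"
      and M: "cmod (of_int (f 0)) * (\<Prod>i<n. max 1 (cmod (\<theta> i))) \<le> (real n + 1) * real_of_int (max_coeff n f)"
      and disc: "cmod (disc n f) = cmod (of_int (f 0)) ^ (2 * n - 2) * (\<Prod>j<n. \<Prod>i\<in>{..<n} - {j}. cmod (\<theta> j - \<theta> i))"
      using form_family_roots[OF f n2] by blast
    define a where "a = cmod (complex_of_int (f 0))"
    define e where "e = (- 1) ^ (g + 1) * complex_of_int (f 0)"
    have e: "e \<noteq> 0" "cmod e = a" using f0 by (simp_all add: e_def a_def norm_mult norm_power)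
    define U where "U x = bform_eval d ?u x 1" for x
    have det': "det (x \<cdot>\<^sub>m map_mat complex_of_int A - map_mat of_int B
        + mat n n (\<lambda>(i, j). c * (of_int ((A *\<^sub>v w) $ i) * of_int ((A *\<^sub>v w) $ j))))
      = e * (\<Prod>i<n. x - \<theta> i) + c * ((- 1) ^ g * U x)" for x c
      unfolding det[rule_format] roots[rule_format] nd(4) U_def e_def by (simp add: algebra_simps)
    have AB': "A \<in> carrier_mat n n" "B \<in> carrier_mat n n" "transpose_mat A = A" "transpose_mat B = B"
      using AB by (auto simp: V_int_def)
    note H = H_gram_values[OF AB' w(1) inj e(1) det', unfolded e(2)]
    have cU: "cmod ((- 1) ^ g * U x) = cmod (U x)" for x by (simp add: norm_mult norm_power)
    have Xf: "real_of_int (max_coeff n f) < Xb" "cmod (disc n f) \<ge> Xb powr (2 * real n - 2 - \<delta>)"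
      using f by (auto simp: form_family_def)
    have "\<bar>f 0\<bar> \<le> max_coeff n f" by (rule max_coeff_ge) simp
    \<comment> \<open>The nonzero integer f_0 is smaller than \<open>Xb\<close> in absolute value,
      so log X is positive.\<close>
    then have X1: "Xb > 1" using f0 Xf(1) by linarith
    obtain i1 where i1: "i1 \<le> d" "u i1 \<noteq> 0"
    proof -
      have "Gcd (u ` {..d}) = 1" using u nd(2) by (simp only: pushforward_form_def)
      then have "\<not> u ` {..d} \<subseteq> {0}" by (metis Gcd_0_iff zero_neq_one)
      then show ?thesis using that by auto
    qed
    have Hu: "real_of_int (max_coeff d u) \<ge> 1" using max_coeff_ge[OF i1(1), of u] i1(2) by linarith
    have bU: "cmod (U (\<theta> i)) \<le> real n * real_of_int (max_coeff d u) * max 1 (cmod (\<theta> i)) ^ (n - 3)" for i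
    proof -
      have "cmod (U (\<theta> i)) \<le> (real d + 1) * real_of_int (max_coeff d u) * max 1 (cmod (\<theta> i)) ^ d"
        unfolding U_def by (rule bform_eval_bound)
      also have "\<dots> \<le> real n * real_of_int (max_coeff d u) * max 1 (cmod (\<theta> i)) ^ d"
        using nd(3) Hu by (intro mult_right_mono) auto
      finally show ?thesis by (simp only: d_def)
    qed
    \<comment> \<open>A nonzero form of degree n - 3 cannot vanish at n distinct roots. This makes
      (w, w) positive, so that its logarithm is genuine.\<close>
    have "\<exists>i<n. U (\<theta> i) \<noteq> 0"
    proof (rule ccontr)
      assume no: "\<not> ?thesis"
      define p where "p = dehomogenize 0 d ?u"
      have "p \<noteq> 0"
      proof
        assume "p = 0"
        then have "dehomogenize 0 d ?u = dehomogenize 0 d (\<lambda>_. 0)" by (simp add: p_def dehomogenize_def)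
        then have "?u i1 = 0" using i1(1) dehomogenize_inject_field by blast
        then show False using i1(2) by simp
      qed
      have "\<theta> ` {..<n} \<subseteq> {x. poly p x = 0}" using no by (auto simp: p_def poly_dehomogenize U_def)
      then have "card (\<theta> ` {..<n}) \<le> card {x. poly p x = 0}"
        by (intro card_mono poly_roots_finite \<open>p \<noteq> 0\<close>)
      also have "\<dots> \<le> degree p" by (rule card_poly_roots_bound[OF \<open>p \<noteq> 0\<close>])
      also have "\<dots> \<le> d" by (simp add: p_def degree_dehomogenize)
      finally show False using nd(3) by (simp add: card_image[OF inj])
    qed
    then obtain i0 where i0: "i0 < n" "U (\<theta> i0) \<noteq> 0" by blast
    have a0: "a > 0" using f0 by (simp add: a_def)
    have "a * (\<Prod>i<n. max 1 (cmod (\<theta> i))) \<le> (real n + 1) * Xb"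
      unfolding a_def by (rule order.trans[OF M]) (use Xf(1) in \<open>intro mult_left_mono; simp\<close>)
    from height_inequality[OF nd(1) a0 inj bU i0 Hu X1 \<delta> this Xf(2)[unfolded disc a_def[symmetric]]]
    have "real n * ln (bil (H_gram n (map_mat real_of_int A) (map_mat real_of_int B)) (map_vec real_of_int w) (map_vec real_of_int w))
        - ln (det (H_gram n (map_mat real_of_int A) (map_mat real_of_int B)))
      \<le> real n * divisor_height D - (real n + 1) * ln Xb + real n * \<delta> * ln Xb + ?\<kappa>"
      unfolding H cU divisor_height_def u_def[symmetric] nd(2) .
    then show ?thesis using AB w by (auto simp: Let_def)
  qed
  then show ?thesis by blast
qed

end
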